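(* Let $\ell\ge 1$, and consider the standard inclusion $\mathfrak{sp}_{2\ell}\subset\mathfrak{sl}_{2\ell}$. (1) For all $m\in\mathbb N$, the restriction to $\mathfrak{sp}_{2\ell}$ of the irreducible $\mathfrak{sl}_{2\ell}$-module $L_{A_{2\ell-1}}(2m\omega_1)$ remains irreducible. More precisely, $$L_{C_\ell}(m\theta)\;\cong\; L_{A_{2\ell-1}}(2m\omega_1)\big|_{\mathfrak{sp}_{2\ell}}\;\cong\; S^{2m}(\mathbb C^{2\ell})\big|_{\mathfrak{sp}_{2\ell}},$$ where $\theta$ is the maximal root of $\mathfrak{sp}_{2\ell}$. (2) In particular, for all $k\ge 1$ and $\ell\geq 1$, under the identification of the two bases and the respective orders described in the context, the Feigin-Stoyanovsky's type subspace $W_{C^{(1)}_{2\ell}}(k\Lambda_0)$ and the standard module $L_{C^{(1)}_{\ell}}(k\Lambda_0)$ have the same combinatorial description of the leading terms of relations. That is, let $\varphi: B_1^{(2\ell)}\to B^{(\ell)}$ be the order-preserving bijection between the ordered basis $B_1^{(2\ell)}$ of $\mathfrak g_1$ (for $\mathfrak g$ of type $C_{2\ell}$) and the ordered basis $B^{(\ell)}$ of the simple Lie algebra of type $C_\ell$, and let $\varphi$ also denote the induced isomorphism of monoids of colored partitions $$\mathcal P^1(C_{2\ell})\to\mathcal P(C_\ell),\qquad x_1(n_1)\cdots x_r(n_r)\mapsto \varphi(x_1)(n_1)\cdots\varphi(x_r)(n_r).$$ Then $$\varphi\big(\ell t(\bar R^0_k(C_{2\ell}))\big)=\ell t\big(\bar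 R_k(C_\ell)\big).$$
   Context: **Finite dimensional modules.** $L_{X}(\lambda)$ denotes the irreducible finite dimensional module of highest weight $\lambda$ for the simple complex Lie algebra of type $X$; $\omega_1$ is the highest weight of the vector representation $\mathbb C^{2\ell}$ of $\mathfrak{sl}_{2\ell}$ (type $A_{2\ell-1}$). $S^{n}(V)$ is the $n$-th symmetric power. Type $C_1$ means $A_1$, i.e. $\mathfrak{sp}_2=\mathfrak{sl}_2$. **Type $C_n$** ($n\ge1$). Let $\mathfrak g$ be the simple complex Lie algebra of type $C_n$ with Cartan subalgebra $\mathfrak h$, roots $R=\{\pm(\varepsilon_i\pm\varepsilon_j)\mid 1\le i,j\le n\}\setminus\{0\}$, and simple roots $\alpha_1=\varepsilon_1-\varepsilon_2,\ \dots,\ \alpha_{n-1}=\varepsilon_{n-1}-\varepsilon_n,\ \alpha_n=2\varepsilon_n$, so that the maximal root is $\theta=2\varepsilon_1$. Fix root vectors $X_\alpha$ with $[X_\alpha,X_{-\alpha}]=\alpha^\vee$, and write $x_\theta=X_\theta$. Use the index set $\{1,\dots,n,\underline n,\dots,\underline 1\}$ with the order $1\succ 2\succ\cdots\succ n\succ\underline n\succ\cdots\succ\underline 2\succ\underline 1$. For $a\succeq b$ in this index set define $X_{ab}$ by: - $X_{ij}=X_{\varepsilon_i+\varepsilon_j}$ for $i\le j$; - $X_{\underline i\,\underline j}=X_{-\varepsilon_i-\varepsilon_j}$ for $i\ge j$; - $X_{i\underline j}=X_{\varepsilon_i-\varepsilon_j}$ for $i\ne j$; - $X_{i\underline i}=\alpha_i^\vee\in\mathfrak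 h$ for $i=1,\dots,n$, the coroot of the simple root $\alpha_i$. These elements form a basis $B^{(n)}=\{X_{ab}\mid a\succeq b\}$ of $\mathfrak g$ (here for each pair of indices of a root $\varepsilon_i-\varepsilon_j$, $i\neq j$, the element is $X_{i\underline j}$). It is ordered lexicographically: $X_{ab}\succ X_{a'b'}$ iff $a\succ a'$, or $a=a'$ and $b\succ b'$. **The grading.** Let $\omega=\tfrac12(\varepsilon_1+\dots+\varepsilon_n)$ be the minuscule coweight, i.e. $\omega(\varepsilon_i)=\tfrac12$ for all $i$, so $\omega(\alpha)\in\{-1,0,1\}$ for every root $\alpha$. Put $\mathfrak g_0=\mathfrak h+\sum_{\omega(\alpha)=0}\mathfrak g_\alpha$ (roots $\varepsilon_i-\varepsilon_j$, $i\neq j$) and $\mathfrak g_{1}=\sum_{\omega(\alpha)=1}\mathfrak g_\alpha$ (roots $\varepsilon_i+\varepsilon_j$, $i\le j$). Then $\mathfrak g_1$ is a commutative subalgebra and a $\mathfrak g_0$-module. It has the ordered basis $B_1^{(n)}=\{X_{ij}\mid 1\le i\le j\le n\}\subset B^{(n)}$, with the order inherited from $B^{(n)}$. **The identification $\varphi$.** Let $\iota:\{1,\dots,2\ell\}\to\{1,\dots,\ell,\underline\ell,\dots,\underline1\}$ be given by $\iota(i)=i$ for $i\le\ell$ and $\iota(2\ell+1-i)=\underline i$ for $1\le i\le\ell$. Then $\varphi:B_1^{(2\ell)}\to B^{(\ell)}$ is $X_{pq}\mapsto X_{\iota(p)\iota(q)}$ for $1\le p\le q\le 2\ell$. **Affine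 algebra.** Normalize the invariant form on $\mathfrak g$ by $\langle\theta,\theta\rangle=2$. Let $\hat{\mathfrak g}=\mathfrak g\otimes\mathbb C[t,t^{-1}]\oplus\mathbb Cc$ with $x(i)=x\otimes t^i$, $[x(i),y(j)]=[x,y](i+j)+i\,\delta_{i+j,0}\langle x,y\rangle c$ and $c$ central, and let $\tilde{\mathfrak g}=\hat{\mathfrak g}+\mathbb Cd$ with $[d,x(i)]=i\,x(i)$. Identify $\mathfrak g$ with $\mathfrak g\otimes 1$. For type $C_n$ denote by $L_{C_n^{(1)}}(k\Lambda_0)$ the standard (integrable highest weight) $\tilde{\mathfrak g}$-module of level $k$ with highest weight $k\Lambda_0$ and highest weight vector $v_{k\Lambda_0}$. Its Feigin-Stoyanovsky's type subspace is $W_{C_n^{(1)}}(k\Lambda_0)=U(\hat{\mathfrak g}_1)v_{k\Lambda_0}$, where $\hat{\mathfrak g}_1=\mathfrak g_1\otimes\mathbb C[t,t^{-1}]$. **Colored partitions.** Write $B=B^{(n)}$ and $B_1=B_1^{(n)}$. Let $\hat B=\{x(m)\mid x\in B,\ m\in\mathbb Z\}$, ordered by $x(m)\prec y(m')$ iff $m<m'$, or $m=m'$ and $x\prec y$. A colored partition is a finite sequence $\pi=(x_1(n_1)\preceq\dots\preceq x_r(n_r))$ in $\hat B$, regarded also as the commutative monomial $x_1(n_1)\cdots x_r(n_r)\in S(\hat{\mathfrak g})$; $r$ is its length and $n_1+\dots+n_r$ its degree. The corresponding ordered product in the enveloping algebra is $u(\pi)=x_1(n_1)\cdots x_r(n_r)\in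 U(\hat{\mathfrak g})$. The monoid of all colored partitions is $\mathcal P$ (written $\mathcal P(C_n)$ for type $C_n$), and $\mathcal P^1\subset\mathcal P$ (written $\mathcal P^1(C_n)$) is the submonoid of those with all $x_i\in B_1$. Order $\mathcal P$ by comparing successively: (i) lengths, shorter is higher; (ii) degrees, greater degree is higher; (iii) plain partitions $n_1\le\dots\le n_r$ in reverse lexicographical order; (iv) colors $x_1,\dots,x_r$ in reverse lexicographical order. Here reverse lexicographical order means that sequences of equal length are compared at the last (rightmost) position where they differ. **Relations and leading terms.** On level $k$ standard modules one has $x_\theta(z)^{k+1}=0$, where $$x_\theta(z)^{k+1}=\sum_{n\in\mathbb Z}\Big(\sum_{j_1+\dots+j_{k+1}=n}x_\theta(j_1)\cdots x_\theta(j_{k+1})\Big)z^{-n-k-1}$$ and the coefficients are infinite sums in a completion of $U(\hat{\mathfrak g})$. Let $\bar R_k=\bar R_k(C_n)$ (relations on $L_{C_n^{(1)}}(k\Lambda_0)$) be the set of all coefficients of all series in the finite dimensional $\mathfrak g$-module $U(\mathfrak g)\cdot x_\theta(z)^{k+1}$ generated by the adjoint action of $\mathfrak g$. Let $\bar R_k^0=\bar R_k^0(C_n)$ (relations on $W_{C_n^{(1)}}(k\Lambda_0)$) be the set of all coefficients of all series in $U(\mathfrak g_0)\cdot x_\theta(z)^{k+1}$. Every nonzero relation $r$ can be written $r=c_\rho u(\rho)+\sum_{\pi\succ\rho}c_\pi u(\pi)$ with $c_\rho\ne0$. Then $\rho=\ell t(r)$ is the leading term of $r$ (the smallest colored partition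 occurring), and $\ell t(\bar R)=\{\ell t(r)\mid r\in\bar R,\ r\ne 0\}$. All elements of $\ell t(\bar R_k)$ (respectively $\ell t(\bar R_k^0)$) are obtained as leading terms, i.e. smallest monomials, of nonzero elements of the finite dimensional subspaces $U(\mathfrak g)\cdot x_\theta(-j-1)^b x_\theta(-j)^a$ (respectively $U(\mathfrak g_0)\cdot x_\theta(-j-1)^b x_\theta(-j)^a$) of $S(\hat{\mathfrak g})$, where $j\in\mathbb Z$, $a,b\ge0$, $a+b=k+1$, and $\mathfrak g=\mathfrak g\otimes1$ acts by the adjoint action extended by derivations.
   Formalization: The basis element X_{i\underline i} is taken to be the coroot of the long root 2ε_i instead of the coroot of the simple root α_i; with α_i^∨ the equality of leading terms in (2) fails for every ℓ≥2 (for ℓ=1 the two agree). *)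

theory Defs
  imports "Jordan_Normal_Form.Matrix" "HOL-Library.Poly_Mapping"
begin

section \<open>Matrix Lie algebras\<close>

definition bracket :: "complex mat \<Rightarrow> complex mat \<Rightarrow> complex mat" where
  "bracket A B = A * B - B * A"

definition mtrace :: "complex mat \<Rightarrow> complex" where
  "mtrace A = (\<Sum>i<dim_row A. A $$ (i, i))"

definition sl :: "nat \<Rightarrow> complex mat set" where
  "sl N = {A \<in> carrier_mat N N. mtrace A = 0}"

text \<open>The symplectic form on the space of column vectors of size \<open>2n\<close> is antidiagonal, so that the
  ordered basis is \<open>e\<^sub>1, \<dots>, e\<^sub>n, e\<^bsub>-n\<^esub>, \<dots>, e\<^bsub>-1\<^esub>\<close>, the Cartan subalgebra consists
  of the diagonal matrices \<open>diag (h\<^sub>1, \<dots>, h\<^sub>n, -h\<^sub>n, \<dots>, -h\<^sub>1)\<close>, and the positive root vectors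
  (for the simple roots \<open>\<epsilon>\<^sub>1 - \<epsilon>\<^sub>2, \<dots>, \<epsilon>\<^bsub>n-1\<^esub> - \<epsilon>\<^sub>n, 2 \<epsilon>\<^sub>n\<close>) are strictly upper triangular.\<close>

definition symp_form :: "nat \<Rightarrow> complex mat" where
  "symp_form n = mat (2*n) (2*n)
     (\<lambda>(i, j). if i + j + 1 = 2*n then (if i < n then 1 else -1) else 0)"

definition sp :: "nat \<Rightarrow> complex mat set" where
  "sp n = {A \<in> carrier_mat (2*n) (2*n).
     transpose_mat A * symp_form n + symp_form n * A = 0\<^sub>m (2*n) (2*n)}"

definition cartan :: "nat \<Rightarrow> complex mat set" where
  "cartan n = {H \<in> sp n. diagonal_mat H}"

definition strictly_upper :: "complex mat \<Rightarrow> bool" where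
  "strictly_upper A \<longleftrightarrow> (\<forall>i < dim_row A. \<forall>j < dim_col A. j \<le> i \<longrightarrow> A $$ (i, j) = 0)"

section \<open>Modules over matrix Lie algebras\<close>

text \<open>A module is a subspace \<open>V\<close> of an ambient complex vector space together with an action on it;
  \<open>\<rho> A v\<close> is irrelevant for \<open>v\<close> outside \<open>V\<close> or \<open>A\<close> outside the Lie algebra. Restriction to a Lie
  subalgebra keeps \<open>V\<close> and \<open>\<rho>\<close> and only changes the parameter \<open>\<gg>\<close>.\<close>

definition lie_module ::
  "complex mat set \<Rightarrow> (complex \<Rightarrow> 'v::ab_group_add \<Rightarrow> 'v) \<Rightarrow> 'v set
    \<Rightarrow> (complex mat \<Rightarrow> 'v \<Rightarrow> 'v) \<Rightarrow> bool" where
  "lie_module \<gg> sc V \<rho> \<longleftrightarrow>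
     vector_space sc \<and> module.subspace sc V \<and>
     (\<forall>A\<in>\<gg>. \<forall>v\<in>V. \<rho> A v \<in> V) \<and>
     (\<forall>A\<in>\<gg>. \<forall>c. \<forall>v\<in>V. \<forall>w\<in>V. \<rho> A (sc c v + w) = sc c (\<rho> A v) + \<rho> A w) \<and>
     (\<forall>A\<in>\<gg>. \<forall>B\<in>\<gg>. \<forall>c. \<forall>v\<in>V. \<rho> (c \<cdot>\<^sub>m A + B) v = sc c (\<rho> A v) + \<rho> B v) \<and>
     (\<forall>A\<in>\<gg>. \<forall>B\<in>\<gg>. \<forall>v\<in>V. \<rho> (bracket A B) v = \<rho> A (\<rho> B v) - \<rho> B (\<rho> A v))"

definition irreducible_module ::
  "complex mat set \<Rightarrow> (complex \<Rightarrow> 'v::ab_group_add \<Rightarrow> 'v) \<Rightarrow> 'v set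
    \<Rightarrow> (complex mat \<Rightarrow> 'v \<Rightarrow> 'v) \<Rightarrow> bool" where
  "irreducible_module \<gg> sc V \<rho> \<longleftrightarrow>
     lie_module \<gg> sc V \<rho> \<and> V \<noteq> {0} \<and>
     (\<forall>W. module.subspace sc W \<and> W \<subseteq> V \<and> (\<forall>A\<in>\<gg>. \<forall>w\<in>W. \<rho> A w \<in> W) \<longrightarrow> W = {0} \<or> W = V)"

text \<open>\<open>is_irrep \<gg> sc V \<rho> \<mu>\<close>: the module is (a model of) \<open>L(\<mu>)\<close>, the finite dimensional irreducible
  module of highest weight \<open>\<mu>\<close>. For \<open>sl\<close> and \<open>sp\<close> as above the Borel subalgebra is the upper
  triangular part of \<open>\<gg>\<close>.\<close>

definition is_irrep ::
  "complex mat set \<Rightarrow> (complex \<Rightarrow> 'v::ab_group_add \<Rightarrow> 'v) \<Rightarrow> 'v set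
    \<Rightarrow> (complex mat \<Rightarrow> 'v \<Rightarrow> 'v) \<Rightarrow> (complex mat \<Rightarrow> complex) \<Rightarrow> bool" where
  "is_irrep \<gg> sc V \<rho> \<mu> \<longleftrightarrow>
     irreducible_module \<gg> sc V \<rho> \<and>
     (\<exists>B. finite B \<and> V = module.span sc B) \<and>
     (\<exists>v\<in>V. v \<noteq> 0 \<and>
        (\<forall>A\<in>\<gg>. strictly_upper A \<longrightarrow> \<rho> A v = 0) \<and>
        (\<forall>H\<in>\<gg>. diagonal_mat H \<longrightarrow> \<rho> H v = sc (\<mu> H) v))"

definition module_iso ::
  "complex mat set \<Rightarrow> (complex \<Rightarrow> 'v::ab_group_add \<Rightarrow> 'v) \<Rightarrow> 'v set \<Rightarrow> (complex mat \<Rightarrow> 'v \<Rightarrow> 'v)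
    \<Rightarrow> (complex \<Rightarrow> 'w::ab_group_add \<Rightarrow> 'w) \<Rightarrow> 'w set \<Rightarrow> (complex mat \<Rightarrow> 'w \<Rightarrow> 'w) \<Rightarrow> bool" where
  "module_iso \<gg> sc V \<rho> sc' W \<sigma> \<longleftrightarrow>
     lie_module \<gg> sc V \<rho> \<and> lie_module \<gg> sc' W \<sigma> \<and>
     (\<exists>f. bij_betw f V W \<and>
        (\<forall>c. \<forall>v\<in>V. \<forall>w\<in>V. f (sc c v + w) = sc' c (f v) + f w) \<and>
        (\<forall>A\<in>\<gg>. \<forall>v\<in>V. f (\<rho> A v) = \<sigma> A (f v)))"

text \<open>\<open>\<omega>\<^sub>1\<close> of \<open>sl N\<close>, and the maximal root \<open>\<theta> = 2 \<epsilon>\<^sub>1\<close> of \<open>sp n\<close>, as functionals on diagonal matrices.\<close>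

definition omega1 :: "complex mat \<Rightarrow> complex" where
  "omega1 H = H $$ (0, 0)"

definition theta :: "complex mat \<Rightarrow> complex" where
  "theta H = 2 * H $$ (0, 0)"

subsection \<open>Symmetric powers of the vector representation\<close>

text \<open>The symmetric algebra of the space with basis \<open>e\<^sub>0, \<dots>, e\<^bsub>N-1\<^esub>\<close> is the polynomial algebra in
  these basis vectors, \<open>S\<^sup>d\<close> is its homogeneous part of degree \<open>d\<close>, and a matrix \<open>A\<close> acts as the
  derivation \<open>\<Sum>\<^sub>i\<^sub>,\<^sub>j A\<^sub>i\<^sub>j e\<^sub>i \<partial>/\<partial>e\<^sub>j\<close> extending \<open>e\<^sub>j \<mapsto> A e\<^sub>j\<close>.\<close>

type_synonym sym_alg = "(nat \<Rightarrow>\<^sub>0 nat) \<Rightarrow>\<^sub>0 complex"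

definition sym_scale :: "complex \<Rightarrow> sym_alg \<Rightarrow> sym_alg" where
  "sym_scale c p = Poly_Mapping.single 0 c * p"

definition sym_pow :: "nat \<Rightarrow> nat \<Rightarrow> sym_alg set" where
  "sym_pow N d = {p. \<forall>m \<in> Poly_Mapping.keys p.
     Poly_Mapping.keys m \<subseteq> {..<N} \<and> (\<Sum>i \<in> Poly_Mapping.keys m. Poly_Mapping.lookup m i) = d}"

definition sym_pd :: "nat \<Rightarrow> sym_alg \<Rightarrow> sym_alg" where
  "sym_pd j p = (\<Sum>m \<in> Poly_Mapping.keys p. Poly_Mapping.single (m - Poly_Mapping.single j 1)
     (of_nat (Poly_Mapping.lookup m j) * Poly_Mapping.lookup p m))"

definition sym_act :: "complex mat \<Rightarrow> sym_alg \<Rightarrow> sym_alg" where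
  "sym_act A p = (\<Sum>i < dim_row A. \<Sum>j < dim_col A.
     sym_scale (A $$ (i, j)) (Poly_Mapping.single (Poly_Mapping.single i 1) 1 * sym_pd j p))"

section \<open>The ordered basis of the symplectic Lie algebra\<close>

text \<open>\<open>Plain i\<close> is the index \<open>i\<close>, \<open>Under i\<close> the underlined index.\<close>

datatype idx = Plain nat | Under nat

fun idx_less :: "idx \<Rightarrow> idx \<Rightarrow> bool" where
  "idx_less (Plain i) (Plain j) \<longleftrightarrow> j < i"
| "idx_less (Plain i) (Under j) \<longleftrightarrow> False"
| "idx_less (Under i) (Plain j) \<longleftrightarrow> True"
| "idx_less (Under i) (Under j) \<longleftrightarrow> i < j"

fun neg :: "idx \<Rightarrow> idx" where
  "neg (Plain i) = Under i"
| "neg (Under i) = Plain i"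

definition idxs :: "nat \<Rightarrow> idx set" where
  "idxs n = Plain ` {1..n} \<union> Under ` {1..n}"

text \<open>A color \<open>(a, b)\<close> stands for the basis element \<open>X\<^sub>a\<^sub>b\<close>.\<close>

type_synonym color = "idx \<times> idx"

definition colors :: "nat \<Rightarrow> color set" where
  "colors n = {(a, b). a \<in> idxs n \<and> b \<in> idxs n \<and> (a = b \<or> idx_less b a)}"

definition colors1 :: "nat \<Rightarrow> color set" where
  "colors1 n = {(Plain i, Plain j) | i j. 1 \<le> i \<and> i \<le> j \<and> j \<le> n}"

definition color_less :: "color \<Rightarrow> color \<Rightarrow> bool" where
  "color_less x y \<longleftrightarrow> idx_less (fst x) (fst y) \<or> fst x = fst y \<and> idx_less (snd x) (snd y)"

text \<open>The weights \<open>\<epsilon>\<^sub>i\<close>, \<open>-\<epsilon>\<^sub>i\<close> of the vector representation, and the weight of \<open>X\<^sub>a\<^sub>b\<close>, which is a root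
  unless \<open>b = neg a\<close>.\<close>

fun eps :: "idx \<Rightarrow> complex mat \<Rightarrow> complex" where
  "eps (Plain i) H = H $$ (i - 1, i - 1)"
| "eps (Under i) H = - H $$ (i - 1, i - 1)"

definition weight :: "color \<Rightarrow> complex mat \<Rightarrow> complex" where
  "weight c H = eps (fst c) H + eps (snd c) H"

definition root_space :: "nat \<Rightarrow> color \<Rightarrow> complex mat set" where
  "root_space n c = {A \<in> sp n. \<forall>H \<in> cartan n. bracket H A = weight c H \<cdot>\<^sub>m A}"

text \<open>\<open>eps_dual n a\<close> is dual to \<open>eps a\<close>; the coroots are \<open>(\<epsilon>\<^sub>a + \<epsilon>\<^sub>b)\<^sup>\<or> = \<epsilon>\<^sub>a\<^sup>* + \<epsilon>\<^sub>b\<^sup>*\<close> for \<open>a \<noteq> b\<close> and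
  \<open>(2 \<epsilon>\<^sub>a)\<^sup>\<or> = \<epsilon>\<^sub>a\<^sup>*\<close>, with \<open>\<epsilon>\<^bsub>Under i\<^esub> = - \<epsilon>\<^sub>i\<close>.\<close>

definition eps_mat :: "nat \<Rightarrow> nat \<Rightarrow> complex mat" where
  "eps_mat n i = mat (2*n) (2*n)
     (\<lambda>(r, s). if r = s then (if r + 1 = i then 1 else if r + i = 2*n then -1 else 0) else 0)"

fun eps_dual :: "nat \<Rightarrow> idx \<Rightarrow> complex mat" where
  "eps_dual n (Plain i) = eps_mat n i"
| "eps_dual n (Under i) = - eps_mat n i"

definition coroot :: "nat \<Rightarrow> color \<Rightarrow> complex mat" where
  "coroot n c = (if fst c = snd c then eps_dual n (fst c)
                 else eps_dual n (fst c) + eps_dual n (snd c))"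

text \<open>An arbitrary choice of root vectors with \<open>[X\<^sub>\<alpha>, X\<^bsub>-\<alpha>\<^esub>] = \<alpha>\<^sup>\<or>\<close>.\<close>

definition root_vectors :: "nat \<Rightarrow> (color \<Rightarrow> complex mat) \<Rightarrow> bool" where
  "root_vectors n X \<longleftrightarrow> (\<forall>a b. (a, b) \<in> colors n \<and> b \<noteq> neg a \<longrightarrow>
     X (a, b) \<in> root_space n (a, b) \<and> bracket (X (a, b)) (X (neg b, neg a)) = coroot n (a, b))"

text \<open>The Cartan element attached to the color \<open>(Plain i, Under i)\<close> is the coroot of the long root
  \<open>2 \<epsilon>\<^sub>i\<close>, which for \<open>i = n\<close> is the simple root \<open>\<alpha>\<^sub>n\<close>. The coroots of all the simple roots \<open>\<alpha>\<^sub>i\<close> would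
  also complete the root vectors to a basis, but for \<open>n \<ge> 2\<close> they give different leading terms, for
  which the identification with type \<open>C\<^bsub>2n\<^esub>\<close> fails: up to scalars, \<open>X\<^bsub>-\<theta>\<^esub>\<close> maps
  \<open>X\<^sub>\<theta>\<^sup>2\<close> to \<open>X\<^sub>\<theta> \<theta>\<^sup>\<or> = X\<^sub>\<theta> (\<alpha>\<^sub>1\<^sup>\<or> + \<dots> + \<alpha>\<^sub>n\<^sup>\<or>)\<close>, whose smallest monomial would be
  \<open>X\<^sub>\<theta> \<alpha>\<^sub>n\<^sup>\<or>\<close>, while its counterpart in type \<open>C\<^bsub>2n\<^esub>\<close> is the monomial with
  colors \<open>(Plain 1, Plain 1)\<close> and \<open>(Plain 1, Plain (2n))\<close>.\<close>

definition basis_vec :: "nat \<Rightarrow> (color \<Rightarrow> complex mat) \<Rightarrow> color \<Rightarrow> complex mat" where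
  "basis_vec n X c = (if snd c = neg (fst c) then coroot n (fst c, fst c) else X c)"

subsection \<open>The degree zero subalgebra\<close>

inductive_set mat_span :: "nat \<Rightarrow> complex mat set \<Rightarrow> complex mat set" for N S where
  zero: "0\<^sub>m N N \<in> mat_span N S"
| step: "A \<in> mat_span N S \<Longrightarrow> B \<in> S \<Longrightarrow> A + c \<cdot>\<^sub>m B \<in> mat_span N S"

text \<open>The coweight \<open>\<omega>\<close> as an element of the Cartan subalgebra, so that \<open>\<omega>(\<alpha>) = weight \<alpha> \<omega>\<close>.\<close>

definition omega :: "nat \<Rightarrow> complex mat" where
  "omega n = mat (2*n) (2*n) (\<lambda>(r, s). if r = s then (if r < n then 1/2 else -1/2) else 0)"

definition g0 :: "nat \<Rightarrow> complex mat set" where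
  "g0 n = mat_span (2*n) (cartan n \<union>
     (\<Union>(a, b) \<in> {(a, b) \<in> colors n. b \<noteq> neg a \<and> weight (a, b) (omega n) = 0}. root_space n (a, b)))"

section \<open>The enveloping algebra of the affine Lie algebra and its completion\<close>

text \<open>Words form the free monoid, hence finitely supported functions on words form the free
  associative algebra (with the convolution product).\<close>

instantiation list :: (type) monoid_add
begin

definition zero_list :: "'a list" where "zero_list = []"

definition plus_list :: "'a list \<Rightarrow> 'a list \<Rightarrow> 'a list" where "plus_list xs ys = xs @ ys"

instance by standard (simp_all add: zero_list_def plus_list_def)

end

text \<open>\<open>Loop x i\<close> is \<open>x(i) = x \<otimes> t\<^sup>i\<close> and \<open>Central\<close> is \<open>c\<close>.\<close>

datatype aff_gen = Loop "complex mat" int | Central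

type_synonym free_alg = "aff_gen list \<Rightarrow>\<^sub>0 complex"

definition scalar :: "complex \<Rightarrow> free_alg" where
  "scalar c = Poly_Mapping.single [] c"

definition gen :: "aff_gen \<Rightarrow> free_alg" where
  "gen g = Poly_Mapping.single [g] 1"

definition lp :: "complex mat \<Rightarrow> int \<Rightarrow> free_alg" where
  "lp x i = gen (Loop x i)"

text \<open>The invariant form normalized by \<open>\<langle>\<theta>, \<theta>\<rangle> = 2\<close> is the trace form of the vector representation.\<close>

definition inv_form :: "complex mat \<Rightarrow> complex mat \<Rightarrow> complex" where
  "inv_form x y = mtrace (x * y)"

text \<open>The two-sided ideal whose quotient is the enveloping algebra of the affine Lie algebra (without
  derivation) of \<open>sp n\<close>. Generators \<open>Loop x i\<close> with \<open>x\<close> not in \<open>sp n\<close> only exist because of the type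
  and are set to zero.\<close>

inductive_set env_ideal :: "nat \<Rightarrow> free_alg set" for n where
  junk: "x \<notin> sp n \<Longrightarrow> lp x i \<in> env_ideal n"
| linear: "x \<in> sp n \<Longrightarrow> y \<in> sp n \<Longrightarrow>
    lp (a \<cdot>\<^sub>m x + y) i - (scalar a * lp x i + lp y i) \<in> env_ideal n"
| commutator: "x \<in> sp n \<Longrightarrow> y \<in> sp n \<Longrightarrow>
    lp x i * lp y j - lp y j * lp x i
      - (lp (bracket x y) (i + j)
         + scalar (if i + j = 0 then of_int i * inv_form x y else 0) * gen Central) \<in> env_ideal n"
| central: "x \<in> sp n \<Longrightarrow> gen Central * lp x i - lp x i * gen Central \<in> env_ideal n"
| zero: "0 \<in> env_ideal n"
| add: "p \<in> env_ideal n \<Longrightarrow> q \<in> env_ideal n \<Longrightarrow> p + q \<in> env_ideal n"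
| mult: "p \<in> env_ideal n \<Longrightarrow> a * p * b \<in> env_ideal n"

text \<open>The neighbourhoods of zero defining the topology: the left ideals of the enveloping algebra
  generated by all \<open>x(i)\<close> with \<open>i \<ge> N\<close>.\<close>

inductive_set nbhd :: "nat \<Rightarrow> nat \<Rightarrow> free_alg set" for n N where
  ideal: "p \<in> env_ideal n \<Longrightarrow> p \<in> nbhd n N"
| gen: "x \<in> sp n \<Longrightarrow> int N \<le> i \<Longrightarrow> lp x i \<in> nbhd n N"
| add: "p \<in> nbhd n N \<Longrightarrow> q \<in> nbhd n N \<Longrightarrow> p + q \<in> nbhd n N"
| mult: "p \<in> nbhd n N \<Longrightarrow> a * p \<in> nbhd n N"

text \<open>An element of the completion (the inverse limit of the quotients of the enveloping algebra by
  these left ideals) is represented by a sequence \<open>r\<close> of approximations, \<open>r N\<close> being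
  relevant modulo \<open>nbhd n N\<close>.\<close>

type_synonym compl = "nat \<Rightarrow> free_alg"

definition compl_zero :: "nat \<Rightarrow> compl \<Rightarrow> bool" where
  "compl_zero n r \<longleftrightarrow> (\<forall>N. r N \<in> nbhd n N)"

definition has_compl_sum :: "nat \<Rightarrow> ('a \<Rightarrow> free_alg) \<Rightarrow> 'a set \<Rightarrow> compl \<Rightarrow> bool" where
  "has_compl_sum n f S r \<longleftrightarrow>
     (\<forall>N. finite {s \<in> S. f s \<notin> nbhd n N} \<and> (\<Sum>s \<in> {s \<in> S. f s \<notin> nbhd n N}. f s) - r N \<in> nbhd n N)"

section \<open>Colored partitions\<close>

text \<open>A part \<open>x(m)\<close> is represented by the pair of the color of \<open>x\<close> and \<open>m\<close>.\<close>

type_synonym cpart = "(color \<times> int) list"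

definition part_less :: "color \<times> int \<Rightarrow> color \<times> int \<Rightarrow> bool" where
  "part_less p q \<longleftrightarrow> snd p < snd q \<or> snd p = snd q \<and> color_less (fst p) (fst q)"

definition cparts_on :: "color set \<Rightarrow> cpart set" where
  "cparts_on C = {\<pi>. sorted_wrt (\<lambda>p q. p = q \<or> part_less p q) \<pi> \<and> fst ` set \<pi> \<subseteq> C}"

definition cparts :: "nat \<Rightarrow> cpart set" where
  "cparts n = cparts_on (colors n)"

definition cparts1 :: "nat \<Rightarrow> cpart set" where
  "cparts1 n = cparts_on (colors1 n)"

definition cdegree :: "cpart \<Rightarrow> int" where
  "cdegree \<pi> = sum_list (map snd \<pi>)"

text \<open>The library relation \<open>lex\<close> compares lists of equal length at the first position where they differ.\<close>

definition revlex :: "('a \<Rightarrow> 'a \<Rightarrow> bool) \<Rightarrow> 'a list \<Rightarrow> 'a list \<Rightarrow> bool" where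
  "revlex lt xs ys \<longleftrightarrow> (rev xs, rev ys) \<in> lex {(x, y). lt x y}"

definition cpart_less :: "cpart \<Rightarrow> cpart \<Rightarrow> bool" where
  "cpart_less \<pi> \<rho> \<longleftrightarrow>
     length \<rho> < length \<pi> \<or> length \<pi> = length \<rho> \<and>
     (cdegree \<pi> < cdegree \<rho> \<or> cdegree \<pi> = cdegree \<rho> \<and>
      (revlex (<) (map snd \<pi>) (map snd \<rho>) \<or> map snd \<pi> = map snd \<rho> \<and>
       revlex color_less (map fst \<pi>) (map fst \<rho>)))"

definition u_mon :: "nat \<Rightarrow> (color \<Rightarrow> complex mat) \<Rightarrow> cpart \<Rightarrow> free_alg" where
  "u_mon n X \<pi> = prod_list (map (\<lambda>(c, m). lp (basis_vec n X c) m) \<pi>)"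

section \<open>Relations and leading terms\<close>

text \<open>\<open>rel_series n X k \<aa>\<close> is \<open>U(\<aa>) \<cdot> x\<^sub>\<theta>(z)\<^bsup>k+1\<^esup>\<close>, with \<open>\<aa>\<close> acting on coefficients by commutators with
  \<open>x = x(0)\<close>; \<open>s d\<close> is the coefficient of \<open>z\<^bsup>-d-k-1\<^esup>\<close>.\<close>

inductive_set rel_series ::
  "nat \<Rightarrow> (color \<Rightarrow> complex mat) \<Rightarrow> nat \<Rightarrow> complex mat set \<Rightarrow> (int \<Rightarrow> compl) set"
  for n X k \<aa> where
  power: "(\<And>d. has_compl_sum n (\<lambda>js. prod_list (map (lp (X (Plain 1, Plain 1))) js))
      {js. length js = k + 1 \<and> sum_list js = d} (s d)) \<Longrightarrow> s \<in> rel_series n X k \<aa>"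
| add: "s \<in> rel_series n X k \<aa> \<Longrightarrow> s' \<in> rel_series n X k \<aa> \<Longrightarrow>
    (\<lambda>d N. s d N + s' d N) \<in> rel_series n X k \<aa>"
| scale: "s \<in> rel_series n X k \<aa> \<Longrightarrow> (\<lambda>d N. scalar c * s d N) \<in> rel_series n X k \<aa>"
| act: "s \<in> rel_series n X k \<aa> \<Longrightarrow> x \<in> \<aa> \<Longrightarrow>
    (\<lambda>d N. lp x 0 * s d N - s d N * lp x 0) \<in> rel_series n X k \<aa>"

definition relations :: "nat \<Rightarrow> (color \<Rightarrow> complex mat) \<Rightarrow> nat \<Rightarrow> compl set" where
  "relations n X k = {s d | s d. s \<in> rel_series n X k (sp n)}"

definition relations0 :: "nat \<Rightarrow> (color \<Rightarrow> complex mat) \<Rightarrow> nat \<Rightarrow> compl set" where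
  "relations0 n X k = {s d | s d. s \<in> rel_series n X k (g0 n)}"

definition is_lead ::
  "nat \<Rightarrow> (color \<Rightarrow> complex mat) \<Rightarrow> compl \<Rightarrow> cpart \<Rightarrow> bool" where
  "is_lead n X r \<rho> \<longleftrightarrow> \<rho> \<in> cparts n \<and>
     (\<exists>c. c \<rho> \<noteq> 0 \<and> has_compl_sum n (\<lambda>\<pi>. scalar (c \<pi>) * u_mon n X \<pi>)
        {\<pi> \<in> cparts n. \<pi> = \<rho> \<or> cpart_less \<rho> \<pi>} r)"

definition leading_terms ::
  "nat \<Rightarrow> (color \<Rightarrow> complex mat) \<Rightarrow> compl set \<Rightarrow> cpart set" where
  "leading_terms n X R = {\<rho>. \<exists>r \<in> R. \<not> compl_zero n r \<and> is_lead n X r \<rho>}"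

section \<open>The identification of the two bases\<close>

definition iota :: "nat \<Rightarrow> nat \<Rightarrow> idx" where
  "iota l p = (if p \<le> l then Plain p else Under (2*l + 1 - p))"

text \<open>Only the values on \<open>colors1 (2*l)\<close> matter.\<close>

fun phi :: "nat \<Rightarrow> color \<Rightarrow> color" where
  "phi l (Plain p, Plain q) = (iota l p, iota l q)"
| "phi l c = undefined"

definition phi_part :: "nat \<Rightarrow> cpart \<Rightarrow> cpart" where
  "phi_part l \<pi> = map (\<lambda>(c, m). (phi l c, m)) \<pi>"

end

theory Submission
  imports Defs "HOL-Library.Multiset" "HOL-Library.Product_Plus"
begin

text \<open>Contraction with the symplectic form identifies \<open>sp n\<close> with the symmetric square of
  \<open>V = \<complex>\<^sup>2\<^sup>n\<close>, in such a way that the color with positions \<open>r \<le> s\<close> in the ordered basis of \<open>V\<close>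
  becomes, up to a scalar, the product \<open>e\<^sub>r e\<^sub>s\<close>; in particular \<open>x\<^sub>\<theta>\<close> becomes \<open>e\<^sub>0\<^sup>2\<close>. Hence every
  series of relations comes from a symmetric tensor \<open>P\<close> of degree \<open>2(k + 1)\<close>, and the tensors that
  occur form the module generated by the power of \<open>e\<^sub>0\<close>: by irreducibility this is the full
  symmetric power of \<open>V\<close> for \<open>sp n\<close>, and of the span of \<open>e\<^sub>0, \<dots>, e\<^bsub>n-1\<^esub>\<close> for \<open>\<gg>\<^sub>0\<close>.
  The coefficient of a partition of length \<open>k + 1\<close> in a relation is, up to a nonzero factor, the
  value of \<open>P\<close> at the multiset of positions of its colors. The leading terms are therefore the
  partitions that are minimal among those with the same degree and the same multiset of positions,
  and this condition only depends on the number and order of the available positions, which for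
  \<open>\<gg>\<^sub>0\<close> in type \<open>C\<^bsub>2l\<^esub>\<close> and for \<open>sp l\<close> are the same. Instead of the full Poincare-Birkhoff-Witt theorem,
  the argument uses that ordered monomials are independent in the action of the loop algebra on
  tensor powers of a matrix representation.\<close>

section \<open>Coordinates on the symplectic Lie algebra\<close>

text \<open>Relations are infinite sums, and without control of the reordering one partition could
  collect contributions from infinitely many words. The modes of \<open>x_\<theta>\<close> commute,
  so the power is symmetric in its modes modulo the defining ideal, and the adjoint action of
  elements of mode zero preserves this symmetry. The modes can therefore be sorted before the colors
  are straightened; then only letters of the same sign are exchanged, and every partition receives
  finitely many contributions. Uniqueness of the expansion is decided modulo a neighbourhood whose
  modes exceed those of the partition in question, and there the central element may be set to zero.

  In top length nothing cancels, because all contributions to one partition are positive multiples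
  of the same number. A tensor therefore sees either all partitions with given degree and positions
  or none of them. Since every tensor concentrated on a single multiset of positions occurs, linear
  combinations create no further leading terms.\<close>

definition sgp :: "nat \<Rightarrow> nat \<Rightarrow> complex" where
  "sgp n s = (if s < n then 1 else -1)"

text \<open>A matrix lies in \<open>sp n\<close> iff its coordinates \<open>mc\<close> form a symmetric matrix; \<open>bm n r s\<close> has the
  coordinates of \<open>e\<^sub>r e\<^sub>s\<close>.\<close>

definition mc :: "nat \<Rightarrow> complex mat \<Rightarrow> nat \<Rightarrow> nat \<Rightarrow> complex" where
  "mc n A r s = sgp n s * A $$ (r, 2*n - 1 - s)"

definition bm :: "nat \<Rightarrow> nat \<Rightarrow> nat \<Rightarrow> complex mat" where
  "bm n r s = mat (2*n) (2*n) (\<lambda>(i, j). sgp n (2*n - 1 - j) *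
     (of_bool (i = r \<and> 2*n - 1 - j = s) + of_bool (i = s \<and> 2*n - 1 - j = r)))"

lemma sgp_square [simp]: "sgp n s * sgp n s = 1" "sgp n s * (sgp n s * x) = x"
  by (auto simp: sgp_def)

lemma sgp_nonzero [simp]: "sgp n s \<noteq> 0"
  by (auto simp: sgp_def)

lemma sgp_reflect:
  "s < 2*n \<Longrightarrow> sgp n (2*n - 1 - s) = - sgp n s" "s < 2*n \<Longrightarrow> sgp n (2*n - Suc s) = - sgp n s"
  "s < n*2 \<Longrightarrow> sgp n (n*2 - Suc s) = - sgp n s"
  by (auto simp: sgp_def)

lemma mult_mat_entry:
  assumes "A \<in> carrier_mat m k" "B \<in> carrier_mat k p" "i < m" "j < p"
  shows "(A * B) $$ (i, j) = (\<Sum>u<k. A $$ (i, u) * B $$ (u, j))"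
  using assms by (auto simp: scalar_prod_def atLeast0LessThan intro!: sum.cong)

lemma sum_reflect: "(\<Sum>u<m. f u) = (\<Sum>u<m. f (m - 1 - u))" for m :: nat
  using sum.nat_diff_reindex[of f m] by simp

lemma mat_entry_mc: "s < 2*n \<Longrightarrow> A $$ (r, s) = - sgp n s * mc n A r (2*n - 1 - s)"
  unfolding mc_def by (simp add: sgp_reflect)

lemma symp_form_entry:
  assumes "u < 2*n" "s < 2*n"
  shows "symp_form n $$ (u, s) = (if u = 2*n - 1 - s then sgp n u else 0)"
  using assms by (auto simp: symp_form_def sgp_def)

text \<open>\<open>symp_form\<close> has one nonzero entry in each row and column, so each entry of
  the defining equation links one entry of \<open>A\<close> with its mirror image. Reflecting both
  indices changes both signs and turns the equation into the symmetry of the coordinates.\<close>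

lemma sp_iff:
  "A \<in> sp n \<longleftrightarrow> A \<in> carrier_mat (2*n) (2*n) \<and> (\<forall>r<2*n. \<forall>s<2*n. mc n A r s = mc n A s r)"
proof (cases "A \<in> carrier_mat (2*n) (2*n)")
  case True
  have J: "symp_form n \<in> carrier_mat (2*n) (2*n)" by (simp add: symp_form_def)
  have AT: "transpose_mat A \<in> carrier_mat (2*n) (2*n)" using True by simp
  have e: "(transpose_mat A * symp_form n + symp_form n * A) $$ (r, s)
      = sgp n (2*n-1-s) * A $$ (2*n-1-s, r) + sgp n r * A $$ (2*n-1-r, s)"
    if "r < 2*n" "s < 2*n" for r s
  proof -
    have "(transpose_mat A * symp_form n + symp_form n * A) $$ (r, s)
      = (transpose_mat A * symp_form n) $$ (r, s) + (symp_form n * A) $$ (r, s)"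
      using that True J by simp
    also have "(transpose_mat A * symp_form n) $$ (r, s)
        = (\<Sum>u<2*n. A $$ (u, r) * (if u = 2*n - 1 - s then sgp n u else 0))"
      unfolding mult_mat_entry[OF AT J that] using that True symp_form_entry
      by (intro sum.cong) auto
    also have "\<dots> = sgp n (2*n-1-s) * A $$ (2*n-1-s, r)"
      using that by (auto simp: if_distrib[of "\<lambda>z. _ * z"] cong: if_cong)
    also have "(symp_form n * A) $$ (r, s) = (\<Sum>u<2*n. (if r = 2*n - 1 - u then sgp n r else 0) * A $$ (u, s))"
      unfolding mult_mat_entry[OF J True that] using that symp_form_entry
      by (intro sum.cong) auto
    also have "\<dots> = (\<Sum>u<2*n. if u = 2*n - 1 - r then sgp n r * A $$ (u, s) else 0)"
      using that by (intro sum.cong) auto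
    also have "\<dots> = sgp n r * A $$ (2*n-1-r, s)"
      using that by auto
    finally show ?thesis .
  qed
  have "A \<in> sp n \<longleftrightarrow> (\<forall>r<2*n. \<forall>s<2*n. (transpose_mat A * symp_form n + symp_form n * A) $$ (r, s) = 0)"
  proof
    assume "A \<in> sp n"
    then have "transpose_mat A * symp_form n + symp_form n * A = 0\<^sub>m (2*n) (2*n)" by (simp add: sp_def)
    then show "\<forall>r<2*n. \<forall>s<2*n. (transpose_mat A * symp_form n + symp_form n * A) $$ (r, s) = 0"
      by simp
  next
    assume *: "\<forall>r<2*n. \<forall>s<2*n. (transpose_mat A * symp_form n + symp_form n * A) $$ (r, s) = 0"
    have "transpose_mat A * symp_form n + symp_form n * A = 0\<^sub>m (2*n) (2*n)"
      by (rule eq_matI) (use * True J in auto)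
    then show "A \<in> sp n" using True by (simp add: sp_def)
  qed
  also have "\<dots> \<longleftrightarrow> (\<forall>r<2*n. \<forall>s<2*n. sgp n (2*n-1-s) * A $$ (2*n-1-s, r) + sgp n r * A $$ (2*n-1-r, s) = 0)"
    using e by simp
  also have "\<dots> \<longleftrightarrow> (\<forall>r<2*n. \<forall>s<2*n. mc n A r s = mc n A s r)"
  proof (intro iffI allI impI)
    fix r s assume *: "\<forall>r<2*n. \<forall>s<2*n. sgp n (2*n-1-s) * A $$ (2*n-1-s, r) + sgp n r * A $$ (2*n-1-r, s) = 0"
      and rs: "r < 2*n" "s < 2*n"
    have "2*n-1-s < 2*n" "2*n-1-r < 2*n" "2*n-1-(2*n-1-s) = s" "2*n-1-(2*n-1-r) = r" using rs by auto
    with *[rule_format, of "2*n-1-s" "2*n-1-r"] rs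
    have "sgp n r * A $$ (r, 2*n-1-s) - sgp n s * A $$ (s, 2*n-1-r) = 0"
      by (simp add: sgp_reflect)
    \<comment> \<open>Multiplying by both signs exchanges them and produces the signs in
      \<open>mc\<close>.\<close>
    then have "sgp n r * sgp n s * (sgp n r * A $$ (r, 2*n-1-s) - sgp n s * A $$ (s, 2*n-1-r)) = 0" by simp
    then show "mc n A r s = mc n A s r" by (simp add: mc_def algebra_simps)
  next
    fix r s assume *: "\<forall>r<2*n. \<forall>s<2*n. mc n A r s = mc n A s r" and rs: "r < 2*n" "s < 2*n"
    have "2*n-1-s < 2*n" "2*n-1-r < 2*n" "2*n-1-(2*n-1-s) = s" "2*n-1-(2*n-1-r) = r" using rs by auto
    with *[rule_format, of "2*n-1-s" "2*n-1-r"] rs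
    have "- sgp n r * A $$ (2*n-1-s, r) = - sgp n s * A $$ (2*n-1-r, s)"
      by (simp add: mc_def sgp_reflect)
    moreover have "sgp n s * x = sgp n r * y" if "- sgp n r * x = - sgp n s * y" for x y
      using that by (auto simp: sgp_def split: if_splits)
    ultimately have "sgp n s * A $$ (2*n-1-s, r) = sgp n r * A $$ (2*n-1-r, s)" by blast
    then show "sgp n (2*n-1-s) * A $$ (2*n-1-s, r) + sgp n r * A $$ (2*n-1-r, s) = 0"
      using rs by (simp add: sgp_reflect)
  qed
  finally show ?thesis using True by simp
qed (simp add: sp_def)

lemma sp_carrier: "A \<in> sp n \<Longrightarrow> A \<in> carrier_mat (2*n) (2*n)"
  by (simp add: sp_def)

lemma mc_sym: "A \<in> sp n \<Longrightarrow> r < 2*n \<Longrightarrow> s < 2*n \<Longrightarrow> mc n A r s = mc n A s r"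
  by (simp add: sp_iff)

lemma mc_lin:
  assumes "A \<in> carrier_mat (2*n) (2*n)" "B \<in> carrier_mat (2*n) (2*n)" "r < 2*n" "s < 2*n"
  shows "mc n (c \<cdot>\<^sub>m A + B) r s = c * mc n A r s + mc n B r s"
    "mc n (c \<cdot>\<^sub>m A) r s = c * mc n A r s"
    "mc n (A + B) r s = mc n A r s + mc n B r s"
    "mc n (A - B) r s = mc n A r s - mc n B r s"
  using assms by (auto simp: mc_def algebra_simps)

text \<open>The identity matrix has antisymmetric coordinates: it corresponds to the symplectic form
  itself, not to an element of the symmetric square. Symmetrized coordinate functionals vanish on
  it, which is how a tensor factor not yet hit by a letter is recognized later.\<close>

lemma mc_one: 
  assumes "r < 2*n" "s < 2*n"
  shows "mc n (1\<^sub>m (2*n)) r s + mc n (1\<^sub>m (2*n)) s r = 0"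
proof -
  have "(r = 2*n-1-s) = (s = 2*n-1-r)" using assms by auto
  moreover have "2*n-1-r < 2*n" "2*n-1-s < 2*n" using assms by auto
  ultimately show ?thesis using assms sgp_reflect[of r n] by (auto simp: mc_def sgp_reflect)
qed

lemma mat_eq_mc:
  assumes "A \<in> carrier_mat (2*n) (2*n)" "B \<in> carrier_mat (2*n) (2*n)"
    "\<And>r s. r < 2*n \<Longrightarrow> s < 2*n \<Longrightarrow> mc n A r s = mc n B r s"
  shows "A = B"
proof (rule eq_matI)
  show "A $$ (i, j) = B $$ (i, j)" if "i < dim_row B" "j < dim_col B" for i j
    using assms that by (simp add: mat_entry_mc)
qed (use assms in auto)

lemma mc_mult:
  assumes "A \<in> carrier_mat (2*n) (2*n)" "B \<in> carrier_mat (2*n) (2*n)" "r < 2*n" "s < 2*n"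
  shows "mc n (A * B) r s = (\<Sum>u<2*n. A $$ (r, u) * mc n B u s)"
proof -
  have "mc n (A * B) r s = sgp n s * (\<Sum>u<2*n. A $$ (r, u) * B $$ (u, 2*n-1-s))"
    unfolding mc_def by (subst mult_mat_entry[OF assms(1,2)]) (use assms in auto)
  then show ?thesis by (simp add: mc_def sum_distrib_left mult_ac)
qed

text \<open>The form turns right multiplication by an element of \<open>sp n\<close> into minus the
  left multiplication on the second index.\<close>

lemma mc_mult2:
  assumes "A \<in> sp n" "B \<in> carrier_mat (2*n) (2*n)" "r < 2*n" "s < 2*n"
  shows "mc n (B * A) r s = - (\<Sum>u<2*n. A $$ (s, u) * mc n B r u)"
proof -
  note A = sp_carrier[OF assms(1)]
  have "mc n (B * A) r s = (\<Sum>u<2*n. B $$ (r, u) * mc n A u s)"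
    using mc_mult[OF assms(2) A assms(3,4)] .
  also have "\<dots> = (\<Sum>u<2*n. B $$ (r, 2*n-1-u) * mc n A (2*n-1-u) s)"
    by (rule sum_reflect)
  also have "\<dots> = (\<Sum>u<2*n. - (A $$ (s, u) * mc n B r u))"
  proof (rule sum.cong)
    fix u assume "u \<in> {..<2*n}"
    then have u: "u < 2*n" "2*n-1-u < 2*n" by auto
    show "B $$ (r, 2*n-1-u) * mc n A (2*n-1-u) s = - (A $$ (s, u) * mc n B r u)"
      unfolding mc_sym[OF assms(1) u(2) assms(4)] using u by (simp add: mc_def sgp_reflect)
  qed simp
  finally show ?thesis by (simp add: sum_negf)
qed

text \<open>In coordinates the adjoint action is the derivation action on tensors with two indices;
  this is what makes \<open>sp n\<close> the symmetric square as a module.\<close>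

lemma mc_bracket:
  assumes "A \<in> sp n" "B \<in> carrier_mat (2*n) (2*n)" "r < 2*n" "s < 2*n"
  shows "mc n (bracket A B) r s = (\<Sum>u<2*n. A $$ (r, u) * mc n B u s) + (\<Sum>u<2*n. A $$ (s, u) * mc n B r u)"
proof -
  note A = sp_carrier[OF assms(1)]
  have "mc n (bracket A B) r s = mc n (A * B) r s - mc n (B * A) r s"
    unfolding bracket_def using A assms by (intro mc_lin) auto
  then show ?thesis
    by (simp only: mc_mult[OF A assms(2-4)] mc_mult2[OF assms]) simp
qed

lemma sp_zero [simp]: "0\<^sub>m (2*n) (2*n) \<in> sp n"
  by (auto simp: sp_iff mc_def)

lemma sp_lin: "A \<in> sp n \<Longrightarrow> B \<in> sp n \<Longrightarrow> c \<cdot>\<^sub>m A + B \<in> sp n"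
  by (auto simp: sp_iff mc_lin)

lemma sp_smult: "A \<in> sp n \<Longrightarrow> c \<cdot>\<^sub>m A \<in> sp n"
  by (auto simp: sp_iff mc_lin)

lemma sp_add: "A \<in> sp n \<Longrightarrow> B \<in> sp n \<Longrightarrow> A + B \<in> sp n"
  by (auto simp: sp_iff mc_lin)

lemma bracket_carrier: "A \<in> carrier_mat m m \<Longrightarrow> B \<in> carrier_mat m m \<Longrightarrow> bracket A B \<in> carrier_mat m m"
  by (auto simp: bracket_def)

lemma sp_bracket:
  assumes "A \<in> sp n" "B \<in> sp n" shows "bracket A B \<in> sp n"
proof -
  have "bracket A B \<in> carrier_mat (2*n) (2*n)"
    using assms by (intro bracket_carrier) (auto dest: sp_carrier)
  moreover have "mc n (bracket A B) r s = mc n (bracket A B) s r" if "r < 2*n" "s < 2*n" for r s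
    using that assms mc_sym[OF assms(2)] by (simp add: mc_bracket sp_carrier add.commute)
  ultimately show ?thesis by (simp add: sp_iff)
qed

lemma bm_carrier [simp]: "bm n r s \<in> carrier_mat (2*n) (2*n)"
  by (simp add: bm_def)

lemma mc_bm:
  assumes "i < 2*n" "j < 2*n"
  shows "mc n (bm n r s) i j = of_bool (i = r \<and> j = s) + of_bool (i = s \<and> j = r)"
proof -
  have "2*n - 1 - (2*n - 1 - j) = j" "2*n-1-j < 2*n" using assms by auto
  then show ?thesis using assms by (simp add: mc_def bm_def)
qed

lemma bm_entry:
  assumes "p < 2*n" "q < 2*n" "u < 2*n" "v < 2*n"
  shows "bm n p q $$ (u, v) = (if v = 2*n-1-q then if u = p then sgp n q else 0 else 0)
      + (if v = 2*n-1-p then if u = q then sgp n p else 0 else 0)"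
proof -
  have e: "2*n-1-v = q \<longleftrightarrow> v = 2*n-1-q" "2*n-1-v = p \<longleftrightarrow> v = 2*n-1-p" using assms by auto
  have "bm n p q $$ (u, v) = sgp n (2*n-1-v) * (of_bool (u = p \<and> 2*n-1-v = q) + of_bool (u = q \<and> 2*n-1-v = p))"
    using assms by (simp add: bm_def)
  also have "\<dots> = (if 2*n-1-v = q then if u = p then sgp n q else 0 else 0) + (if 2*n-1-v = p then if u = q then sgp n p else 0 else 0)"
    by auto
  finally show ?thesis unfolding e .
qed

lemma bm_sp [simp]: "bm n r s \<in> sp n"
  by (simp add: sp_iff mc_bm conj_commute add.commute)

lemma bm_commute: "bm n r s = bm n s r"
  by (rule mat_eq_mc[of _ n]) (auto simp: mc_bm)

section \<open>The Cartan subalgebra and the root spaces\<close>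

lemma cartan_entry:
  assumes "H \<in> cartan n" "r < 2*n"
  shows "H $$ (2*n-1-r, 2*n-1-r) = - H $$ (r, r)"
proof -
  have H: "H \<in> sp n" using assms by (simp add: cartan_def)
  have r: "2*n-1-r < 2*n" "2*n-1-(2*n-1-r) = r" using assms by auto
  have "sgp n r * (- H $$ (r, r)) = sgp n r * H $$ (2*n-1-r, 2*n-1-r)"
    using mc_sym[OF H assms(2) r(1)] assms(2) r by (simp add: mc_def sgp_reflect)
  then show ?thesis by (metis mult_left_cancel sgp_nonzero)
qed

text \<open>The Cartan subalgebra scales every coordinate separately, so root spaces can be
  determined one coordinate at a time.\<close>

lemma bracket_diag_mc:
  assumes "H \<in> cartan n" "A \<in> carrier_mat (2*n) (2*n)" "r < 2*n" "s < 2*n"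
  shows "mc n (bracket H A) r s = (H $$ (r, r) + H $$ (s, s)) * mc n A r s"
proof -
  have H: "H \<in> sp n" "diagonal_mat H" "H \<in> carrier_mat (2*n) (2*n)"
    using assms by (auto simp: cartan_def sp_def)
  have d: "H $$ (i, u) = 0" if "i < 2*n" "u < 2*n" "i \<noteq> u" for i u
    using H(2,3) that by (auto simp: diagonal_mat_def)
  have "(\<Sum>u<2*n. H $$ (i, u) * f u) = H $$ (i, i) * f i" if "i < 2*n" for i f
  proof -
    have "(\<Sum>u<2*n. H $$ (i, u) * f u) = (\<Sum>u<2*n. if i = u then H $$ (i, i) * f i else 0)"
      using d that by (intro sum.cong) auto
    then show ?thesis using that by simp
  qed
  then show ?thesis using assms(3,4) by (simp only: mc_bracket[OF H(1) assms(2-4)] distrib_right)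
qed

lemma reflect_neq: "p < 2*n \<Longrightarrow> p \<noteq> 2*n - 1 - p" "p < 2*n \<Longrightarrow> 2*n - 1 - p \<noteq> p" for p n :: nat
  by presburger+

text \<open>The Cartan element dual to the weight of the basis vector at position \<open>p\<close>;
  the mirror position carries the opposite weight.\<close>

definition cart_unit :: "nat \<Rightarrow> nat \<Rightarrow> complex mat" where
  "cart_unit n p = mat (2*n) (2*n)
     (\<lambda>(i, j). if i = j then (if i = p then 1 else if i = 2*n-1-p then -1 else 0) else 0)"

lemma cart_unit_entry:
  "i < 2*n \<Longrightarrow> cart_unit n p $$ (i, i) = (if i = p then 1 else if i = 2*n-1-p then -1 else 0)"
  by (simp add: cart_unit_def)

lemma diag_in_cartan:
  assumes "H \<in> carrier_mat (2*n) (2*n)" "diagonal_mat H"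
    "\<And>r. r < 2*n \<Longrightarrow> H $$ (2*n-1-r, 2*n-1-r) = - H $$ (r, r)"
  shows "H \<in> cartan n"
proof -
  have "mc n H r s = mc n H s r" if rs: "r < 2*n" "s < 2*n" for r s
  proof (cases "r = 2*n-1-s")
    case True
    then have "s = 2*n-1-r" "2*n-1-s < 2*n" using rs by auto
    then show ?thesis using rs True assms(3)[of s] by (simp add: mc_def sgp_reflect)
  next
    case False
    then have "s \<noteq> 2*n-1-r" "2*n-1-r < 2*n" "2*n-1-s < 2*n" using rs by auto
    then have "H $$ (r, 2*n-1-s) = 0" "H $$ (s, 2*n-1-r) = 0"
      using assms(1,2) rs False by (auto simp: diagonal_mat_def)
    then show ?thesis by (simp add: mc_def)
  qed
  then show ?thesis using assms by (simp add: cartan_def sp_iff)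
qed

lemma cart_unit_cartan: "p < 2*n \<Longrightarrow> cart_unit n p \<in> cartan n"
  using reflect_neq[of p n] by (intro diag_in_cartan) (auto simp: cart_unit_def diagonal_mat_def)

text \<open>Zero-based positions in the ordered basis. They reverse the order of the indices: a
  larger index has a smaller position.\<close>

fun pos :: "nat \<Rightarrow> idx \<Rightarrow> nat" where
  "pos n (Plain i) = i - 1"
| "pos n (Under i) = 2*n - i"

lemma pos_less: "a \<in> idxs n \<Longrightarrow> pos n a < 2*n"
  by (auto simp: idxs_def)

lemma pos_neg: "a \<in> idxs n \<Longrightarrow> pos n (neg a) = 2*n - 1 - pos n a"
  by (auto simp: idxs_def)

lemma neg_idxs: "a \<in> idxs n \<Longrightarrow> neg a \<in> idxs n"
  by (auto simp: idxs_def)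

lemma neg_neg [simp]: "neg (neg a) = a"
  by (cases a) auto

lemma pos_inj: "a \<in> idxs n \<Longrightarrow> b \<in> idxs n \<Longrightarrow> pos n a = pos n b \<longleftrightarrow> a = b"
  by (auto simp: idxs_def)

lemma pos_image: "pos n ` idxs n = {..<2*n}"
proof
  show "pos n ` idxs n \<subseteq> {..<2*n}" by (auto simp: pos_less)
  show "{..<2*n} \<subseteq> pos n ` idxs n"
  proof
    fix r assume r: "r \<in> {..<2*n}"
    show "r \<in> pos n ` idxs n"
    proof (cases "r < n")
      case True
      then have "r = pos n (Plain (r + 1))" "Plain (r + 1) \<in> idxs n" by (auto simp: idxs_def)
      then show ?thesis by blast
    next
      case False
      then have "r = pos n (Under (2*n - r))" "Under (2*n - r) \<in> idxs n"
        using r by (auto simp: idxs_def image_iff)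
      then show ?thesis by blast
    qed
  qed
qed

lemma idx_less_pos: "a \<in> idxs n \<Longrightarrow> b \<in> idxs n \<Longrightarrow> idx_less a b \<longleftrightarrow> pos n b < pos n a"
  by (auto simp: idxs_def)

lemma eps_pos:
  assumes "H \<in> cartan n" "a \<in> idxs n"
  shows "eps a H = H $$ (pos n a, pos n a)"
proof (cases a)
  case (Under i)
  then have i: "1 \<le> i" "i \<le> n" using assms by (auto simp: idxs_def)
  then have "2*n - 1 - (i - 1) = 2*n - i" by auto
  with cartan_entry[OF assms(1), of "i-1"] Under i show ?thesis by auto
qed auto

lemma colors_idxs: "(a, b) \<in> colors n \<Longrightarrow> a \<in> idxs n \<and> b \<in> idxs n"
  by (auto simp: colors_def)

lemma colors_iff_pos: "(a, b) \<in> colors n \<longleftrightarrow> a \<in> idxs n \<and> b \<in> idxs n \<and> pos n a \<le> pos n b"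
  by (auto simp: colors_def idx_less_pos pos_inj[symmetric])

lemma bm_root_space:
  assumes "a \<in> idxs n" "b \<in> idxs n"
  shows "bm n (pos n a) (pos n b) \<in> root_space n (a, b)"
proof -
  have "bracket H (bm n (pos n a) (pos n b)) = weight (a, b) H \<cdot>\<^sub>m bm n (pos n a) (pos n b)"
    if H: "H \<in> cartan n" for H
  proof (rule mat_eq_mc[of _ n])
    show "bracket H (bm n (pos n a) (pos n b)) \<in> carrier_mat (2*n) (2*n)"
      using H by (intro bracket_carrier) (auto simp: cartan_def sp_def)
    fix r s assume rs: "r < 2*n" "s < 2*n"
    show "mc n (bracket H (bm n (pos n a) (pos n b))) r s
        = mc n (weight (a, b) H \<cdot>\<^sub>m bm n (pos n a) (pos n b)) r s"
      unfolding bracket_diag_mc[OF H bm_carrier rs] mc_lin(2)[OF bm_carrier bm_carrier rs] mc_bm[OF rs] weight_def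
      using eps_pos[OF H assms(1)] eps_pos[OF H assms(2)] by (auto simp: algebra_simps)
  qed auto
  then show ?thesis by (simp add: root_space_def)
qed

text \<open>Here \<open>p'\<close> and \<open>q'\<close> stand for the mirror images of
  \<open>p\<close> and \<open>q\<close>, and the two equations compare the weights of
  \<open>e_r e_s\<close> and \<open>e_p e_q\<close> on the Cartan elements dual to \<open>p\<close>
  and \<open>q\<close>. Since \<open>q\<close> is not the mirror of \<open>p\<close>, the weight is
  nonzero, and these two values already determine the unordered pair.\<close>

lemma unit_sums_unique:
  fixes p q r s p' q' :: nat
  assumes "p \<noteq> p'" "q \<noteq> q'" "q \<noteq> p'" "p \<noteq> q'"
    and "(if r = p then 1 else if r = p' then -1 else 0) + (if s = p then 1 else if s = p' then -1 else 0)
      = 1 + (if q = p then 1 else 0 :: complex)"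
    and "(if r = q then 1 else if r = q' then -1 else 0) + (if s = q then 1 else if s = q' then -1 else 0)
      = 1 + (if p = q then 1 else 0 :: complex)"
  shows "(r = p \<and> s = q) \<or> (r = q \<and> s = p)"
proof (cases "q = p")
  case True
  have "r = p" "s = p"
    by (cases "r = p"; cases "r = p'"; cases "s = p"; cases "s = p'"; use assms(1,5) True in simp)+
  then show ?thesis using True by simp
next
  case False
  have 1: "(r = p \<and> s \<noteq> p \<and> s \<noteq> p') \<or> (s = p \<and> r \<noteq> p \<and> r \<noteq> p')"
    by (cases "r = p"; cases "r = p'"; cases "s = p"; cases "s = p'"; use assms(1,5) False in simp)
  have 2: "(r = q \<and> s \<noteq> q \<and> s \<noteq> q') \<or> (s = q \<and> r \<noteq> q \<and> r \<noteq> q')"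
    by (cases "r = q"; cases "r = q'"; cases "s = q"; cases "s = q'"; use assms(2,6) False in simp)
  show ?thesis using 1 2 False by blast
qed

text \<open>A nonzero weight occurs at one unordered pair of positions only, hence root spaces are
  lines. The condition \<open>b \<noteq> neg a\<close> excludes the zero weight, whose weight space
  is the whole Cartan subalgebra.\<close>

lemma root_space_eq:
  assumes ab: "a \<in> idxs n" "b \<in> idxs n" "b \<noteq> neg a" and A: "A \<in> root_space n (a, b)"
  shows "\<exists>c. A = c \<cdot>\<^sub>m bm n (pos n a) (pos n b)"
proof -
  let ?p = "pos n a" and ?q = "pos n b"
  have p: "?p < 2*n" and q: "?q < 2*n" using ab pos_less by auto
  have pq: "?q \<noteq> 2*n-1-?p"
    using ab pos_neg[OF ab(1)] pos_inj[OF ab(2) neg_idxs[OF ab(1)]] by auto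
  have Asp: "A \<in> sp n" using A by (simp add: root_space_def)
  have Ac: "A \<in> carrier_mat (2*n) (2*n)" using sp_carrier[OF Asp] .
  have zero: "(H $$ (r, r) + H $$ (s, s) - H $$ (?p, ?p) - H $$ (?q, ?q)) * mc n A r s = 0"
    if "H \<in> cartan n" "r < 2*n" "s < 2*n" for H r s
  proof -
    have "bracket H A = weight (a, b) H \<cdot>\<^sub>m A" using A that by (auto simp: root_space_def)
    then have "mc n (bracket H A) r s = (H $$ (?p, ?p) + H $$ (?q, ?q)) * mc n A r s"
      using mc_lin(2)[OF Ac Ac that(2,3)] eps_pos[OF that(1)] ab by (simp add: weight_def)
    then show ?thesis using bracket_diag_mc[OF that(1) Ac that(2,3)] by (simp add: algebra_simps)
  qed
  have off: "mc n A r s = 0" if rs: "r < 2*n" "s < 2*n" and ne: "\<not> (r = ?p \<and> s = ?q)" "\<not> (r = ?q \<and> s = ?p)" for r s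
  proof (rule ccontr)
    assume nz: "mc n A r s \<noteq> 0"
    let ?P = "cart_unit n ?p" and ?Q = "cart_unit n ?q"
    have 1: "?P $$ (r, r) + ?P $$ (s, s) = ?P $$ (?p, ?p) + ?P $$ (?q, ?q)"
      using zero[OF cart_unit_cartan[OF p] rs] nz by (simp add: diff_diff_add)
    have 2: "?Q $$ (r, r) + ?Q $$ (s, s) = ?Q $$ (?p, ?p) + ?Q $$ (?q, ?q)"
      using zero[OF cart_unit_cartan[OF q] rs] nz by (simp add: diff_diff_add)
    have pq': "?p \<noteq> 2*n-1-?q" using p q pq by auto
    have "(r = ?p \<and> s = ?q) \<or> (r = ?q \<and> s = ?p)"
      by (rule unit_sums_unique[OF reflect_neq(1)[OF p] reflect_neq(1)[OF q] pq pq'])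
        (use 1 2 pq pq' in \<open>simp_all add: cart_unit_entry p q rs\<close>)
    then show False using ne by blast
  qed
  \<comment> \<open>The denominator is 1 for \<open>a \<noteq> b\<close> and 2 for a long root,
    where the two terms of \<open>bm\<close> coincide.\<close>
  let ?c = "mc n A ?p ?q / mc n (bm n ?p ?q) ?p ?q"
  have "A = ?c \<cdot>\<^sub>m bm n ?p ?q"
  proof (rule mat_eq_mc[of _ n])
    fix r s assume rs: "r < 2*n" "s < 2*n"
    show "mc n A r s = mc n (?c \<cdot>\<^sub>m bm n ?p ?q) r s"
    proof (cases "(r = ?p \<and> s = ?q) \<or> (r = ?q \<and> s = ?p)")
      case True
      then have "mc n A r s = mc n A ?p ?q" "mc n (bm n ?p ?q) r s = mc n (bm n ?p ?q) ?p ?q"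
        using mc_sym[OF Asp p q] mc_sym[OF bm_sp p q] by (elim disjE; simp)+
      moreover have "mc n (bm n ?p ?q) ?p ?q \<noteq> 0" by (simp add: mc_bm p q)
      ultimately show ?thesis
        unfolding mc_lin(2)[OF bm_carrier bm_carrier rs] by (metis nonzero_divide_eq_eq)
    next
      case False
      then have 0: "mc n A r s = 0" by (intro off[OF rs]) blast+
      have "(r = ?p \<and> s = ?q) = False" "(r = ?q \<and> s = ?p) = False" using False by blast+
      then show ?thesis unfolding mc_lin(2)[OF bm_carrier bm_carrier rs] mc_bm[OF rs] 0
        by (simp only: of_bool_eq) simp
    qed
  qed (use Ac in auto)
  then show ?thesis by blast
qed

section \<open>Coroots and the chosen basis\<close>

lemma eps_dual_carrier [simp]: "eps_dual n a \<in> carrier_mat (2*n) (2*n)"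
  by (cases a) (auto simp: eps_mat_def)

lemma eps_dual_entry:
  assumes "a \<in> idxs n" "r < 2*n" "s < 2*n"
  shows "eps_dual n a $$ (r, s) = (if r = s then (if r = pos n a then 1 else if r = 2*n-1-pos n a then -1 else 0) else 0)"
proof -
  have "r + r + 1 \<noteq> 2*n" by presburger
  obtain i where a: "a = Plain i \<or> a = Under i" and i: "1 \<le> i" "i \<le> n"
    using assms by (auto simp: idxs_def)
  have "i - 1 \<noteq> 2*n - i" "2*n - 1 - (i - 1) = 2*n - i" "2*n - 1 - (2*n - i) = i - 1" using i by presburger+
  moreover have "eps_mat n i $$ (r, s) = (if r = s then (if r = i - 1 then 1 else if r = 2*n - i then -1 else 0) else 0)"
    using i assms(2,3) by (auto simp: eps_mat_def)
  moreover have "eps_mat n i \<in> carrier_mat (2*n) (2*n)" by (simp add: eps_mat_def)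
  ultimately show ?thesis using a assms(2,3) by (elim disjE) simp_all
qed

lemma coroot_nonzero:
  assumes "a \<in> idxs n" "b \<in> idxs n" "b \<noteq> neg a"
  shows "coroot n (a, b) \<noteq> 0\<^sub>m (2*n) (2*n)"
proof -
  let ?p = "pos n a" and ?q = "pos n b"
  have p: "?p < 2*n" and q: "?q < 2*n" using assms pos_less by auto
  have pq: "?q \<noteq> 2*n-1-?p"
    using assms pos_neg[OF assms(1)] pos_inj[OF assms(2) neg_idxs[OF assms(1)]] by auto
  then have pq': "?p \<noteq> 2*n-1-?q" using p q by auto
  have "coroot n (a, b) $$ (?p, ?p) \<noteq> 0"
  proof (cases "a = b")
    case True then show ?thesis using eps_dual_entry[OF assms(1) p p] by (simp add: coroot_def)
  next
    case False
    then have "?p \<noteq> ?q" using pos_inj assms by auto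
    moreover have "(eps_dual n a + eps_dual n b) $$ (?p, ?p) = eps_dual n a $$ (?p, ?p) + eps_dual n b $$ (?p, ?p)"
      using eps_dual_carrier[of n b] p by (simp only: index_add_mat carrier_matD)
    ultimately show ?thesis using False eps_dual_entry[OF assms(1) p p] eps_dual_entry[OF assms(2) p p] pq'
      by (simp add: coroot_def)
  qed
  then show ?thesis using p by auto
qed

text \<open>The bracket normalization makes root vectors nonzero, because the coroot is nonzero. The
  scalars themselves stay arbitrary and are carried along.\<close>

lemma root_vector_bm:
  assumes X: "root_vectors n X" and c: "(a, b) \<in> colors n" "b \<noteq> neg a"
  shows "\<exists>l. l \<noteq> 0 \<and> X (a, b) = l \<cdot>\<^sub>m bm n (pos n a) (pos n b)"
proof -
  have ab: "a \<in> idxs n" "b \<in> idxs n" using c colors_idxs by auto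
  have c': "(neg b, neg a) \<in> colors n"
    using c ab pos_less[OF ab(1)] pos_less[OF ab(2)] by (auto simp: colors_iff_pos pos_neg neg_idxs)
  have 1: "X (a, b) \<in> root_space n (a, b)" "bracket (X (a, b)) (X (neg b, neg a)) = coroot n (a, b)"
    using X c by (auto simp: root_vectors_def)
  have "X (neg b, neg a) \<in> root_space n (neg b, neg a)"
    using X c' c by (auto simp: root_vectors_def)
  then have Y: "X (neg b, neg a) \<in> carrier_mat (2*n) (2*n)" by (auto simp: root_space_def sp_def)
  obtain l where l: "X (a, b) = l \<cdot>\<^sub>m bm n (pos n a) (pos n b)"
    using root_space_eq[OF ab c(2) 1(1)] by blast
  have "l \<noteq> 0"
  proof
    assume "l = 0"
    then have "X (a, b) = 0\<^sub>m (2*n) (2*n)" unfolding l by (intro eq_matI) (auto simp: bm_def)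
    then have "bracket (X (a, b)) (X (neg b, neg a)) = 0\<^sub>m (2*n) (2*n)"
      using Y by (simp add: bracket_def)
    with 1(2) coroot_nonzero[OF ab c(2)] show False by simp
  qed
  with l show ?thesis by blast
qed

text \<open>The coroot of a long root is, up to sign, the single product of a basis vector with its
  mirror image. With these Cartan elements every basis vector, root vector or not, is a multiple of
  one \<open>bm\<close>.\<close>

lemma coroot_bm:
  assumes "a \<in> idxs n"
  shows "\<exists>l. l \<noteq> 0 \<and> coroot n (a, a) = l \<cdot>\<^sub>m bm n (pos n a) (pos n (neg a))"
proof -
  let ?p = "pos n a"
  have p: "?p < 2*n" using assms pos_less by auto
  let ?l = "sgp n (2*n-1-?p)"
  have "eps_dual n a = ?l \<cdot>\<^sub>m bm n ?p (2*n-1-?p)"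
  proof (rule eq_matI)
    fix r s assume "r < dim_row (?l \<cdot>\<^sub>m bm n ?p (2*n-1-?p))" "s < dim_col (?l \<cdot>\<^sub>m bm n ?p (2*n-1-?p))"
    then have rs: "r < 2*n" "s < 2*n" by (auto simp: bm_def)
    have eq: "(2*n-1-s = 2*n-1-?p) = (s = ?p)" "(2*n-1-s = ?p) = (s = 2*n-1-?p)" using rs p by auto
    have "?p \<noteq> 2*n-1-?p" using p by presburger
    then show "eps_dual n a $$ (r, s) = (?l \<cdot>\<^sub>m bm n ?p (2*n-1-?p)) $$ (r, s)"
      unfolding eps_dual_entry[OF assms rs] using rs p eq
      by (auto simp: bm_def sgp_reflect)
  qed (auto simp: eps_dual_carrier[THEN carrier_matD(1)] eps_dual_carrier[THEN carrier_matD(2)] bm_def)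
  then show ?thesis by (auto simp: coroot_def pos_neg[OF assms] intro!: exI[of _ ?l])
qed

lemma basis_vec_bm:
  assumes "root_vectors n X" "c \<in> colors n"
  shows "\<exists>l. l \<noteq> 0 \<and> basis_vec n X c = l \<cdot>\<^sub>m bm n (pos n (fst c)) (pos n (snd c))"
  using assms root_vector_bm[OF assms(1)] coroot_bm[of "fst c" n] colors_idxs[of "fst c" "snd c" n]
  by (cases c) (auto simp: basis_vec_def)

section \<open>The degree zero subalgebra\<close>

lemma mat_span_closed:
  assumes "A \<in> mat_span N S" "P (0\<^sub>m N N)" "\<And>A B c. P A \<Longrightarrow> B \<in> S \<Longrightarrow> P (A + c \<cdot>\<^sub>m B)"
  shows "P A"
  using assms(1) by induction (use assms in auto)

text \<open>A root killed by the coweight joins a plain with an underlined index, and the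
  corresponding \<open>bm\<close> has no entry in the lower left block. Thus the degree zero
  subalgebra preserves the span of the first \<open>n\<close> basis vectors.\<close>

lemma g0_sp_block:
  assumes "A \<in> g0 n"
  shows "A \<in> sp n \<and> (\<forall>u r. r < n \<longrightarrow> n \<le> u \<longrightarrow> u < 2*n \<longrightarrow> A $$ (u, r) = 0)"
  using assms unfolding g0_def
proof (rule mat_span_closed)
  show "0\<^sub>m (2 * n) (2 * n) \<in> sp n \<and> (\<forall>u r. r < n \<longrightarrow> n \<le> u \<longrightarrow> u < 2*n \<longrightarrow> 0\<^sub>m (2 * n) (2 * n) $$ (u, r) = 0)"
    by auto
next
  fix A B c
  assume A: "A \<in> sp n \<and> (\<forall>u r. r < n \<longrightarrow> n \<le> u \<longrightarrow> u < 2*n \<longrightarrow> A $$ (u, r) = 0)"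
    and B: "B \<in> cartan n \<union> (\<Union>(a, b) \<in> {(a, b) \<in> colors n. b \<noteq> neg a \<and> weight (a, b) (omega n) = 0}. root_space n (a, b))"
  have B': "B \<in> sp n \<and> (\<forall>u r. r < n \<longrightarrow> n \<le> u \<longrightarrow> u < 2*n \<longrightarrow> B $$ (u, r) = 0)"
  proof (cases "B \<in> cartan n")
    case True
    then show ?thesis by (auto simp: cartan_def diagonal_mat_def sp_def)
  next
    case False
    then obtain a b where ab: "(a, b) \<in> colors n" "b \<noteq> neg a" "weight (a, b) (omega n) = 0" "B \<in> root_space n (a, b)"
      using B by auto
    then have i: "a \<in> idxs n" "b \<in> idxs n" using colors_idxs by auto
    obtain l where l: "B = l \<cdot>\<^sub>m bm n (pos n a) (pos n b)"
      using root_space_eq[OF i ab(2,4)] by blast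
    have "eps a (omega n) = (case a of Plain _ \<Rightarrow> 1/2 | Under _ \<Rightarrow> -1/2)" if "a \<in> idxs n" for a
      using that by (auto simp: omega_def idxs_def)
    from this[OF i(1)] this[OF i(2)] ab(3)
    have "(case a of Plain _ \<Rightarrow> 1/2 | Under _ \<Rightarrow> -1/2) + (case b of Plain _ \<Rightarrow> 1/2 | Under _ \<Rightarrow> -1/2) = (0::complex)"
      by (simp add: weight_def)
    then obtain i j where ij: "(a = Plain i \<and> b = Under j) \<or> (a = Under i \<and> b = Plain j)" "1 \<le> i" "i \<le> n" "1 \<le> j" "j \<le> n"
      using i by (cases a; cases b) (auto simp: idxs_def)
    have "bm n (pos n a) (pos n b) $$ (u, r) = 0" if "r < n" "n \<le> u" "u < 2*n" for u r
    proof -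
      have "(pos n a < n) \<noteq> (pos n b < n)" "n \<le> 2*n - 1 - r" using ij that by auto
      then have "(u = pos n a \<and> 2*n - 1 - r = pos n b) = False" "(u = pos n b \<and> 2*n - 1 - r = pos n a) = False"
        using that by auto
      moreover have "bm n p q $$ (u, r) = sgp n (2*n - 1 - r) *
        (of_bool (u = p \<and> 2*n - 1 - r = q) + of_bool (u = q \<and> 2*n - 1 - r = p))" for p q
        using that unfolding bm_def by (subst index_mat(1)) simp_all
      ultimately show ?thesis by (simp only: of_bool_eq) simp
    qed
    then show ?thesis using l sp_smult[OF bm_sp] by (auto simp: bm_def)
  qed
  then show "A + c \<cdot>\<^sub>m B \<in> sp n \<and> (\<forall>u r. r < n \<longrightarrow> n \<le> u \<longrightarrow> u < 2*n \<longrightarrow> (A + c \<cdot>\<^sub>m B) $$ (u, r) = 0)"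
    using A by (auto simp: sp_add sp_smult sp_carrier[THEN carrier_matD(1)] sp_carrier[THEN carrier_matD(2)])
qed

text \<open>Up to sign this operator replaces \<open>e_0\<close> by \<open>e_b\<close> among the
  first \<open>n\<close> basis vectors; its root is the difference of the weights of these two
  vectors.\<close>

lemma g0_lower:
  assumes "b < n" "b \<noteq> 0"
  shows "bm n b (2*n-1) \<in> g0 n"
proof -
  let ?S = "cartan n \<union> (\<Union>(a, b) \<in> {(a, b) \<in> colors n. b \<noteq> neg a \<and> weight (a, b) (omega n) = 0}. root_space n (a, b))"
  let ?a = "Plain (b+1)" and ?b = "Under 1"
  have i: "?a \<in> idxs n" "?b \<in> idxs n" using assms by (auto simp: idxs_def)
  have "(?a, ?b) \<in> colors n" "?b \<noteq> neg ?a" "weight (?a, ?b) (omega n) = 0"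
    using assms by (auto simp: colors_def idxs_def weight_def omega_def)
  moreover have "bm n b (2*n-1) \<in> root_space n (?a, ?b)" using bm_root_space[OF i] by simp
  ultimately have "bm n b (2*n-1) \<in> ?S" by blast
  then have "0\<^sub>m (2*n) (2*n) + 1 \<cdot>\<^sub>m bm n b (2*n-1) \<in> mat_span (2*n) ?S"
    by (intro mat_span.intros)
  moreover have "0\<^sub>m (2*n) (2*n) + 1 \<cdot>\<^sub>m bm n b (2*n-1) = bm n b (2*n-1)"
    by (intro eq_matI) (auto simp: bm_def)
  ultimately show ?thesis by (simp add: g0_def)
qed

section \<open>Independence of ordered monomials\<close>

definition tsi :: "free_alg set \<Rightarrow> bool" where
  "tsi J \<longleftrightarrow> 0 \<in> J \<and> (\<forall>p\<in>J. \<forall>q\<in>J. p + q \<in> J) \<and> (\<forall>p\<in>J. \<forall>a b. a * p * b \<in> J)"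

lemma tsiD:
  assumes "tsi J"
  shows "0 \<in> J" "p \<in> J \<Longrightarrow> q \<in> J \<Longrightarrow> p + q \<in> J" "p \<in> J \<Longrightarrow> a * p * b \<in> J"
    "p \<in> J \<Longrightarrow> a * p \<in> J" "p \<in> J \<Longrightarrow> p * b \<in> J" "p \<in> J \<Longrightarrow> - p \<in> J"
    "p \<in> J \<Longrightarrow> q \<in> J \<Longrightarrow> p - q \<in> J"
proof -
  show 1: "0 \<in> J" "p \<in> J \<Longrightarrow> q \<in> J \<Longrightarrow> p + q \<in> J" "p \<in> J \<Longrightarrow> a * p * b \<in> J" for p q a b
    using assms by (auto simp: tsi_def)
  show "p \<in> J \<Longrightarrow> a * p \<in> J" "p \<in> J \<Longrightarrow> p * b \<in> J" for p
    using 1(3)[of p a 1] 1(3)[of p 1 b] by auto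
  show m: "p \<in> J \<Longrightarrow> - p \<in> J" for p using 1(3)[of p "-1" 1] by auto
  show "p \<in> J \<Longrightarrow> q \<in> J \<Longrightarrow> p - q \<in> J" using 1(2)[of p "-q"] m by auto
qed

lemma tsi_sum: "tsi J \<Longrightarrow> (\<And>x. x \<in> S \<Longrightarrow> f x \<in> J) \<Longrightarrow> sum f S \<in> J"
  by (induction S rule: infinite_finite_induct) (auto intro: tsiD)

lemma tsi_trans: "tsi J \<Longrightarrow> p - q \<in> J \<Longrightarrow> q - r \<in> J \<Longrightarrow> p - r \<in> J"
  using tsiD(2)[of J "p - q" "q - r"] by simp

lemma tsi_env_ideal: "tsi (env_ideal n)"
  by (auto simp: tsi_def intro: env_ideal.intros)

lemmas envI = tsiD[OF tsi_env_ideal]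

lemma scalar_0 [simp]: "scalar 0 = 0" by (simp add: scalar_def)
lemma scalar_1 [simp]: "scalar 1 = 1"
  using single_one by (simp add: scalar_def zero_list_def flip: single_one)
lemma scalar_add: "scalar (a + b) = scalar a + scalar b" by (simp add: scalar_def single_add)
lemma scalar_mult: "scalar (a * b) = scalar a * scalar b" by (simp add: scalar_def mult_single plus_list_def)
lemma scalar_minus: "scalar (- a) = - scalar a" by (simp add: scalar_def single_uminus)
lemma scalar_diff: "scalar (a - b) = scalar a - scalar b" using scalar_add[of a "-b"] by (simp add: scalar_minus)
lemma scalar_sum: "scalar (sum f S) = (\<Sum>x\<in>S. scalar (f x))"
  by (induction S rule: infinite_finite_induct) (auto simp: scalar_add)

lemma free_alg_expand: "p = (\<Sum>w\<in>Poly_Mapping.keys p. Poly_Mapping.single w (Poly_Mapping.lookup p w))"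
proof (rule poly_mapping_eqI)
  fix k
  show "Poly_Mapping.lookup p k = Poly_Mapping.lookup (\<Sum>w\<in>Poly_Mapping.keys p. Poly_Mapping.single w (Poly_Mapping.lookup p w)) k"
    unfolding lookup_sum lookup_single
    by (cases "k \<in> Poly_Mapping.keys p") (auto simp: when_def in_keys_iff)
qed

lemma free_alg_induct [case_names zero add scalar gen]:
  fixes p :: free_alg
  assumes "P 0" "\<And>p q. P p \<Longrightarrow> P q \<Longrightarrow> P (p + q)" "\<And>c. P (scalar c)" "\<And>g p. P p \<Longrightarrow> P (gen g * p)"
  shows "P p"
proof -
  have "P (Poly_Mapping.single w c)" for w c
  proof (induction w)
    case Nil
    then show ?case using assms(3) by (simp add: scalar_def)
  next
    case (Cons g w)
    have "gen g * Poly_Mapping.single w c = Poly_Mapping.single (g # w) c"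
      by (simp add: gen_def mult_single plus_list_def)
    then show ?case using assms(4)[OF Cons, of g] by simp
  qed
  then have "P (\<Sum>w\<in>S. Poly_Mapping.single w (f w))" for S f
    by (induction S rule: infinite_finite_induct) (auto intro: assms)
  then show ?thesis using free_alg_expand[of p] by metis
qed

lemma scalar_commute: "scalar c * p = p * scalar c"
proof (induction p rule: free_alg_induct)
  case (scalar d)
  then show ?case by (simp flip: scalar_mult add: mult.commute)
next
  case (gen g p)
  have "scalar c * gen g = gen g * scalar c" by (simp add: gen_def scalar_def mult_single plus_list_def)
  then show ?case using gen by (metis mult.assoc)
qed (auto simp: algebra_simps)

lemma scalar_left_commute: "p * (scalar c * q) = scalar c * (p * q)"
  by (metis mult.assoc scalar_commute)

definition lin :: "(aff_gen list \<Rightarrow> complex) \<Rightarrow> free_alg \<Rightarrow> complex" where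
  "lin f p = (\<Sum>w\<in>Poly_Mapping.keys p. Poly_Mapping.lookup p w * f w)"

lemma lin_superset:
  assumes "finite S" "Poly_Mapping.keys p \<subseteq> S"
  shows "lin f p = (\<Sum>w\<in>S. Poly_Mapping.lookup p w * f w)"
  unfolding lin_def using assms by (intro sum.mono_neutral_left) (auto simp: in_keys_iff)

lemma lin_add: "lin f (p + q) = lin f p + lin f q"
proof -
  let ?S = "Poly_Mapping.keys p \<union> Poly_Mapping.keys q"
  have "Poly_Mapping.keys (p + q) \<subseteq> ?S" by (rule Poly_Mapping.keys_add)
  then show ?thesis
    using lin_superset[of ?S p f] lin_superset[of ?S q f] lin_superset[of ?S "p + q" f]
    by (simp add: lookup_add algebra_simps sum.distrib)
qed

lemma lin_0 [simp]: "lin f 0 = 0" by (simp add: lin_def)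

lemma lin_single [simp]: "lin f (Poly_Mapping.single w c) = c * f w"
  by (cases "c = 0") (auto simp: lin_def)

lemma lin_uminus: "lin f (- p) = - lin f p"
  using lin_add[of f p "-p"] by (simp add: eq_neg_iff_add_eq_0 add.commute)

lemma lin_diff: "lin f (p - q) = lin f p - lin f q"
  using lin_add[of f p "-q"] by (simp add: lin_uminus)

lemma lin_sum: "lin f (sum g S) = (\<Sum>x\<in>S. lin f (g x))"
  by (induction S rule: infinite_finite_induct) (auto simp: lin_add)

lemma lin_fun_sum: "lin (\<lambda>w. \<Sum>t\<in>S. f t w) p = (\<Sum>t\<in>S. lin (f t) p)"
  unfolding lin_def by (simp add: sum_distrib_left sum.swap[of _ S])

lemma lin_fun_zero [simp]: "lin (\<lambda>w. 0) p = 0" by (simp add: lin_def)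

lemma lin_single_mult: "lin f (Poly_Mapping.single v c * p) = c * lin (\<lambda>w. f (v @ w)) p"
proof -
  have "Poly_Mapping.single v c * p = (\<Sum>w\<in>Poly_Mapping.keys p. Poly_Mapping.single (v @ w) (c * Poly_Mapping.lookup p w))"
    by (subst free_alg_expand[of p]) (simp add: sum_distrib_left mult_single plus_list_def)
  then show ?thesis by (simp add: lin_sum) (simp add: lin_def sum_distrib_left mult.assoc)
qed

lemma lin_mult_single: "lin f (p * Poly_Mapping.single v c) = c * lin (\<lambda>w. f (w @ v)) p"
proof -
  have "p * Poly_Mapping.single v c = (\<Sum>w\<in>Poly_Mapping.keys p. Poly_Mapping.single (w @ v) (Poly_Mapping.lookup p w * c))"
    by (subst free_alg_expand[of p]) (simp add: sum_distrib_right mult_single plus_list_def)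
  then show ?thesis by (simp add: lin_sum) (simp add: lin_def sum_distrib_left mult_ac)
qed

lemma lin_gen_mult: "lin f (gen g * p) = lin (\<lambda>w. f (g # w)) p"
  by (simp add: gen_def lin_single_mult)

lemma lin_scalar_mult: "lin f (scalar c * p) = c * lin f p"
  by (simp add: scalar_def lin_single_mult)

text \<open>Matrix coefficients of the right action of words on tensors \<open>\<Otimes>\<^sub>t (A\<^sub>t \<otimes> z\<^bsup>j\<^sub>t\<^esup>)\<close> of \<open>L\<close> matrix-valued
  Laurent monomials; the central element acts by zero.\<close>

fun tens :: "nat \<Rightarrow> nat \<Rightarrow> (nat \<Rightarrow> complex mat \<times> int \<Rightarrow> complex) \<Rightarrow> (nat \<Rightarrow> complex mat \<times> int)
    \<Rightarrow> aff_gen list \<Rightarrow> complex" where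
  "tens n L F st [] = (\<Prod>t<L. F t (st t))"
| "tens n L F st (Loop x i # w) = (if x \<in> sp n then
     (\<Sum>t<L. tens n L F (st(t := (fst (st t) * x, snd (st t) + i))) w) else 0)"
| "tens n L F st (Central # w) = 0"

definition tlin :: "nat \<Rightarrow> nat \<Rightarrow> (nat \<Rightarrow> complex mat \<times> int \<Rightarrow> complex) \<Rightarrow> bool" where
  "tlin n L F \<longleftrightarrow> (\<forall>t<L. \<forall>A\<in>carrier_mat (2*n) (2*n). \<forall>B\<in>carrier_mat (2*n) (2*n). \<forall>c j.
     F t (c \<cdot>\<^sub>m A + B, j) = c * F t (A, j) + F t (B, j))"

definition tvalid :: "nat \<Rightarrow> nat \<Rightarrow> (nat \<Rightarrow> complex mat \<times> int) \<Rightarrow> bool" where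
  "tvalid n L st \<longleftrightarrow> (\<forall>t<L. fst (st t) \<in> carrier_mat (2*n) (2*n))"

lemma tvalid_upd:
  "tvalid n L st \<Longrightarrow> t < L \<Longrightarrow> x \<in> sp n \<Longrightarrow> tvalid n L (st(t := (fst (st t) * x, j)))"
  by (auto simp: tvalid_def intro!: mult_carrier_mat[OF _ sp_carrier])

lemma tens_multilinear:
  assumes "tlin n L F" "t < L" "A \<in> carrier_mat (2*n) (2*n)" "B \<in> carrier_mat (2*n) (2*n)"
  shows "tens n L F (st(t := (c \<cdot>\<^sub>m A + B, j))) w
    = c * tens n L F (st(t := (A, j))) w + tens n L F (st(t := (B, j))) w"
  using assms(3,4)
proof (induction w arbitrary: st A B j)
  case Nil
  have "(\<Prod>s<L. F s ((st(t := y)) s)) = F t y * (\<Prod>s\<in>{..<L} - {t}. F s (st s))" for y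
    using assms(2) by (subst prod.remove[of _ t]) auto
  then show ?case using assms(1,2) Nil by (simp add: tlin_def algebra_simps)
next
  case (Cons g w)
  show ?case
  proof (cases g)
    case (Loop x i)
    show ?thesis
    proof (cases "x \<in> sp n")
      case True
      then have x: "x \<in> carrier_mat (2*n) (2*n)" by (rule sp_carrier)
      have eq: "tens n L F ((st(t := (c \<cdot>\<^sub>m A + B, j)))(s := (fst ((st(t := (c \<cdot>\<^sub>m A + B, j))) s) * x, snd ((st(t := (c \<cdot>\<^sub>m A + B, j))) s) + i))) w
        = c * tens n L F ((st(t := (A, j)))(s := (fst ((st(t := (A, j))) s) * x, snd ((st(t := (A, j))) s) + i))) w
        + tens n L F ((st(t := (B, j)))(s := (fst ((st(t := (B, j))) s) * x, snd ((st(t := (B, j))) s) + i))) w" for s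
      proof (cases "s = t")
        case True
        have *: "(c \<cdot>\<^sub>m A + B) * x = c \<cdot>\<^sub>m (A * x) + B * x"
          using Cons.prems x add_mult_distrib_mat[of "c \<cdot>\<^sub>m A" "2*n" "2*n" B x "2*n"]
            mult_smult_assoc_mat[of A "2*n" "2*n" x "2*n" c] by simp
        have "A * x \<in> carrier_mat (2*n) (2*n)" "B * x \<in> carrier_mat (2*n) (2*n)"
          using Cons.prems x by auto
        then show ?thesis unfolding True fun_upd_same fst_conv snd_conv fun_upd_upd *
          by (intro Cons.IH)
      next
        case False
        show ?thesis unfolding fun_upd_other[OF False] fun_upd_twist[OF False[symmetric]]
          by (rule Cons.IH[OF Cons.prems])
      qed
      show ?thesis using True unfolding Loop tens.simps eq
        by (simp add: sum.distrib sum_distrib_left)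
    qed (simp add: Loop)
  qed simp
qed

text \<open>The annihilator of all such tensors. Letting the initial state \<open>st\<close> vary
  makes it a left ideal, since a letter on the left only changes the state; letting the continuation
  \<open>w\<close> vary makes it a right ideal.\<close>

definition loop_ideal :: "nat \<Rightarrow> free_alg set" where
  "loop_ideal n = {p. \<forall>L F st w. tlin n L F \<longrightarrow> tvalid n L st \<longrightarrow> lin (\<lambda>v. tens n L F st (v @ w)) p = 0}"

lemma tsi_loop_ideal: "tsi (loop_ideal n)"
proof -
  have left: "gen g * p \<in> loop_ideal n" if p: "p \<in> loop_ideal n" for g p
  proof -
    have "lin (\<lambda>v. tens n L F st (v @ w)) (gen g * p) = 0" if "tlin n L F" "tvalid n L st" for L F st w
    proof (cases g)
      case (Loop x i)
      show ?thesis
      proof (cases "x \<in> sp n")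
        case True
        then show ?thesis using p that by (auto simp: Loop lin_gen_mult lin_fun_sum loop_ideal_def tvalid_upd)
      qed (simp add: Loop lin_gen_mult)
    qed (simp add: lin_gen_mult)
    then show ?thesis by (simp add: loop_ideal_def)
  qed
  have right: "p * Poly_Mapping.single v c \<in> loop_ideal n" if p: "p \<in> loop_ideal n" for v c p
    using p by (simp add: loop_ideal_def lin_mult_single)
  have add: "p + q \<in> loop_ideal n" if "p \<in> loop_ideal n" "q \<in> loop_ideal n" for p q
    using that by (simp add: loop_ideal_def lin_add)
  have zero: "0 \<in> loop_ideal n" by (simp add: loop_ideal_def)
  have l: "a * p \<in> loop_ideal n" if p: "p \<in> loop_ideal n" for a p
  proof (induction a rule: free_alg_induct)
    case (scalar c)
    then show ?case using p by (simp add: loop_ideal_def lin_scalar_mult)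
  qed (use left add zero in \<open>auto simp: distrib_right mult.assoc\<close>)
  have r: "p * b \<in> loop_ideal n" if p: "p \<in> loop_ideal n" for b p
  proof -
    have "(\<Sum>w\<in>S. p * Poly_Mapping.single w (f w)) \<in> loop_ideal n" for S f
      by (induction S rule: infinite_finite_induct) (auto intro: zero add right p)
    then show ?thesis by (subst free_alg_expand[of b]) (simp add: sum_distrib_left)
  qed
  show ?thesis using zero add l r by (simp add: tsi_def)
qed

text \<open>Letters that act on different tensor factors commute, and on one factor the difference
  of the two orders is multiplication by the bracket. The cocycle leaves no trace because
  \<open>Central\<close> acts by zero.\<close>

lemma env_subset_loop: "env_ideal n \<subseteq> loop_ideal n"
proof
  fix p assume "p \<in> env_ideal n"
  then show "p \<in> loop_ideal n"
  proof induction
    case (junk x i)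
    then show ?case by (simp add: loop_ideal_def lp_def gen_def)
  next
    case (linear x y a i)
    have xy: "x \<in> carrier_mat (2*n) (2*n)" "y \<in> carrier_mat (2*n) (2*n)" "a \<cdot>\<^sub>m x + y \<in> sp n"
      using linear by (auto dest: sp_carrier intro: sp_lin)
    have "tens n L F st (Loop (a \<cdot>\<^sub>m x + y) i # w) = a * tens n L F st (Loop x i # w) + tens n L F st (Loop y i # w)"
      if F: "tlin n L F" and st: "tvalid n L st" for L F st w
    proof -
      have "tens n L F (st(t := (fst (st t) * (a \<cdot>\<^sub>m x + y), snd (st t) + i))) w
        = a * tens n L F (st(t := (fst (st t) * x, snd (st t) + i))) w
          + tens n L F (st(t := (fst (st t) * y, snd (st t) + i))) w" if t: "t < L" for t
      proof -
        have c: "fst (st t) \<in> carrier_mat (2*n) (2*n)" using st t by (simp add: tvalid_def)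
        have "fst (st t) * (a \<cdot>\<^sub>m x + y) = a \<cdot>\<^sub>m (fst (st t) * x) + fst (st t) * y"
          using c xy mult_add_distrib_mat[of "fst (st t)" "2*n" "2*n" "a \<cdot>\<^sub>m x" "2*n" y]
            mult_smult_distrib[of "fst (st t)" "2*n" "2*n" x "2*n" a] by simp
        then show ?thesis using tens_multilinear[OF F t, of "fst (st t) * x" "fst (st t) * y"] c xy by simp
      qed
      then show ?thesis using linear xy by (simp add: sum.distrib sum_distrib_left)
    qed
    then show ?case
      by (simp add: loop_ideal_def lin_diff lin_add lin_scalar_mult lp_def) (simp add: gen_def)
  next
    case (commutator x y i j)
    note xy = sp_carrier[OF commutator(1)] sp_carrier[OF commutator(2)]
    have b: "bracket x y \<in> sp n" using commutator sp_bracket by blast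
    have "tens n L F st (Loop x i # Loop y j # w) - tens n L F st (Loop y j # Loop x i # w)
        = tens n L F st (Loop (bracket x y) (i + j) # w)"
      if F: "tlin n L F" and st: "tvalid n L st" for L F st w
    proof -
      \<comment> \<open>\<open>G t s\<close> lets \<open>x\<close> act on factor \<open>t\<close>
        and then \<open>y\<close> on factor \<open>s\<close>; \<open>H t s\<close> is the same in
        the opposite order. They differ only for \<open>t = s\<close>.\<close>
      define G where "G = (\<lambda>t s. let st' = st(t := (fst (st t) * x, snd (st t) + i))
        in tens n L F (st'(s := (fst (st' s) * y, snd (st' s) + j))) w)"
      define H where "H = (\<lambda>t s. let st' = st(s := (fst (st s) * y, snd (st s) + j))
        in tens n L F (st'(t := (fst (st' t) * x, snd (st' t) + i))) w)"
      have off: "G t s = H t s" if "t \<noteq> s" for t s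
        using that by (simp add: G_def H_def fun_upd_twist)
      have dia: "G t t - H t t = tens n L F (st(t := (fst (st t) * bracket x y, snd (st t) + (i + j)))) w" if t: "t < L" for t
      proof -
        have c: "fst (st t) \<in> carrier_mat (2*n) (2*n)" using st t by (simp add: tvalid_def)
        let ?M = "fst (st t)"
        have "?M * bracket x y = (-1) \<cdot>\<^sub>m (?M * y * x) + ?M * x * y"
        proof -
          have "?M * bracket x y = ?M * (x * y) - ?M * (y * x)"
            unfolding bracket_def using c xy by (intro mult_minus_distrib_mat) auto
          then show ?thesis using c xy by (auto intro!: eq_matI)
        qed
        then show ?thesis
          using tens_multilinear[OF F t, of "?M * y * x" "?M * x * y" st "-1" "snd (st t) + (i + j)"] c xy
          by (simp add: G_def H_def algebra_simps)
      qed
      have "tens n L F st (Loop x i # Loop y j # w) = (\<Sum>t<L. \<Sum>s<L. G t s)"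
        using commutator by (simp add: G_def Let_def)
      moreover have "tens n L F st (Loop y j # Loop x i # w) = (\<Sum>s<L. \<Sum>t<L. H t s)"
        using commutator by (simp add: H_def Let_def)
      moreover have "(\<Sum>s<L. \<Sum>t<L. H t s) = (\<Sum>t<L. \<Sum>s<L. H t s)" by (rule sum.swap)
      moreover have "(\<Sum>t<L. \<Sum>s<L. G t s) - (\<Sum>t<L. \<Sum>s<L. H t s) = (\<Sum>t<L. \<Sum>s<L. if s = t then G t t - H t t else 0)"
        unfolding sum_subtractf[symmetric] using off by (intro sum.cong refl) auto
      ultimately show ?thesis using b dia by simp
    qed
    then show ?case
      by (simp add: loop_ideal_def lin_diff lin_add lin_scalar_mult lp_def lin_gen_mult del: tens.simps(2)) (simp add: gen_def del: tens.simps(2))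
  next
    case (central x i)
    then show ?case by (simp add: loop_ideal_def lin_diff lp_def lin_gen_mult) (simp add: gen_def)
  qed (auto intro: tsiD[OF tsi_loop_ideal])
qed

lemma central_loop: "gen Central \<in> loop_ideal n"
  by (simp add: loop_ideal_def gen_def)

definition loop_word :: "nat \<Rightarrow> (color \<Rightarrow> complex mat) \<Rightarrow> cpart \<Rightarrow> aff_gen list" where
  "loop_word n X \<pi> = map (\<lambda>(c, m). Loop (basis_vec n X c) m) \<pi>"

lemma u_mon_Nil [simp]: "u_mon n X [] = 1"
  by (simp add: u_mon_def)

lemma u_mon_Cons: "u_mon n X (p # \<pi>) = lp (basis_vec n X (fst p)) (snd p) * u_mon n X \<pi>"
  by (simp add: u_mon_def case_prod_beta)

lemma u_mon_append: "u_mon n X (\<pi> @ \<sigma>) = u_mon n X \<pi> * u_mon n X \<sigma>"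
  by (simp add: u_mon_def)

lemma u_mon_single: "u_mon n X \<pi> = Poly_Mapping.single (loop_word n X \<pi>) 1"
proof (induction \<pi>)
  case Nil
  then show ?case using scalar_1 by (simp add: loop_word_def scalar_def)
next
  case (Cons p \<pi>)
  then show ?case by (simp add: u_mon_Cons loop_word_def lp_def gen_def mult_single plus_list_def case_prod_beta)
qed

text \<open>Each letter changes one factor, so a word shorter than the number of untouched factors
  leaves one of them at the identity, where its functional vanishes.\<close>

lemma tens_untouched_short:
  assumes "\<And>t. t < L \<Longrightarrow> F t (1\<^sub>m (2*n), 0) = 0"
    "U \<subseteq> {..<L}" "\<And>t. t \<in> U \<Longrightarrow> st t = (1\<^sub>m (2*n), 0)" "length w < card U"
  shows "tens n L F st w = 0"
  using assms(2-4)
proof (induction w arbitrary: st U)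
  case Nil
  then have "U \<noteq> {}" by auto
  then obtain t where "t \<in> U" by blast
  then have "t \<in> {..<L}" "F t (st t) = 0" using Nil assms(1) by auto
  then show ?case using prod_zero[of "{..<L}" "\<lambda>t. F t (st t)"] by auto
next
  case (Cons g w)
  show ?case
  proof (cases g)
    case (Loop x i)
    have "tens n L F (st(s := (fst (st s) * x, snd (st s) + i))) w = 0" for s
    proof (rule Cons.IH[of "U - {s}"])
      have "finite U" using Cons.prems(1) finite_subset by blast
      then have "card U \<le> Suc (card (U - {s}))" by (metis card_Suc_Diff1 card_Diff_singleton_if diff_le_self eq_imp_le le_SucI)
      then show "length w < card (U - {s})" using Cons.prems(3) by simp
    qed (use Cons.prems in auto)
    then show ?thesis by (simp add: Loop)
  qed simp
qed

text \<open>If the functionals \<open>F\<close> vanish at the identity matrix, a word of length \<open>L\<close> must hit every tensor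
  factor exactly once; the ways of doing so are counted by matchings of factors and letters.\<close>

fun matchings :: "(nat \<Rightarrow> 'a) \<Rightarrow> nat set \<Rightarrow> 'a list \<Rightarrow> nat" where
  "matchings \<sigma> U [] = 1"
| "matchings \<sigma> U (p # w) = (\<Sum>t\<in>U. if \<sigma> t = p then matchings \<sigma> (U - {t}) w else 0)"

text \<open>The first letter has to be matched with some factor carrying its label; removing both
  leaves the same question for the rest.\<close>

lemma matchings_pos_iff:
  assumes "finite U" "card U = length w"
  shows "matchings \<sigma> U w > 0 \<longleftrightarrow> image_mset \<sigma> (mset_set U) = mset w"
  using assms
proof (induction w arbitrary: U)
  case (Cons p w)
  have U: "mset_set U = add_mset t (mset_set (U - {t}))" if "t \<in> U" for t
    using mset_set.remove[OF Cons.prems(1) that] by simp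
  have IH: "matchings \<sigma> (U - {t}) w > 0 \<longleftrightarrow> image_mset \<sigma> (mset_set (U - {t})) = mset w" if "t \<in> U" for t
    using Cons.IH[of "U - {t}"] Cons.prems that by simp
  have "matchings \<sigma> U (p # w) > 0 \<longleftrightarrow> (\<exists>t\<in>U. \<sigma> t = p \<and> matchings \<sigma> (U - {t}) w > 0)"
    using Cons.prems(1) by (auto simp: sum_eq_0_iff split: if_splits simp flip: neq0_conv)
  also have "\<dots> \<longleftrightarrow> image_mset \<sigma> (mset_set U) = mset (p # w)"
  proof
    assume "\<exists>t\<in>U. \<sigma> t = p \<and> matchings \<sigma> (U - {t}) w > 0"
    then show "image_mset \<sigma> (mset_set U) = mset (p # w)" using IH U by auto
  next
    assume eq: "image_mset \<sigma> (mset_set U) = mset (p # w)"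
    then have "p \<in># image_mset \<sigma> (mset_set U)" by simp
    then obtain t where t: "t \<in> U" "\<sigma> t = p" using Cons.prems(1) by auto
    then have "image_mset \<sigma> (mset_set (U - {t})) = mset w" using eq U[OF t(1)] by simp
    then show "\<exists>t\<in>U. \<sigma> t = p \<and> matchings \<sigma> (U - {t}) w > 0" using IH t by blast
  qed
  finally show ?case .
qed auto

text \<open>With exactly as many letters as untouched factors, a letter spent on a touched factor
  leaves too few for the others. Every surviving term is therefore a bijection between letters and
  untouched factors, and all of these contribute the same product of values
  \<open>\<kappa>\<close>.\<close>

lemma tens_full:
  assumes zero: "\<And>t. t < L \<Longrightarrow> F t (1\<^sub>m (2*n), 0) = 0"
    and val: "\<And>t p. t < L \<Longrightarrow> p \<in> set w \<Longrightarrow>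
      F t (basis_vec n X (fst p), snd p) = (if \<sigma> t = p then \<kappa> p else 0)"
    and sp: "\<And>p. p \<in> set w \<Longrightarrow> basis_vec n X (fst p) \<in> sp n"
    and U: "U \<subseteq> {..<L}" "\<And>t. t \<in> U \<Longrightarrow> st t = (1\<^sub>m (2*n), 0)" "length w = card U"
  shows "tens n L F st (loop_word n X w) =
    (\<Prod>t\<in>{..<L} - U. F t (st t)) * (\<Prod>p\<leftarrow>w. \<kappa> p) * of_nat (matchings \<sigma> U w)"
  using val sp U
proof (induction w arbitrary: st U)
  case Nil
  then have "U = {}" using finite_subset[OF Nil(3)] by auto
  then show ?case by (simp add: loop_word_def)
next
  case (Cons p w)
  let ?x = "basis_vec n X (fst p)" and ?i = "snd p"
  have x: "?x \<in> sp n" "?x \<in> carrier_mat (2*n) (2*n)" using Cons.prems sp_carrier by auto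
  have fU: "finite U" using Cons.prems finite_subset by blast
  let ?st = "\<lambda>s. st(s := (fst (st s) * ?x, snd (st s) + ?i))"
  have out: "tens n L F (?st s) (loop_word n X w) = 0" if "s \<notin> U" for s
    using zero Cons.prems(3,4,5) that by (intro tens_untouched_short[of L F n U]) (auto simp: loop_word_def)
  have "inn": "tens n L F (?st s) (loop_word n X w) =
     (\<Prod>t\<in>{..<L} - U. F t (st t)) * (\<Prod>p\<leftarrow>p # w. \<kappa> p) * of_nat (if \<sigma> s = p then matchings \<sigma> (U - {s}) w else 0)"
    if s: "s \<in> U" for s
  proof -
    have sL: "s < L" using s Cons.prems by auto
    have "?st s s = (?x, ?i)" using Cons.prems(4)[OF s] x by simp
    then have "F s (?st s s) = (if \<sigma> s = p then \<kappa> p else 0)" using Cons.prems(1)[OF sL, of p] by simp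
    moreover have "(\<Prod>t\<in>{..<L} - (U - {s}). F t (?st s t)) = F s (?st s s) * (\<Prod>t\<in>{..<L} - U. F t (st t))"
    proof -
      have "{..<L} - (U - {s}) = insert s ({..<L} - U)" using s sL by auto
      moreover have "(\<Prod>t\<in>{..<L} - U. F t (?st s t)) = (\<Prod>t\<in>{..<L} - U. F t (st t))"
        using s by (intro prod.cong) auto
      ultimately show ?thesis using s by simp
    qed
    moreover have "tens n L F (?st s) (loop_word n X w) =
      (\<Prod>t\<in>{..<L} - (U - {s}). F t (?st s t)) * (\<Prod>p\<leftarrow>w. \<kappa> p) * of_nat (matchings \<sigma> (U - {s}) w)"
      using Cons.prems s fU by (intro Cons.IH) auto
    ultimately show ?thesis by simp
  qed
  have "tens n L F st (loop_word n X (p # w)) = (\<Sum>s<L. tens n L F (?st s) (loop_word n X w))"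
    using x by (simp add: loop_word_def case_prod_beta)
  also have "\<dots> = (\<Sum>s\<in>U. tens n L F (?st s) (loop_word n X w))"
    using out Cons.prems(3) by (intro sum.mono_neutral_right) auto
  also have "\<dots> = (\<Sum>s\<in>U. (\<Prod>t\<in>{..<L} - U. F t (st t)) * (\<Prod>p\<leftarrow>p # w. \<kappa> p) * of_nat (if \<sigma> s = p then matchings \<sigma> (U - {s}) w else 0))"
    using "inn" by (intro sum.cong) auto
  finally show ?case by (simp add: sum_distrib_left)
qed

section \<open>Total orders on colors and parts\<close>

lemma idx_less_strict:
  "\<not> idx_less a a" "idx_less a b \<Longrightarrow> idx_less b c \<Longrightarrow> idx_less a c" "idx_less a b \<or> a = b \<or> idx_less b a"
  by (cases a; cases b; cases c; auto)+

lemma color_less_strict: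
  "\<not> color_less a a" "color_less a b \<Longrightarrow> color_less b c \<Longrightarrow> color_less a c"
  "color_less a b \<or> a = b \<or> color_less b a"
  unfolding color_less_def using idx_less_strict by (metis prod.collapse)+

lemma part_less_strict:
  "\<not> part_less a a" "part_less a b \<Longrightarrow> part_less b c \<Longrightarrow> part_less a c"
  "part_less a b \<or> a = b \<or> part_less b a"
proof -
  show "\<not> part_less a a" using color_less_strict(1) by (simp add: part_less_def)
  show "part_less a b \<Longrightarrow> part_less b c \<Longrightarrow> part_less a c"
    unfolding part_less_def by (auto intro: color_less_strict(2))
  show "part_less a b \<or> a = b \<or> part_less b a"
    using color_less_strict(3)[of "fst a" "fst b"] unfolding part_less_def
    by (metis linorder_less_linear prod.collapse)
qed

abbreviation part_le :: "color \<times> int \<Rightarrow> color \<times> int \<Rightarrow> bool" where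
  "part_le \<equiv> (\<lambda>p q. p = q \<or> part_less p q)"

lemma sorted_parts_unique:
  assumes "sorted_wrt part_le \<pi>" "sorted_wrt part_le \<sigma>" "mset \<pi> = mset \<sigma>"
  shows "\<pi> = \<sigma>"
  using assms
proof (induction \<pi> arbitrary: \<sigma>)
  case (Cons p \<pi>)
  then obtain q \<tau> where q: "\<sigma> = q # \<tau>" by (cases \<sigma>) auto
  have "p = q"
  proof (rule ccontr)
    assume ne: "p \<noteq> q"
    have "q \<in> set (p # \<pi>)" "p \<in> set (q # \<tau>)" using Cons.prems(3) q by (metis list.set_intros(1) set_mset_mset)+
    then have "part_less p q" "part_less q p" using ne Cons.prems q by auto
    then show False using part_less_strict(1,2) by blast
  qed
  then show ?case using Cons q by auto
qed simp

lemma basis_vec_scale: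
  assumes "root_vectors n X"
  obtains lam where "\<And>c. c \<in> colors n \<Longrightarrow> lam c \<noteq> 0 \<and> basis_vec n X c = lam c \<cdot>\<^sub>m bm n (pos n (fst c)) (pos n (snd c))"
proof -
  have "\<forall>c\<in>colors n. \<exists>l. l \<noteq> 0 \<and> basis_vec n X c = l \<cdot>\<^sub>m bm n (pos n (fst c)) (pos n (snd c))"
    using basis_vec_bm[OF assms] by blast
  from bchoice[OF this] show thesis using that by blast
qed

lemma basis_vec_sp: "root_vectors n X \<Longrightarrow> c \<in> colors n \<Longrightarrow> basis_vec n X c \<in> sp n"
  using basis_vec_bm[of n X c] sp_smult by fastforce

lemma colors_pos: "c \<in> colors n \<Longrightarrow> pos n (fst c) < 2*n \<and> pos n (snd c) < 2*n \<and> pos n (fst c) \<le> pos n (snd c)"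
  by (cases c) (auto simp: colors_iff_pos pos_less)

lemma colors_eq_iff:
  "c \<in> colors n \<Longrightarrow> d \<in> colors n \<Longrightarrow> c = d \<longleftrightarrow> pos n (fst c) = pos n (fst d) \<and> pos n (snd c) = pos n (snd d)"
  by (cases c; cases d) (auto simp: colors_iff_pos pos_inj)

text \<open>Take a longest monomial \<open>\<rho>\<close> with nonzero coefficient, as many tensor
  factors as \<open>\<rho>\<close> has parts, and on the \<open>t\<close>-th factor a functional
  dual to the \<open>t\<close>-th part. Shorter monomials leave a factor untouched, and an equally
  long one contributes only if it is a rearrangement of \<open>\<rho>\<close>, hence equal to
  it.\<close>

lemma u_mon_independent:
  assumes X: "root_vectors n X" and T: "finite T" "T \<subseteq> cparts n"
    and J: "(\<Sum>\<pi>\<in>T. scalar (e \<pi>) * u_mon n X \<pi>) \<in> loop_ideal n"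
  shows "\<forall>\<pi>\<in>T. e \<pi> = 0"
proof (rule ccontr)
  assume "\<not> (\<forall>\<pi>\<in>T. e \<pi> = 0)"
  define S where "S = {\<pi>\<in>T. e \<pi> \<noteq> 0}"
  have S: "finite S" "S \<noteq> {}" using T \<open>\<not> _\<close> by (auto simp: S_def)
  define L where "L = Max (length ` S)"
  have "L \<in> length ` S" unfolding L_def using S by (intro Max_in) auto
  then obtain \<rho> where \<rho>: "\<rho> \<in> S" "length \<rho> = L" by auto
  have le: "length \<pi> \<le> L" if "\<pi> \<in> S" for \<pi> unfolding L_def using S that by simp
  obtain lam where lam: "\<And>c. c \<in> colors n \<Longrightarrow> lam c \<noteq> 0 \<and> basis_vec n X c = lam c \<cdot>\<^sub>m bm n (pos n (fst c)) (pos n (snd c))"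
    using basis_vec_scale[OF X] by blast
  define r where "r = (\<lambda>t. pos n (fst (fst (\<rho> ! t))))"
  define s where "s = (\<lambda>t. pos n (snd (fst (\<rho> ! t))))"
  \<comment> \<open>The symmetrized coordinate belonging to the \<open>t\<close>-th part of
    \<open>\<rho>\<close>, restricted to its mode. Symmetrizing leaves elements of
    \<open>sp n\<close> visible and kills the identity matrix.\<close>
  define F where "F = (\<lambda>t (A, j). if j = snd (\<rho> ! t) then mc n A (r t) (s t) + mc n A (s t) (r t) else 0)"
  \<comment> \<open>The value of the functional on its own part: the coordinate of \<open>bm\<close>
    is 1, or 2 if both positions coincide, and symmetrizing doubles it.\<close>
  define \<kappa> where "\<kappa> = (\<lambda>p :: color \<times> int. 2 * lam (fst p) * (1 + of_bool (fst (fst p) = snd (fst p))))"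
  have cp: "sorted_wrt part_le \<pi> \<and> fst ` set \<pi> \<subseteq> colors n" if "\<pi> \<in> T" for \<pi>
    using T that by (auto simp: cparts_def cparts_on_def)
  have \<rho>c: "fst (\<rho> ! t) \<in> colors n" if "t < L" for t
    using cp[of \<rho>] \<rho> that by (auto simp: S_def)
  have rs: "r t < 2*n" "s t < 2*n" if "t < L" for t
    using colors_pos[OF \<rho>c[OF that]] by (auto simp: r_def s_def)
  have F: "tlin n L F"
    using rs by (auto simp: tlin_def F_def mc_lin algebra_simps)
  have F0: "F t (1\<^sub>m (2*n), 0) = 0" if "t < L" for t
    using mc_one[OF rs[OF that]] by (simp add: F_def)
  have Fb: "F t (basis_vec n X (fst p), snd p) = (if \<rho> ! t = p then \<kappa> p else 0)"
    if t: "t < L" and p: "fst p \<in> colors n" for t p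
  proof -
    have c: "pos n (fst (fst p)) \<le> pos n (snd (fst p))" "r t \<le> s t"
      using colors_pos[OF p] colors_pos[OF \<rho>c[OF t]] by (auto simp: r_def s_def)
    have eq: "\<rho> ! t = p \<longleftrightarrow> snd p = snd (\<rho> ! t) \<and> r t = pos n (fst (fst p)) \<and> s t = pos n (snd (fst p))"
    proof -
      have "\<rho> ! t = p \<longleftrightarrow> snd p = snd (\<rho> ! t) \<and> fst p = fst (\<rho> ! t)" by (cases p; cases "\<rho> ! t") auto
      then show ?thesis unfolding colors_eq_iff[OF p \<rho>c[OF t]] r_def s_def by (simp only: eq_commute)
    qed
    have dd: "fst (fst p) = snd (fst p) \<longleftrightarrow> pos n (fst (fst p)) = pos n (snd (fst p))"
      using p pos_inj by (metis colors_idxs prod.collapse)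
    show ?thesis
    proof (cases "snd p = snd (\<rho> ! t)")
      case True
      have "F t (basis_vec n X (fst p), snd p) = lam (fst p) * (2 * of_bool (r t = pos n (fst (fst p)) \<and> s t = pos n (snd (fst p)))
        + 2 * of_bool (r t = pos n (snd (fst p)) \<and> s t = pos n (fst (fst p))))"
        using lam[OF p] rs[OF t] True by (simp add: F_def mc_lin(2)[OF bm_carrier bm_carrier] mc_bm algebra_simps conj_commute)
      then show ?thesis unfolding eq \<kappa>_def dd using c True by (auto simp: of_bool_def split: if_splits)
    next
      case False
      then show ?thesis by (auto simp: F_def)
    qed
  qed
  define st where "st = (\<lambda>t::nat. (1\<^sub>m (2*n) :: complex mat, 0 :: int))"
  have st: "tvalid n L st" by (simp add: tvalid_def st_def)
  define \<Phi> where "\<Phi> = lin (\<lambda>v. tens n L F st v)"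
  have Phi0: "\<Phi> (\<Sum>\<pi>\<in>T. scalar (e \<pi>) * u_mon n X \<pi>) = 0"
  proof -
    have "\<forall>w. lin (\<lambda>v. tens n L F st (v @ w)) (\<Sum>\<pi>\<in>T. scalar (e \<pi>) * u_mon n X \<pi>) = 0"
      using J F st unfolding loop_ideal_def by blast
    from this[rule_format, of "[]"] show ?thesis by (simp add: \<Phi>_def)
  qed
  have Phi: "\<Phi> (u_mon n X \<pi>) = (\<Prod>p\<leftarrow>\<pi>. \<kappa> p) * of_nat (matchings ((!) \<rho>) {..<L} \<pi>)"
    if "\<pi> \<in> T" "length \<pi> = L" for \<pi>
  proof -
    have "tens n L F st (loop_word n X \<pi>) = (\<Prod>t\<in>{..<L} - {..<L}. F t (st t)) * (\<Prod>p\<leftarrow>\<pi>. \<kappa> p) * of_nat (matchings ((!) \<rho>) {..<L} \<pi>)"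
    proof (rule tens_full)
      fix t p assume t: "t < L" and "p \<in> set \<pi>"
      then have "fst p \<in> colors n" using cp[OF that(1)] by blast
      then show "F t (basis_vec n X (fst p), snd p) = (if \<rho> ! t = p then \<kappa> p else 0)" by (rule Fb[OF t])
    next
      fix p assume "p \<in> set \<pi>"
      then show "basis_vec n X (fst p) \<in> sp n" using cp[OF that(1)] basis_vec_sp[OF X] by blast
    qed (use that F0 in \<open>auto simp: st_def\<close>)
    then show ?thesis by (simp add: \<Phi>_def u_mon_single)
  qed
  have img: "image_mset ((!) \<rho>) (mset_set {..<L}) = mset \<rho>"
  proof -
    have "image_mset ((!) \<rho>) (mset_set {..<L}) = image_mset ((!) \<rho>) (mset [0..<L])"
      unfolding mset_upt atLeast0LessThan ..
    also have "\<dots> = mset (map ((!) \<rho>) [0..<length \<rho>])" using \<rho>(2) by (simp only: mset_map)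
    finally show ?thesis by (simp only: map_nth)
  qed
  have other: "e \<pi> * \<Phi> (u_mon n X \<pi>) = 0" if \<pi>: "\<pi> \<in> T" "\<pi> \<noteq> \<rho>" for \<pi>
  proof (cases "e \<pi> = 0")
    case False
    then have "\<pi> \<in> S" using \<pi> by (simp add: S_def)
    then consider "length \<pi> < L" | "length \<pi> = L" using le[of \<pi>] by linarith
    then show ?thesis
    proof cases
      case 1
      have "tens n L F st (loop_word n X \<pi>) = 0"
        using 1 by (intro tens_untouched_short[of L F n "{..<L}"]) (auto simp: F0 st_def loop_word_def)
      then show ?thesis by (simp add: \<Phi>_def u_mon_single)
    next
      case 2
      \<comment> \<open>Sorted lists that are rearrangements of each other are equal, so an equally
        long monomial other than \<open>\<rho>\<close> admits no matching.\<close>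
      have "mset \<rho> \<noteq> mset \<pi>" using sorted_parts_unique[of \<rho> \<pi>] cp \<pi> \<rho> by (auto simp: S_def)
      then have "matchings ((!) \<rho>) {..<L} \<pi> = 0"
        using matchings_pos_iff[of "{..<L}" \<pi> "(!) \<rho>"] 2 img by simp
      then show ?thesis using Phi[OF \<pi>(1) 2] by simp
    qed
  qed simp
  have "\<Phi> (\<Sum>\<pi>\<in>T. scalar (e \<pi>) * u_mon n X \<pi>) = (\<Sum>\<pi>\<in>T. e \<pi> * \<Phi> (u_mon n X \<pi>))"
    by (simp add: \<Phi>_def lin_sum lin_scalar_mult)
  also have "\<dots> = (\<Sum>\<pi>\<in>{\<rho>}. e \<pi> * \<Phi> (u_mon n X \<pi>))"
    using T \<rho> other by (intro sum.mono_neutral_right) (auto simp: S_def)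
  finally have "e \<rho> * \<Phi> (u_mon n X \<rho>) = 0" using Phi0 by simp
  moreover have "e \<rho> \<noteq> 0" "\<rho> \<in> T" using \<rho> by (auto simp: S_def)
  moreover have "matchings ((!) \<rho>) {..<L} \<rho> > 0"
    using matchings_pos_iff[of "{..<L}" \<rho> "(!) \<rho>"] \<rho>(2) img by simp
  moreover have "(\<Prod>p\<leftarrow>\<rho>. \<kappa> p) \<noteq> 0"
  proof -
    have "\<kappa> p \<noteq> 0" if "p \<in> set \<rho>" for p
      using lam[of "fst p"] cp[OF \<open>\<rho> \<in> T\<close>] that by (auto simp: \<kappa>_def)
    then show ?thesis by (auto simp: prod_list_zero_iff)
  qed
  ultimately show False using Phi[of \<rho>] \<rho>(2) by simp
qed

section \<open>Straightening\<close>

fun inversions :: "cpart \<Rightarrow> nat" where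
  "inversions [] = 0"
| "inversions (p # w) = size {#q \<in># mset w. part_less q p#} + inversions w"

lemma inversions_swap:
  assumes "part_less q p"
  shows "inversions (a @ q # p # b) < inversions (a @ p # q # b)"
proof (induction a)
  case Nil
  have "\<not> part_less p q" using assms part_less_strict(1,2) by blast
  then show ?case using assms by simp
next
  case (Cons r a)
  then show ?case by (simp add: add_mset_commute)
qed

lemma sorted_or_descent:
  "sorted_wrt part_le w \<or> (\<exists>a p q b. w = a @ p # q # b \<and> part_less q p)"
proof (induction w)
  case (Cons p w)
  show ?case
  proof (cases w)
    case (Cons q w')
    show ?thesis
    proof (cases "part_less q p")
      case True
      then show ?thesis using Cons by (metis append_Nil)
    next
      case False
      then have pq: "part_le p q" using part_less_strict(3) by blast
      from Cons.IH show ?thesis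
      proof
        assume s: "sorted_wrt part_le w"
        have "part_le p r" if "r \<in> set w" for r
        proof -
          have "part_le q r" using s that Cons by auto
          then show ?thesis using pq part_less_strict(2) by blast
        qed
        then show ?thesis using s by simp
      next
        assume "\<exists>a p q b. w = a @ p # q # b \<and> part_less q p"
        then show ?thesis by (metis append_Cons)
      qed
    qed
  qed simp
qed simp

text \<open>The span of the monomials in \<open>S\<close> modulo \<open>J\<close>, with explicit
  coefficient functions so that the independence of ordered monomials can be applied to
  them.\<close>

definition spanmod :: "nat \<Rightarrow> (color \<Rightarrow> complex mat) \<Rightarrow> free_alg set \<Rightarrow> cpart set \<Rightarrow> free_alg set" where
  "spanmod n X J S = {p. \<exists>e. finite {\<pi>. e \<pi> \<noteq> 0} \<and> {\<pi>. e \<pi> \<noteq> 0} \<subseteq> S \<and>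
     p - (\<Sum>\<pi> | e \<pi> \<noteq> 0. scalar (e \<pi>) * u_mon n X \<pi>) \<in> J}"

lemma finite_support_sum:
  assumes "finite T" "{\<pi>. e \<pi> \<noteq> 0} \<subseteq> T"
  shows "(\<Sum>\<pi> | e \<pi> \<noteq> 0. scalar (e \<pi>) * u_mon n X \<pi>) = (\<Sum>\<pi>\<in>T. scalar (e \<pi>) * u_mon n X \<pi>)"
  using assms by (intro sum.mono_neutral_left) auto

lemma spanmod_ideal: "p \<in> J \<Longrightarrow> p \<in> spanmod n X J S"
  by (auto simp: spanmod_def intro!: exI[of _ "\<lambda>_. 0"])

lemma spanmod_mono: "S \<subseteq> S' \<Longrightarrow> spanmod n X J S \<subseteq> spanmod n X J S'"
  by (fastforce simp: spanmod_def)

lemma spanmod_u_mon: "tsi J \<Longrightarrow> \<pi> \<in> S \<Longrightarrow> u_mon n X \<pi> \<in> spanmod n X J S"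
  by (auto simp: spanmod_def tsi_def intro!: exI[of _ "\<lambda>\<sigma>. of_bool (\<sigma> = \<pi>)"])

lemma spanmod_add:
  assumes J: "tsi J" and p: "p \<in> spanmod n X J S" and q: "q \<in> spanmod n X J S"
  shows "p + q \<in> spanmod n X J S"
proof -
  obtain e where e: "finite {\<pi>. e \<pi> \<noteq> 0}" "{\<pi>. e \<pi> \<noteq> 0} \<subseteq> S"
    "p - (\<Sum>\<pi> | e \<pi> \<noteq> 0. scalar (e \<pi>) * u_mon n X \<pi>) \<in> J" using p by (auto simp: spanmod_def)
  obtain f where f: "finite {\<pi>. f \<pi> \<noteq> 0}" "{\<pi>. f \<pi> \<noteq> 0} \<subseteq> S"
    "q - (\<Sum>\<pi> | f \<pi> \<noteq> 0. scalar (f \<pi>) * u_mon n X \<pi>) \<in> J" using q by (auto simp: spanmod_def)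
  let ?T = "{\<pi>. e \<pi> \<noteq> 0} \<union> {\<pi>. f \<pi> \<noteq> 0}"
  have T: "finite ?T" using e f by simp
  have sub: "{\<pi>. e \<pi> + f \<pi> \<noteq> 0} \<subseteq> ?T" by auto
  have "p + q - (\<Sum>\<pi>\<in>?T. scalar (e \<pi> + f \<pi>) * u_mon n X \<pi>) =
     (p - (\<Sum>\<pi>\<in>?T. scalar (e \<pi>) * u_mon n X \<pi>)) + (q - (\<Sum>\<pi>\<in>?T. scalar (f \<pi>) * u_mon n X \<pi>))"
    by (simp add: scalar_add distrib_right sum.distrib)
  also have "\<dots> \<in> J"
    using e(3) f(3) T by (intro tsiD(2)[OF J]) (simp_all add: finite_support_sum[of ?T])
  finally show ?thesis unfolding spanmod_def mem_Collect_eq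
    using T sub e f by (intro exI[of _ "\<lambda>\<pi>. e \<pi> + f \<pi>"]) (auto simp: finite_support_sum[OF T sub] intro: finite_subset[OF sub])
qed

lemma spanmod_scalar:
  assumes J: "tsi J" and p: "p \<in> spanmod n X J S"
  shows "scalar c * p \<in> spanmod n X J S"
proof -
  obtain e where e: "finite {\<pi>. e \<pi> \<noteq> 0}" "{\<pi>. e \<pi> \<noteq> 0} \<subseteq> S"
    "p - (\<Sum>\<pi> | e \<pi> \<noteq> 0. scalar (e \<pi>) * u_mon n X \<pi>) \<in> J" using p by (auto simp: spanmod_def)
  have sub: "{\<pi>. c * e \<pi> \<noteq> 0} \<subseteq> {\<pi>. e \<pi> \<noteq> 0}" by auto
  have "scalar c * p - (\<Sum>\<pi> | e \<pi> \<noteq> 0. scalar (c * e \<pi>) * u_mon n X \<pi>) =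
     scalar c * (p - (\<Sum>\<pi> | e \<pi> \<noteq> 0. scalar (e \<pi>) * u_mon n X \<pi>))"
    by (simp add: scalar_mult right_diff_distrib sum_distrib_left mult.assoc)
  also have "\<dots> \<in> J" using e by (intro tsiD(4)[OF J])
  finally have "scalar c * p - (\<Sum>\<pi> | c * e \<pi> \<noteq> 0. scalar (c * e \<pi>) * u_mon n X \<pi>) \<in> J"
    unfolding finite_support_sum[OF e(1) sub] .
  then show ?thesis unfolding spanmod_def mem_Collect_eq
    using finite_subset[OF sub e(1)] order.trans[OF sub e(2)]
    by (intro exI[of _ "\<lambda>\<pi>. c * e \<pi>"] conjI)
qed

lemma spanmod_sum: "tsi J \<Longrightarrow> (\<And>x. x \<in> A \<Longrightarrow> f x \<in> spanmod n X J S) \<Longrightarrow> sum f A \<in> spanmod n X J S"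
  by (induction A rule: infinite_finite_induct) (auto intro: spanmod_add spanmod_ideal tsiD(1))

lemma spanmod_cong: "tsi J \<Longrightarrow> p - q \<in> J \<Longrightarrow> q \<in> spanmod n X J S \<Longrightarrow> p \<in> spanmod n X J S"
  using spanmod_add[OF _ spanmod_ideal[of "p - q" J n X S], of q] by simp

section \<open>Expansion of loop elements in the chosen basis\<close>

lemma lp_zero: "lp (0\<^sub>m (2*n) (2*n)) i \<in> env_ideal n"
proof -
  let ?z = "0\<^sub>m (2*n) (2*n) :: complex mat"
  \<comment> \<open>Linearity applied to this trivial identity says that the generator equals twice
    itself.\<close>
  have "?z = 1 \<cdot>\<^sub>m ?z + ?z" by (intro eq_matI) auto
  then have "lp ?z i - (scalar 1 * lp ?z i + lp ?z i) \<in> env_ideal n"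
    using env_ideal.linear[of ?z n ?z 1 i] by simp
  then show ?thesis using envI(6) by fastforce
qed

lemma lp_smult:
  assumes "x \<in> sp n" shows "lp (c \<cdot>\<^sub>m x) i - scalar c * lp x i \<in> env_ideal n"
proof -
  let ?z = "0\<^sub>m (2*n) (2*n) :: complex mat"
  have "c \<cdot>\<^sub>m x + ?z = c \<cdot>\<^sub>m x" using sp_carrier[OF assms] by auto
  then have "lp (c \<cdot>\<^sub>m x) i - (scalar c * lp x i + lp ?z i) \<in> env_ideal n"
    using env_ideal.linear[OF assms sp_zero, of c i] by simp
  from envI(2)[OF this lp_zero[of n i]] show ?thesis by simp
qed

lemma lp_sum:
  assumes "finite S" "\<And>c. c \<in> S \<Longrightarrow> B c \<in> sp n"
  shows "mat (2*n) (2*n) (\<lambda>p. \<Sum>c\<in>S. \<kappa> c * B c $$ p) \<in> sp n \<and>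
    lp (mat (2*n) (2*n) (\<lambda>p. \<Sum>c\<in>S. \<kappa> c * B c $$ p)) m - (\<Sum>c\<in>S. scalar (\<kappa> c) * lp (B c) m) \<in> env_ideal n"
  using assms
proof (induction S rule: finite_induct)
  case empty
  have "mat (2*n) (2*n) (\<lambda>p. \<Sum>c\<in>{}. \<kappa> c * B c $$ p) = 0\<^sub>m (2*n) (2*n)" by (intro eq_matI) auto
  then show ?case using lp_zero[of n m] sp_zero[of n] by simp
next
  case (insert b S)
  let ?M = "\<lambda>S. mat (2*n) (2*n) (\<lambda>p. \<Sum>c\<in>S. \<kappa> c * B c $$ p)"
  have IH: "?M S \<in> sp n" "lp (?M S) m - (\<Sum>c\<in>S. scalar (\<kappa> c) * lp (B c) m) \<in> env_ideal n"
    using insert by auto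
  have b: "B b \<in> sp n" using insert by simp
  have eq: "?M (insert b S) = \<kappa> b \<cdot>\<^sub>m B b + ?M S"
    using sp_carrier[OF b] insert.hyps by (intro eq_matI) auto
  have "lp (\<kappa> b \<cdot>\<^sub>m B b + ?M S) m - (scalar (\<kappa> b) * lp (B b) m + lp (?M S) m) \<in> env_ideal n"
    by (rule env_ideal.linear[OF b IH(1)])
  from envI(2)[OF this IH(2)] show ?case
    unfolding eq using sp_lin[OF b IH(1)] insert.hyps by (simp add: algebra_simps)
qed

lemma finite_idxs: "finite (idxs n)" by (simp add: idxs_def)

lemma finite_colors: "finite (colors n)"
  by (rule finite_subset[of _ "idxs n \<times> idxs n"]) (auto simp: colors_def finite_idxs)

lemma ex_color:
  assumes "r < 2*n" "s < 2*n"
  shows "\<exists>c\<in>colors n. pos n (fst c) = min r s \<and> pos n (snd c) = max r s"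
proof -
  obtain a b where "a \<in> idxs n" "b \<in> idxs n" "pos n a = min r s" "pos n b = max r s"
    using assms pos_image[of n] by (metis imageE lessThan_iff max_less_iff_conj min_less_iff_disj)
  then show ?thesis by (intro bexI[of _ "(a, b)"]) (auto simp: colors_iff_pos)
qed

text \<open>Summing over ordered pairs meets every \<open>bm n r s\<close> with
  \<open>r \<noteq> s\<close> twice, while \<open>bm n r r\<close> has coordinate 2; in both cases
  the factor 1/2 is the right one.\<close>

lemma sum_bm:
  assumes "A \<in> sp n"
  shows "A = mat (2*n) (2*n) (\<lambda>p. \<Sum>x\<in>{..<2*n} \<times> {..<2*n}. mc n A (fst x) (snd x) / 2 * bm n (fst x) (snd x) $$ p)"
    (is "A = ?M")
proof (rule mat_eq_mc[of _ n])
  fix i j assume ij: "i < 2*n" "j < 2*n"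
  have "mc n ?M i j = (\<Sum>(r, s)\<in>{..<2*n} \<times> {..<2*n}. mc n A r s / 2 * mc n (bm n r s) i j)"
    using ij by (simp add: mc_def sum_distrib_left case_prod_beta mult_ac)
  also have "\<dots> = (\<Sum>r<2*n. \<Sum>s<2*n. (if r = i then if s = j then mc n A r s / 2 else 0 else 0)
      + (if r = j then if s = i then mc n A r s / 2 else 0 else 0))"
    unfolding mc_bm[OF ij] sum.cartesian_product by (intro sum.cong) auto
  also have "\<dots> = mc n A i j / 2 + mc n A j i / 2"
  proof -
    have pull: "(\<Sum>s<2*n. if P then f s else 0) = (if P then \<Sum>s<2*n. f s else 0)" for P and f :: "nat \<Rightarrow> complex"
      by simp
    show ?thesis using ij by (simp add: sum.distrib pull)
  qed
  finally show "mc n A i j = mc n ?M i j" using mc_sym[OF assms ij] by simp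
qed (use assms sp_carrier in auto)

lemma lp_bm:
  assumes "A \<in> sp n"
  shows "lp A m - (\<Sum>r<2*n. \<Sum>s<2*n. scalar (mc n A r s / 2) * lp (bm n r s) m) \<in> env_ideal n"
proof -
  let ?S = "{..<2*n} \<times> {..<2*n}"
  note eq = sum_bm[OF assms]
  have "lp (mat (2*n) (2*n) (\<lambda>p. \<Sum>c\<in>?S. mc n A (fst c) (snd c) / 2 * bm n (fst c) (snd c) $$ p)) m -
     (\<Sum>c\<in>?S. scalar (mc n A (fst c) (snd c) / 2) * lp (bm n (fst c) (snd c)) m) \<in> env_ideal n"
    using lp_sum[of ?S "\<lambda>c. bm n (fst c) (snd c)" n "\<lambda>c. mc n A (fst c) (snd c) / 2" m] by simp
  then show ?thesis unfolding eq[symmetric] by (simp add: sum.cartesian_product case_prod_beta)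
qed

definition color_of :: "nat \<Rightarrow> nat \<Rightarrow> nat \<Rightarrow> color" where
  "color_of n r s = (SOME c. c \<in> colors n \<and> pos n (fst c) = min r s \<and> pos n (snd c) = max r s)"

lemma color_of:
  assumes "r < 2*n" "s < 2*n"
  shows "color_of n r s \<in> colors n" "pos n (fst (color_of n r s)) = min r s" "pos n (snd (color_of n r s)) = max r s"
proof -
  have "\<exists>c. c \<in> colors n \<and> pos n (fst c) = min r s \<and> pos n (snd c) = max r s"
    using ex_color[OF assms] by blast
  from someI_ex[OF this]
  show "color_of n r s \<in> colors n" "pos n (fst (color_of n r s)) = min r s" "pos n (snd (color_of n r s)) = max r s"
    unfolding color_of_def by blast+
qed

lemma color_of_pos:
  assumes "c \<in> colors n" shows "color_of n (pos n (fst c)) (pos n (snd c)) = c"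
proof -
  have c: "pos n (fst c) < 2*n" "pos n (snd c) < 2*n" "pos n (fst c) \<le> pos n (snd c)"
    using colors_pos[OF assms] by auto
  show ?thesis
    unfolding colors_eq_iff[OF color_of(1)[OF c(1,2)] assms] color_of(2,3)[OF c(1,2)] using c(3) by simp
qed

lemma bm_basis_vec:
  assumes X: "root_vectors n X" and rs: "r < 2*n" "s < 2*n"
    and l: "l \<noteq> 0" "basis_vec n X (color_of n r s) = l \<cdot>\<^sub>m bm n (pos n (fst (color_of n r s))) (pos n (snd (color_of n r s)))"
  shows "lp (bm n r s) m - scalar (1 / l) * lp (basis_vec n X (color_of n r s)) m \<in> env_ideal n"
proof -
  have "bm n (min r s) (max r s) = bm n r s" using bm_commute[of n r s] by (simp add: min_def max_def)
  then have "basis_vec n X (color_of n r s) = l \<cdot>\<^sub>m bm n r s"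
    using l(2) color_of[OF rs] by simp
  moreover have "(1 / l) \<cdot>\<^sub>m (l \<cdot>\<^sub>m M) = M" for M :: "complex mat"
    using l(1) by (intro eq_matI) auto
  ultimately have "bm n r s = (1 / l) \<cdot>\<^sub>m basis_vec n X (color_of n r s)" by simp
  then show ?thesis using lp_smult[OF basis_vec_sp[OF X color_of(1)[OF rs]], of "1/l" m] by simp
qed

lemma lp_basis_expand:
  assumes X: "root_vectors n X" and A: "A \<in> sp n"
  shows "\<exists>\<kappa>. lp A m - (\<Sum>c\<in>colors n. scalar (\<kappa> c) * lp (basis_vec n X c) m) \<in> env_ideal n"
proof -
  obtain lam where lam: "\<And>c. c \<in> colors n \<Longrightarrow> lam c \<noteq> 0 \<and> basis_vec n X c = lam c \<cdot>\<^sub>m bm n (pos n (fst c)) (pos n (snd c))"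
    using basis_vec_scale[OF X] by blast
  let ?S = "{..<2*n} \<times> {..<2*n}"
  let ?g = "\<lambda>c. scalar (mc n A (fst c) (snd c) / 2 / lam (color_of n (fst c) (snd c)))"
  let ?col = "\<lambda>c. color_of n (fst c) (snd c)"
  \<comment> \<open>The coefficient of a color collects both orders of its two positions.\<close>
  let ?\<kappa> = "\<lambda>c. \<Sum>x\<in>{x \<in> ?S. ?col x = c}. mc n A (fst x) (snd x) / 2 / lam (?col x)"
  have 1: "lp A m - (\<Sum>c\<in>?S. scalar (mc n A (fst c) (snd c) / 2) * lp (bm n (fst c) (snd c)) m) \<in> env_ideal n"
    using lp_bm[OF A, of m] by (simp add: sum.cartesian_product case_prod_beta)
  have 2: "(\<Sum>c\<in>?S. scalar (mc n A (fst c) (snd c) / 2) * lp (bm n (fst c) (snd c)) m)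
      - (\<Sum>c\<in>?S. ?g c * lp (basis_vec n X (?col c)) m) \<in> env_ideal n"
  proof -
    have "scalar (mc n A (fst c) (snd c) / 2) * (lp (bm n (fst c) (snd c)) m
       - scalar (1 / lam (?col c)) * lp (basis_vec n X (?col c)) m) \<in> env_ideal n" if "c \<in> ?S" for c
      using that lam[OF color_of(1)] by (intro envI(4) bm_basis_vec[OF X]) auto
    then have "(\<Sum>c\<in>?S. scalar (mc n A (fst c) (snd c) / 2) * (lp (bm n (fst c) (snd c)) m
       - scalar (1 / lam (?col c)) * lp (basis_vec n X (?col c)) m)) \<in> env_ideal n"
      by (intro tsi_sum[OF tsi_env_ideal])
    moreover have "?g c = scalar (mc n A (fst c) (snd c) / 2) * scalar (1 / lam (?col c))" for c
      by (simp flip: scalar_mult)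
    ultimately show ?thesis by (simp add: right_diff_distrib sum_subtractf mult.assoc)
  qed
  have 3: "(\<Sum>c\<in>?S. ?g c * lp (basis_vec n X (?col c)) m) = (\<Sum>c\<in>colors n. scalar (?\<kappa> c) * lp (basis_vec n X c) m)"
  proof -
    have "(\<Sum>c\<in>?S. ?g c * lp (basis_vec n X (?col c)) m)
      = (\<Sum>c\<in>colors n. \<Sum>x\<in>{x\<in>?S. ?col x = c}. ?g x * lp (basis_vec n X (?col x)) m)"
      using color_of(1) by (intro sum.group[symmetric]) (auto simp: finite_colors)
    also have "\<dots> = (\<Sum>c\<in>colors n. scalar (?\<kappa> c) * lp (basis_vec n X c) m)"
      unfolding scalar_sum sum_distrib_right by (intro sum.cong refl) auto
    finally show ?thesis .
  qed
  from envI(2)[OF 1 2] show ?thesis unfolding 3 by (intro exI[of _ ?\<kappa>]) simp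
qed

text \<open>Termination of straightening: exchanging a descent keeps the length and lowers the
  number of inversions, and a bracket shortens the word.\<close>

lemma length_inversions_induct [case_names less]:
  assumes "\<And>w. (\<And>v. length v < length w \<or> length v = length w \<and> inversions v < inversions w \<Longrightarrow> P v) \<Longrightarrow> P w"
  shows "P w"
  by (rule wf_induct_rule[OF wf_measures[of "[length, inversions]"]]) (auto intro: assms)

text \<open>\<open>G\<close> is a class of words that survives the two outcomes of a rewriting step,
  the exchange of a descent and its replacement by a bracket; all monomials that arise then stay in
  \<open>G\<close>. The central term is harmless because either its coefficient contains the mode
  zero as a factor or \<open>Central\<close> lies in \<open>J\<close>. Leaving \<open>J\<close> open
  allows straightening modulo the defining ideal itself as well as modulo the larger ideal that
  contains the central element.\<close>

lemma straighten:
  assumes J: "tsi J" "env_ideal n \<subseteq> J" and X: "root_vectors n X"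
    and colors: "\<And>w. w \<in> G \<Longrightarrow> fst ` set w \<subseteq> colors n"
    and swap: "\<And>a p q b. a @ p # q # b \<in> G \<Longrightarrow> part_less q p \<Longrightarrow> a @ q # p # b \<in> G"
    and merge: "\<And>a p q b c. a @ p # q # b \<in> G \<Longrightarrow> part_less q p \<Longrightarrow> c \<in> colors n \<Longrightarrow>
       a @ (c, snd p + snd q) # b \<in> G"
    and central: "\<And>a p q b. a @ p # q # b \<in> G \<Longrightarrow> part_less q p \<Longrightarrow> snd p + snd q = 0 \<Longrightarrow>
       snd p = 0 \<or> gen Central \<in> J"
    and w: "w \<in> G"
  shows "\<exists>\<pi>\<in>cparts n \<inter> G. mset \<pi> = mset w \<and>
    u_mon n X w - u_mon n X \<pi> \<in> spanmod n X J {\<pi> \<in> cparts n \<inter> G. length \<pi> < length w}"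
  using w
proof (induction w rule: length_inversions_induct)
  case (less w)
  let ?Sp = "\<lambda>k. spanmod n X J {\<pi> \<in> cparts n \<inter> G. length \<pi> < k}"
  show ?case
  proof (cases "sorted_wrt part_le w")
    case True
    then have "w \<in> cparts n" using colors[OF less.prems] by (simp add: cparts_def cparts_on_def)
    then show ?thesis using less.prems by (intro bexI[of _ w]) (auto intro: spanmod_ideal tsiD[OF J(1)])
  next
    case False
    then obtain a p q b where w: "w = a @ p # q # b" and qp: "part_less q p"
      using sorted_or_descent by blast
    let ?w' = "a @ q # p # b"
    have w': "?w' \<in> G" using swap less.prems w qp by blast
    obtain \<pi> where \<pi>: "\<pi> \<in> cparts n \<inter> G" "mset \<pi> = mset ?w'" "u_mon n X ?w' - u_mon n X \<pi> \<in> ?Sp (length ?w')"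
      using less.IH[of ?w'] w' inversions_swap[OF qp, of a b] w by auto
    let ?x = "basis_vec n X (fst p)" and ?y = "basis_vec n X (fst q)"
    have xy: "?x \<in> sp n" "?y \<in> sp n"
      using colors[OF less.prems] w basis_vec_sp[OF X] by auto
    let ?i = "snd p" and ?j = "snd q"
    let ?z = "scalar (if ?i + ?j = 0 then of_int ?i * inv_form ?x ?y else 0) * gen Central"
    obtain \<kappa> where \<kappa>: "lp (bracket ?x ?y) (?i + ?j) - (\<Sum>c\<in>colors n. scalar (\<kappa> c) * lp (basis_vec n X c) (?i + ?j)) \<in> env_ideal n"
      using lp_basis_expand[OF X sp_bracket[OF xy]] by blast
    have z: "?z \<in> J"
      using central[of a p q b] less.prems w qp tsiD[OF J(1)] by (cases "?i + ?j = 0") auto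
    let ?R = "\<Sum>c\<in>colors n. scalar (\<kappa> c) * lp (basis_vec n X c) (?i + ?j)"
    have "(lp ?x ?i * lp ?y ?j - lp ?y ?j * lp ?x ?i - (lp (bracket ?x ?y) (?i + ?j) + ?z))
        + (lp (bracket ?x ?y) (?i + ?j) - ?R) + ?z \<in> J"
      using env_ideal.commutator[OF xy, of ?i ?j] \<kappa> J(2) z by (intro tsiD(2)[OF J(1)]) auto
    then have "lp ?x ?i * lp ?y ?j - lp ?y ?j * lp ?x ?i - ?R \<in> J" by (simp add: algebra_simps)
    \<comment> \<open>Placed between prefix and suffix, the commutator relation writes
      \<open>w\<close> as the exchanged word plus words that are one letter shorter.\<close>
    then have "u_mon n X a * (lp ?x ?i * lp ?y ?j - lp ?y ?j * lp ?x ?i - ?R) * u_mon n X b \<in> J"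
      by (rule tsiD(3)[OF J(1)])
    moreover have "u_mon n X a * (lp ?x ?i * lp ?y ?j - lp ?y ?j * lp ?x ?i - ?R) * u_mon n X b
       = (u_mon n X w - u_mon n X ?w') - (\<Sum>c\<in>colors n. scalar (\<kappa> c) * u_mon n X (a @ (c, ?i + ?j) # b))"
      by (simp add: w u_mon_append u_mon_Cons left_diff_distrib right_diff_distrib mult.assoc
          sum_distrib_left sum_distrib_right scalar_left_commute)
    ultimately have 1: "(u_mon n X w - u_mon n X ?w') - (\<Sum>c\<in>colors n. scalar (\<kappa> c) * u_mon n X (a @ (c, ?i + ?j) # b)) \<in> J"
      by simp
    have "u_mon n X (a @ (c, ?i + ?j) # b) \<in> ?Sp (length w)" if c: "c \<in> colors n" for c
    proof -
      let ?v = "a @ (c, ?i + ?j) # b"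
      have v: "?v \<in> G" using merge less.prems w qp c by blast
      have len: "length ?v < length w" using w by simp
      obtain \<sigma> where \<sigma>: "\<sigma> \<in> cparts n \<inter> G" "mset \<sigma> = mset ?v" "u_mon n X ?v - u_mon n X \<sigma> \<in> ?Sp (length ?v)"
        using less.IH[of ?v] v len by auto
      have "length \<sigma> = length ?v" using \<sigma>(2) by (metis size_mset)
      then have "u_mon n X \<sigma> \<in> ?Sp (length w)" using \<sigma>(1) len by (intro spanmod_u_mon[OF J(1)]) auto
      moreover have "u_mon n X ?v - u_mon n X \<sigma> \<in> ?Sp (length w)"
      proof -
        have "{\<pi> \<in> cparts n \<inter> G. length \<pi> < length ?v} \<subseteq> {\<pi> \<in> cparts n \<inter> G. length \<pi> < length w}"
          using len by auto
        from spanmod_mono[OF this] \<sigma>(3) show ?thesis by blast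
      qed
      ultimately show ?thesis using spanmod_add[OF J(1)] by fastforce
    qed
    then have "(\<Sum>c\<in>colors n. scalar (\<kappa> c) * u_mon n X (a @ (c, ?i + ?j) # b)) \<in> ?Sp (length w)"
      by (intro spanmod_sum[OF J(1)] spanmod_scalar[OF J(1)])
    with spanmod_cong[OF J(1) 1] have "u_mon n X w - u_mon n X ?w' \<in> ?Sp (length w)" by blast
    moreover have "u_mon n X ?w' - u_mon n X \<pi> \<in> ?Sp (length w)" using \<pi>(3) w by simp
    ultimately have "u_mon n X w - u_mon n X \<pi> \<in> ?Sp (length w)" using spanmod_add[OF J(1)] by fastforce
    moreover have "mset \<pi> = mset w" using \<pi>(2) w by (simp add: add_mset_commute)
    ultimately show ?thesis using \<pi>(1) by blast
  qed
qed

section \<open>Uniqueness of expansions in the completion\<close>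

lemma nbhd_zero [simp]: "0 \<in> nbhd n N"
  by (intro nbhd.ideal envI)

lemma nbhd_uminus: "p \<in> nbhd n N \<Longrightarrow> - p \<in> nbhd n N"
  using nbhd.mult[of p n N "-1"] by simp

lemma nbhd_diff: "p \<in> nbhd n N \<Longrightarrow> q \<in> nbhd n N \<Longrightarrow> p - q \<in> nbhd n N"
  using nbhd.add[of p n N "-q"] nbhd_uminus by simp

lemma nbhd_sum: "(\<And>x. x \<in> S \<Longrightarrow> f x \<in> nbhd n N) \<Longrightarrow> sum f S \<in> nbhd n N"
  by (induction S rule: infinite_finite_induct) (auto intro: nbhd.add)

lemma nbhd_cong: "p - q \<in> env_ideal n \<Longrightarrow> p \<in> nbhd n N \<longleftrightarrow> q \<in> nbhd n N"
  using nbhd.add[of "p - q" n N q] nbhd_diff[of p n N "p - q"] nbhd.ideal[of "p - q" n N] by auto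

lemma ad_env:
  "p \<in> env_ideal n \<Longrightarrow> lp x 0 * p - p * lp x 0 \<in> env_ideal n"
  by (intro envI)

text \<open>A neighbourhood is defined as a left ideal, so right multiplication by
  \<open>x(0)\<close> is a problem. The commutator is not: bracketing with mode zero keeps the mode
  of a generator, and the commutator is a derivation.\<close>

lemma ad_nbhd:
  assumes "x \<in> sp n" "p \<in> nbhd n N"
  shows "lp x 0 * p - p * lp x 0 \<in> nbhd n N"
  using assms(2)
proof induction
  case (ideal p)
  then show ?case by (intro nbhd.ideal ad_env)
next
  case (gen y i)
  \<comment> \<open>The cocycle has the first mode, here zero, as a factor.\<close>
  have "lp x 0 * lp y i - lp y i * lp x 0 - lp (bracket x y) i \<in> env_ideal n"
    using env_ideal.commutator[OF assms(1) gen(1), of 0 i] by (simp split: if_splits)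
  moreover have "lp (bracket x y) i \<in> nbhd n N" using gen sp_bracket[OF assms(1) gen(1)] by (intro nbhd.gen)
  ultimately show ?case using nbhd_cong by blast
next
  case (add p q)
  from nbhd.add[OF add.IH] show ?case by (simp add: algebra_simps)
next
  case (mult p a)
  have "lp x 0 * (a * p) - a * p * lp x 0 = (lp x 0 * a - a * lp x 0) * p + a * (lp x 0 * p - p * lp x 0)"
    by (simp add: algebra_simps)
  then show ?case using mult by (auto intro: nbhd.add nbhd.mult)
qed

text \<open>Enlarging the finite set of relevant terms only adds terms that lie in the
  neighbourhood. This makes it possible to compare several sums over one common finite set.\<close>

lemma has_compl_sumD:
  assumes "has_compl_sum n f S r" "finite T" "T \<subseteq> S" "{s \<in> S. f s \<notin> nbhd n N} \<subseteq> T"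
  shows "sum f T - r N \<in> nbhd n N"
proof -
  let ?A = "{s \<in> S. f s \<notin> nbhd n N}"
  have "sum f T = sum f (T - ?A) + sum f ?A"
    by (rule sum.subset_diff[OF assms(4,2)])
  moreover have "sum f (T - ?A) \<in> nbhd n N" using assms(3) by (intro nbhd_sum) auto
  moreover have "sum f ?A - r N \<in> nbhd n N" using assms(1) by (simp add: has_compl_sum_def)
  ultimately show ?thesis using nbhd.add[of "sum f ?A - r N" n N "sum f (T - ?A)"] by (simp add: algebra_simps)
qed

lemma has_compl_sumI:
  assumes "\<And>N. \<exists>T. finite T \<and> T \<subseteq> S \<and> (\<forall>s\<in>S - T. f s \<in> nbhd n N) \<and> sum f T - r N \<in> nbhd n N"
  shows "has_compl_sum n f S r"
  unfolding has_compl_sum_def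
proof
  fix N
  obtain T where T: "finite T" "T \<subseteq> S" "\<forall>s\<in>S - T. f s \<in> nbhd n N" "sum f T - r N \<in> nbhd n N"
    using assms by blast
  let ?A = "{s \<in> S. f s \<notin> nbhd n N}"
  have sub: "?A \<subseteq> T" using T by auto
  have "sum f T = sum f (T - ?A) + sum f ?A"
    by (rule sum.subset_diff[OF sub T(1)])
  moreover have "sum f (T - ?A) \<in> nbhd n N" using T(2) by (intro nbhd_sum) auto
  ultimately have "sum f ?A - r N \<in> nbhd n N"
    using nbhd_diff[OF T(4), of "sum f (T - ?A)"] by (simp add: algebra_simps)
  then show "finite ?A \<and> sum f ?A - r N \<in> nbhd n N" using sub T(1) finite_subset by blast
qed

lemma has_compl_sum_finite: "has_compl_sum n f S r \<Longrightarrow> finite {s \<in> S. f s \<notin> nbhd n N}"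
  by (simp add: has_compl_sum_def)

lemma has_compl_sum_add:
  assumes "has_compl_sum n f S r" "has_compl_sum n g S r'"
  shows "has_compl_sum n (\<lambda>s. f s + g s) S (\<lambda>N. r N + r' N)"
proof (rule has_compl_sumI)
  fix N
  let ?T = "{s \<in> S. f s \<notin> nbhd n N} \<union> {s \<in> S. g s \<notin> nbhd n N}"
  have T: "finite ?T" using assms has_compl_sum_finite by blast
  have "sum f ?T - r N + (sum g ?T - r' N) \<in> nbhd n N"
    by (intro nbhd.add has_compl_sumD[OF assms(1) T] has_compl_sumD[OF assms(2) T]) auto
  then have "(\<Sum>s\<in>?T. f s + g s) - (r N + r' N) \<in> nbhd n N" by (simp add: sum.distrib algebra_simps)
  moreover have "\<forall>s\<in>S - ?T. f s + g s \<in> nbhd n N" by (auto intro: nbhd.add)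
  ultimately show "\<exists>T. finite T \<and> T \<subseteq> S \<and> (\<forall>s\<in>S - T. f s + g s \<in> nbhd n N) \<and>
      (\<Sum>s\<in>T. f s + g s) - (r N + r' N) \<in> nbhd n N"
    using T by (intro exI[of _ ?T]) auto
qed

text \<open>Additive maps that preserve all neighbourhoods are continuous. Multiplication by scalars
  and the adjoint action of elements of mode zero are of this kind.\<close>

lemma has_compl_sum_map:
  assumes "has_compl_sum n f S r" "h 0 = 0" "\<And>p q. h (p + q) = h p + h q" "\<And>N p. p \<in> nbhd n N \<Longrightarrow> h p \<in> nbhd n N"
  shows "has_compl_sum n (\<lambda>s. h (f s)) S (\<lambda>N. h (r N))"
proof (rule has_compl_sumI)
  fix N
  let ?T = "{s \<in> S. f s \<notin> nbhd n N}"
  have T: "finite ?T" using assms has_compl_sum_finite by blast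
  have hm: "h (p - q) = h p - h q" for p q using assms(3)[of "p - q" q] by simp
  have "sum f ?T - r N \<in> nbhd n N" by (intro has_compl_sumD[OF assms(1) T]) auto
  then have "h (sum f ?T) - h (r N) \<in> nbhd n N" using assms(4) hm by metis
  moreover have "h (sum f A) = (\<Sum>s\<in>A. h (f s))" for A
    by (induction A rule: infinite_finite_induct) (auto simp: assms(2,3))
  ultimately show "\<exists>T. finite T \<and> T \<subseteq> S \<and> (\<forall>s\<in>S - T. h (f s) \<in> nbhd n N) \<and>
      (\<Sum>s\<in>T. h (f s)) - h (r N) \<in> nbhd n N"
    using T by (intro exI[of _ ?T]) (auto intro: assms(4))
qed

lemma has_compl_sum_scalar:
  "has_compl_sum n f S r \<Longrightarrow> has_compl_sum n (\<lambda>s. scalar c * f s) S (\<lambda>N. scalar c * r N)"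
  by (rule has_compl_sum_map) (auto simp: distrib_left intro: nbhd.mult)

lemma has_compl_sum_ad:
  "has_compl_sum n f S r \<Longrightarrow> x \<in> sp n \<Longrightarrow>
    has_compl_sum n (\<lambda>s. lp x 0 * f s - f s * lp x 0) S (\<lambda>N. lp x 0 * r N - r N * lp x 0)"
  by (rule has_compl_sum_map) (auto simp: algebra_simps intro: ad_nbhd[simplified])

lemma has_compl_sum_cong:
  assumes "has_compl_sum n f S r" "\<And>s. s \<in> S \<Longrightarrow> g s - f s \<in> env_ideal n"
  shows "has_compl_sum n g S r"
proof (rule has_compl_sumI)
  fix N
  let ?T = "{s \<in> S. f s \<notin> nbhd n N}"
  have T: "finite ?T" using assms has_compl_sum_finite by blast
  have "sum g ?T - sum f ?T \<in> env_ideal n"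
    unfolding sum_subtractf[symmetric] using assms(2) by (intro tsi_sum[OF tsi_env_ideal]) auto
  moreover have "sum f ?T - r N \<in> nbhd n N" by (intro has_compl_sumD[OF assms(1) T]) auto
  ultimately have "(sum g ?T - sum f ?T) + (sum f ?T - r N) \<in> nbhd n N" using nbhd.add nbhd.ideal by blast
  then have "sum g ?T - r N \<in> nbhd n N" by simp
  moreover have "\<forall>s\<in>S - ?T. g s \<in> nbhd n N" using assms(2) nbhd_cong by blast
  ultimately show "\<exists>T. finite T \<and> T \<subseteq> S \<and> (\<forall>s\<in>S - T. g s \<in> nbhd n N) \<and> sum g T - r N \<in> nbhd n N"
    using T by (intro exI[of _ ?T]) auto
qed

lemma has_compl_sum_superset:
  assumes "A \<subseteq> S" "\<And>s. s \<in> S - A \<Longrightarrow> f s = 0"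
  shows "has_compl_sum n f A r \<longleftrightarrow> has_compl_sum n f S r"
proof -
  have "{s \<in> A. f s \<notin> nbhd n N} = {s \<in> S. f s \<notin> nbhd n N}" for N using assms by fastforce
  then show ?thesis by (simp add: has_compl_sum_def)
qed

lemma has_compl_sum_zero: "has_compl_sum n (\<lambda>_. 0) S r \<longleftrightarrow> compl_zero n r"
  using nbhd_uminus[of "- r N" n N for N] nbhd_uminus[of "r N" n N for N]
  by (auto simp: has_compl_sum_def compl_zero_def)

section \<open>Neighbourhoods in terms of ordered monomials\<close>

definition high_words :: "nat \<Rightarrow> nat \<Rightarrow> cpart set" where
  "high_words n N = {w. fst ` set w \<subseteq> colors n \<and> w \<noteq> [] \<and> int N \<le> snd (last w)}"

text \<open>The class is stable under straightening: exchanging a descent in the last two places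
  leaves the larger mode last, and a bracket there adds two modes that are both at least
  \<open>N\<close>, hence nonnegative.\<close>

lemma high_words_spanmod:
  assumes X: "root_vectors n X" and w: "w \<in> high_words n N"
  shows "u_mon n X w \<in> spanmod n X (loop_ideal n) (cparts n \<inter> high_words n N)"
proof -
  have "\<exists>\<pi>\<in>cparts n \<inter> high_words n N. mset \<pi> = mset w \<and> u_mon n X w - u_mon n X \<pi> \<in>
     spanmod n X (loop_ideal n) {\<pi> \<in> cparts n \<inter> high_words n N. length \<pi> < length w}"
  proof (rule straighten[OF tsi_loop_ideal env_subset_loop X _ _ _ _ w])
    fix a p q b assume "a @ p # q # b \<in> high_words n N" "part_less q p"
    then show "a @ q # p # b \<in> high_words n N"
      by (cases b) (auto simp: high_words_def part_less_def split: if_splits)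
  next
    fix a p q b c assume "a @ p # q # b \<in> high_words n N" "part_less q p" "c \<in> colors n"
    then show "a @ (c, snd p + snd q) # b \<in> high_words n N"
      by (cases b) (auto simp: high_words_def part_less_def split: if_splits)
  qed (auto simp: central_loop high_words_def)
  then obtain \<pi> where \<pi>: "\<pi> \<in> cparts n \<inter> high_words n N"
    and d: "u_mon n X w - u_mon n X \<pi> \<in> spanmod n X (loop_ideal n) {\<pi> \<in> cparts n \<inter> high_words n N. length \<pi> < length w}" by blast
  have "u_mon n X w - u_mon n X \<pi> \<in> spanmod n X (loop_ideal n) (cparts n \<inter> high_words n N)"
    using d spanmod_mono[of "{\<pi> \<in> cparts n \<inter> high_words n N. length \<pi> < length w}" "cparts n \<inter> high_words n N"] by blast
  from spanmod_add[OF tsi_loop_ideal this spanmod_u_mon[OF tsi_loop_ideal \<pi>]] show ?thesis by simp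
qed

text \<open>The left ideal is spanned by words whose last letter has mode at least \<open>N\<close>,
  and prefixing letters keeps this property. With the central element set to zero these words
  straighten to ordered monomials of the same kind, so monomials with all modes below
  \<open>N\<close> can be avoided.\<close>

lemma nbhd_spanmod:
  assumes X: "root_vectors n X" and p: "p \<in> nbhd n N"
  shows "p \<in> spanmod n X (loop_ideal n) (cparts n \<inter> high_words n N)" (is "p \<in> ?S")
proof -
  note J = tsi_loop_ideal[of n]
  have gen: "gen g * u_mon n X \<pi> \<in> ?S" if "\<pi> \<in> high_words n N" for g \<pi>
  proof (cases g)
    case Central
    then show ?thesis by (intro spanmod_ideal) (simp add: tsiD(5)[OF J] central_loop)
  next
    case (Loop x i)
    show ?thesis
    proof (cases "x \<in> sp n")
      case False
      then show ?thesis using env_ideal.junk[OF False, of i] env_subset_loop[of n]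
        by (intro spanmod_ideal) (auto simp: Loop lp_def intro!: tsiD(5)[OF J])
    next
      case True
      obtain \<kappa> where \<kappa>: "lp x i - (\<Sum>c\<in>colors n. scalar (\<kappa> c) * lp (basis_vec n X c) i) \<in> env_ideal n"
        using lp_basis_expand[OF X True] by blast
      then have "(lp x i - (\<Sum>c\<in>colors n. scalar (\<kappa> c) * lp (basis_vec n X c) i)) * u_mon n X \<pi> \<in> loop_ideal n"
        using env_subset_loop by (intro tsiD(5)[OF J]) auto
      then have "lp x i * u_mon n X \<pi> - (\<Sum>c\<in>colors n. scalar (\<kappa> c) * u_mon n X ((c, i) # \<pi>)) \<in> loop_ideal n"
        by (simp add: left_diff_distrib sum_distrib_right mult.assoc u_mon_Cons)
      moreover have "(\<Sum>c\<in>colors n. scalar (\<kappa> c) * u_mon n X ((c, i) # \<pi>)) \<in> ?S"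
        using that by (intro spanmod_sum[OF J] spanmod_scalar[OF J] high_words_spanmod[OF X]) (auto simp: high_words_def)
      ultimately show ?thesis using spanmod_cong[OF J] by (simp add: Loop lp_def)
    qed
  qed
  have gen': "gen g * q \<in> ?S" if q: "q \<in> ?S" for g q
  proof -
    obtain e where e: "finite {\<pi>. e \<pi> \<noteq> 0}" "{\<pi>. e \<pi> \<noteq> 0} \<subseteq> cparts n \<inter> high_words n N"
      "q - (\<Sum>\<pi> | e \<pi> \<noteq> 0. scalar (e \<pi>) * u_mon n X \<pi>) \<in> loop_ideal n"
      using q by (auto simp: spanmod_def)
    have "gen g * q - (\<Sum>\<pi> | e \<pi> \<noteq> 0. scalar (e \<pi>) * (gen g * u_mon n X \<pi>)) \<in> loop_ideal n"
      using tsiD(4)[OF J e(3), of "gen g"] by (simp add: right_diff_distrib sum_distrib_left scalar_left_commute)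
    moreover have "(\<Sum>\<pi> | e \<pi> \<noteq> 0. scalar (e \<pi>) * (gen g * u_mon n X \<pi>)) \<in> ?S"
      using e(2) gen by (intro spanmod_sum[OF J] spanmod_scalar[OF J]) auto
    ultimately show ?thesis by (rule spanmod_cong[OF J])
  qed
  from p show ?thesis
  proof induction
    case (ideal p)
    then show ?case using env_subset_loop by (intro spanmod_ideal) auto
  next
    case (gen x i)
    obtain \<kappa> where \<kappa>: "lp x i - (\<Sum>c\<in>colors n. scalar (\<kappa> c) * lp (basis_vec n X c) i) \<in> env_ideal n"
      using lp_basis_expand[OF X gen(1)] by blast
    have "(\<Sum>c\<in>colors n. scalar (\<kappa> c) * u_mon n X [(c, i)]) \<in> ?S"
      using gen by (intro spanmod_sum[OF J] spanmod_scalar[OF J] high_words_spanmod[OF X]) (auto simp: high_words_def)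
    moreover have "lp x i - (\<Sum>c\<in>colors n. scalar (\<kappa> c) * u_mon n X [(c, i)]) \<in> loop_ideal n"
      using \<kappa> env_subset_loop by (auto simp: u_mon_Cons)
    ultimately show ?case using spanmod_cong[OF J] by blast
  next
    case (add p q)
    then show ?case by (intro spanmod_add[OF J])
  next
    case (mult p a)
    show ?case
    proof (induction a rule: free_alg_induct)
      case zero
      then show ?case by (simp add: spanmod_ideal tsiD(1)[OF J])
    next
      case (add a b)
      then show ?case by (simp add: distrib_right spanmod_add[OF J])
    next
      case (scalar c)
      then show ?case using mult.IH by (rule spanmod_scalar[OF J])
    next
      case (gen g a)
      then show ?case by (simp add: mult.assoc gen')
    qed
  qed
qed

text \<open>For \<open>N\<close> beyond all modes of \<open>\<rho>\<close>, the difference of the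
  two expansions lies in the neighbourhood and is therefore, modulo \<open>loop_ideal\<close>, a
  combination of ordered monomials other than \<open>\<rho>\<close>. Independence then forces the
  two coefficients of \<open>\<rho>\<close> to agree.\<close>

lemma expansion_unique:
  assumes X: "root_vectors n X"
    and c: "has_compl_sum n (\<lambda>\<pi>. scalar (c \<pi>) * u_mon n X \<pi>) (cparts n) r"
    and c': "has_compl_sum n (\<lambda>\<pi>. scalar (c' \<pi>) * u_mon n X \<pi>) (cparts n) r"
    and \<rho>: "\<rho> \<in> cparts n"
  shows "c \<rho> = c' \<rho>"
proof -
  \<comment> \<open>The inserted 0 covers the empty partition and negative modes; adding 1 puts
    \<open>N\<close> strictly above all modes.\<close>
  define N where "N = nat (Max (insert 0 (snd ` set \<rho>))) + 1"
  have N: "snd p < int N" if "p \<in> set \<rho>" for p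
  proof -
    have "snd p \<le> Max (insert 0 (snd ` set \<rho>))" using that by (intro Max_ge) auto
    then show ?thesis by (simp add: N_def)
  qed
  have low: "\<rho> \<notin> high_words n N"
  proof
    assume "\<rho> \<in> high_words n N"
    then have "last \<rho> \<in> set \<rho>" "int N \<le> snd (last \<rho>)" by (auto simp: high_words_def)
    then show False using N[of "last \<rho>"] by linarith
  qed
  let ?f = "\<lambda>c \<pi>. scalar (c \<pi>) * u_mon n X \<pi>"
  define T where "T = insert \<rho> ({\<pi> \<in> cparts n. ?f c \<pi> \<notin> nbhd n N} \<union> {\<pi> \<in> cparts n. ?f c' \<pi> \<notin> nbhd n N})"
  have T: "finite T" "T \<subseteq> cparts n"
    using has_compl_sum_finite[OF c] has_compl_sum_finite[OF c'] \<rho> by (auto simp: T_def)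
  have "sum (?f c) T - r N - (sum (?f c') T - r N) \<in> nbhd n N"
    by (intro nbhd_diff has_compl_sumD[OF c T] has_compl_sumD[OF c' T]) (auto simp: T_def)
  moreover have "sum (?f c) T - r N - (sum (?f c') T - r N) = (\<Sum>\<pi>\<in>T. scalar (c \<pi> - c' \<pi>) * u_mon n X \<pi>)"
    by (simp add: scalar_diff left_diff_distrib sum_subtractf)
  ultimately have "(\<Sum>\<pi>\<in>T. scalar (c \<pi> - c' \<pi>) * u_mon n X \<pi>) \<in> nbhd n N" by simp
  from nbhd_spanmod[OF X this] obtain e where e: "finite {\<pi>. e \<pi> \<noteq> 0}" "{\<pi>. e \<pi> \<noteq> 0} \<subseteq> cparts n \<inter> high_words n N"
    "(\<Sum>\<pi>\<in>T. scalar (c \<pi> - c' \<pi>) * u_mon n X \<pi>) - (\<Sum>\<pi> | e \<pi> \<noteq> 0. scalar (e \<pi>) * u_mon n X \<pi>) \<in> loop_ideal n"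
    by (auto simp: spanmod_def)
  let ?E = "T \<union> {\<pi>. e \<pi> \<noteq> 0}"
  let ?g = "\<lambda>\<pi>. (if \<pi> \<in> T then c \<pi> - c' \<pi> else 0) - e \<pi>"
  have E: "finite ?E" "?E \<subseteq> cparts n" using T e by auto
  have "(\<Sum>\<pi>\<in>?E. scalar (?g \<pi>) * u_mon n X \<pi>) =
     (\<Sum>\<pi>\<in>?E. scalar (if \<pi> \<in> T then c \<pi> - c' \<pi> else 0) * u_mon n X \<pi>) - (\<Sum>\<pi>\<in>?E. scalar (e \<pi>) * u_mon n X \<pi>)"
    by (simp add: scalar_diff left_diff_distrib sum_subtractf)
  also have "(\<Sum>\<pi>\<in>?E. scalar (if \<pi> \<in> T then c \<pi> - c' \<pi> else 0) * u_mon n X \<pi>) = (\<Sum>\<pi>\<in>T. scalar (c \<pi> - c' \<pi>) * u_mon n X \<pi>)"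
    using E by (intro sum.mono_neutral_cong_right) auto
  also have "(\<Sum>\<pi>\<in>?E. scalar (e \<pi>) * u_mon n X \<pi>) = (\<Sum>\<pi> | e \<pi> \<noteq> 0. scalar (e \<pi>) * u_mon n X \<pi>)"
    using E by (intro sum.mono_neutral_right) auto
  finally have "(\<Sum>\<pi>\<in>?E. scalar (?g \<pi>) * u_mon n X \<pi>) \<in> loop_ideal n" using e(3) by simp
  from u_mon_independent[OF X E this] have "?g \<rho> = 0" by (auto simp: T_def)
  moreover have "e \<rho> = 0" using low e(2) by auto
  ultimately show ?thesis by (simp add: T_def)
qed

section \<open>Relations as symmetric tensors\<close>

text \<open>The contraction of the symmetric tensor \<open>P\<close> with a product of letters of
  modes \<open>js\<close>. Coordinates of a symmetric tensor depend only on the multiset of their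
  indices, so \<open>P\<close> is a function of multisets, of which every letter consumes two
  elements.\<close>

fun symF :: "nat \<Rightarrow> (nat multiset \<Rightarrow> complex) \<Rightarrow> int list \<Rightarrow> free_alg" where
  "symF n P [] = scalar (P {#})"
| "symF n P (j # js) = (\<Sum>r<2*n. \<Sum>s<2*n. lp (bm n r s) j * symF n (\<lambda>M. P (add_mset r (add_mset s M))) js)"

text \<open>The derivation action of the matrix \<open>x\<close> on symmetric tensors, in
  coordinates: each index \<open>u\<close>, counted with multiplicity, is contracted with row
  \<open>u\<close> of \<open>x\<close>.\<close>

definition sact :: "nat \<Rightarrow> complex mat \<Rightarrow> (nat multiset \<Rightarrow> complex) \<Rightarrow> nat multiset \<Rightarrow> complex" where
  "sact n x P M = (\<Sum>u\<in>#M. if u < 2*n then \<Sum>v<2*n. x $$ (u, v) * P (add_mset v (M - {#u#})) else 0)"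

lemma sact_add_mset2:
  assumes "r < 2*n" "s < 2*n"
  shows "sact n x P (add_mset r (add_mset s M)) =
    (\<Sum>v<2*n. x $$ (r, v) * P (add_mset v (add_mset s M))) + (\<Sum>v<2*n. x $$ (s, v) * P (add_mset v (add_mset r M)))
    + sact n x (\<lambda>M. P (add_mset r (add_mset s M))) M"
proof -
  have "(\<Sum>u\<in>#M. if u < 2*n then \<Sum>v<2*n. x $$ (u, v) * P (add_mset v (add_mset r (add_mset s M) - {#u#})) else 0)
      = sact n x (\<lambda>M. P (add_mset r (add_mset s M))) M"
    unfolding sact_def
  proof (intro arg_cong[of _ _ sum_mset] image_mset_cong)
    fix u assume u: "u \<in># M"
    then have "add_mset r (add_mset s M) - {#u#} = add_mset r (add_mset s (M - {#u#}))"
    proof -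
      obtain M' where M: "M = add_mset u M'" using multi_member_split[OF u] by blast
      have "add_mset r (add_mset s M) = add_mset u (add_mset r (add_mset s M'))" by (simp add: M add_mset_commute)
      then show ?thesis by (simp add: M)
    qed
    then show "(if u < 2*n then \<Sum>v<2*n. x $$ (u, v) * P (add_mset v (add_mset r (add_mset s M) - {#u#})) else 0)
      = (if u < 2*n then \<Sum>v<2*n. x $$ (u, v) * P (add_mset r (add_mset s (add_mset v (M - {#u#})))) else 0)"
      by (simp add: add_mset_commute)
  qed
  moreover have "add_mset r (add_mset s M) - {#s#} = add_mset r M" by (simp add: add_mset_commute)
  ultimately show ?thesis using assms by (simp add: sact_def)
qed

lemma symF_lin: "symF n (\<lambda>M. a * P M + Q M) js = scalar a * symF n P js + symF n Q js"
proof (induction js arbitrary: P Q)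
  case (Cons j js)
  show ?case
    by (simp add: Cons.IH distrib_left sum.distrib sum_distrib_left scalar_left_commute)
qed (simp add: scalar_add scalar_mult)

lemma symF_zero: "symF n (\<lambda>M. 0) js = 0"
  by (induction js) auto

lemma symF_scale: "symF n (\<lambda>M. a * P M) js = scalar a * symF n P js"
  using symF_lin[of n a P "\<lambda>_. 0"] by (simp add: symF_zero)

lemma symF_add: "symF n (\<lambda>M. P M + Q M) js = symF n P js + symF n Q js"
  using symF_lin[of n 1 P Q] by simp

lemma symF_sum: "symF n (\<lambda>M. \<Sum>i\<in>S. P i M) js = (\<Sum>i\<in>S. symF n (P i) js)"
  by (induction S rule: infinite_finite_induct) (auto simp: symF_zero symF_add)

lemma mc_bracket_bm:
  assumes x: "x \<in> sp n" and "r < 2*n" "s < 2*n" "a < 2*n" "b < 2*n"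
  shows "mc n (bracket x (bm n r s)) a b =
    (if s = b then x $$ (a, r) else 0) + (if r = b then x $$ (a, s) else 0)
    + (if s = a then x $$ (b, r) else 0) + (if r = a then x $$ (b, s) else 0)"
proof -
  have 1: "(\<Sum>u<2*n. x $$ (i, u) * mc n (bm n r s) u j) = (if s = j then x $$ (i, r) else 0) + (if r = j then x $$ (i, s) else 0)"
    if "j < 2*n" for i j
  proof -
    have "(\<Sum>u<2*n. x $$ (i, u) * mc n (bm n r s) u j) =
      (\<Sum>u<2*n. (if u = r then (if s = j then x $$ (i, r) else 0) else 0) + (if u = s then (if r = j then x $$ (i, s) else 0) else 0))"
      using that by (intro sum.cong) (auto simp: mc_bm algebra_simps)
    then show ?thesis using assms by (simp add: sum.distrib)
  qed
  have 2: "(\<Sum>u<2*n. x $$ (b, u) * mc n (bm n r s) a u) = (\<Sum>u<2*n. x $$ (b, u) * mc n (bm n r s) u a)"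
    using assms by (intro sum.cong) (auto simp: mc_sym[OF bm_sp])
  show ?thesis
    by (simp only: mc_bracket[OF x bm_carrier assms(4,5)] 1[OF assms(5)] 2 1[OF assms(4)] add.assoc)
qed

text \<open>Symmetry of \<open>g\<close> makes the four terms of the bracket equal in pairs, which
  cancels the factor 1/2. This moves the action of \<open>x\<close> from the letters to their
  coefficients.\<close>

lemma bracket_bm_contract:
  fixes g :: "nat \<Rightarrow> nat \<Rightarrow> free_alg"
  assumes x: "x \<in> sp n" and ab: "a < 2*n" "b < 2*n" and sym: "\<And>r s. g r s = g s r"
  shows "(\<Sum>r<2*n. \<Sum>s<2*n. scalar (mc n (bracket x (bm n r s)) a b / 2) * g r s)
    = (\<Sum>u<2*n. scalar (x $$ (a, u)) * g u b) + (\<Sum>u<2*n. scalar (x $$ (b, u)) * g u a)"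
proof -
  have half: "scalar (z / 2) * q + scalar (z / 2) * q = scalar z * q" for z q
    by (simp flip: distrib_right scalar_add)
  have "(\<Sum>r<2*n. \<Sum>s<2*n. scalar (mc n (bracket x (bm n r s)) a b / 2) * g r s) =
    (\<Sum>r<2*n. \<Sum>s<2*n. (if s = b then scalar (x $$ (a, r) / 2) * g r b else 0)
      + (if r = b then scalar (x $$ (a, s) / 2) * g s b else 0)
      + (if s = a then scalar (x $$ (b, r) / 2) * g r a else 0)
      + (if r = a then scalar (x $$ (b, s) / 2) * g s a else 0))"
  proof (intro sum.cong refl)
    fix r s assume "r \<in> {..<2*n}" "s \<in> {..<2*n}"
    then have rs: "r < 2*n" "s < 2*n" by auto
    have d: "scalar ((if P then z else 0) / 2) * q = (if P then scalar (z / 2) * q else 0)" for P z q by simp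
    show "scalar (mc n (bracket x (bm n r s)) a b / 2) * g r s = (if s = b then scalar (x $$ (a, r) / 2) * g r b else 0)
      + (if r = b then scalar (x $$ (a, s) / 2) * g s b else 0)
      + (if s = a then scalar (x $$ (b, r) / 2) * g r a else 0)
      + (if r = a then scalar (x $$ (b, s) / 2) * g s a else 0)"
      unfolding mc_bracket_bm[OF x rs ab] add_divide_distrib scalar_add distrib_right d
      using sym by (intro arg_cong2[of _ _ _ _ "(+)"]) auto
  qed
  also have "\<dots> = (\<Sum>u<2*n. scalar (x $$ (a, u) / 2) * g u b) + (\<Sum>u<2*n. scalar (x $$ (a, u) / 2) * g u b)
      + (\<Sum>u<2*n. scalar (x $$ (b, u) / 2) * g u a) + (\<Sum>u<2*n. scalar (x $$ (b, u) / 2) * g u a)"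
  proof -
    have pull: "(\<Sum>s<2*n. if P then f s else 0) = (if P then \<Sum>s<2*n. f s else 0)" for P and f :: "nat \<Rightarrow> free_alg"
      by simp
    show ?thesis using ab by (simp add: sum.distrib pull)
  qed
  also have "\<dots> = (\<Sum>u<2*n. scalar (x $$ (a, u)) * g u b) + (\<Sum>u<2*n. scalar (x $$ (b, u)) * g u a)"
    by (simp only: add.assoc sum.distrib[symmetric] half)
  finally show ?thesis .
qed

lemma sum_swap_pairs:
  "(\<Sum>r\<in>A. \<Sum>s\<in>A. \<Sum>a\<in>A. \<Sum>b\<in>A. f r s a b) = (\<Sum>a\<in>A. \<Sum>b\<in>A. \<Sum>r\<in>A. \<Sum>s\<in>A. f r s a b)"
proof -
  have "(\<Sum>r\<in>A. \<Sum>s\<in>A. \<Sum>a\<in>A. \<Sum>b\<in>A. f r s a b) = (\<Sum>r\<in>A. \<Sum>a\<in>A. \<Sum>s\<in>A. \<Sum>b\<in>A. f r s a b)"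
    by (intro sum.cong refl sum.swap)
  also have "\<dots> = (\<Sum>a\<in>A. \<Sum>r\<in>A. \<Sum>s\<in>A. \<Sum>b\<in>A. f r s a b)" by (rule sum.swap)
  also have "\<dots> = (\<Sum>a\<in>A. \<Sum>r\<in>A. \<Sum>b\<in>A. \<Sum>s\<in>A. f r s a b)" by (intro sum.cong refl sum.swap)
  also have "\<dots> = (\<Sum>a\<in>A. \<Sum>b\<in>A. \<Sum>r\<in>A. \<Sum>s\<in>A. f r s a b)" by (intro sum.cong refl sum.swap)
  finally show ?thesis .
qed

text \<open>The commutator with \<open>x(0)\<close> is a derivation that changes neither the modes
  nor the number of letters, and no central term arises in mode zero. Contracting the bracket of
  each letter with the symmetric coefficients yields \<open>sact\<close>, so the adjoint action on
  relations is the natural action on symmetric tensors.\<close>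

lemma ad_symF:
  assumes x: "x \<in> sp n"
  shows "lp x 0 * symF n P js - symF n P js * lp x 0 - symF n (sact n x P) js \<in> env_ideal n"
proof (induction js arbitrary: P)
  case Nil
  have "sact n x P {#} = 0" by (simp add: sact_def)
  then show ?case using scalar_commute[of "P {#}" "lp x 0"] by (simp add: envI)
next
  case (Cons j js)
  define G where "G = (\<lambda>r s. symF n (\<lambda>M. P (add_mset r (add_mset s M))) js)"
  define G' where "G' = (\<lambda>r s. symF n (sact n x (\<lambda>M. P (add_mset r (add_mset s M)))) js)"
  let ?B = "\<lambda>r s. lp (bm n r s) j"
  let ?S = "{..<2*n}"
  have symF_Cons: "symF n P (j # js) = (\<Sum>r\<in>?S. \<Sum>s\<in>?S. ?B r s * G r s)" by (simp add: G_def)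
  have Gsym: "G r s = G s r" for r s by (simp add: G_def add_mset_commute)
  have ad: "lp x 0 * ?B r s - ?B r s * lp x 0 - (\<Sum>a\<in>?S. \<Sum>b\<in>?S. scalar (mc n (bracket x (bm n r s)) a b / 2) * ?B a b) \<in> env_ideal n" for r s
  proof -
    have "lp x 0 * ?B r s - ?B r s * lp x 0 - lp (bracket x (bm n r s)) j \<in> env_ideal n"
      using env_ideal.commutator[OF x bm_sp, of 0 r s j] by (simp split: if_splits)
    moreover have "lp (bracket x (bm n r s)) j - (\<Sum>a\<in>?S. \<Sum>b\<in>?S. scalar (mc n (bracket x (bm n r s)) a b / 2) * ?B a b) \<in> env_ideal n"
      using lp_bm[OF sp_bracket[OF x bm_sp]] .
    ultimately show ?thesis by (rule tsi_trans[OF tsi_env_ideal])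
  qed
  have IH: "lp x 0 * G r s - G r s * lp x 0 - G' r s \<in> env_ideal n" for r s
    unfolding G_def G'_def by (rule Cons.IH)
  \<comment> \<open>Leibniz rule: the first summand brackets the first letter, the second uses the
    induction hypothesis for the remaining ones.\<close>
  have "(\<Sum>r\<in>?S. \<Sum>s\<in>?S. (lp x 0 * ?B r s - ?B r s * lp x 0 - (\<Sum>a\<in>?S. \<Sum>b\<in>?S. scalar (mc n (bracket x (bm n r s)) a b / 2) * ?B a b)) * G r s
     + ?B r s * (lp x 0 * G r s - G r s * lp x 0 - G' r s)) \<in> env_ideal n"
    by (intro tsi_sum[OF tsi_env_ideal] envI(2) envI(5)[OF ad] envI(4)[OF IH])
  also have "(\<Sum>r\<in>?S. \<Sum>s\<in>?S. (lp x 0 * ?B r s - ?B r s * lp x 0 - (\<Sum>a\<in>?S. \<Sum>b\<in>?S. scalar (mc n (bracket x (bm n r s)) a b / 2) * ?B a b)) * G r s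
     + ?B r s * (lp x 0 * G r s - G r s * lp x 0 - G' r s))
    = lp x 0 * symF n P (j # js) - symF n P (j # js) * lp x 0
      - ((\<Sum>r\<in>?S. \<Sum>s\<in>?S. \<Sum>a\<in>?S. \<Sum>b\<in>?S. scalar (mc n (bracket x (bm n r s)) a b / 2) * ?B a b * G r s)
        + (\<Sum>r\<in>?S. \<Sum>s\<in>?S. ?B r s * G' r s))"
    by (simp add: symF_Cons sum_distrib_left sum_distrib_right left_diff_distrib right_diff_distrib
        sum_subtractf sum.distrib mult.assoc algebra_simps del: symF.simps)
  also have "(\<Sum>r\<in>?S. \<Sum>s\<in>?S. \<Sum>a\<in>?S. \<Sum>b\<in>?S. scalar (mc n (bracket x (bm n r s)) a b / 2) * ?B a b * G r s)
    = (\<Sum>a\<in>?S. \<Sum>b\<in>?S. \<Sum>r\<in>?S. \<Sum>s\<in>?S. scalar (mc n (bracket x (bm n r s)) a b / 2) * ?B a b * G r s)"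
    by (rule sum_swap_pairs)
  also have "\<dots> = (\<Sum>a\<in>?S. \<Sum>b\<in>?S. ?B a b * (\<Sum>r\<in>?S. \<Sum>s\<in>?S. scalar (mc n (bracket x (bm n r s)) a b / 2) * G r s))"
    by (simp add: sum_distrib_left scalar_left_commute mult.assoc)
  also have "\<dots> = (\<Sum>a\<in>?S. \<Sum>b\<in>?S. ?B a b * ((\<Sum>u\<in>?S. scalar (x $$ (a, u)) * G u b) + (\<Sum>u\<in>?S. scalar (x $$ (b, u)) * G u a)))"
    by (intro sum.cong refl arg_cong2[of _ _ _ _ "(*)"] bracket_bm_contract[OF x _ _ Gsym]) auto
  also have "(\<Sum>a\<in>?S. \<Sum>b\<in>?S. ?B a b * ((\<Sum>u\<in>?S. scalar (x $$ (a, u)) * G u b) + (\<Sum>u\<in>?S. scalar (x $$ (b, u)) * G u a)))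
     + (\<Sum>r\<in>?S. \<Sum>s\<in>?S. ?B r s * G' r s) = symF n (sact n x P) (j # js)"
  proof -
    have "symF n (\<lambda>M. sact n x P (add_mset a (add_mset b M))) js =
       (\<Sum>u\<in>?S. scalar (x $$ (a, u)) * G u b) + (\<Sum>u\<in>?S. scalar (x $$ (b, u)) * G u a) + G' a b"
      if "a < 2*n" "b < 2*n" for a b
      unfolding sact_add_mset2[OF that] symF_add symF_sum symF_scale G_def G'_def by simp
    then show ?thesis by (simp add: distrib_left sum.distrib)
  qed
  finally show ?case .
qed

text \<open>The scalar at the end of the recursion commutes with everything, so every term ends in a
  letter of mode \<open>j\<close>.\<close>

lemma symF_high:
  assumes "int N \<le> j"
  shows "symF n P (js @ [j]) \<in> nbhd n N"
proof (induction js arbitrary: P)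
  case Nil
  have "lp (bm n r s) j * scalar c \<in> nbhd n N" for r s c
    unfolding scalar_commute[symmetric] using assms by (intro nbhd.mult nbhd.gen) auto
  then show ?case by (auto intro!: nbhd_sum)
next
  case (Cons i js)
  then show ?case by (auto intro!: nbhd_sum nbhd.mult)
qed

lemma scalar_mult_scalar_mult: "(scalar a * p) * (scalar b * q) = (scalar a * scalar b) * (p * q)"
  by (simp only: mult.assoc scalar_left_commute[of p])

section \<open>From tensors to words in the basis\<close>

definition pairwords :: "nat \<Rightarrow> nat \<Rightarrow> (nat \<times> nat) list set" where
  "pairwords n k = {R. set R \<subseteq> {..<2*n} \<times> {..<2*n} \<and> length R = k}"

definition pcont :: "(nat \<times> nat) list \<Rightarrow> nat multiset" where
  "pcont R = (\<Sum>p\<leftarrow>R. {#fst p, snd p#})"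

definition ccont :: "nat \<Rightarrow> cpart \<Rightarrow> nat multiset" where
  "ccont n \<pi> = (\<Sum>p\<leftarrow>\<pi>. {#pos n (fst (fst p)), pos n (snd (fst p))#})"

definition cword :: "nat \<Rightarrow> (nat \<times> nat) list \<Rightarrow> int list \<Rightarrow> cpart" where
  "cword n R js = zip (map (\<lambda>p. color_of n (fst p) (snd p)) R) js"

lemma finite_pairwords: "finite (pairwords n k)"
  unfolding pairwords_def by (intro finite_lists_length_eq) auto

lemma ccont_mset: "mset \<pi> = mset \<sigma> \<Longrightarrow> ccont n \<pi> = ccont n \<sigma>"
  by (simp add: ccont_def flip: sum_mset_sum_list)

lemma ccont_cword:
  assumes "R \<in> pairwords n (length js)"
  shows "ccont n (cword n R js) = pcont R"
  using assms
proof (induction R arbitrary: js)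
  case (Cons p R)
  then obtain j js' where js: "js = j # js'" by (cases js) (auto simp: pairwords_def)
  have p: "fst p < 2*n" "snd p < 2*n" and R: "R \<in> pairwords n (length js')" using Cons.prems js by (auto simp: pairwords_def)
  have "{#min (fst p) (snd p), max (fst p) (snd p)#} = {#fst p, snd p#}" by (auto simp: min_def max_def)
  then show ?case using Cons.IH[OF R] color_of[OF p] js by (simp add: ccont_def pcont_def cword_def)
qed (simp add: ccont_def pcont_def cword_def)

lemma cword_colors: "R \<in> pairwords n (length js) \<Longrightarrow> fst ` set (cword n R js) \<subseteq> colors n"
proof -
  assume R: "R \<in> pairwords n (length js)"
  have "color_of n (fst p) (snd p) \<in> colors n" if "p \<in> set R" for p
    using R that by (intro color_of(1)) (auto simp: pairwords_def)
  then show ?thesis by (auto simp: cword_def dest!: set_zip_leftD)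
qed

lemma cword_degrees: "R \<in> pairwords n (length js) \<Longrightarrow> map snd (cword n R js) = js"
  by (simp add: cword_def pairwords_def)

lemma pairwords_Suc:
  fixes f :: "(nat \<times> nat) list \<Rightarrow> 'a::comm_monoid_add"
  shows "(\<Sum>R\<in>pairwords n (Suc k). f R) = (\<Sum>r<2*n. \<Sum>s<2*n. \<Sum>R\<in>pairwords n k. f ((r, s) # R))"
proof -
  have eq: "pairwords n (Suc k) = (\<lambda>(R, p). p # R) ` (pairwords n k \<times> ({..<2*n} \<times> {..<2*n}))"
    unfolding pairwords_def by (auto simp: length_Suc_conv image_iff)
  have "(\<Sum>R\<in>pairwords n (Suc k). f R) = (\<Sum>(R, p)\<in>pairwords n k \<times> ({..<2*n} \<times> {..<2*n}). f (p # R))"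
    unfolding eq by (subst sum.reindex) (auto simp: inj_on_def case_prod_beta)
  also have "\<dots> = (\<Sum>R\<in>pairwords n k. \<Sum>p\<in>{..<2*n} \<times> {..<2*n}. f (p # R))"
    by (simp add: sum.cartesian_product)
  also have "\<dots> = (\<Sum>p\<in>{..<2*n} \<times> {..<2*n}. \<Sum>R\<in>pairwords n k. f (p # R))" by (rule sum.swap)
  also have "\<dots> = (\<Sum>r<2*n. \<Sum>s<2*n. \<Sum>R\<in>pairwords n k. f ((r, s) # R))"
  proof -
    have "(\<Sum>p\<in>A \<times> B. g p) = (\<Sum>r\<in>A. \<Sum>s\<in>B. g (r, s))" for A B :: "nat set" and g :: "nat \<times> nat \<Rightarrow> 'a"
      by (simp add: sum.cartesian_product)
    then show ?thesis .
  qed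
  finally show ?thesis .
qed

text \<open>Each \<open>bm n r s\<close> is a multiple of the basis vector of one color, whatever
  the order of \<open>r\<close> and \<open>s\<close>. \<open>K\<close> is the product of these
  nonzero scalars over the parts, so it depends only on the multiset of parts.\<close>

lemma symF_cwords:
  assumes X: "root_vectors n X"
  obtains K :: "cpart \<Rightarrow> complex" where
    "\<And>\<pi>. fst ` set \<pi> \<subseteq> colors n \<Longrightarrow> K \<pi> \<noteq> 0"
    "\<And>\<pi> \<sigma>. mset \<pi> = mset \<sigma> \<Longrightarrow> K \<pi> = K \<sigma>"
    "\<And>P js. symF n P js - (\<Sum>R\<in>pairwords n (length js). scalar (P (pcont R) * K (cword n R js)) * u_mon n X (cword n R js))
       \<in> env_ideal n"
proof -
  obtain lam where lam: "\<And>c. c \<in> colors n \<Longrightarrow> lam c \<noteq> 0 \<and> basis_vec n X c = lam c \<cdot>\<^sub>m bm n (pos n (fst c)) (pos n (snd c))"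
    using basis_vec_scale[OF X] by blast
  define K where "K = (\<lambda>\<pi> :: cpart. \<Prod>p\<leftarrow>\<pi>. 1 / lam (fst p))"
  have 1: "K \<pi> \<noteq> 0" if "fst ` set \<pi> \<subseteq> colors n" for \<pi>
    using lam that by (auto simp: K_def prod_list_zero_iff)
  have 2: "K \<pi> = K \<sigma>" if "mset \<pi> = mset \<sigma>" for \<pi> \<sigma>
    using that by (simp add: K_def flip: prod_mset_prod_list)
  have 3: "symF n P js - (\<Sum>R\<in>pairwords n (length js). scalar (P (pcont R) * K (cword n R js)) * u_mon n X (cword n R js))
       \<in> env_ideal n" for P js
  proof (induction js arbitrary: P)
    case Nil
    have "pairwords n 0 = {[]}" by (auto simp: pairwords_def)
    then show ?case by (simp add: pcont_def cword_def K_def envI)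
  next
    case (Cons j js)
    let ?Q = "\<lambda>r s M. P (add_mset r (add_mset s M))"
    let ?c = "\<lambda>r s. color_of n r s"
    let ?U = "\<lambda>r s. \<Sum>R\<in>pairwords n (length js). scalar (?Q r s (pcont R) * K (cword n R js)) * u_mon n X (cword n R js)"
    let ?v = "\<lambda>r s. scalar (1 / lam (?c r s)) * lp (basis_vec n X (?c r s)) j"
    have "lp (bm n r s) j * (symF n (?Q r s) js - ?U r s) + (lp (bm n r s) j - ?v r s) * ?U r s \<in> env_ideal n"
      if "r < 2*n" "s < 2*n" for r s
      using lam[OF color_of(1)[OF that]] that
      by (intro envI(2) envI(4)[OF Cons.IH] envI(5) bm_basis_vec[OF X]) auto
    then have "lp (bm n r s) j * symF n (?Q r s) js - ?v r s * ?U r s \<in> env_ideal n" if "r < 2*n" "s < 2*n" for r s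
      using that by (simp add: algebra_simps)
    then have "(\<Sum>r<2*n. \<Sum>s<2*n. lp (bm n r s) j * symF n (?Q r s) js - ?v r s * ?U r s) \<in> env_ideal n"
      by (intro tsi_sum[OF tsi_env_ideal]) auto
    moreover have "?v r s * ?U r s = (\<Sum>R\<in>pairwords n (length js).
        scalar (P (pcont ((r, s) # R)) * K (cword n ((r, s) # R) (j # js))) * u_mon n X (cword n ((r, s) # R) (j # js)))" for r s
      unfolding sum_distrib_left
    proof (intro sum.cong refl)
      fix R
      let ?z = "P (add_mset r (add_mset s (pcont R))) * K (cword n R js)"
      have "?v r s * (scalar ?z * u_mon n X (cword n R js)) = scalar (1 / lam (?c r s)) * scalar ?z * (lp (basis_vec n X (?c r s)) j * u_mon n X (cword n R js))"
        by (rule scalar_mult_scalar_mult)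
      also have "scalar (1 / lam (?c r s)) * scalar ?z = scalar (P (pcont ((r, s) # R)) * K (cword n ((r, s) # R) (j # js)))"
        by (simp add: pcont_def cword_def K_def flip: scalar_mult)
      finally show "?v r s * (scalar ?z * u_mon n X (cword n R js)) =
         scalar (P (pcont ((r, s) # R)) * K (cword n ((r, s) # R) (j # js))) * u_mon n X (cword n ((r, s) # R) (j # js))"
        by (simp add: cword_def u_mon_Cons)
    qed
    ultimately show ?case by (simp add: pairwords_Suc sum_subtractf)
  qed
  show thesis by (rule that[OF 1 2 3])
qed

section \<open>Control of the modes during straightening\<close>

definition ppos :: "int list \<Rightarrow> int" where
  "ppos js = (\<Sum>j\<leftarrow>js. max 0 j)"

lemma ppos_mset: "mset js = mset is \<Longrightarrow> ppos js = ppos is"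
  by (simp add: ppos_def flip: sum_mset_sum_list)

lemma sum_list_mset: "mset js = mset is \<Longrightarrow> sum_list js = (sum_list is :: int)"
  by (simp flip: sum_mset_sum_list)

text \<open>The other modes sum to at most \<open>ppos js\<close>, which bounds a single mode from
  below. For fixed degree a bound on \<open>ppos\<close> thus confines all modes to a finite
  interval.\<close>

lemma ppos_bounds:
  assumes "j \<in> set js" shows "j \<le> ppos js" "sum_list js - ppos js \<le> j"
proof -
  have "0 \<le> ppos js" "sum_list js \<le> ppos js" for js :: "int list"
    by (induction js) (auto simp: ppos_def)
  then have aux: "0 \<le> ppos js" "sum_list js \<le> ppos js" for js by auto
  have "j \<le> ppos js \<and> sum_list js - ppos js \<le> j" using assms
  proof (induction js)
    case (Cons i js)
    have "ppos (i # js) = max 0 i + ppos js" by (simp add: ppos_def)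
    then show ?case using Cons aux[of js] by fastforce
  qed simp
  then show "j \<le> ppos js" "sum_list js - ppos js \<le> j" by auto
qed

lemma ppos_large:
  assumes "int (length js) * int N < ppos js"
  shows "\<exists>j\<in>set js. int N < j"
proof (rule ccontr)
  assume "\<not> ?thesis"
  then have "\<forall>j\<in>set js. j \<le> int N" by auto
  then have "ppos js \<le> int (length js) * int N"
    by (induction js) (auto simp: ppos_def distrib_right)
  then show False using assms by simp
qed

text \<open>Letters of negative mode come first, so straightening only commutes letters whose modes have the
  same sign. No central terms arise and \<open>ppos\<close> is preserved, so that only finitely many words of
  given length and degree contribute to a given partition.\<close>

definition signed_words :: "nat \<Rightarrow> int \<Rightarrow> int \<Rightarrow> cpart set" where
  "signed_words n d b = {w. fst ` set w \<subseteq> colors n \<and> sorted_wrt (\<lambda>p q. sgn (snd p) \<le> sgn (snd q)) w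
     \<and> cdegree w = d \<and> ppos (map snd w) = b}"

text \<open>In a word sorted by signs a descent joins two modes of equal sign. Their positive parts
  add up under a bracket, and modes of equal sign that sum to zero are both zero.\<close>

lemma signed_words_straighten:
  assumes X: "root_vectors n X" and w: "w \<in> signed_words n d b"
  shows "\<exists>\<pi>\<in>cparts n \<inter> signed_words n d b. mset \<pi> = mset w \<and> u_mon n X w - u_mon n X \<pi> \<in>
     spanmod n X (env_ideal n) {\<pi> \<in> cparts n \<inter> signed_words n d b. length \<pi> < length w}"
proof (rule straighten[OF tsi_env_ideal order.refl X _ _ _ _ w])
  have eq: "sgn (snd p) = sgn (snd q)"
    if "u @ p # q # v \<in> signed_words n d b" "part_less q p" for u p q v
  proof -
    have "sgn (snd p) \<le> sgn (snd q)" using that(1) by (simp add: signed_words_def sorted_wrt_append)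
    moreover have "snd q \<le> snd p" using that(2) by (auto simp: part_less_def)
    ultimately show ?thesis by (auto simp: sgn_if split: if_splits)
  qed
  fix u p q v assume w: "u @ p # q # v \<in> signed_words n d b" and less: "part_less q p"
  note eq = eq[OF w less]
  show "u @ q # p # v \<in> signed_words n d b"
    using w eq by (auto simp: signed_words_def sorted_wrt_append cdegree_def ppos_def)
  show "snd p = 0 \<or> gen Central \<in> env_ideal n" if "snd p + snd q = 0"
    using eq that by (auto simp: sgn_if split: if_splits)
  show "u @ (c, snd p + snd q) # v \<in> signed_words n d b" if "c \<in> colors n" for c
  proof -
    have "sgn (snd p + snd q) = sgn (snd p)" "max 0 (snd p + snd q) = max 0 (snd p) + max 0 (snd q)"
      using eq by (auto simp: sgn_if split: if_splits)
    then show ?thesis using w eq that by (auto simp: signed_words_def sorted_wrt_append cdegree_def ppos_def)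
  qed
qed (auto simp: signed_words_def)

text \<open>\<open>K\<close> absorbs the scalars between the chosen basis of \<open>sp n\<close> and the elements \<open>bm\<close>.\<close>

definition scale_fun :: "nat \<Rightarrow> (color \<Rightarrow> complex mat) \<Rightarrow> (cpart \<Rightarrow> complex) \<Rightarrow> bool" where
  "scale_fun n X K \<longleftrightarrow> (\<forall>\<pi>. fst ` set \<pi> \<subseteq> colors n \<longrightarrow> K \<pi> \<noteq> 0) \<and> (\<forall>\<pi> \<sigma>. mset \<pi> = mset \<sigma> \<longrightarrow> K \<pi> = K \<sigma>) \<and>
    (\<forall>P js. symF n P js - (\<Sum>R\<in>pairwords n (length js). scalar (P (pcont R) * K (cword n R js)) * u_mon n X (cword n R js))
       \<in> env_ideal n)"

lemma scale_fun_exists: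
  assumes "root_vectors n X" shows "\<exists>K. scale_fun n X K"
proof (rule symF_cwords[OF assms])
  fix K assume "\<And>\<pi>. fst ` set \<pi> \<subseteq> colors n \<Longrightarrow> K \<pi> \<noteq> 0" "\<And>\<pi> \<sigma>. mset \<pi> = mset \<sigma> \<Longrightarrow> K \<pi> = K \<sigma>"
    "\<And>P js. symF n P js - (\<Sum>R\<in>pairwords n (length js). scalar (P (pcont R) * K (cword n R js)) * u_mon n X (cword n R js))
       \<in> env_ideal n"
  then have "scale_fun n X K" unfolding scale_fun_def by blast
  then show ?thesis by blast
qed

lemma cpartsD: "\<pi> \<in> cparts n \<Longrightarrow> sorted_wrt part_le \<pi> \<and> fst ` set \<pi> \<subseteq> colors n"
  by (simp add: cparts_def cparts_on_def)

text \<open>The ways to attach pairs of positions to the modes \<open>js\<close> that produce a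
  rearrangement of \<open>\<pi>\<close>; each of them contributes once to the coefficient of
  \<open>\<pi>\<close>.\<close>

definition fillings :: "nat \<Rightarrow> int list \<Rightarrow> cpart \<Rightarrow> (nat \<times> nat) list set" where
  "fillings n js \<pi> = {R \<in> pairwords n (length js). mset (cword n R js) = mset \<pi>}"

text \<open>A word of full length straightens to its own sorted rearrangement plus shorter
  monomials. In top length the coefficient of \<open>\<pi>\<close> is thus a sum over its fillings,
  and all of them carry the same factor because \<open>P\<close> and \<open>K\<close> ignore the
  order of the parts.\<close>

lemma symF_expand:
  assumes X: "root_vectors n X" and K: "scale_fun n X K" and js: "sorted js"
  shows "\<exists>e. finite {\<pi>. e \<pi> \<noteq> 0} \<and>
    (\<forall>\<pi>. e \<pi> \<noteq> 0 \<longrightarrow> \<pi> \<in> cparts n \<and> length \<pi> \<le> length js \<and> cdegree \<pi> = sum_list js \<and> ppos (map snd \<pi>) = ppos js) \<and>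
    symF n P js - (\<Sum>\<pi> | e \<pi> \<noteq> 0. scalar (e \<pi>) * u_mon n X \<pi>) \<in> env_ideal n \<and>
    (\<forall>\<pi>\<in>cparts n. length \<pi> = length js \<longrightarrow> e \<pi> = P (ccont n \<pi>) * K \<pi> * of_nat (card (fillings n js \<pi>)))"
proof -
  note J = tsi_env_ideal[of n]
  let ?W = "pairwords n (length js)"
  let ?w = "\<lambda>R. cword n R js"
  let ?G = "signed_words n (sum_list js) (ppos js)"
  have fW: "finite ?W" by (rule finite_pairwords)
  have w: "?w R \<in> ?G" if "R \<in> ?W" for R
  proof -
    have "sorted_wrt (\<lambda>x y. sgn x \<le> sgn y) js"
      by (rule sorted_wrt_mono_rel[OF _ js]) (auto simp: sgn_if)
    then have "sorted_wrt (\<lambda>x y. sgn x \<le> sgn y) (map snd (?w R))" using cword_degrees[OF that] by simp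
    from this[unfolded sorted_wrt_map] show ?thesis using cword_colors[OF that] cword_degrees[OF that]
      by (simp add: signed_words_def cdegree_def)
  qed
  have lw: "length (?w R) = length js" if "R \<in> ?W" for R using cword_degrees[OF that] by (metis length_map)
  have "\<forall>R\<in>?W. \<exists>\<pi>. \<pi> \<in> cparts n \<inter> ?G \<and> mset \<pi> = mset (?w R) \<and> u_mon n X (?w R) - u_mon n X \<pi> \<in>
     spanmod n X (env_ideal n) {\<pi> \<in> cparts n \<inter> ?G. length \<pi> < length js}"
    using signed_words_straighten[OF X w] lw by fastforce
  from bchoice[OF this] obtain pi where pi: "\<And>R. R \<in> ?W \<Longrightarrow> pi R \<in> cparts n \<inter> ?G"
    "\<And>R. R \<in> ?W \<Longrightarrow> mset (pi R) = mset (?w R)"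
    "\<And>R. R \<in> ?W \<Longrightarrow> u_mon n X (?w R) - u_mon n X (pi R) \<in>
     spanmod n X (env_ideal n) {\<pi> \<in> cparts n \<inter> ?G. length \<pi> < length js}" by blast
  let ?a = "\<lambda>R. P (pcont R) * K (?w R)"
  let ?u = "u_mon n X"
  have "(\<Sum>R\<in>?W. scalar (?a R) * (?u (?w R) - ?u (pi R))) \<in> spanmod n X (env_ideal n) {\<pi> \<in> cparts n \<inter> ?G. length \<pi> < length js}"
    using pi(3) by (intro spanmod_sum[OF J] spanmod_scalar[OF J])
  \<comment> \<open>\<open>e1\<close> gathers the shorter monomials produced by brackets, while
    \<open>e2\<close> below describes the sorted words of full length.\<close>
  then obtain e1 where e1: "finite {\<pi>. e1 \<pi> \<noteq> 0}" "{\<pi>. e1 \<pi> \<noteq> 0} \<subseteq> {\<pi> \<in> cparts n \<inter> ?G. length \<pi> < length js}"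
    "(\<Sum>R\<in>?W. scalar (?a R) * (?u (?w R) - ?u (pi R))) - (\<Sum>\<pi> | e1 \<pi> \<noteq> 0. scalar (e1 \<pi>) * ?u \<pi>) \<in> env_ideal n"
    by (auto simp: spanmod_def)
  define e2 where "e2 = (\<lambda>\<pi>. if \<pi> \<in> cparts n \<and> length \<pi> = length js
     then P (ccont n \<pi>) * K \<pi> * of_nat (card (fillings n js \<pi>)) else 0)"
  have fib: "{R \<in> ?W. pi R = \<pi>} = fillings n js \<pi>" if "\<pi> \<in> cparts n" for \<pi>
  proof -
    have "pi R = \<pi> \<longleftrightarrow> mset (?w R) = mset \<pi>" if R: "R \<in> ?W" for R
      using pi(1,2)[OF R] cpartsD[of "pi R" n] cpartsD[OF \<open>\<pi> \<in> cparts n\<close>] sorted_parts_unique[of "pi R" \<pi>] by auto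
    then show ?thesis by (auto simp: fillings_def)
  qed
  have lpi: "length (pi R) = length js" if "R \<in> ?W" for R
    using pi(2)[OF that] lw[OF that] by (metis size_mset)
  have aR: "?a R = P (ccont n (pi R)) * K (pi R)" if "R \<in> ?W" for R
  proof -
    have "K (pi R) = K (?w R)" using K pi(2)[OF that] unfolding scale_fun_def by blast
    then show ?thesis unfolding ccont_mset[OF pi(2)[OF that]] ccont_cword[OF that] by simp
  qed
  have "(\<Sum>R\<in>?W. scalar (?a R) * ?u (pi R)) = (\<Sum>\<pi>\<in>pi ` ?W. \<Sum>R\<in>{R\<in>?W. pi R = \<pi>}. scalar (?a R) * ?u (pi R))"
    by (rule sum.image_gen[OF fW])
  also have "\<dots> = (\<Sum>\<pi>\<in>pi ` ?W. scalar (e2 \<pi>) * ?u \<pi>)"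
  proof (intro sum.cong refl)
    fix \<pi> assume \<pi>: "\<pi> \<in> pi ` ?W"
    then have c: "\<pi> \<in> cparts n" "length \<pi> = length js" using pi(1) lpi by auto
    have "(\<Sum>R\<in>{R\<in>?W. pi R = \<pi>}. scalar (?a R) * ?u (pi R)) = (\<Sum>R\<in>{R\<in>?W. pi R = \<pi>}. scalar (P (ccont n \<pi>) * K \<pi>) * ?u \<pi>)"
      using aR by (intro sum.cong refl) auto
    also have "\<dots> = (\<Sum>R\<in>{R\<in>?W. pi R = \<pi>}. scalar (P (ccont n \<pi>) * K \<pi>)) * ?u \<pi>"
      by (simp only: sum_distrib_right)
    also have "(\<Sum>R\<in>{R\<in>?W. pi R = \<pi>}. scalar (P (ccont n \<pi>) * K \<pi>)) = scalar (e2 \<pi>)"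
      unfolding scalar_sum[symmetric] using c fib[OF c(1)] by (simp add: e2_def mult.commute)
    finally show "(\<Sum>R\<in>{R\<in>?W. pi R = \<pi>}. scalar (?a R) * ?u (pi R)) = scalar (e2 \<pi>) * ?u \<pi>" .
  qed
  finally have sum2: "(\<Sum>R\<in>?W. scalar (?a R) * ?u (pi R)) = (\<Sum>\<pi>\<in>pi ` ?W. scalar (e2 \<pi>) * ?u \<pi>)" .
  have supp2: "{\<pi>. e2 \<pi> \<noteq> 0} \<subseteq> pi ` ?W"
  proof
    fix \<pi> assume "\<pi> \<in> {\<pi>. e2 \<pi> \<noteq> 0}"
    then have "\<pi> \<in> cparts n" "card (fillings n js \<pi>) \<noteq> 0" by (auto simp: e2_def split: if_splits)
    then have "\<pi> \<in> cparts n" "fillings n js \<pi> \<noteq> {}" by (metis card.empty)+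
    then show "\<pi> \<in> pi ` ?W" using fib[of \<pi>] by auto
  qed
  let ?e = "\<lambda>\<pi>. e1 \<pi> + e2 \<pi>"
  let ?T = "{\<pi>. e1 \<pi> \<noteq> 0} \<union> pi ` ?W"
  have T: "finite ?T" "{\<pi>. ?e \<pi> \<noteq> 0} \<subseteq> ?T" using e1(1) fW supp2 by auto
  have T1: "(\<Sum>\<pi> | e1 \<pi> \<noteq> 0. scalar (e1 \<pi>) * ?u \<pi>) = (\<Sum>\<pi>\<in>?T. scalar (e1 \<pi>) * ?u \<pi>)"
    using T(1) by (intro finite_support_sum) auto
  have T2: "(\<Sum>\<pi>\<in>pi ` ?W. scalar (e2 \<pi>) * ?u \<pi>) = (\<Sum>\<pi>\<in>?T. scalar (e2 \<pi>) * ?u \<pi>)"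
  proof (rule sum.mono_neutral_left[OF T(1)])
    have "e2 i = 0" if "i \<notin> pi ` ?W" for i using supp2 that by blast
    then show "\<forall>i\<in>?T - pi ` ?W. scalar (e2 i) * ?u i = 0" by simp
  qed auto
  have "symF n P js - (\<Sum>R\<in>?W. scalar (?a R) * ?u (?w R)) \<in> env_ideal n"
    using K unfolding scale_fun_def by blast
  from envI(2)[OF this e1(3)]
  have "symF n P js - (\<Sum>R\<in>?W. scalar (?a R) * ?u (?w R)) + ((\<Sum>R\<in>?W. scalar (?a R) * (?u (?w R) - ?u (pi R))) - (\<Sum>\<pi> | e1 \<pi> \<noteq> 0. scalar (e1 \<pi>) * ?u \<pi>)) \<in> env_ideal n" .
  also have "symF n P js - (\<Sum>R\<in>?W. scalar (?a R) * ?u (?w R)) + ((\<Sum>R\<in>?W. scalar (?a R) * (?u (?w R) - ?u (pi R))) - (\<Sum>\<pi> | e1 \<pi> \<noteq> 0. scalar (e1 \<pi>) * ?u \<pi>))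
    = symF n P js - (\<Sum>\<pi>\<in>?T. scalar (?e \<pi>) * ?u \<pi>)"
    unfolding T1 right_diff_distrib sum_subtractf sum2 T2 scalar_add distrib_right sum.distrib by simp
  finally have main: "symF n P js - (\<Sum>\<pi> | ?e \<pi> \<noteq> 0. scalar (?e \<pi>) * ?u \<pi>) \<in> env_ideal n"
    unfolding finite_support_sum[OF T] .
  have supp: "\<pi> \<in> cparts n \<and> length \<pi> \<le> length js \<and> cdegree \<pi> = sum_list js \<and> ppos (map snd \<pi>) = ppos js" if "?e \<pi> \<noteq> 0" for \<pi>
  proof -
    have "\<pi> \<in> ?T" using that T(2) by blast
    then show ?thesis using e1(2) pi(1) lpi by (fastforce simp: signed_words_def)
  qed
  have top: "?e \<pi> = P (ccont n \<pi>) * K \<pi> * of_nat (card (fillings n js \<pi>))" if "\<pi> \<in> cparts n" "length \<pi> = length js" for \<pi>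
  proof -
    have "e1 \<pi> = 0" using e1(2) that by auto
    then show ?thesis using that by (simp add: e2_def)
  qed
  show ?thesis using main supp top finite_subset[OF T(2,1)] by (intro exI[of _ ?e]) blast
qed

section \<open>The coefficients of a relation\<close>

lemma finite_degree_lists:
  "finite {js :: int list. length js = k \<and> sum_list js = d \<and> ppos js \<le> b}"
proof (rule finite_subset)
  show "{js. length js = k \<and> sum_list js = d \<and> ppos js \<le> b} \<subseteq> {js. set js \<subseteq> {d - b..b} \<and> length js = k}"
    using ppos_bounds by fastforce
qed (intro finite_lists_length_eq, simp)

lemma finite_bounded_cparts:
  "finite {\<pi> \<in> cparts n. length \<pi> \<le> k \<and> cdegree \<pi> = d \<and> ppos (map snd \<pi>) \<le> b}"
proof (rule finite_subset)
  show "{\<pi> \<in> cparts n. length \<pi> \<le> k \<and> cdegree \<pi> = d \<and> ppos (map snd \<pi>) \<le> b}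
    \<subseteq> {\<pi>. set \<pi> \<subseteq> colors n \<times> {d - b..b} \<and> length \<pi> \<le> k}"
  proof
    fix \<pi> assume "\<pi> \<in> {\<pi> \<in> cparts n. length \<pi> \<le> k \<and> cdegree \<pi> = d \<and> ppos (map snd \<pi>) \<le> b}"
    then have \<pi>: "\<pi> \<in> cparts n" "length \<pi> \<le> k" "cdegree \<pi> = d" "ppos (map snd \<pi>) \<le> b" by auto
    have "p \<in> colors n \<times> {d - b..b}" if "p \<in> set \<pi>" for p
      using ppos_bounds[of "snd p" "map snd \<pi>"] that \<pi> cpartsD[OF \<pi>(1)] by (cases p) (force simp: cdegree_def)
    then show "\<pi> \<in> {\<pi>. set \<pi> \<subseteq> colors n \<times> {d - b..b} \<and> length \<pi> \<le> k}" using \<pi> by auto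
  qed
qed (intro finite_lists_length_le, simp add: finite_colors)

lemma cparts_degrees_sorted:
  assumes "\<pi> \<in> cparts n" shows "sorted (map snd \<pi>)"
proof -
  have "sorted_wrt (\<lambda>p q. snd p \<le> snd q) \<pi>"
    by (rule sorted_wrt_mono_rel[of _ part_le]) (use cpartsD[OF assms] in \<open>auto simp: part_less_def\<close>)
  then show ?thesis by (simp add: sorted_wrt_map)
qed

lemma sorted_le_last: "sorted xs \<Longrightarrow> x \<in> set xs \<Longrightarrow> x \<le> last xs"
  by (induction xs) auto

lemma sorted_part_le_last: "sorted_wrt part_le \<pi> \<Longrightarrow> p \<in> set \<pi> \<Longrightarrow> part_le p (last \<pi>)"
  by (induction \<pi>) auto

text \<open>A large value of \<open>ppos\<close> forces one large mode. Sorting, allowed by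
  \<open>symm\<close>, puts the largest mode last, and the neighbourhood is a left ideal.\<close>

lemma symF_nbhd:
  assumes symm: "\<And>js. length js = k \<Longrightarrow> symF n P js - symF n P (sort js) \<in> env_ideal n"
    and js: "length js = k" "int k * int N < ppos js"
  shows "symF n P js \<in> nbhd n N"
proof -
  obtain j where j: "j \<in> set js" "int N < j" using ppos_large[of js N] js by auto
  then have ne: "sort js \<noteq> []" by (metis length_pos_if_in_set length_sort length_greater_0_conv)
  have "last (sort js) \<ge> j" using sorted_le_last[OF sorted_sort, of j js] j(1) by simp
  then have "int N \<le> last (sort js)" using j(2) by simp
  then have "symF n P (butlast (sort js) @ [last (sort js)]) \<in> nbhd n N" by (rule symF_high)
  then show ?thesis using nbhd_cong[OF symm[OF js(1)]] ne by simp
qed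

text \<open>A partition is already sorted by modes, so a large value of \<open>ppos\<close> shows in
  its last part.\<close>

lemma u_mon_nbhd:
  assumes X: "root_vectors n X" and \<pi>: "\<pi> \<in> cparts n" "length \<pi> \<le> k" "int k * int N < ppos (map snd \<pi>)"
  shows "u_mon n X \<pi> \<in> nbhd n N"
proof -
  have "int (length (map snd \<pi>)) * int N \<le> int k * int N" using \<pi>(2) by (intro mult_right_mono) auto
  then obtain j where j: "j \<in> set (map snd \<pi>)" "int N < j"
    using ppos_large[of "map snd \<pi>" N] \<pi>(3) by auto
  then have ne: "\<pi> \<noteq> []" by auto
  have split: "\<pi> = butlast \<pi> @ [last \<pi>]" using ne by simp
  have "\<forall>p\<in>set \<pi>. part_le p (last \<pi>)"
    using cpartsD[OF \<pi>(1)] sorted_part_le_last by blast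
  then have "j \<le> snd (last \<pi>)" using j(1) by (fastforce simp: part_less_def)
  moreover have "basis_vec n X (fst (last \<pi>)) \<in> sp n"
    using cpartsD[OF \<pi>(1)] ne basis_vec_sp[OF X] by (meson imageI last_in_set subsetD)
  ultimately have "u_mon n X (butlast \<pi>) * lp (basis_vec n X (fst (last \<pi>))) (snd (last \<pi>)) \<in> nbhd n N"
    using j(2) by (intro nbhd.mult nbhd.gen) auto
  then show ?thesis by (subst split) (simp add: u_mon_append u_mon_Cons)
qed

text \<open>Symmetry in the modes replaces every \<open>js\<close> by its sorted version, whose
  straightening preserves \<open>ppos\<close>. Hence a partition receives contributions only from
  the finitely many \<open>js\<close> that share its value of \<open>ppos\<close>. In length
  \<open>k\<close> these are nonnegative multiples of one number, not all zero multiples, so the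
  coefficient vanishes exactly when \<open>P\<close> does.\<close>

lemma relation_expansion:
  assumes X: "root_vectors n X"
    and symm: "\<And>js. length js = k \<Longrightarrow> symF n P js - symF n P (sort js) \<in> env_ideal n"
    and r: "has_compl_sum n (symF n P) {js. length js = k \<and> sum_list js = d} r"
  obtains c where "has_compl_sum n (\<lambda>\<pi>. scalar (c \<pi>) * u_mon n X \<pi>) (cparts n) r"
    "\<And>\<pi>. c \<pi> \<noteq> 0 \<Longrightarrow> length \<pi> \<le> k \<and> cdegree \<pi> = d"
    "\<And>\<pi>. \<pi> \<in> cparts n \<Longrightarrow> length \<pi> = k \<Longrightarrow> cdegree \<pi> = d \<Longrightarrow> c \<pi> = 0 \<longleftrightarrow> P (ccont n \<pi>) = 0"
proof -
  obtain K where K: "scale_fun n X K" using scale_fun_exists[OF X] by blast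
  have "\<forall>js\<in>{js. sorted js}. \<exists>e. finite {\<pi>. e \<pi> \<noteq> 0} \<and>
    (\<forall>\<pi>. e \<pi> \<noteq> 0 \<longrightarrow> \<pi> \<in> cparts n \<and> length \<pi> \<le> length js \<and> cdegree \<pi> = sum_list js \<and> ppos (map snd \<pi>) = ppos js) \<and>
    symF n P js - (\<Sum>\<pi> | e \<pi> \<noteq> 0. scalar (e \<pi>) * u_mon n X \<pi>) \<in> env_ideal n \<and>
    (\<forall>\<pi>\<in>cparts n. length \<pi> = length js \<longrightarrow> e \<pi> = P (ccont n \<pi>) * K \<pi> * of_nat (card (fillings n js \<pi>)))"
    using symF_expand[OF X K] by blast
  from bchoice[OF this] obtain e where e: "\<And>js. sorted js \<Longrightarrow> finite {\<pi>. e js \<pi> \<noteq> 0}"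
    "\<And>js \<pi>. sorted js \<Longrightarrow> e js \<pi> \<noteq> 0 \<Longrightarrow> \<pi> \<in> cparts n \<and> length \<pi> \<le> length js \<and> cdegree \<pi> = sum_list js \<and> ppos (map snd \<pi>) = ppos js"
    "\<And>js. sorted js \<Longrightarrow> symF n P js - (\<Sum>\<pi> | e js \<pi> \<noteq> 0. scalar (e js \<pi>) * u_mon n X \<pi>) \<in> env_ideal n"
    "\<And>js \<pi>. sorted js \<Longrightarrow> \<pi> \<in> cparts n \<Longrightarrow> length \<pi> = length js \<Longrightarrow> e js \<pi> = P (ccont n \<pi>) * K \<pi> * of_nat (card (fillings n js \<pi>))"
    by auto
  define E where "E = (\<lambda>js. e (sort js))"
  have E_supp: "\<pi> \<in> cparts n \<and> length \<pi> \<le> length js \<and> cdegree \<pi> = sum_list js \<and> ppos (map snd \<pi>) = ppos js"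
    if "E js \<pi> \<noteq> 0" for js \<pi>
    using e(2)[of "sort js" \<pi>] that ppos_mset[of "sort js" js] sum_list_mset[of "sort js" js] by (simp add: E_def)
  let ?D = "\<lambda>b. {js. length js = k \<and> sum_list js = d \<and> ppos js = b}"
  have fD: "finite (?D b)" for b by (rule finite_subset[OF _ finite_degree_lists[of k d b]]) auto
  define c where "c = (\<lambda>\<pi>. \<Sum>js\<in>?D (ppos (map snd \<pi>)). E js \<pi>)"
  have c_supp: "length \<pi> \<le> k \<and> cdegree \<pi> = d" if "c \<pi> \<noteq> 0" for \<pi>
  proof -
    obtain js where "js \<in> ?D (ppos (map snd \<pi>))" "E js \<pi> \<noteq> 0"
      using \<open>c \<pi> \<noteq> 0\<close> unfolding c_def by (meson sum.not_neutral_contains_not_neutral)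
    then show ?thesis using E_supp by fastforce
  qed
  have c_top: "c \<pi> = 0 \<longleftrightarrow> P (ccont n \<pi>) = 0" if \<pi>: "\<pi> \<in> cparts n" "length \<pi> = k" "cdegree \<pi> = d" for \<pi>
  proof -
    let ?S = "?D (ppos (map snd \<pi>))"
    have "c \<pi> = (\<Sum>js\<in>?S. P (ccont n \<pi>) * K \<pi> * of_nat (card (fillings n (sort js) \<pi>)))"
      unfolding c_def E_def using \<pi> by (intro sum.cong refl e(4)) auto
    then have c: "c \<pi> = P (ccont n \<pi>) * K \<pi> * of_nat (\<Sum>js\<in>?S. card (fillings n (sort js) \<pi>))"
      by (simp add: sum_distrib_left)
    have js: "map snd \<pi> \<in> ?S" using \<pi> by (simp add: cdegree_def)
    \<comment> \<open>The positions of \<open>\<pi>\<close> itself fill its own modes, so the total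
      number of fillings is positive.\<close>
    let ?R = "map (\<lambda>p. (pos n (fst (fst p)), pos n (snd (fst p)))) \<pi>"
    have "?R \<in> pairwords n (length (map snd \<pi>))"
      using cpartsD[OF \<pi>(1)] colors_pos by (fastforce simp: pairwords_def)
    moreover have "cword n ?R (map snd \<pi>) = \<pi>"
    proof -
      have "map (\<lambda>p. color_of n (fst p) (snd p)) ?R = map fst \<pi>"
        using cpartsD[OF \<pi>(1)] color_of_pos by (auto simp: image_subset_iff)
      then show ?thesis unfolding cword_def by (simp only: zip_map_fst_snd)
    qed
    ultimately have "?R \<in> fillings n (map snd \<pi>) \<pi>" by (simp add: fillings_def)
    moreover have "finite (fillings n (map snd \<pi>) \<pi>)"
      unfolding fillings_def using finite_pairwords by (intro finite_Collect_conjI) auto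
    ultimately have "card (fillings n (map snd \<pi>) \<pi>) > 0" by (auto simp: card_gt_0_iff)
    moreover have "sort (map snd \<pi>) = map snd \<pi>" using cparts_degrees_sorted[OF \<pi>(1)] by (simp add: sorted_sort_id)
    ultimately have "card (fillings n (sort (map snd \<pi>)) \<pi>) > 0" by simp
    then have "(\<Sum>js\<in>?S. card (fillings n (sort js) \<pi>)) > 0"
      using js fD[of "ppos (map snd \<pi>)"] by (meson sum_pos2 zero_le)
    moreover have "K \<pi> \<noteq> 0" using K cpartsD[OF \<pi>(1)] unfolding scale_fun_def by blast
    ultimately show ?thesis unfolding c by (auto simp del: of_nat_sum)
  qed
  have "has_compl_sum n (\<lambda>\<pi>. scalar (c \<pi>) * u_mon n X \<pi>) (cparts n) r"
  proof (rule has_compl_sumI)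
    fix N
    \<comment> \<open>Up to \<open>k\<close> modes with \<open>ppos\<close> beyond this bound
      include one above \<open>N\<close>, which places the term in the neighbourhood.\<close>
    let ?b = "int k * int N"
    let ?T = "{\<pi> \<in> cparts n. length \<pi> \<le> k \<and> cdegree \<pi> = d \<and> ppos (map snd \<pi>) \<le> ?b}"
    let ?JT = "{js. length js = k \<and> sum_list js = d \<and> ppos js \<le> ?b}"
    have fT: "finite ?T" by (rule finite_bounded_cparts)
    have fJ: "finite ?JT" by (rule finite_degree_lists)
    have out: "scalar (c \<pi>) * u_mon n X \<pi> \<in> nbhd n N" if \<pi>: "\<pi> \<in> cparts n - ?T" for \<pi>
    proof (cases "c \<pi> = 0")
      case False
      then have "length \<pi> \<le> k" "?b < ppos (map snd \<pi>)" using c_supp[OF False] \<pi> by auto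
      then show ?thesis using \<pi> by (intro nbhd.mult u_mon_nbhd[OF X]) auto
    qed simp
    have J: "(\<Sum>js\<in>?JT. symF n P js) - r N \<in> nbhd n N"
    proof (rule has_compl_sumD[OF r fJ])
      show "{js \<in> {js. length js = k \<and> sum_list js = d}. symF n P js \<notin> nbhd n N} \<subseteq> ?JT"
        using symF_nbhd[OF symm, where N = N] by fastforce
    qed auto
    have Ejs: "symF n P js - (\<Sum>\<pi>\<in>?T. scalar (E js \<pi>) * u_mon n X \<pi>) \<in> env_ideal n" if js: "js \<in> ?JT" for js
    proof -
      have sub: "{\<pi>. e (sort js) \<pi> \<noteq> 0} \<subseteq> ?T" using E_supp[of js] js by (auto simp: E_def)
      have "symF n P js - symF n P (sort js) \<in> env_ideal n" using symm js by blast
      moreover have "symF n P (sort js) - (\<Sum>\<pi>\<in>?T. scalar (E js \<pi>) * u_mon n X \<pi>) \<in> env_ideal n"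
        using e(3)[of "sort js"] unfolding finite_support_sum[OF fT sub] E_def by simp
      ultimately show ?thesis by (rule tsi_trans[OF tsi_env_ideal])
    qed
    have cT: "c \<pi> = (\<Sum>js\<in>?JT. E js \<pi>)" if "\<pi> \<in> ?T" for \<pi>
      unfolding c_def using fJ that E_supp by (intro sum.mono_neutral_left) auto
    have "(\<Sum>js\<in>?JT. symF n P js - (\<Sum>\<pi>\<in>?T. scalar (E js \<pi>) * u_mon n X \<pi>)) \<in> env_ideal n"
      using Ejs by (intro tsi_sum[OF tsi_env_ideal])
    moreover have "(\<Sum>js\<in>?JT. \<Sum>\<pi>\<in>?T. scalar (E js \<pi>) * u_mon n X \<pi>) = (\<Sum>\<pi>\<in>?T. scalar (c \<pi>) * u_mon n X \<pi>)"
    proof -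
      have "(\<Sum>js\<in>?JT. \<Sum>\<pi>\<in>?T. scalar (E js \<pi>) * u_mon n X \<pi>) = (\<Sum>\<pi>\<in>?T. \<Sum>js\<in>?JT. scalar (E js \<pi>) * u_mon n X \<pi>)"
        by (rule sum.swap)
      also have "\<dots> = (\<Sum>\<pi>\<in>?T. scalar (c \<pi>) * u_mon n X \<pi>)"
        by (intro sum.cong refl) (simp only: cT scalar_sum sum_distrib_right)
      finally show ?thesis .
    qed
    ultimately have "(\<Sum>js\<in>?JT. symF n P js) - (\<Sum>\<pi>\<in>?T. scalar (c \<pi>) * u_mon n X \<pi>) \<in> nbhd n N"
      by (simp add: sum_subtractf nbhd.ideal)
    from nbhd_diff[OF J this] have "(\<Sum>\<pi>\<in>?T. scalar (c \<pi>) * u_mon n X \<pi>) - r N \<in> nbhd n N" by simp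
    then show "\<exists>T. finite T \<and> T \<subseteq> cparts n \<and> (\<forall>\<pi>\<in>cparts n - T. scalar (c \<pi>) * u_mon n X \<pi> \<in> nbhd n N) \<and>
      (\<Sum>\<pi>\<in>T. scalar (c \<pi>) * u_mon n X \<pi>) - r N \<in> nbhd n N"
      using fT out by (intro exI[of _ ?T]) auto
  qed
  then show thesis using c_supp c_top by (rule that)
qed

section \<open>Leading terms\<close>

text \<open>\<open>D\<close> is the number of available positions: \<open>2*n\<close> for
  \<open>sp n\<close> and \<open>n\<close> for the degree zero subalgebra.\<close>

definition supp_in :: "nat \<Rightarrow> nat \<Rightarrow> (nat multiset \<Rightarrow> complex) \<Rightarrow> bool" where
  "supp_in k D P \<longleftrightarrow> (\<forall>M. P M \<noteq> 0 \<longrightarrow> size M = 2 * (k + 1) \<and> set_mset M \<subseteq> {..<D})"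

abbreviation degree_lists :: "nat \<Rightarrow> int \<Rightarrow> int list set" where
  "degree_lists k d \<equiv> {js. length js = k + 1 \<and> sum_list js = d}"

section \<open>Powers of the maximal root vector\<close>

lemma theta_vector:
  assumes "root_vectors n X" "1 \<le> n"
  obtains l where "l \<noteq> 0" "X (Plain 1, Plain 1) = l \<cdot>\<^sub>m bm n 0 0"
proof -
  have "(Plain 1, Plain 1) \<in> colors n" using assms(2) by (auto simp: colors_def idxs_def)
  from root_vector_bm[OF assms(1) this] show thesis using that by auto
qed

text \<open>The maximal root vector has square zero, so both its bracket and its invariant form with
  itself vanish. Its modes commute, even opposite ones.\<close>

lemma theta_commute:
  assumes X: "root_vectors n X" "1 \<le> n"
  shows "lp (X (Plain 1, Plain 1)) i * lp (X (Plain 1, Plain 1)) j - lp (X (Plain 1, Plain 1)) j * lp (X (Plain 1, Plain 1)) i \<in> env_ideal n"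
proof -
  obtain l where l: "X (Plain 1, Plain 1) = l \<cdot>\<^sub>m bm n 0 0" using theta_vector[OF X] by blast
  let ?x = "l \<cdot>\<^sub>m bm n 0 0"
  have x: "?x \<in> sp n" "?x \<in> carrier_mat (2*n) (2*n)" by (auto intro: sp_smult)
  have entry: "?x $$ (a, b) = 0" if "a < 2*n" "b < 2*n" "a \<noteq> 0 \<or> b \<noteq> 2*n - 1" for a b
    using that by (auto simp: bm_def)
  have sq: "(?x * ?x) $$ (a, b) = 0" if "a < 2*n" "b < 2*n" for a b
  proof -
    have "?x $$ (a, u) * ?x $$ (u, b) = 0" if "u < 2*n" for u
      using entry[of a u] entry[of u b] that \<open>a < 2*n\<close> \<open>b < 2*n\<close> assms(2) by (cases "u = 0") auto
    then show ?thesis unfolding mult_mat_entry[OF x(2) x(2) that] by (intro sum.neutral) blast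
  qed
  have c: "?x * ?x \<in> carrier_mat (2*n) (2*n)" by (rule mult_carrier_mat[OF x(2) x(2)])
  have "inv_form ?x ?x = 0"
    unfolding inv_form_def mtrace_def carrier_matD(1)[OF c] by (intro sum.neutral) (use sq in blast)
  moreover have "bracket ?x ?x = 0\<^sub>m (2*n) (2*n)" unfolding bracket_def by (rule minus_r_inv_mat[OF c])
  ultimately have "lp ?x i * lp ?x j - lp ?x j * lp ?x i - lp (0\<^sub>m (2*n) (2*n)) (i + j) \<in> env_ideal n"
    using env_ideal.commutator[OF x(1) x(1), of i j] by (simp split: if_splits)
  from envI(2)[OF this lp_zero[of n "i + j"]] show ?thesis unfolding l by simp
qed

lemma commuting_prod:
  assumes "\<And>i j. f i * f j - f j * f i \<in> env_ideal n" "mset js = mset is"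
  shows "prod_list (map f js) - prod_list (map f is) \<in> env_ideal n"
  using assms(2)
proof (induction js arbitrary: "is")
  case Nil
  then show ?case by (simp add: envI)
next
  case (Cons j js)
  have "j \<in> set is" using Cons.prems by (metis list.set_intros(1) set_mset_mset)
  then obtain a b where ab: "is = a @ j # b" by (meson split_list)
  have move: "prod_list (map f (a @ j # b)) - f j * prod_list (map f (a @ b)) \<in> env_ideal n"
  proof (induction a)
    case Nil
    then show ?case by (simp add: envI)
  next
    case (Cons i a)
    let ?A = "prod_list (map f (a @ j # b))" and ?B = "prod_list (map f (a @ b))"
    have "f i * (?A - f j * ?B) + (f i * f j - f j * f i) * ?B \<in> env_ideal n"
      using Cons.IH assms(1) by (intro envI(2) envI(4) envI(5))
    then show ?case by (simp add: algebra_simps)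
  qed
  have "mset js = mset (a @ b)" using Cons.prems ab by simp
  from envI(4)[OF Cons.IH[OF this], of "f j"]
  have "prod_list (map f (j # js)) - f j * prod_list (map f (a @ b)) \<in> env_ideal n" by (simp add: right_diff_distrib)
  from envI(7)[OF this move] show ?case by (simp add: ab)
qed

lemma add_mset2_eq_replicate:
  "add_mset r (add_mset s M) = replicate_mset (Suc (Suc m)) z \<longleftrightarrow> r = z \<and> s = z \<and> M = replicate_mset m z"
proof
  assume eq: "add_mset r (add_mset s M) = replicate_mset (Suc (Suc m)) z"
  have "r \<in># replicate_mset (Suc (Suc m)) z" "s \<in># replicate_mset (Suc (Suc m)) z" unfolding eq[symmetric] by auto
  then have "r = z" "s = z" by (simp_all only: in_replicate_mset)
  then show "r = z \<and> s = z \<and> M = replicate_mset m z" using eq by simp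
qed auto

text \<open>A tensor concentrated at the multiset of zeros leaves only the letter
  \<open>bm n 0 0\<close> in every place.\<close>

lemma symF_power:
  assumes "1 \<le> n"
  shows "symF n (\<lambda>M. a * of_bool (M = replicate_mset (2 * length js) 0)) js = scalar a * prod_list (map (lp (bm n 0 0)) js)"
proof (induction js)
  case (Cons j js)
  have "symF n (\<lambda>M. a * of_bool (add_mset r (add_mset s M) = replicate_mset (2 * length (j # js)) 0)) js =
     (if r = 0 \<and> s = 0 then scalar a * prod_list (map (lp (bm n 0 0)) js) else 0)" for r s
  proof (cases "r = 0 \<and> s = 0")
    case True
    have "(\<lambda>M. a * of_bool (add_mset r (add_mset s M) = replicate_mset (2 * length (j # js)) 0)) =
        (\<lambda>M. a * of_bool (M = replicate_mset (2 * length js) (0::nat)))"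
      using True by (intro ext) (simp only: length_Cons mult_Suc_right add_2_eq_Suc add_mset2_eq_replicate simp_thms)
    then show ?thesis using True Cons.IH by simp
  next
    case False
    have "(\<lambda>M. a * of_bool (add_mset r (add_mset s M) = replicate_mset (2 * length (j # js)) 0)) = (\<lambda>M. 0)"
      using False by (intro ext) (simp only: length_Cons mult_Suc_right add_2_eq_Suc add_mset2_eq_replicate, auto)
    then show ?thesis using False by (simp only: symF_zero if_False)
  qed
  then have "symF n (\<lambda>M. a * of_bool (M = replicate_mset (2 * length (j # js)) 0)) (j # js)
    = (\<Sum>r<2*n. \<Sum>s<2*n. if r = 0 then (if s = 0 then lp (bm n 0 0) j * (scalar a * prod_list (map (lp (bm n 0 0)) js)) else 0) else 0)"
    unfolding symF.simps by (intro sum.cong refl) auto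
  also have "\<dots> = lp (bm n 0 0) j * (scalar a * prod_list (map (lp (bm n 0 0)) js))"
  proof -
    have pull: "(\<Sum>s<2*n. if Q then f s else 0) = (if Q then \<Sum>s<2*n. f s else 0)" for Q and f :: "nat \<Rightarrow> free_alg"
      by simp
    show ?thesis using assms by (simp add: pull)
  qed
  finally show ?case by (simp add: scalar_left_commute)
qed simp

lemma theta_power:
  assumes X: "root_vectors n X" "1 \<le> n"
  obtains a where "a \<noteq> 0" "\<And>js. length js = k \<Longrightarrow> symF n (\<lambda>M. a * of_bool (M = replicate_mset (2 * k) 0)) js
     - prod_list (map (lp (X (Plain 1, Plain 1))) js) \<in> env_ideal n"
proof -
  obtain l where l: "l \<noteq> 0" "X (Plain 1, Plain 1) = l \<cdot>\<^sub>m bm n 0 0" using theta_vector[OF X] by blast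
  have "scalar (l ^ length js) * prod_list (map (lp (bm n 0 0)) js) - prod_list (map (lp (X (Plain 1, Plain 1))) js) \<in> env_ideal n" for js
  proof (induction js)
    case Nil
    then show ?case by (simp add: envI)
  next
    case (Cons j js)
    let ?b = "lp (bm n 0 0) j" and ?x = "lp (X (Plain 1, Plain 1)) j"
    let ?B = "prod_list (map (lp (bm n 0 0)) js)" and ?X = "prod_list (map (lp (X (Plain 1, Plain 1))) js)"
    have "- (?x - scalar l * ?b) \<in> env_ideal n" using lp_smult[OF bm_sp, of l n 0 0 j] l(2) by (intro envI(6)) simp
    then have "- (?x - scalar l * ?b) * (scalar (l ^ length js) * ?B) + ?x * (scalar (l ^ length js) * ?B - ?X) \<in> env_ideal n"
      using Cons.IH by (intro envI(2) envI(5) envI(4))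
    moreover have "(scalar l * ?b) * (scalar (l ^ length js) * ?B) = scalar (l ^ Suc (length js)) * (?b * ?B)"
      unfolding scalar_mult_scalar_mult by (simp flip: scalar_mult)
    ultimately show ?case by (simp add: algebra_simps)
  qed
  \<comment> \<open>The constant is the \<open>k\<close>-th power of the ratio between the chosen
    root vector and \<open>bm n 0 0\<close>.\<close>
  then show thesis using symF_power[OF X(2)] l(1) by (intro that[of "l ^ k"]) auto
qed

section \<open>Series represented by symmetric tensors\<close>

lemma symF_env_ad:
  assumes "x \<in> sp n" "symF n P js - symF n P is \<in> env_ideal n"
  shows "symF n (sact n x P) js - symF n (sact n x P) is \<in> env_ideal n"
proof -
  let ?ad = "\<lambda>p. lp x 0 * p - p * lp x 0"
  have "?ad (symF n P js - symF n P is) \<in> env_ideal n" by (rule ad_env[OF assms(2)])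
  from envI(2)[OF envI(7)[OF this ad_symF[OF assms(1), of P js]] ad_symF[OF assms(1), of P "is"]]
  show ?thesis by (simp add: algebra_simps)
qed

text \<open>The block condition says that \<open>x\<close> preserves the span of the first
  \<open>D\<close> basis vectors, so an index below \<open>D\<close> is replaced only by indices
  below \<open>D\<close>.\<close>

lemma supp_in_sact:
  assumes P: "supp_in k D P" and D: "D \<le> 2*n"
    and block: "\<And>u v. v < D \<Longrightarrow> D \<le> u \<Longrightarrow> u < 2*n \<Longrightarrow> x $$ (u, v) = 0"
  shows "supp_in k D (sact n x P)"
proof -
  have "size M = 2 * (k + 1) \<and> set_mset M \<subseteq> {..<D}" if "sact n x P M \<noteq> 0" for M
  proof -
    have "\<exists>u\<in>#M. (if u < 2*n then \<Sum>v<2*n. x $$ (u, v) * P (add_mset v (M - {#u#})) else 0) \<noteq> 0"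
    proof (rule ccontr)
      assume "\<not> ?thesis"
      then have "sact n x P M = (\<Sum>u\<in>#M. 0)" unfolding sact_def by (intro arg_cong[of _ _ sum_mset] image_mset_cong) auto
      then show False using that by simp
    qed
    then obtain u where u: "u \<in># M" "u < 2*n" "(\<Sum>v<2*n. x $$ (u, v) * P (add_mset v (M - {#u#}))) \<noteq> 0"
      by (auto split: if_splits)
    then obtain v where v: "v < 2*n" "x $$ (u, v) \<noteq> 0" "P (add_mset v (M - {#u#})) \<noteq> 0"
      by (metis (no_types, lifting) lessThan_iff mult_eq_0_iff sum.not_neutral_contains_not_neutral)
    then have s: "size (add_mset v (M - {#u#})) = 2 * (k + 1)" "set_mset (add_mset v (M - {#u#})) \<subseteq> {..<D}"
      using P v(3) unfolding supp_in_def by blast+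
    have M: "M = add_mset u (M - {#u#})" using u(1) by simp
    have "v < D" using s(2) by auto
    then have "u < D" using block[of v u] v(2) u(2) by (meson not_le)
    then show ?thesis using s by (subst (1 2) M) auto
  qed
  then show ?thesis by (simp add: supp_in_def)
qed

text \<open>Letters do not commute, so symmetry in the modes modulo the ideal is an additional
  property of the tensor. It holds for the power of the maximal root vector, is inherited under the
  adjoint action, and is what permits sorting.\<close>

definition represents :: "nat \<Rightarrow> nat \<Rightarrow> (nat multiset \<Rightarrow> complex) \<Rightarrow> (int \<Rightarrow> compl) \<Rightarrow> bool" where
  "represents n k P s \<longleftrightarrow> (\<forall>d. has_compl_sum n (symF n P) (degree_lists k d) (s d)) \<and>
    (\<forall>js is. length js = k + 1 \<longrightarrow> mset js = mset is \<longrightarrow> symF n P js - symF n P is \<in> env_ideal n)"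

lemma representsD:
  assumes "represents n k P s"
  shows "has_compl_sum n (symF n P) (degree_lists k d) (s d)"
    "length js = k + 1 \<Longrightarrow> mset js = mset is \<Longrightarrow> symF n P js - symF n P is \<in> env_ideal n"
  using assms by (auto simp: represents_def)

lemma represents_add:
  assumes P: "represents n k P s" and Q: "represents n k Q s'"
  shows "represents n k (\<lambda>M. P M + Q M) (\<lambda>d N. s d N + s' d N)"
proof -
  have "symF n (\<lambda>M. P M + Q M) js - symF n (\<lambda>M. P M + Q M) is \<in> env_ideal n"
    if "length js = k + 1" "mset js = mset is" for js "is"
    using envI(2)[OF representsD(2)[OF P that] representsD(2)[OF Q that]] by (simp add: symF_add algebra_simps)
  moreover have "has_compl_sum n (symF n (\<lambda>M. P M + Q M)) (degree_lists k d) (\<lambda>N. s d N + s' d N)" for d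
    by (rule has_compl_sum_cong[OF has_compl_sum_add[OF representsD(1)[OF P] representsD(1)[OF Q]]])
      (simp add: symF_add envI(1))
  ultimately show ?thesis unfolding represents_def by blast
qed

lemma represents_scale:
  assumes P: "represents n k P s"
  shows "represents n k (\<lambda>M. c * P M) (\<lambda>d N. scalar c * s d N)"
proof -
  have "symF n (\<lambda>M. c * P M) js - symF n (\<lambda>M. c * P M) is \<in> env_ideal n"
    if "length js = k + 1" "mset js = mset is" for js "is"
    using envI(4)[OF representsD(2)[OF P that], of "scalar c"] by (simp add: symF_scale right_diff_distrib)
  moreover have "has_compl_sum n (symF n (\<lambda>M. c * P M)) (degree_lists k d) (\<lambda>N. scalar c * s d N)" for d
    by (rule has_compl_sum_cong[OF has_compl_sum_scalar[OF representsD(1)[OF P]]]) (simp add: symF_scale envI(1))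
  ultimately show ?thesis unfolding represents_def by blast
qed

lemma represents_act:
  assumes P: "represents n k P s" and x: "x \<in> sp n"
  shows "represents n k (sact n x P) (\<lambda>d N. lp x 0 * s d N - s d N * lp x 0)"
proof -
  have "has_compl_sum n (symF n (sact n x P)) (degree_lists k d) (\<lambda>N. lp x 0 * s d N - s d N * lp x 0)" for d
  proof (rule has_compl_sum_cong[OF has_compl_sum_ad[OF representsD(1)[OF P] x]])
    fix js
    show "symF n (sact n x P) js - (lp x 0 * symF n P js - symF n P js * lp x 0) \<in> env_ideal n"
      using envI(6)[OF ad_symF[OF x, of P js]] by simp
  qed
  then show ?thesis using symF_env_ad[OF x representsD(2)[OF P]] by (simp add: represents_def)
qed

lemma represents_power:
  assumes X: "root_vectors n X" "1 \<le> n"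
    and s: "\<And>d. has_compl_sum n (\<lambda>js. prod_list (map (lp (X (Plain 1, Plain 1))) js)) (degree_lists k d) (s d)"
  obtains a where "a \<noteq> 0" "represents n k (\<lambda>M. a * of_bool (M = replicate_mset (2 * (k + 1)) 0)) s"
proof -
  let ?f = "\<lambda>js. prod_list (map (lp (X (Plain 1, Plain 1))) js)"
  obtain a where a: "a \<noteq> 0" "\<And>js. length js = k + 1 \<Longrightarrow> symF n (\<lambda>M. a * of_bool (M = replicate_mset (2 * (k + 1)) 0)) js - ?f js \<in> env_ideal n"
    using theta_power[OF X, of "k + 1"] by blast
  let ?P = "\<lambda>M. a * of_bool (M = replicate_mset (2 * (k + 1)) (0::nat))"
  have "has_compl_sum n (symF n ?P) (degree_lists k d) (s d)" for d
    by (rule has_compl_sum_cong[OF s]) (use a in auto)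
  moreover have "symF n ?P js - symF n ?P is \<in> env_ideal n" if js: "length js = k + 1" "mset js = mset is" for js "is"
  proof -
    have "length is = k + 1" using js by (metis size_mset)
    have comm: "?f js - ?f is \<in> env_ideal n"
      by (rule commuting_prod[of "lp (X (Plain 1, Plain 1))", OF theta_commute[OF X] js(2)])
    from envI(7)[OF envI(2)[OF a(2)[OF js(1)] comm] a(2)[OF \<open>length is = k + 1\<close>]]
    show ?thesis by simp
  qed
  ultimately have "represents n k ?P s" by (simp only: represents_def) blast
  then show thesis using that a(1) by blast
qed

text \<open>The power starts at the multiset of zeros, and the block condition keeps the support
  within the first \<open>D\<close> positions.\<close>

lemma rel_series_represents:
  assumes X: "root_vectors n X" "1 \<le> n" and a: "\<aa> \<subseteq> sp n" and D: "1 \<le> D" "D \<le> 2*n"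
    and block: "\<And>x u v. x \<in> \<aa> \<Longrightarrow> v < D \<Longrightarrow> D \<le> u \<Longrightarrow> u < 2*n \<Longrightarrow> x $$ (u, v) = 0"
    and s: "s \<in> rel_series n X k \<aa>"
  shows "\<exists>P. supp_in k D P \<and> represents n k P s"
  using s
proof induction
  case (power s)
  obtain a where "represents n k (\<lambda>M. a * of_bool (M = replicate_mset (2 * (k + 1)) 0)) s"
    using represents_power[OF X power] by blast
  moreover have "supp_in k D (\<lambda>M. a * of_bool (M = replicate_mset (2 * (k + 1)) 0))"
    using D(1) by (auto simp: supp_in_def)
  ultimately show ?case by blast
next
  case (add s s')
  then obtain P Q where P: "supp_in k D P" "represents n k P s" and Q: "supp_in k D Q" "represents n k Q s'" by blast
  have "supp_in k D (\<lambda>M. P M + Q M)" using P(1) Q(1) unfolding supp_in_def by (metis add.right_neutral)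
  then show ?case using represents_add[OF P(2) Q(2)] by blast
next
  case (scale s c)
  then obtain P where P: "supp_in k D P" "represents n k P s" by blast
  have "supp_in k D (\<lambda>M. c * P M)" using P(1) by (auto simp: supp_in_def)
  then show ?case using represents_scale[OF P(2)] by blast
next
  case (act s x)
  then obtain P where P: "supp_in k D P" "represents n k P s" by blast
  have "x \<in> sp n" using act a by blast
  then show ?case using represents_act[OF P(2)] supp_in_sact[OF P(1) D(2) block[OF act(2)]] by blast
qed

definition realized :: "nat \<Rightarrow> (color \<Rightarrow> complex mat) \<Rightarrow> nat \<Rightarrow> complex mat set \<Rightarrow> (nat multiset \<Rightarrow> complex) \<Rightarrow> bool" where
  "realized n X k \<aa> P \<longleftrightarrow> (\<exists>s\<in>rel_series n X k \<aa>. represents n k P s)"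

lemma realized_add: "realized n X k \<aa> P \<Longrightarrow> realized n X k \<aa> Q \<Longrightarrow> realized n X k \<aa> (\<lambda>M. P M + Q M)"
  unfolding realized_def using represents_add rel_series.add by blast

lemma realized_scale: "realized n X k \<aa> P \<Longrightarrow> realized n X k \<aa> (\<lambda>M. c * P M)"
  unfolding realized_def using represents_scale rel_series.scale by blast

lemma realized_act: "realized n X k \<aa> P \<Longrightarrow> x \<in> \<aa> \<Longrightarrow> x \<in> sp n \<Longrightarrow> realized n X k \<aa> (sact n x P)"
  unfolding realized_def using represents_act rel_series.act by blast

text \<open>The power has to be shown to exist in the completion. Its factors commute, so a product
  with a large mode can be reordered to end in that mode and then lies in the neighbourhood.\<close>

lemma realized_power:
  assumes X: "root_vectors n X" "1 \<le> n"
  shows "realized n X k \<aa> (\<lambda>M. of_bool (M = replicate_mset (2 * (k + 1)) 0))"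
proof -
  let ?x = "X (Plain 1, Plain 1)"
  let ?f = "\<lambda>js. prod_list (map (lp ?x) js)"
  let ?\<delta> = "\<lambda>M :: nat multiset. of_bool (M = replicate_mset (2 * (k + 1)) 0) :: complex"
  \<comment> \<open>The approximation at level \<open>N\<close> is the sum of exactly those terms
    that lie outside the neighbourhood, so only the finiteness of their number remains to be
    shown.\<close>
  define s where "s = (\<lambda>d N. \<Sum>js \<in> {js \<in> degree_lists k d. ?f js \<notin> nbhd n N}. ?f js)"
  have x: "?x \<in> sp n" using theta_vector[OF X] sp_smult[OF bm_sp] by metis
  have high: "?f js \<in> nbhd n N" if js: "length js = k + 1" "int (k + 1) * int N < ppos js" for js N
  proof -
    have comm: "?f js - ?f (sort js) \<in> env_ideal n" by (rule commuting_prod[OF theta_commute[OF X]]) simp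
    obtain j where j: "j \<in> set js" "int N < j" using ppos_large[of js N] js by auto
    then have ne: "sort js \<noteq> []" by (metis length_pos_if_in_set length_sort length_greater_0_conv)
    have "last (sort js) \<ge> j" using sorted_le_last[OF sorted_sort, of j js] j(1) by simp
    then have "?f (butlast (sort js)) * lp ?x (last (sort js)) \<in> nbhd n N"
      using j x by (intro nbhd.mult nbhd.gen) auto
    moreover have "?f (butlast (sort js)) * lp ?x (last (sort js)) = ?f (butlast (sort js) @ [last (sort js)])" by simp
    ultimately have "?f (sort js) \<in> nbhd n N" using ne by simp
    then show ?thesis using nbhd_cong[OF comm] by blast
  qed
  have sum: "has_compl_sum n ?f (degree_lists k d) (s d)" for d
    unfolding has_compl_sum_def
  proof
    fix N
    have "{js \<in> degree_lists k d. ?f js \<notin> nbhd n N} \<subseteq> {js. length js = k + 1 \<and> sum_list js = d \<and> ppos js \<le> int (k + 1) * int N}"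
      using high[of _ N] by fastforce
    then have "finite {js \<in> degree_lists k d. ?f js \<notin> nbhd n N}" using finite_degree_lists finite_subset by blast
    then show "finite {js \<in> degree_lists k d. ?f js \<notin> nbhd n N} \<and> sum ?f {js \<in> degree_lists k d. ?f js \<notin> nbhd n N} - s d N \<in> nbhd n N"
      by (simp add: s_def)
  qed
  then have "s \<in> rel_series n X k \<aa>" by (intro rel_series.power)
  moreover obtain a where a: "a \<noteq> 0" "represents n k (\<lambda>M. a * ?\<delta> M) s"
    using represents_power[OF X sum] by blast
  ultimately have "realized n X k \<aa> (\<lambda>M. a * ?\<delta> M)" unfolding realized_def by blast
  from realized_scale[OF this, of "1 / a"] show ?thesis using a(1) by simp
qed

section \<open>The order on colored partitions\<close>

lemma lex_total:
  assumes "\<And>x y. lt x y \<or> x = y \<or> lt y x" "length xs = length ys"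
  shows "(xs, ys) \<in> lex {(x, y). lt x y} \<or> xs = ys \<or> (ys, xs) \<in> lex {(x, y). lt x y}"
  using assms(2)
proof (induction xs arbitrary: ys)
  case (Cons x xs)
  then obtain y zs where "ys = y # zs" by (cases ys) auto
  then show ?case using Cons assms(1)[of x y] by auto
qed simp

lemma lex_asym:
  assumes "\<And>x y. lt x y \<Longrightarrow> \<not> lt y x" "(xs, ys) \<in> lex {(x, y). lt x y}"
  shows "(ys, xs) \<notin> lex {(x, y). lt x y}"
  using assms(2)
proof (induction xs arbitrary: ys)
  case (Cons x xs)
  then obtain y zs where "ys = y # zs" by (cases ys) auto
  then show ?case using Cons assms(1)[of x y] assms(1)[of x x] by auto
qed simp

lemma revlex_total:
  assumes "\<And>x y. lt x y \<or> x = y \<or> lt y x" "length xs = length ys"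
  shows "revlex lt xs ys \<or> xs = ys \<or> revlex lt ys xs"
  using lex_total[of lt "rev xs" "rev ys"] assms by (auto simp: revlex_def)

lemma revlex_asym: "(\<And>x y. lt x y \<Longrightarrow> \<not> lt y x) \<Longrightarrow> revlex lt xs ys \<Longrightarrow> \<not> revlex lt ys xs"
  unfolding revlex_def by (rule lex_asym)

lemma cpart_less_total:
  assumes "length \<pi> = length \<sigma>" "cdegree \<pi> = cdegree \<sigma>" "\<pi> \<noteq> \<sigma>"
  shows "cpart_less \<pi> \<sigma> \<or> cpart_less \<sigma> \<pi>"
proof -
  have "revlex (<) (map snd \<pi>) (map snd \<sigma>) \<or> map snd \<pi> = map snd \<sigma> \<or> revlex (<) (map snd \<sigma>) (map snd \<pi>)"
    using assms(1) by (intro revlex_total) auto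
  moreover have "revlex color_less (map fst \<pi>) (map fst \<sigma>) \<or> map fst \<pi> = map fst \<sigma> \<or> revlex color_less (map fst \<sigma>) (map fst \<pi>)"
    using assms(1) color_less_strict(3) by (intro revlex_total) auto
  moreover have "\<pi> = \<sigma>" if "map fst \<pi> = map fst \<sigma>" "map snd \<pi> = map snd \<sigma>"
    using that by (metis zip_map_fst_snd)
  ultimately show ?thesis using assms by (auto simp: cpart_less_def)
qed

lemma cpart_less_asym: "cpart_less \<pi> \<sigma> \<Longrightarrow> \<not> cpart_less \<sigma> \<pi>"
proof -
  have 1: "revlex (<) xs ys \<Longrightarrow> \<not> revlex (<) ys xs" for xs ys :: "int list" by (rule revlex_asym) auto
  have 2: "revlex color_less xs ys \<Longrightarrow> \<not> revlex color_less ys xs" for xs ys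
    by (rule revlex_asym) (use color_less_strict(1,2) in blast)
  have 3: "\<not> revlex (<) xs xs" for xs :: "int list" using 1[of xs xs] by blast
  show "cpart_less \<pi> \<sigma> \<Longrightarrow> \<not> cpart_less \<sigma> \<pi>" unfolding cpart_less_def by (auto simp: 3 dest: 1 2)
qed

section \<open>Characterization of the leading terms\<close>

lemma size_ge_2_split:
  assumes "size M = Suc (Suc m)" shows "\<exists>r s N. M = add_mset r (add_mset s N) \<and> size N = m"
proof -
  obtain r N1 where M: "M = add_mset r N1" using size_eq_Suc_imp_eq_union[OF assms] by blast
  then have "size N1 = Suc m" using assms by simp
  from size_eq_Suc_imp_eq_union[OF this] obtain s N where N: "N1 = add_mset s N" by blast
  then have "M = add_mset r (add_mset s N) \<and> size N = m" using M \<open>size N1 = Suc m\<close> by simp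
  then show ?thesis by blast
qed

lemma ex_sorted: "\<exists>\<pi>. sorted_wrt part_le \<pi> \<and> mset \<pi> = mset w"
proof (induction w rule: length_inversions_induct)
  case (less w)
  show ?case
  proof (cases "sorted_wrt part_le w")
    case False
    then obtain a p q b where w: "w = a @ p # q # b" and qp: "part_less q p" using sorted_or_descent by blast
    from less[of "a @ q # p # b"] inversions_swap[OF qp, of a b] w show ?thesis by (auto simp: add_mset_commute)
  qed auto
qed

text \<open>The elements of \<open>M\<close> are paired arbitrarily into colors; one part carries
  the whole degree and the others have mode zero.\<close>

lemma ex_cpart:
  assumes M: "size M = 2 * (k + 1)" "set_mset M \<subseteq> {..<2*n}"
  shows "\<exists>\<pi>\<in>cparts n. length \<pi> = k + 1 \<and> cdegree \<pi> = d \<and> ccont n \<pi> = M"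
proof -
  have "\<exists>w. fst ` set w \<subseteq> colors n \<and> length w = k + 1 \<and> cdegree w = d \<and> ccont n w = M"
    using M
  proof (induction k arbitrary: M)
    case 0
    then obtain r s where "M = {#r, s#}" using size_ge_2_split[of M 0] by auto
    moreover have "{#min r s, max r s#} = {#r, s#}" by (auto simp: min_def max_def)
    ultimately show ?case using 0 color_of[of r n s]
      by (intro exI[of _ "[(color_of n r s, d)]"]) (auto simp: ccont_def cdegree_def)
  next
    case (Suc k)
    obtain r s M2 where M2: "M = add_mset r (add_mset s M2)"
      using Suc.prems(1) size_ge_2_split[of M "2 * (k + 1)"] by auto
    have "size M2 = 2 * (k + 1)" "set_mset M2 \<subseteq> {..<2*n}" using Suc.prems M2 by auto
    from Suc.IH[OF this] obtain w where w: "fst ` set w \<subseteq> colors n" "length w = k + 1" "cdegree w = d" "ccont n w = M2" by blast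
    have "{#min r s, max r s#} = {#r, s#}" by (auto simp: min_def max_def)
    then show ?case using w color_of[of r n s] Suc.prems(2) M2
      by (intro exI[of _ "(color_of n r s, 0) # w"]) (auto simp: ccont_def cdegree_def)
  qed
  then obtain w where w: "fst ` set w \<subseteq> colors n" "length w = k + 1" "cdegree w = d" "ccont n w = M" by blast
  obtain \<pi> where \<pi>: "sorted_wrt part_le \<pi>" "mset \<pi> = mset w" using ex_sorted by blast
  have "set \<pi> = set w" "length \<pi> = length w" "ccont n \<pi> = ccont n w" using \<pi>(2) by (auto dest: mset_eq_setD mset_eq_length ccont_mset)
  moreover have "cdegree \<pi> = cdegree w" unfolding cdegree_def using \<pi>(2) by (intro sum_list_mset) simp
  ultimately show ?thesis using w \<pi>(1) by (intro bexI[of _ \<pi>]) (auto simp: cparts_def cparts_on_def)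
qed

definition minimal_parts :: "nat \<Rightarrow> nat \<Rightarrow> nat \<Rightarrow> cpart set" where
  "minimal_parts n D k = {\<rho> \<in> cparts n. set_mset (ccont n \<rho>) \<subseteq> {..<D} \<and> length \<rho> = k + 1 \<and>
     (\<forall>\<sigma>\<in>cparts n. length \<sigma> = k + 1 \<and> cdegree \<sigma> = cdegree \<rho> \<and> ccont n \<sigma> = ccont n \<rho> \<longrightarrow> \<not> cpart_less \<sigma> \<rho>)}"

lemma size_ccont: "size (ccont n \<pi>) = 2 * length \<pi>"
  by (induction \<pi>) (auto simp: ccont_def)

text \<open>A nonzero tensor is nonzero at some multiset of positions, and every degree contains a
  partition with these positions; as longer partitions are smaller, the leading term has full
  length. All partitions with its positions and degree occur along with it, so it is minimal among
  them. Conversely, a minimal partition leads the relation whose tensor is concentrated on its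
  positions.\<close>

lemma leading_terms_minimal:
  assumes X: "root_vectors n X" "1 \<le> n" and a: "\<aa> \<subseteq> sp n" and D: "1 \<le> D" "D \<le> 2*n"
    and block: "\<And>x u v. x \<in> \<aa> \<Longrightarrow> v < D \<Longrightarrow> D \<le> u \<Longrightarrow> u < 2*n \<Longrightarrow> x $$ (u, v) = 0"
    and gen: "\<And>M. size M = 2 * (k + 1) \<Longrightarrow> set_mset M \<subseteq> {..<D} \<Longrightarrow> realized n X k \<aa> (\<lambda>M'. of_bool (M' = M))"
  shows "leading_terms n X {s d |s d. s \<in> rel_series n X k \<aa>} = minimal_parts n D k"
proof
  show "leading_terms n X {s d |s d. s \<in> rel_series n X k \<aa>} \<subseteq> minimal_parts n D k"
  proof
    fix \<rho> assume "\<rho> \<in> leading_terms n X {s d |s d. s \<in> rel_series n X k \<aa>}"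
    then obtain s d where s: "s \<in> rel_series n X k \<aa>" and nz: "\<not> compl_zero n (s d)" and lead: "is_lead n X (s d) \<rho>"
      by (auto simp: leading_terms_def)
    obtain P where P: "supp_in k D P" "represents n k P s"
      using rel_series_represents[OF X a D block s] by blast
    obtain c where c: "has_compl_sum n (\<lambda>\<pi>. scalar (c \<pi>) * u_mon n X \<pi>) (cparts n) (s d)"
      "\<And>\<pi>. c \<pi> \<noteq> 0 \<Longrightarrow> length \<pi> \<le> k + 1 \<and> cdegree \<pi> = d"
      "\<And>\<pi>. \<pi> \<in> cparts n \<Longrightarrow> length \<pi> = k + 1 \<Longrightarrow> cdegree \<pi> = d \<Longrightarrow> c \<pi> = 0 \<longleftrightarrow> P (ccont n \<pi>) = 0"
      using relation_expansion[OF X(1) representsD(2)[OF P(2) _ mset_sort[symmetric]] representsD(1)[OF P(2)]] by blast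
    have \<rho>: "\<rho> \<in> cparts n" using lead by (simp add: is_lead_def)
    obtain c' where c': "c' \<rho> \<noteq> 0" "has_compl_sum n (\<lambda>\<pi>. scalar (c' \<pi>) * u_mon n X \<pi>)
        {\<pi> \<in> cparts n. \<pi> = \<rho> \<or> cpart_less \<rho> \<pi>} (s d)" using lead by (auto simp: is_lead_def)
    let ?A = "{\<pi> \<in> cparts n. \<pi> = \<rho> \<or> cpart_less \<rho> \<pi>}"
    \<comment> \<open>Extended by zero, the expansion above \<open>\<rho>\<close> becomes one over
      all partitions and can be compared with \<open>c\<close>.\<close>
    define c2 where "c2 = (\<lambda>\<pi>. if \<pi> \<in> ?A then c' \<pi> else 0)"
    have "has_compl_sum n (\<lambda>\<pi>. scalar (c2 \<pi>) * u_mon n X \<pi>) ?A (s d)"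
      by (rule has_compl_sum_cong[OF c'(2)]) (auto simp: c2_def envI)
    moreover have "has_compl_sum n (\<lambda>\<pi>. scalar (c2 \<pi>) * u_mon n X \<pi>) ?A (s d) \<longleftrightarrow>
       has_compl_sum n (\<lambda>\<pi>. scalar (c2 \<pi>) * u_mon n X \<pi>) (cparts n) (s d)"
      by (rule has_compl_sum_superset) (auto simp: c2_def)
    ultimately have c2: "has_compl_sum n (\<lambda>\<pi>. scalar (c2 \<pi>) * u_mon n X \<pi>) (cparts n) (s d)" by blast
    have eq: "c \<pi> = c2 \<pi>" if "\<pi> \<in> cparts n" for \<pi> by (rule expansion_unique[OF X(1) c(1) c2 that])
    have c\<rho>: "c \<rho> \<noteq> 0" using eq[OF \<rho>] c'(1) \<rho> by (simp add: c2_def)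
    have above: "\<pi> = \<rho> \<or> cpart_less \<rho> \<pi>" if "\<pi> \<in> cparts n" "c \<pi> \<noteq> 0" for \<pi>
      using eq[OF that(1)] that by (auto simp: c2_def split: if_splits)
    have "\<exists>M. P M \<noteq> 0"
    proof (rule ccontr)
      assume "\<not> ?thesis"
      then have "P = (\<lambda>_. 0)" by auto
      then have "has_compl_sum n (\<lambda>_. 0) (degree_lists k d) (s d)"
        by (intro has_compl_sum_cong[OF representsD(1)[OF P(2)]]) (simp add: symF_zero envI(1))
      then show False using nz has_compl_sum_zero by blast
    qed
    then obtain M where M: "P M \<noteq> 0" by blast
    then have "size M = 2 * (k + 1)" "set_mset M \<subseteq> {..<2*n}" using P(1) D(2) by (auto simp: supp_in_def) force
    from ex_cpart[OF this] obtain \<pi> where \<pi>: "\<pi> \<in> cparts n" "length \<pi> = k + 1" "cdegree \<pi> = d" "ccont n \<pi> = M" by blast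
    then have "c \<pi> \<noteq> 0" using c(3)[OF \<pi>(1-3)] M by simp
    \<comment> \<open>Shorter partitions are higher in the order, so \<open>\<rho>\<close> is at
      least as long as \<open>\<pi>\<close>.\<close>
    then have "k + 1 \<le> length \<rho>" using above[OF \<pi>(1)] \<pi>(2) by (auto simp: cpart_less_def)
    then have len: "length \<rho> = k + 1" and deg: "cdegree \<rho> = d" using c(2)[OF c\<rho>] by auto
    have P\<rho>: "P (ccont n \<rho>) \<noteq> 0" using c(3)[OF \<rho> len deg] c\<rho> by simp
    have "\<not> cpart_less \<sigma> \<rho>"
      if \<sigma>: "\<sigma> \<in> cparts n" "length \<sigma> = k + 1" "cdegree \<sigma> = cdegree \<rho>" "ccont n \<sigma> = ccont n \<rho>" for \<sigma>
    proof -
      have "c \<sigma> \<noteq> 0" using c(3)[OF \<sigma>(1,2)] \<sigma> P\<rho> deg by simp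
      then show ?thesis using above[OF \<sigma>(1)] cpart_less_asym by blast
    qed
    then show "\<rho> \<in> minimal_parts n D k"
      using \<rho> len P\<rho> P(1) by (auto simp: minimal_parts_def supp_in_def)
  qed
next
  show "minimal_parts n D k \<subseteq> leading_terms n X {s d |s d. s \<in> rel_series n X k \<aa>}"
  proof
    fix \<rho> assume "\<rho> \<in> minimal_parts n D k"
    then have \<rho>: "\<rho> \<in> cparts n" "set_mset (ccont n \<rho>) \<subseteq> {..<D}" "length \<rho> = k + 1"
      and min: "\<And>\<sigma>. \<sigma> \<in> cparts n \<Longrightarrow> length \<sigma> = k + 1 \<Longrightarrow> cdegree \<sigma> = cdegree \<rho> \<Longrightarrow> ccont n \<sigma> = ccont n \<rho> \<Longrightarrow> \<not> cpart_less \<sigma> \<rho>"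
      by (auto simp: minimal_parts_def)
    let ?P = "\<lambda>M. of_bool (M = ccont n \<rho>) :: complex"
    let ?d = "cdegree \<rho>"
    have "realized n X k \<aa> ?P" using \<rho> by (intro gen) (auto simp: size_ccont)
    then obtain s where s: "s \<in> rel_series n X k \<aa>" "represents n k ?P s"
      by (auto simp: realized_def)
    obtain c where c: "has_compl_sum n (\<lambda>\<pi>. scalar (c \<pi>) * u_mon n X \<pi>) (cparts n) (s ?d)"
      "\<And>\<pi>. c \<pi> \<noteq> 0 \<Longrightarrow> length \<pi> \<le> k + 1 \<and> cdegree \<pi> = ?d"
      "\<And>\<pi>. \<pi> \<in> cparts n \<Longrightarrow> length \<pi> = k + 1 \<Longrightarrow> cdegree \<pi> = ?d \<Longrightarrow> c \<pi> = 0 \<longleftrightarrow> ?P (ccont n \<pi>) = 0"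
      using relation_expansion[OF X(1) representsD(2)[OF s(2) _ mset_sort[symmetric]] representsD(1)[OF s(2)]] by blast
    have c\<rho>: "c \<rho> \<noteq> 0" using c(3)[OF \<rho>(1,3)] by simp
    have above: "\<pi> = \<rho> \<or> cpart_less \<rho> \<pi>" if \<pi>: "\<pi> \<in> cparts n" "c \<pi> \<noteq> 0" for \<pi>
    proof (cases "length \<pi> = k + 1")
      case True
      then have "ccont n \<pi> = ccont n \<rho>" using c(3)[OF \<pi>(1) True] c(2)[OF \<pi>(2)] \<pi>(2) by auto
      then have "\<not> cpart_less \<pi> \<rho>" using min \<pi> True c(2) by blast
      then show ?thesis using cpart_less_total[of \<pi> \<rho>] True \<rho>(3) c(2)[OF \<pi>(2)] by auto
    next
      case False
      then show ?thesis using c(2)[OF \<pi>(2)] \<rho>(3) by (auto simp: cpart_less_def)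
    qed
    have "has_compl_sum n (\<lambda>\<pi>. scalar (c \<pi>) * u_mon n X \<pi>) {\<pi> \<in> cparts n. \<pi> = \<rho> \<or> cpart_less \<rho> \<pi>} (s ?d)"
    proof (subst has_compl_sum_superset[of _ "cparts n"])
      show "scalar (c \<pi>) * u_mon n X \<pi> = 0" if "\<pi> \<in> cparts n - {\<pi> \<in> cparts n. \<pi> = \<rho> \<or> cpart_less \<rho> \<pi>}" for \<pi>
      proof -
        have "c \<pi> = 0" using above[of \<pi>] that by blast
        then show ?thesis by simp
      qed
    qed (use c(1) in auto)
    then have "is_lead n X (s ?d) \<rho>" using \<rho>(1) c\<rho> by (auto simp: is_lead_def)
    moreover have "\<not> compl_zero n (s ?d)"
    proof
      assume "compl_zero n (s ?d)"
      then have "has_compl_sum n (\<lambda>_. 0) (cparts n) (s ?d)" by (simp add: has_compl_sum_zero)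
      then have z: "has_compl_sum n (\<lambda>\<pi>. scalar (0::complex) * u_mon n X \<pi>) (cparts n) (s ?d)" by simp
      have "c \<rho> = 0" by (rule expansion_unique[OF X(1) c(1) z \<rho>(1)])
      then show False using c\<rho> by simp
    qed
    ultimately show "\<rho> \<in> leading_terms n X {s d |s d. s \<in> rel_series n X k \<aa>}"
      using s(1) unfolding leading_terms_def by blast
  qed
qed

section \<open>Generation of tensors by lowering operators\<close>

lemma multiset_split_zero: "M = replicate_mset (count M z) z + filter_mset (\<lambda>x. x \<noteq> z) M"
  by (metis filter_eq_replicate_mset multiset_partition)

text \<open>Every nonzero element is created from a zero, one at a time; the induction is on the
  nonzero part.\<close>

lemma multiset_generation:
  fixes S :: "nat multiset set" and D :: nat
  assumes base: "replicate_mset m 0 \<in> S"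
    and step: "\<And>M b. M \<in> S \<Longrightarrow> 0 \<in># M \<Longrightarrow> set_mset M \<subseteq> {..<D} \<Longrightarrow> b < D \<Longrightarrow> b \<noteq> 0 \<Longrightarrow> add_mset b (M - {#0#}) \<in> S"
    and M: "size M = m" "set_mset M \<subseteq> {..<D}" and D: "0 < D"
  shows "M \<in> S"
proof -
  have "replicate_mset a 0 + N \<in> S" if "a + size N = m" "set_mset N \<subseteq> {..<D} - {0}" for a and N :: "nat multiset"
    using that
  proof (induction N arbitrary: a)
    case empty
    then show ?case using base by simp
  next
    case (add b N)
    have "replicate_mset (Suc a) 0 + N \<in> S" using add by (intro add.IH) auto
    moreover have "set_mset (replicate_mset (Suc a) 0 + N) \<subseteq> {..<D}" using add.prems D by auto
    ultimately show ?case using step[of "replicate_mset (Suc a) 0 + N" b] add.prems by simp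
  qed
  note gen = this
  let ?N = "filter_mset (\<lambda>x. x \<noteq> 0) M"
  have "count M 0 + size ?N = m"
    using arg_cong[OF multiset_split_zero[of M 0], of size] M(1) by (simp only: size_union size_replicate_mset)
  moreover have "set_mset ?N \<subseteq> {..<D} - {0}" using M(2) by auto
  ultimately have "replicate_mset (count M 0) 0 + ?N \<in> S" by (intro gen)
  then show ?thesis using multiset_split_zero[of M 0] by simp
qed

text \<open>Here \<open>z\<close> is the mirror of 0. The operator that turns 0 into
  \<open>b\<close> also turns \<open>z - b\<close> into \<open>z\<close>, and this second term must
  already be available. It has fewer elements strictly between 0 and \<open>z\<close>, so the
  induction is on the number of these interior elements, with the extreme ones \<open>0\<close> and
  \<open>z\<close> left free.\<close>

lemma multiset_generation_symplectic:
  fixes S :: "nat multiset set" and z :: nat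
  assumes base: "replicate_mset m 0 \<in> S"
    and long: "\<And>M. M \<in> S \<Longrightarrow> 0 \<in># M \<Longrightarrow> add_mset z (M - {#0#}) \<in> S"
    and short: "\<And>M b. M \<in> S \<Longrightarrow> 0 \<in># M \<Longrightarrow> b < z \<Longrightarrow> b \<noteq> 0 \<Longrightarrow>
       (z - b \<in># M \<Longrightarrow> add_mset z (M - {#z - b#}) \<in> S) \<Longrightarrow> add_mset b (M - {#0#}) \<in> S"
    and M: "size M = m" "set_mset M \<subseteq> {..z}" and z: "0 < z"
  shows "M \<in> S"
proof -
  have gen: "replicate_mset a 0 + replicate_mset c z + N \<in> S"
    if "a + c + size N = m" "set_mset N \<subseteq> {0<..<z}" for a c and N :: "nat multiset"
    using that
  proof (induction "size N" arbitrary: N a c rule: less_induct)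
    case less
    show ?case
    proof (cases "N = {#}")
      case True
      have "replicate_mset a 0 + replicate_mset c z \<in> S" if "a + c = m" for a c
        using that
      proof (induction c arbitrary: a)
        case (Suc c)
        then have "replicate_mset (Suc a) 0 + replicate_mset c z \<in> S" by (intro Suc.IH) simp
        from long[OF this] show ?case by simp
      qed (use base in simp)
      then show ?thesis using True less.prems by simp
    next
      case False
      then obtain b N' where N: "N = add_mset b N'" by (meson multiset_cases)
      have b: "b < z" "b \<noteq> 0" "set_mset N' \<subseteq> {0<..<z}" using less.prems N by auto
      \<comment> \<open>The target with \<open>b\<close> put back to 0; it has one interior element
        fewer.\<close>
      let ?M = "replicate_mset (Suc a) 0 + replicate_mset c z + N'"
      have M: "?M \<in> S" using less.prems N b by (intro less.hyps) auto
      have "add_mset z (?M - {#z - b#}) \<in> S" if "z - b \<in># ?M"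
      proof -
        have "z - b \<in># N'" using that b by (auto split: if_splits)
        then obtain N'' where N'': "N' = add_mset (z - b) N''" by (meson multi_member_split)
        have "replicate_mset (Suc a) 0 + replicate_mset (Suc c) z + N'' \<in> S"
          using less.prems N N'' b by (intro less.hyps) auto
        then show ?thesis using N'' by simp
      qed
      from short[OF M _ b(1,2) this] show ?thesis by (simp add: N)
    qed
  qed
  let ?M0 = "filter_mset (\<lambda>x. x \<noteq> 0) M"
  let ?N = "filter_mset (\<lambda>x. x \<noteq> z) ?M0"
  have eq: "M = replicate_mset (count M 0) 0 + replicate_mset (count ?M0 z) z + ?N"
    using multiset_split_zero[of M 0] multiset_split_zero[of ?M0 z] by (metis add.assoc)
  have "set_mset ?N \<subseteq> {0<..<z}" using M(2) by force
  moreover have "count M 0 + count ?M0 z + size ?N = m"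
    using arg_cong[OF eq, of size] M(1) by (simp only: size_union size_replicate_mset)
  ultimately have "replicate_mset (count M 0) 0 + replicate_mset (count ?M0 z) z + ?N \<in> S" by (intro gen)
  then show ?thesis using eq by simp
qed

abbreviation mdelta :: "nat multiset \<Rightarrow> nat multiset \<Rightarrow> complex" where
  "mdelta M \<equiv> (\<lambda>M'. of_bool (M' = M))"

text \<open>The effect of replacing one \<open>r\<close> by \<open>u\<close> on the tensor
  concentrated at \<open>M\<close>. In coordinates of tensors the factor is the multiplicity of
  \<open>u\<close> after the replacement.\<close>

definition mtransfer :: "nat \<Rightarrow> nat \<Rightarrow> nat multiset \<Rightarrow> nat multiset \<Rightarrow> complex" where
  "mtransfer u r M M' = (if r \<in># M then of_nat (count (M - {#r#}) u + 1) * mdelta (add_mset u (M - {#r#})) M' else 0)"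

lemma sum_mset_indicator:
  fixes c :: complex
  shows "(\<Sum>v\<in>#M. if v = u then c else 0) = of_nat (count M u) * c"
  by (induction M) (auto simp: algebra_simps)

lemma mtransfer_eq:
  "(\<Sum>v\<in>#M'. if v = u then mdelta M (add_mset r (M' - {#v#})) else 0) = mtransfer u r M M'"
proof -
  have "(\<Sum>v\<in>#M'. if v = u then mdelta M (add_mset r (M' - {#v#})) else 0)
     = (\<Sum>v\<in>#M'. if v = u then mdelta M (add_mset r (M' - {#u#})) else 0)"
    by (intro arg_cong[of _ _ sum_mset] image_mset_cong) auto
  also have "\<dots> = of_nat (count M' u) * mdelta M (add_mset r (M' - {#u#}))" by (rule sum_mset_indicator)
  also have "\<dots> = mtransfer u r M M'"
  proof (cases "u \<in># M'")
    case True
    then obtain K where K: "M' = add_mset u K" by (meson multi_member_split)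
    show ?thesis
    proof (cases "r \<in># M")
      case True
      then obtain R where R: "M = add_mset r R" by (meson multi_member_split)
      then show ?thesis using K by (auto simp: mtransfer_def)
    next
      case False
      then show ?thesis using K by (auto simp: mtransfer_def)
    qed
  next
    case False
    then have "count M' u = 0" by (simp add: not_in_iff)
    moreover have "M' \<noteq> add_mset u (M - {#r#})" using False by auto
    ultimately show ?thesis by (simp add: mtransfer_def)
  qed
  finally show ?thesis .
qed

text \<open>As an operator \<open>bm n p q\<close> is, up to signs, \<open>e_p\<close> times the
  derivative at the mirror of \<open>q\<close> plus \<open>e_q\<close> times the derivative at the
  mirror of \<open>p\<close>.\<close>

lemma sact_bm_mdelta:
  assumes pq: "p < 2*n" "q < 2*n"
  shows "sact n (bm n p q) (mdelta M) =
    (\<lambda>M'. sgp n q * mtransfer p (2*n-1-q) M M' + sgp n p * mtransfer q (2*n-1-p) M M')"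
proof
  fix M'
  let ?\<delta> = "\<lambda>v u. mdelta M (add_mset v (M' - {#u#}))"
  have "(if u < 2*n then \<Sum>v<2*n. bm n p q $$ (u, v) * ?\<delta> v u else 0)
     = (if u = p then sgp n q * ?\<delta> (2*n-1-q) u else 0) + (if u = q then sgp n p * ?\<delta> (2*n-1-p) u else 0)" for u
  proof (cases "u < 2*n")
    case True
    have lt: "2*n-1-q < 2*n" "2*n-1-p < 2*n" using pq by auto
    have "(\<Sum>v<2*n. bm n p q $$ (u, v) * ?\<delta> v u) = (\<Sum>v<2*n. (if v = 2*n-1-q then if u = p then sgp n q * ?\<delta> v u else 0 else 0)
      + (if v = 2*n-1-p then if u = q then sgp n p * ?\<delta> v u else 0 else 0))"
      using True bm_entry[OF pq] by (intro sum.cong refl) (auto simp del: of_bool_eq_iff)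
    also have "\<dots> = (if u = p then sgp n q * ?\<delta> (2*n-1-q) u else 0) + (if u = q then sgp n p * ?\<delta> (2*n-1-p) u else 0)"
      using lt unfolding sum.distrib by (subst (1 2) sum.delta) auto
    finally show ?thesis using True by simp
  qed (use pq in auto)
  then have "sact n (bm n p q) (mdelta M) M' = (\<Sum>u\<in>#M'. (if u = p then sgp n q * ?\<delta> (2*n-1-q) u else 0) + (if u = q then sgp n p * ?\<delta> (2*n-1-p) u else 0))"
    unfolding sact_def by simp
  also have "\<dots> = (\<Sum>u\<in>#M'. sgp n q * (if u = p then ?\<delta> (2*n-1-q) u else 0)) + (\<Sum>u\<in>#M'. sgp n p * (if u = q then ?\<delta> (2*n-1-p) u else 0))"
    unfolding sum_mset.distrib[symmetric] by (intro arg_cong[of _ _ sum_mset] image_mset_cong) auto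
  also have "\<dots> = sgp n q * mtransfer p (2*n-1-q) M M' + sgp n p * mtransfer q (2*n-1-p) M M'"
    unfolding sum_mset_distrib_left[symmetric] mtransfer_eq ..
  finally show "sact n (bm n p q) (mdelta M) M' = sgp n q * mtransfer p (2*n-1-q) M M' + sgp n p * mtransfer q (2*n-1-p) M M'" .
qed

lemma realized_unscale:
  assumes "realized n X k \<aa> (\<lambda>M. c * P M)" "c \<noteq> 0" shows "realized n X k \<aa> P"
  using realized_scale[OF assms(1), of "1 / c"] assms(2) by simp

lemma realized_transfer:
  assumes "realized n X k \<aa> (\<lambda>M'. a * mtransfer u r M M')" "a \<noteq> 0" "r \<in># M"
  shows "realized n X k \<aa> (mdelta (add_mset u (M - {#r#})))"
proof (rule realized_unscale)
  show "realized n X k \<aa> (\<lambda>M'. (a * of_nat (count (M - {#r#}) u + 1)) * mdelta (add_mset u (M - {#r#})) M')"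
    using assms(1,3) by (simp add: mtransfer_def mult.assoc)
  show "a * of_nat (count (M - {#r#}) u + 1) \<noteq> 0" using assms(2) of_nat_neq_0 by (simp del: of_nat_add of_nat_Suc)
qed

text \<open>The lowering operators are \<open>bm n z z\<close> with \<open>z = 2*n - 1\<close>,
  which turns 0 into \<open>z\<close>, and \<open>bm n b z\<close>, whose two terms are those of the
  symplectic generation lemma.\<close>

lemma realized_sp:
  assumes X: "root_vectors n X" "1 \<le> n" and M: "size M = 2 * (k + 1)" "set_mset M \<subseteq> {..<2*n}"
  shows "realized n X k (sp n) (mdelta M)"
proof -
  let ?S = "{M. realized n X k (sp n) (mdelta M)}"
  let ?z = "2*n - 1"
  have z: "?z < 2*n" "0 < ?z" using X(2) by auto
  have act: "realized n X k (sp n) (sact n (bm n p q) (mdelta M))" if "realized n X k (sp n) (mdelta M)" for p q M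
    by (rule realized_act[OF that bm_sp bm_sp])
  have "M \<in> ?S"
  proof (rule multiset_generation_symplectic[where m = "2 * (k + 1)" and z = ?z])
    show "replicate_mset (2 * (k + 1)) 0 \<in> ?S" using realized_power[OF X] by simp
    show "set_mset M \<subseteq> {..?z}" using M(2) z by auto
  next
    fix M assume M: "M \<in> ?S" "0 \<in># M"
    then have "realized n X k (sp n) (\<lambda>M'. (2 * sgp n ?z) * mtransfer ?z 0 M M')"
      using act[of M ?z ?z] unfolding sact_bm_mdelta[OF z(1) z(1)] by (simp add: algebra_simps)
    from realized_transfer[OF this _ M(2)] show "add_mset ?z (M - {#0#}) \<in> ?S" by simp
  next
    fix M b assume M: "M \<in> ?S" "0 \<in># M" and b: "b < ?z" "b \<noteq> 0"
      and h: "?z - b \<in># M \<Longrightarrow> add_mset ?z (M - {#?z - b#}) \<in> ?S"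
    have bn: "b < 2*n" using b z by linarith
    let ?T = "\<lambda>M'. sgp n b * mtransfer ?z (?z - b) M M'"
    have 1: "realized n X k (sp n) (\<lambda>M'. sgp n ?z * mtransfer b 0 M M' + ?T M')"
      using act[of M b ?z] M unfolding sact_bm_mdelta[OF bn z(1)] by simp
    have 2: "realized n X k (sp n) ?T"
    proof (cases "?z - b \<in># M")
      case True
      from realized_scale[of n X k "sp n" "mdelta (add_mset ?z (M - {#?z - b#}))" "sgp n b * of_nat (count (M - {#?z - b#}) ?z + 1)"] h[OF True]
      show ?thesis using True by (simp add: mtransfer_def mult.assoc)
    next
      case False
      then show ?thesis using realized_scale[of n X k "sp n" "mdelta M" 0] M by (simp add: mtransfer_def)
    qed
    have "realized n X k (sp n) (\<lambda>M'. sgp n ?z * mtransfer b 0 M M')"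
      using realized_add[OF 1 realized_scale[OF 2, of "-1"]] by simp
    from realized_transfer[OF this _ M(2)] show "add_mset b (M - {#0#}) \<in> ?S" by simp
  qed (use M z in auto)
  then show ?thesis by simp
qed

lemma realized_g0:
  assumes X: "root_vectors n X" "1 \<le> n" and M: "size M = 2 * (k + 1)" "set_mset M \<subseteq> {..<n}"
  shows "realized n X k (g0 n) (mdelta M)"
proof -
  let ?S = "{M. realized n X k (g0 n) (mdelta M)}"
  have "M \<in> ?S"
  proof (rule multiset_generation[where m = "2 * (k + 1)" and D = n])
    show "replicate_mset (2 * (k + 1)) 0 \<in> ?S" using realized_power[OF X] by simp
  next
    fix M b assume M: "M \<in> ?S" "0 \<in># M" "set_mset M \<subseteq> {..<n}" and b: "b < n" "b \<noteq> 0"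
    \<comment> \<open>The mirror of \<open>b\<close> is at least \<open>n\<close>, so the second
      term of the operator vanishes on \<open>M\<close>.\<close>
    have "2*n - 1 - b \<notin># M" using M(3) b by auto
    then have "mtransfer u (2*n-1-b) M = (\<lambda>M'. 0)" for u by (auto simp: mtransfer_def)
    moreover have "realized n X k (g0 n) (sact n (bm n b (2*n-1)) (mdelta M))"
      using M(1) by (intro realized_act g0_lower b bm_sp) auto
    ultimately have "realized n X k (g0 n) (\<lambda>M'. sgp n (2*n-1) * mtransfer b 0 M M')"
      using b by (subst (asm) sact_bm_mdelta) auto
    from realized_transfer[OF this _ M(2)] show "add_mset b (M - {#0#}) \<in> ?S" by simp
  qed (use M X(2) in auto)
  then show ?thesis by simp
qed

lemma leading_terms_relations:
  assumes X: "root_vectors n X" "1 \<le> n"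
  shows "leading_terms n X (relations n X k) = minimal_parts n (2*n) k"
  unfolding relations_def
  by (rule leading_terms_minimal[OF X]) (use X(2) realized_sp[OF X] in auto)

text \<open>The block form of \<open>g0 n\<close> keeps all positions below \<open>n\<close>, and
  its lowering operators reach every multiset of such positions.\<close>

lemma leading_terms_relations0:
  assumes X: "root_vectors n X" "1 \<le> n"
  shows "leading_terms n X (relations0 n X k) = minimal_parts n n k"
  unfolding relations0_def
  by (rule leading_terms_minimal[OF X]) (use X(2) realized_g0[OF X] g0_sp_block in auto)

section \<open>Transport along the identification of bases\<close>

lemma color_less_pos:
  assumes "x \<in> colors n" "y \<in> colors n"
  shows "color_less x y \<longleftrightarrow> pos n (fst y) < pos n (fst x) \<or> pos n (fst x) = pos n (fst y) \<and> pos n (snd y) < pos n (snd x)"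
proof -
  have i: "fst x \<in> idxs n" "snd x \<in> idxs n" "fst y \<in> idxs n" "snd y \<in> idxs n"
    using assms colors_idxs by (metis prod.collapse)+
  show ?thesis unfolding color_less_def
    using idx_less_pos[OF i(1,3)] idx_less_pos[OF i(2,4)] pos_inj[OF i(1,3)] by auto
qed

lemma colors1_iff:
  "c \<in> colors1 n \<longleftrightarrow> c \<in> colors n \<and> pos n (fst c) < n \<and> pos n (snd c) < n"
proof (cases c)
  case (Pair a b)
  show ?thesis unfolding Pair by (cases a; cases b) (auto simp: colors1_def colors_def idxs_def)
qed

text \<open>\<open>iota l p\<close> has position \<open>p - 1\<close> for type C_l, just as
  \<open>Plain p\<close> has for type C_{2l}. In terms of positions the identification is the
  identity, and the order on colors is expressed by positions as well.\<close>

lemma phi_pos: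
  assumes "c \<in> colors1 (2*l)"
  shows "phi l c \<in> colors l" "pos l (fst (phi l c)) = pos (2*l) (fst c)" "pos l (snd (phi l c)) = pos (2*l) (snd c)"
proof -
  obtain p q where c: "c = (Plain p, Plain q)" and pq: "1 \<le> p" "p \<le> q" "q \<le> 2*l"
    using assms by (auto simp: colors1_def)
  have io: "iota l r \<in> idxs l \<and> pos l (iota l r) = r - 1" if "1 \<le> r" "r \<le> 2*l" for r
    using that by (auto simp: iota_def idxs_def image_iff)
  have "iota l p \<in> idxs l" "pos l (iota l p) = p - 1" "iota l q \<in> idxs l" "pos l (iota l q) = q - 1"
    using io[of p] io[of q] pq by auto
  then show "phi l c \<in> colors l" "pos l (fst (phi l c)) = pos (2*l) (fst c)" "pos l (snd (phi l c)) = pos (2*l) (snd c)"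
    using pq by (auto simp: c colors_iff_pos)
qed

lemma phi_bij: "bij_betw (phi l) (colors1 (2*l)) (colors l)"
proof (rule bij_betw_imageI)
  show "inj_on (phi l) (colors1 (2*l))"
  proof (rule inj_onI)
    fix c d assume cd: "c \<in> colors1 (2*l)" "d \<in> colors1 (2*l)" "phi l c = phi l d"
    then have "c \<in> colors (2*l)" "d \<in> colors (2*l)" by (auto simp: colors1_iff)
    then show "c = d" using phi_pos[OF cd(1)] phi_pos[OF cd(2)] cd(3) by (simp add: colors_eq_iff)
  qed
  show "phi l ` colors1 (2*l) = colors l"
  proof
    show "phi l ` colors1 (2*l) \<subseteq> colors l" using phi_pos(1) by blast
    show "colors l \<subseteq> phi l ` colors1 (2*l)"
    proof
      fix d assume d: "d \<in> colors l"
      \<comment> \<open>Plain indices start at 1, positions at 0.\<close>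
      let ?c = "(Plain (pos l (fst d) + 1), Plain (pos l (snd d) + 1))"
      have c: "?c \<in> colors1 (2*l)" using colors_pos[OF d] by (auto simp: colors1_def)
      have "phi l ?c = d" using phi_pos[OF c] colors_eq_iff[OF phi_pos(1)[OF c] d] by simp
      then show "d \<in> phi l ` colors1 (2*l)" using c by (metis imageI)
    qed
  qed
qed

lemma phi_color_less:
  assumes "x \<in> colors1 (2*l)" "y \<in> colors1 (2*l)"
  shows "color_less x y \<longleftrightarrow> color_less (phi l x) (phi l y)"
proof -
  have "x \<in> colors (2*l)" "y \<in> colors (2*l)" using assms by (auto simp: colors1_iff)
  then show ?thesis
    using color_less_pos[of x "2*l" y] color_less_pos[OF phi_pos(1)[OF assms(1)] phi_pos(1)[OF assms(2)]]
      phi_pos(2,3)[OF assms(1)] phi_pos(2,3)[OF assms(2)] by simp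
qed

abbreviation phi1 :: "nat \<Rightarrow> color \<times> int \<Rightarrow> color \<times> int" where
  "phi1 l \<equiv> (\<lambda>(c, m). (phi l c, m))"

lemma phi_part_le:
  assumes "fst p \<in> colors1 (2*l)" "fst q \<in> colors1 (2*l)"
  shows "part_le (phi1 l p) (phi1 l q) \<longleftrightarrow> part_le p q"
proof -
  have "phi l (fst p) = phi l (fst q) \<longleftrightarrow> fst p = fst q"
    by (rule inj_on_eq_iff[OF bij_betw_imp_inj_on[OF phi_bij] assms])
  then show ?thesis using phi_color_less[OF assms] by (cases p; cases q) (simp add: part_less_def)
qed

lemma phi_part_cparts_iff:
  assumes "fst ` set \<pi> \<subseteq> colors1 (2*l)"
  shows "phi_part l \<pi> \<in> cparts l \<longleftrightarrow> \<pi> \<in> cparts1 (2*l)"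
proof -
  have "sorted_wrt part_le (phi_part l \<pi>) \<longleftrightarrow> sorted_wrt part_le \<pi>"
    unfolding phi_part_def sorted_wrt_map using assms phi_part_le
    by (intro iffI; elim sorted_wrt_mono_rel[rotated]; blast)
  moreover have "fst ` set (phi_part l \<pi>) \<subseteq> colors l"
    using assms phi_pos(1) by (fastforce simp: phi_part_def)
  ultimately show ?thesis using assms by (simp add: cparts_def cparts1_def cparts_on_def)
qed

lemma phi_part_bij: "bij_betw (phi_part l) (cparts1 (2*l)) (cparts l)"
proof (rule bij_betw_imageI)
  show "inj_on (phi_part l) (cparts1 (2*l))"
  proof (rule inj_onI)
    fix \<pi> \<sigma> assume h: "\<pi> \<in> cparts1 (2*l)" "\<sigma> \<in> cparts1 (2*l)" "phi_part l \<pi> = phi_part l \<sigma>"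
    have "inj_on (phi1 l) (set \<pi> \<union> set \<sigma>)"
    proof (rule inj_onI)
      fix p q assume pq: "p \<in> set \<pi> \<union> set \<sigma>" "q \<in> set \<pi> \<union> set \<sigma>" "phi1 l p = phi1 l q"
      then have "fst p \<in> colors1 (2*l)" "fst q \<in> colors1 (2*l)" using h by (auto simp: cparts1_def cparts_on_def)
      moreover have "phi l (fst p) = phi l (fst q)" "snd p = snd q" using pq(3) by (simp_all add: case_prod_beta)
      ultimately show "p = q" using inj_on_eq_iff[OF bij_betw_imp_inj_on[OF phi_bij]] by (blast intro: prod_eqI)
    qed
    then show "\<pi> = \<sigma>" using h(3) inj_on_map_eq_map unfolding phi_part_def by blast
  qed
  show "phi_part l ` cparts1 (2*l) = cparts l"
  proof
    show "phi_part l ` cparts1 (2*l) \<subseteq> cparts l"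
    proof
      fix \<tau> assume "\<tau> \<in> phi_part l ` cparts1 (2*l)"
      then obtain \<pi> where "\<pi> \<in> cparts1 (2*l)" "\<tau> = phi_part l \<pi>" by blast
      then show "\<tau> \<in> cparts l" using phi_part_cparts_iff[of \<pi> l] by (simp add: cparts1_def cparts_on_def)
    qed
    show "cparts l \<subseteq> phi_part l ` cparts1 (2*l)"
    proof
      fix \<tau> assume \<tau>: "\<tau> \<in> cparts l"
      let ?inv = "inv_into (colors1 (2*l)) (phi l)"
      let ?\<pi> = "map (\<lambda>(c, m). (?inv c, m)) \<tau>"
      have inv: "?inv c \<in> colors1 (2*l)" "phi l (?inv c) = c" if "c \<in> colors l" for c
        using phi_bij[of l] that by (auto simp: bij_betw_def inv_into_into f_inv_into_f)
      have col: "fst ` set ?\<pi> \<subseteq> colors1 (2*l)" using cpartsD[OF \<tau>] inv(1) by fastforce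
      have "phi_part l ?\<pi> = \<tau>"
        unfolding phi_part_def map_map using cpartsD[OF \<tau>] inv(2) by (intro map_idI) (auto simp: case_prod_beta image_subset_iff prod_eq_iff)
      then show "\<tau> \<in> phi_part l ` cparts1 (2*l)" using phi_part_cparts_iff[OF col] \<tau> by (metis imageI)
    qed
  qed
qed

lemma lex_map:
  assumes "\<And>x y. x \<in> A \<Longrightarrow> y \<in> A \<Longrightarrow> lt x y \<longleftrightarrow> lt' (f x) (f y)" "inj_on f A" "set xs \<subseteq> A" "set ys \<subseteq> A"
  shows "(map f xs, map f ys) \<in> lex {(x, y). lt' x y} \<longleftrightarrow> (xs, ys) \<in> lex {(x, y). lt x y}"
  using assms(3,4)
proof (induction xs arbitrary: ys)
  case (Cons x xs)
  show ?case
  proof (cases ys)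
    case (Cons y zs)
    then show ?thesis using Cons.IH[of zs] Cons.prems assms(1)[of x y] inj_on_eq_iff[OF assms(2), of x y] by simp
  qed simp
qed simp

lemma phi_cpart_less:
  assumes "\<pi> \<in> cparts1 (2*l)" "\<sigma> \<in> cparts1 (2*l)"
  shows "cpart_less (phi_part l \<pi>) (phi_part l \<sigma>) \<longleftrightarrow> cpart_less \<pi> \<sigma>"
proof -
  have s: "map snd (phi_part l \<pi>) = map snd \<pi>" "map fst (phi_part l \<pi>) = map (phi l) (map fst \<pi>)"
    "length (phi_part l \<pi>) = length \<pi>" for \<pi>
    by (auto simp: phi_part_def)
  have "revlex color_less (map (phi l) (map fst \<pi>)) (map (phi l) (map fst \<sigma>)) \<longleftrightarrow> revlex color_less (map fst \<pi>) (map fst \<sigma>)"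
    unfolding revlex_def rev_map using assms phi_color_less bij_betw_imp_inj_on[OF phi_bij]
    by (intro lex_map[of "colors1 (2*l)"]) (auto simp: cparts1_def cparts_on_def simp del: phi.simps)
  then show ?thesis unfolding cpart_less_def cdegree_def s by simp
qed

lemma phi_ccont:
  assumes "\<pi> \<in> cparts1 (2*l)"
  shows "ccont l (phi_part l \<pi>) = ccont (2*l) \<pi>"
proof -
  have "{#pos l (fst (fst (phi1 l p))), pos l (snd (fst (phi1 l p)))#} = {#pos (2*l) (fst (fst p)), pos (2*l) (snd (fst p))#}"
    if "p \<in> set \<pi>" for p
    using that assms phi_pos[of "fst p" l] by (auto simp: case_prod_beta cparts1_def cparts_on_def)
  then show ?thesis unfolding ccont_def phi_part_def map_map
    by (intro arg_cong[of _ _ sum_list] map_cong refl) (simp add: case_prod_beta)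
qed

lemma ccont_set: "set_mset (ccont n \<pi>) = (\<Union>p\<in>set \<pi>. {pos n (fst (fst p)), pos n (snd (fst p))})"
  by (induction \<pi>) (auto simp: ccont_def)

lemma cparts1_iff: "\<pi> \<in> cparts1 n \<longleftrightarrow> \<pi> \<in> cparts n \<and> set_mset (ccont n \<pi>) \<subseteq> {..<n}"
  by (auto simp: cparts_def cparts1_def cparts_on_def ccont_set colors1_iff image_subset_iff)

text \<open>Minimality refers only to length, degree, positions and order, all of which are
  preserved. For type C_{2l} a competitor has the same positions, all below \<open>2*l\<close>, and
  so again has its colors in \<open>colors1\<close>; for type C_l these are all the positions there
  are.\<close>

lemma minimal_parts_phi:
  "phi_part l ` minimal_parts (2*l) (2*l) k = minimal_parts l (2*l) k"
proof -
  let ?Q = "\<lambda>n \<pi> \<sigma>. length \<sigma> = k + 1 \<and> cdegree \<sigma> = cdegree \<pi> \<and> ccont n \<sigma> = ccont n \<pi>"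
  have 1: "minimal_parts (2*l) (2*l) k = {\<pi>\<in>cparts1 (2*l). length \<pi> = k + 1 \<and> (\<forall>\<sigma>\<in>cparts1 (2*l). ?Q (2*l) \<pi> \<sigma> \<longrightarrow> \<not> cpart_less \<sigma> \<pi>)}"
    by (auto simp: minimal_parts_def cparts1_iff)
  have 2: "minimal_parts l (2*l) k = {\<pi>\<in>cparts l. length \<pi> = k + 1 \<and> (\<forall>\<sigma>\<in>cparts l. ?Q l \<pi> \<sigma> \<longrightarrow> \<not> cpart_less \<sigma> \<pi>)}"
  proof -
    have "set_mset (ccont l \<pi>) \<subseteq> {..<2*l}" if "\<pi> \<in> cparts l" for \<pi>
      using cpartsD[OF that] colors_pos by (fastforce simp: ccont_set)
    then show ?thesis unfolding minimal_parts_def by blast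
  qed
  have len: "length (phi_part l \<pi>) = length \<pi>" "cdegree (phi_part l \<pi>) = cdegree \<pi>" for \<pi>
    by (auto simp: phi_part_def cdegree_def comp_def case_prod_beta)
  have Q: "?Q l (phi_part l \<pi>) (phi_part l \<sigma>) \<longleftrightarrow> ?Q (2*l) \<pi> \<sigma>" if "\<pi> \<in> cparts1 (2*l)" "\<sigma> \<in> cparts1 (2*l)" for \<pi> \<sigma>
    using phi_ccont[OF that(1)] phi_ccont[OF that(2)] by (simp add: len)
  have img: "cparts l = phi_part l ` cparts1 (2*l)" using phi_part_bij by (simp add: bij_betw_def)
  have eq: "phi_part l \<pi> \<in> minimal_parts l (2*l) k \<longleftrightarrow> \<pi> \<in> minimal_parts (2*l) (2*l) k" if \<pi>: "\<pi> \<in> cparts1 (2*l)" for \<pi>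
    unfolding 1 2 img using \<pi> Q[OF \<pi>] phi_cpart_less[OF _ \<pi>] by (auto simp: len)
  show ?thesis
  proof
    show "phi_part l ` minimal_parts (2*l) (2*l) k \<subseteq> minimal_parts l (2*l) k" using eq 1 by blast
    show "minimal_parts l (2*l) k \<subseteq> phi_part l ` minimal_parts (2*l) (2*l) k"
    proof
      fix \<tau> assume \<tau>: "\<tau> \<in> minimal_parts l (2*l) k"
      then have "\<tau> \<in> cparts l" by (simp add: minimal_parts_def)
      then obtain \<pi> where "\<pi> \<in> cparts1 (2*l)" "\<tau> = phi_part l \<pi>" unfolding img by blast
      then show "\<tau> \<in> phi_part l ` minimal_parts (2*l) (2*l) k" using eq \<tau> by blast
    qed
  qed
qed

lemma minimal_parts_cparts1: "minimal_parts n n k \<subseteq> cparts1 n"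
  by (auto simp: minimal_parts_def cparts1_iff)

section \<open>Uniqueness of highest weight modules\<close>

text \<open>Matrices on the \<open>j\<close>-th diagonal, counted upwards from the main one: the
  principal grading.\<close>

definition homog :: "int \<Rightarrow> complex mat \<Rightarrow> bool" where
  "homog j A \<longleftrightarrow> (\<forall>r<dim_row A. \<forall>s<dim_col A. A $$ (r, s) \<noteq> 0 \<longrightarrow> int s - int r = j)"

definition band :: "nat \<Rightarrow> int set \<Rightarrow> complex mat \<Rightarrow> complex mat" where
  "band N S A = mat N N (\<lambda>(r, s). if int s - int r \<in> S then A $$ (r, s) else 0)"

text \<open>The sum of the positive coroots of \<open>sl N\<close>.\<close>

definition grading_el :: "nat \<Rightarrow> complex mat" where
  "grading_el N = mat N N (\<lambda>(r, s). if r = s then of_int (int N - 1 - 2 * int r) else 0)"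

text \<open>What \<open>sl N\<close> and \<open>sp n\<close> share: stability under extracting
  diagonals, which splits elements into raising, diagonal and lowering parts, and an element whose
  bracket measures the degree.\<close>

definition graded_alg :: "nat \<Rightarrow> complex mat set \<Rightarrow> bool" where
  "graded_alg N \<gg> \<longleftrightarrow> \<gg> \<subseteq> carrier_mat N N \<and> 0\<^sub>m N N \<in> \<gg> \<and>
     (\<forall>A\<in>\<gg>. \<forall>B\<in>\<gg>. \<forall>c. c \<cdot>\<^sub>m A + B \<in> \<gg>) \<and> (\<forall>A\<in>\<gg>. \<forall>B\<in>\<gg>. bracket A B \<in> \<gg>) \<and>
     (\<forall>A\<in>\<gg>. \<forall>j. band N {j} A \<in> \<gg>) \<and> grading_el N \<in> \<gg>"

lemma graded_algD:
  assumes "graded_alg N \<gg>"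
  shows "A \<in> \<gg> \<Longrightarrow> A \<in> carrier_mat N N" "0\<^sub>m N N \<in> \<gg>" "A \<in> \<gg> \<Longrightarrow> B \<in> \<gg> \<Longrightarrow> c \<cdot>\<^sub>m A + B \<in> \<gg>"
    "A \<in> \<gg> \<Longrightarrow> B \<in> \<gg> \<Longrightarrow> bracket A B \<in> \<gg>" "A \<in> \<gg> \<Longrightarrow> band N {j} A \<in> \<gg>" "grading_el N \<in> \<gg>"
  using assms by (auto simp: graded_alg_def)

lemma homog_band: "homog j (band N {j} A)"
  by (auto simp: homog_def band_def)

lemma homog_bracket:
  assumes A: "A \<in> carrier_mat N N" "homog i A" and B: "B \<in> carrier_mat N N" "homog j B"
  shows "homog (i + j) (bracket A B)"
proof -
  have prod: "int s - int r = i + j" if A: "A \<in> carrier_mat N N" "homog i A" and B: "B \<in> carrier_mat N N" "homog j B"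
    and rs: "r < N" "s < N" "(A * B) $$ (r, s) \<noteq> 0" for A B i j r s
  proof -
    have "(\<Sum>u<N. A $$ (r, u) * B $$ (u, s)) \<noteq> 0" using mult_mat_entry[OF A(1) B(1) rs(1,2)] rs(3) by simp
    then obtain u where "u < N" "A $$ (r, u) * B $$ (u, s) \<noteq> 0"
      by (meson lessThan_iff sum.not_neutral_contains_not_neutral)
    then have "int u - int r = i" "int s - int u = j" using A B rs by (auto simp: homog_def)
    then show ?thesis by simp
  qed
  have "int s - int r = i + j" if "r < N" "s < N" "bracket A B $$ (r, s) \<noteq> 0" for r s
  proof -
    have "bracket A B $$ (r, s) = (A * B) $$ (r, s) - (B * A) $$ (r, s)"
      using that A(1) B(1) by (simp add: bracket_def)
    then have "(A * B) $$ (r, s) \<noteq> 0 \<or> (B * A) $$ (r, s) \<noteq> 0" using that(3) by auto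
    then show ?thesis using prod[OF A B that(1,2)] prod[OF B A that(1,2)] by auto
  qed
  moreover have "bracket A B \<in> carrier_mat N N" by (rule bracket_carrier[OF A(1) B(1)])
  ultimately show ?thesis by (auto simp: homog_def)
qed

lemma bracket_grading_el:
  assumes A: "A \<in> carrier_mat N N" "homog j A"
  shows "bracket (grading_el N) A = of_int (2 * j) \<cdot>\<^sub>m A"
proof -
  have H: "grading_el N \<in> carrier_mat N N" by (simp add: grading_el_def)
  have "bracket (grading_el N) A $$ (r, s) = of_int (2 * j) * A $$ (r, s)" if rs: "r < N" "s < N" for r s
  proof -
    have "(grading_el N * A) $$ (r, s) = (\<Sum>u<N. if u = r then of_int (int N - 1 - 2 * int r) * A $$ (r, s) else 0)"
      unfolding mult_mat_entry[OF H A(1) rs] using rs by (intro sum.cong) (auto simp: grading_el_def)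
    moreover have "(A * grading_el N) $$ (r, s) = (\<Sum>u<N. if u = s then A $$ (r, s) * of_int (int N - 1 - 2 * int s) else 0)"
      unfolding mult_mat_entry[OF A(1) H rs] using rs by (intro sum.cong) (auto simp: grading_el_def)
    moreover have "bracket (grading_el N) A $$ (r, s) = (grading_el N * A) $$ (r, s) - (A * grading_el N) $$ (r, s)"
      using rs A(1) H by (simp add: bracket_def)
    ultimately have "bracket (grading_el N) A $$ (r, s) = of_int (int N - 1 - 2 * int r) * A $$ (r, s) - A $$ (r, s) * of_int (int N - 1 - 2 * int s)"
      using rs by (simp only: sum.delta finite_lessThan lessThan_iff if_True)
    also have "\<dots> = (of_int (int N - 1 - 2 * int r) - of_int (int N - 1 - 2 * int s)) * A $$ (r, s)"
      by (simp only: left_diff_distrib right_diff_distrib mult.commute)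
    also have "\<dots> = of_int (2 * (int s - int r)) * A $$ (r, s)" by simp
    also have "\<dots> = of_int (2 * j) * A $$ (r, s)" using A rs by (cases "A $$ (r, s) = 0") (auto simp: homog_def)
    finally show ?thesis .
  qed
  then show ?thesis using A(1) bracket_carrier[OF H A(1)] by (intro eq_matI) auto
qed

lemma grading_el_diagonal: "diagonal_mat (grading_el N)"
  by (auto simp: diagonal_mat_def grading_el_def)

lemma lie_moduleD:
  assumes "lie_module \<gg> sc V \<rho>"
  shows "vector_space sc" "module.subspace sc V" "A \<in> \<gg> \<Longrightarrow> v \<in> V \<Longrightarrow> \<rho> A v \<in> V"
    "A \<in> \<gg> \<Longrightarrow> v \<in> V \<Longrightarrow> w \<in> V \<Longrightarrow> \<rho> A (sc c v + w) = sc c (\<rho> A v) + \<rho> A w"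
    "A \<in> \<gg> \<Longrightarrow> B \<in> \<gg> \<Longrightarrow> v \<in> V \<Longrightarrow> \<rho> (c \<cdot>\<^sub>m A + B) v = sc c (\<rho> A v) + \<rho> B v"
    "A \<in> \<gg> \<Longrightarrow> B \<in> \<gg> \<Longrightarrow> v \<in> V \<Longrightarrow> \<rho> (bracket A B) v = \<rho> A (\<rho> B v) - \<rho> B (\<rho> A v)"
  using assms by (auto simp: lie_module_def)

lemma subspace_iff:
  assumes "vector_space sc"
  shows "module.subspace sc V \<longleftrightarrow> 0 \<in> V \<and> (\<forall>c. \<forall>v\<in>V. \<forall>w\<in>V. sc c v + w \<in> V)"
proof -
  interpret vector_space sc by (rule assms)
  show ?thesis
  proof
    assume "subspace V"
    then show "0 \<in> V \<and> (\<forall>c. \<forall>v\<in>V. \<forall>w\<in>V. sc c v + w \<in> V)"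
      by (auto intro: subspace_0 subspace_add subspace_scale)
  next
    assume *: "0 \<in> V \<and> (\<forall>c. \<forall>v\<in>V. \<forall>w\<in>V. sc c v + w \<in> V)"
    show "subspace V"
    proof (rule subspaceI)
      show "0 \<in> V" using * by simp
      show "x + y \<in> V" if "x \<in> V" "y \<in> V" for x y using *[THEN conjunct2, rule_format, of x y 1] that by simp
      show "sc c x \<in> V" if "x \<in> V" for c x using *[THEN conjunct2, rule_format, of x 0 c] * that by simp
    qed
  qed
qed

text \<open>Each vector is recorded with its depth, the total degree by which the lowering operators
  have descended from the highest weight vector. The span below mixes words of different
  depths.\<close>

inductive_set hwords :: "complex mat set \<Rightarrow> (complex mat \<Rightarrow> 'p \<Rightarrow> 'p) \<Rightarrow> 'p \<Rightarrow> (nat \<times> 'p) set"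
  for \<gg> act v0 where
  base: "(0, v0) \<in> hwords \<gg> act v0"
| step: "(r, x) \<in> hwords \<gg> act v0 \<Longrightarrow> A \<in> \<gg> \<Longrightarrow> homog (- int j) A \<Longrightarrow> 0 < j \<Longrightarrow> (r + j, act A x) \<in> hwords \<gg> act v0"

inductive_set hspan :: "complex mat set \<Rightarrow> (complex \<Rightarrow> 'p::ab_group_add \<Rightarrow> 'p) \<Rightarrow> (complex mat \<Rightarrow> 'p \<Rightarrow> 'p) \<Rightarrow> 'p \<Rightarrow> 'p set"
  for \<gg> sc act v0 where
  zero: "0 \<in> hspan \<gg> sc act v0"
| add: "(r, y) \<in> hwords \<gg> act v0 \<Longrightarrow> z \<in> hspan \<gg> sc act v0 \<Longrightarrow> sc c y + z \<in> hspan \<gg> sc act v0"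

definition highest_vector where
  "highest_vector \<gg> sc V \<rho> \<mu> v \<longleftrightarrow> v \<in> V \<and> (\<forall>A\<in>\<gg>. strictly_upper A \<longrightarrow> \<rho> A v = 0) \<and>
     (\<forall>H\<in>\<gg>. diagonal_mat H \<longrightarrow> \<rho> H v = sc (\<mu> H) v)"

section \<open>The submodule generated by a highest weight vector\<close>

context
  fixes N \<gg> sc and V :: "'p::ab_group_add set" and \<rho> \<mu> v0
  assumes g: "graded_alg N \<gg>" and m: "lie_module \<gg> sc V \<rho>" and hv: "highest_vector \<gg> sc V \<rho> \<mu> v0"
begin

interpretation vs: vector_space sc by (rule lie_moduleD(1)[OF m])

lemma act_zero: "A \<in> \<gg> \<Longrightarrow> \<rho> A 0 = 0"
  using lie_moduleD(4)[OF m, of A 0 0 "-1"] lie_moduleD(2)[OF m] by (simp add: vs.subspace_0)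

lemma act_scale: "A \<in> \<gg> \<Longrightarrow> x \<in> V \<Longrightarrow> \<rho> A (sc c x) = sc c (\<rho> A x)"
  using lie_moduleD(4)[OF m, of A x 0 c] lie_moduleD(2)[OF m] act_zero by (simp add: vs.subspace_0)

lemma act_add: "A \<in> \<gg> \<Longrightarrow> x \<in> V \<Longrightarrow> y \<in> V \<Longrightarrow> \<rho> A (x + y) = \<rho> A x + \<rho> A y"
  using lie_moduleD(4)[OF m, of A x y 1] by simp

lemma zero_act: "x \<in> V \<Longrightarrow> \<rho> (0\<^sub>m N N) x = 0"
proof -
  assume x: "x \<in> V"
  have "(-1) \<cdot>\<^sub>m (0\<^sub>m N N :: complex mat) + 0\<^sub>m N N = 0\<^sub>m N N" by (intro eq_matI) auto
  then show ?thesis using lie_moduleD(5)[OF m graded_algD(2)[OF g] graded_algD(2)[OF g] x, of "-1"] by simp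
qed

lemma act_smult: "A \<in> \<gg> \<Longrightarrow> x \<in> V \<Longrightarrow> \<rho> (c \<cdot>\<^sub>m A) x = sc c (\<rho> A x)"
proof -
  assume A: "A \<in> \<gg>" and x: "x \<in> V"
  have "c \<cdot>\<^sub>m A + 0\<^sub>m N N = c \<cdot>\<^sub>m A" using graded_algD(1)[OF g A] by auto
  then show ?thesis using lie_moduleD(5)[OF m A graded_algD(2)[OF g] x, of c] zero_act[OF x] by simp
qed

lemma hwords_V: "(r, x) \<in> hwords \<gg> \<rho> v0 \<Longrightarrow> x \<in> V"
  by (induction rule: hwords.induct) (use hv m in \<open>auto simp: highest_vector_def dest: lie_moduleD(3)\<close>)

lemma hspan_V: "x \<in> hspan \<gg> sc \<rho> v0 \<Longrightarrow> x \<in> V"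
proof (induction rule: hspan.induct)
  case (add r y z c)
  then show ?case using lie_moduleD(2)[OF m] hwords_V by (auto intro!: vs.subspace_add vs.subspace_scale)
qed (use lie_moduleD(2)[OF m] in \<open>auto intro: vs.subspace_0\<close>)

lemma hspan_add: "x \<in> hspan \<gg> sc \<rho> v0 \<Longrightarrow> y \<in> hspan \<gg> sc \<rho> v0 \<Longrightarrow> x + y \<in> hspan \<gg> sc \<rho> v0"
  by (induction rule: hspan.induct) (auto simp: add.assoc intro: hspan.add)

lemma hspan_scale: "x \<in> hspan \<gg> sc \<rho> v0 \<Longrightarrow> sc c x \<in> hspan \<gg> sc \<rho> v0"
proof (induction rule: hspan.induct)
  case (add r y z d)
  from hspan.add[OF add(1,3), of "c * d"] show ?case by (simp add: vs.scale_right_distrib)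
qed (simp add: hspan.zero)

lemma hspan_word: "(r, y) \<in> hwords \<gg> \<rho> v0 \<Longrightarrow> y \<in> hspan \<gg> sc \<rho> v0"
  using hspan.add[where c = 1 and sc = sc, OF _ hspan.zero] by fastforce

lemma hspan_lower:
  assumes "A \<in> \<gg>" "homog (- int j) A" "0 < j" "x \<in> hspan \<gg> sc \<rho> v0"
  shows "\<rho> A x \<in> hspan \<gg> sc \<rho> v0"
  using assms(4)
proof (induction rule: hspan.induct)
  case zero
  then show ?case using act_zero[OF assms(1)] hspan.zero by simp
next
  case (add r y z c)
  have "\<rho> A (sc c y + z) = sc c (\<rho> A y) + \<rho> A z"
    using lie_moduleD(4)[OF m assms(1)] hwords_V[OF add(1)] hspan_V[OF add(2)] by simp
  then show ?case using hspan.add[OF hwords.step[OF add(1) assms(1-3)] add(3)] by simp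
qed

text \<open>A substitute for the triangular decomposition of the enveloping algebra:
  \<open>A B x = [A, B] x + B A x\<close> moves \<open>A\<close> towards the highest weight vector.
  The induction treats all homogeneous \<open>A\<close> at once, because the bracket has another
  degree.\<close>

lemma hspan_homog_word:
  assumes "(r, x) \<in> hwords \<gg> \<rho> v0" "A \<in> \<gg>" "homog j A"
  shows "\<rho> A x \<in> hspan \<gg> sc \<rho> v0"
  using assms
proof (induction arbitrary: A j rule: hwords.induct)
  case base
  have Ac: "A \<in> carrier_mat N N" using graded_algD(1)[OF g base(1)] .
  consider "j < 0" | "j = 0" | "j > 0" by linarith
  then show ?case
  proof cases
    case 1
    then show ?thesis using hspan_word[OF hwords.step[OF hwords.base base(1), of "nat (- j)"]] base(2) by simp
  next
    case 2
    then have "diagonal_mat A" using base(2) Ac by (auto simp: diagonal_mat_def homog_def)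
    then have "\<rho> A v0 = sc (\<mu> A) v0" using hv base(1) by (simp add: highest_vector_def)
    then show ?thesis using hspan_scale[OF hspan_word[OF hwords.base]] by simp
  next
    case 3
    then have "strictly_upper A" using base(2) Ac by (fastforce simp: strictly_upper_def homog_def)
    then have "\<rho> A v0 = 0" using hv base(1) by (simp add: highest_vector_def)
    then show ?thesis using hspan.zero by simp
  qed
next
  case (step r x B i)
  show ?case
  proof (cases "j < 0")
    case True
    then show ?thesis
      using hspan_word[OF hwords.step[OF hwords.step[OF step(1-4)] step(6), of "nat (- j)"]] step(7) by simp
  next
    case False
    have AB: "bracket A B \<in> \<gg>" "homog (j + (- int i)) (bracket A B)"
      using graded_algD(4)[OF g step(6,2)] homog_bracket[OF _ step(7) _ step(3)] graded_algD(1)[OF g] step by auto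
    have "\<rho> A (\<rho> B x) = \<rho> (bracket A B) x + \<rho> B (\<rho> A x)"
      using lie_moduleD(6)[OF m step(6,2) hwords_V[OF step(1)]] by simp
    moreover have "\<rho> (bracket A B) x \<in> hspan \<gg> sc \<rho> v0" using step.IH[OF AB] .
    moreover have "\<rho> B (\<rho> A x) \<in> hspan \<gg> sc \<rho> v0" by (rule hspan_lower[OF step(2-4) step.IH[OF step(6,7)]])
    ultimately show ?thesis using hspan_add by simp
  qed
qed

text \<open>An element of the algebra is the sum of its diagonals, each of which is homogeneous and
  again in the algebra.\<close>

lemma hspan_word_stable:
  assumes x: "(r, x) \<in> hwords \<gg> \<rho> v0" and A: "A \<in> \<gg>"
  shows "\<rho> A x \<in> hspan \<gg> sc \<rho> v0"
proof -
  have "band N S A \<in> \<gg> \<and> \<rho> (band N S A) x \<in> hspan \<gg> sc \<rho> v0" if "finite S" for S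
    using that
  proof (induction S rule: finite_induct)
    case empty
    have "band N {} A = 0\<^sub>m N N" by (intro eq_matI) (auto simp: band_def)
    then show ?case using graded_algD(2)[OF g] zero_act[OF hwords_V[OF x]] hspan.zero by simp
  next
    case (insert j S)
    have eq: "band N (insert j S) A = 1 \<cdot>\<^sub>m band N {j} A + band N S A"
      using insert.hyps by (intro eq_matI) (auto simp: band_def)
    have j: "band N {j} A \<in> \<gg>" by (rule graded_algD(5)[OF g A])
    have "\<rho> (band N (insert j S) A) x = sc 1 (\<rho> (band N {j} A) x) + \<rho> (band N S A) x"
      unfolding eq using insert.IH j lie_moduleD(5)[OF m] hwords_V[OF x] by blast
    moreover have "\<rho> (band N {j} A) x \<in> hspan \<gg> sc \<rho> v0" by (rule hspan_homog_word[OF x j homog_band])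
    ultimately show ?case using insert.IH eq graded_algD(3)[OF g j] hspan_add by simp
  qed
  from this[of "{- int N..int N}"] have "\<rho> (band N {- int N..int N} A) x \<in> hspan \<gg> sc \<rho> v0" by simp
  moreover have "band N {- int N..int N} A = A"
    using graded_algD(1)[OF g A] by (intro eq_matI) (auto simp: band_def)
  ultimately show ?thesis by simp
qed

lemma hspan_stable:
  assumes "A \<in> \<gg>" "x \<in> hspan \<gg> sc \<rho> v0"
  shows "\<rho> A x \<in> hspan \<gg> sc \<rho> v0"
  using assms(2)
proof (induction rule: hspan.induct)
  case zero
  then show ?case using act_zero[OF assms(1)] hspan.zero by simp
next
  case (add r y z c)
  have "\<rho> A (sc c y + z) = sc c (\<rho> A y) + \<rho> A z"
    using lie_moduleD(4)[OF m assms(1)] hwords_V[OF add(1)] hspan_V[OF add(2)] by simp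
  then show ?case using hspan_add[OF hspan_scale[OF hspan_word_stable[OF add(1) assms(1)]] add(3)] by simp
qed

text \<open>The bracket with \<open>grading_el N\<close> multiplies a lowering operator of degree
  \<open>-j\<close> by \<open>-2*j\<close>, so the eigenvalue records the depth.\<close>

lemma hwords_weight:
  "(r, x) \<in> hwords \<gg> \<rho> v0 \<Longrightarrow> \<rho> (grading_el N) x = sc (\<mu> (grading_el N) - 2 * of_nat r) x"
proof (induction rule: hwords.induct)
  case base
  then show ?case using hv graded_algD(6)[OF g] grading_el_diagonal by (simp add: highest_vector_def)
next
  case (step r x A j)
  let ?H = "grading_el N"
  have H: "?H \<in> \<gg>" by (rule graded_algD(6)[OF g])
  have x: "x \<in> V" by (rule hwords_V[OF step(1)])
  have "\<rho> ?H (\<rho> A x) = \<rho> A (\<rho> ?H x) + \<rho> (bracket ?H A) x"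
    using lie_moduleD(6)[OF m H step(2) x] by simp
  also have "\<rho> A (\<rho> ?H x) = sc (\<mu> ?H - 2 * of_nat r) (\<rho> A x)"
    using act_scale[OF step(2) x] step.IH by simp
  also have "\<rho> (bracket ?H A) x = sc (of_int (2 * (- int j))) (\<rho> A x)"
    unfolding bracket_grading_el[OF graded_algD(1)[OF g step(2)] step(3)] by (rule act_smult[OF step(2) x])
  also have "sc (\<mu> ?H - 2 * of_nat r) (\<rho> A x) + sc (of_int (2 * (- int j))) (\<rho> A x)
      = sc (\<mu> ?H - 2 * of_nat r + of_int (2 * (- int j))) (\<rho> A x)"
    by (rule vs.scale_left_distrib[symmetric])
  also have "\<mu> ?H - 2 * of_nat r + of_int (2 * (- int j)) = \<mu> ?H - 2 * of_nat (r + j)" by simp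
  finally show ?case .
qed

text \<open>A product of factors \<open>H - (\<mu>(H) - 2r)\<close>, which projects away the weight spaces at the depths \<open>r\<close>.\<close>

definition shift_op :: "nat list \<Rightarrow> 'p \<Rightarrow> 'p" where
  "shift_op rs x = foldr (\<lambda>r z. \<rho> (grading_el N) z - sc (\<mu> (grading_el N) - 2 * of_nat r) z) rs x"

lemma shift_op_V: "x \<in> V \<Longrightarrow> shift_op rs x \<in> V"
proof (induction rs)
  case (Cons r rs)
  then show ?case using lie_moduleD(2)[OF m] lie_moduleD(3)[OF m graded_algD(6)[OF g]]
    by (auto simp: shift_op_def intro!: vs.subspace_diff vs.subspace_scale)
qed (simp add: shift_op_def)

lemma shift_op_add: "x \<in> V \<Longrightarrow> y \<in> V \<Longrightarrow> shift_op rs (x + y) = shift_op rs x + shift_op rs y"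
proof (induction rs)
  case (Cons r rs)
  then show ?case using act_add[OF graded_algD(6)[OF g] shift_op_V[of x rs] shift_op_V[of y rs]]
    by (simp add: shift_op_def vs.scale_right_distrib)
qed (simp add: shift_op_def)

lemma shift_op_weight:
  assumes "x \<in> V" "\<rho> (grading_el N) x = sc c x"
  shows "shift_op rs x = sc (\<Prod>r\<leftarrow>rs. c - (\<mu> (grading_el N) - 2 * of_nat r)) x"
proof (induction rs)
  case (Cons r rs)
  let ?k = "\<mu> (grading_el N) - 2 * of_nat r"
  let ?P = "\<Prod>r\<leftarrow>rs. c - (\<mu> (grading_el N) - 2 * of_nat r)"
  have "shift_op (r # rs) x = \<rho> (grading_el N) (shift_op rs x) - sc ?k (shift_op rs x)"
    by (simp add: shift_op_def)
  also have "\<dots> = sc (?P * c) x - sc (?k * ?P) x"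
    unfolding Cons.IH act_scale[OF graded_algD(6)[OF g] assms(1)] assms(2) vs.scale_scale ..
  also have "\<dots> = sc (?P * c - ?k * ?P) x" by (rule vs.scale_left_diff_distrib[symmetric])
  also have "?P * c - ?k * ?P = (c - ?k) * ?P" by (simp only: left_diff_distrib right_diff_distrib mult.commute)
  finally show ?case by (simp only: list.map prod_list.Cons)
qed (simp add: shift_op_def)

text \<open>Words of positive depth are eigenvectors with eigenvalues different from the top one, so
  finitely many factors of \<open>shift_op\<close> kill any combination of them.\<close>

lemma hspan_decompose:
  "x \<in> hspan \<gg> sc \<rho> v0 \<Longrightarrow> \<exists>c y rs. x = sc c v0 + y \<and> y \<in> V \<and> 0 \<notin> set rs \<and> shift_op rs y = 0"
proof (induction rule: hspan.induct)
  case zero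
  show ?case using lie_moduleD(2)[OF m]
    by (intro exI[of _ 0] exI[of _ "0::'p"] exI[of _ "[]"]) (auto simp: shift_op_def intro: vs.subspace_0)
next
  case (add r y z c)
  obtain d z' rs where z: "z = sc d v0 + z'" "z' \<in> V" "0 \<notin> set rs" "shift_op rs z' = 0" using add.IH by blast
  have y: "y \<in> V" by (rule hwords_V[OF add(1)])
  show ?case
  proof (cases "r = 0")
    case True
    \<comment> \<open>Lowering operators have positive degree, so depth 0 belongs to the highest
      weight vector alone.\<close>
    have "y = v0" using add(1) True by (cases rule: hwords.cases) auto
    then have "sc c y + z = sc (c + d) v0 + z'" using z by (simp add: vs.scale_left_distrib)
    then show ?thesis using z by blast
  next
    case False
    have cy: "sc c y \<in> V" using y lie_moduleD(2)[OF m] by (intro vs.subspace_scale)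
    have w: "\<rho> (grading_el N) (sc c y) = sc (\<mu> (grading_el N) - 2 * of_nat r) (sc c y)"
      using act_scale[OF graded_algD(6)[OF g] y] hwords_weight[OF add(1)] by (simp add: mult.commute)
    have "shift_op (r # rs) z' = 0" using z(4) act_zero[OF graded_algD(6)[OF g]] by (simp add: shift_op_def)
    moreover have "shift_op (r # rs) (sc c y) = 0" unfolding shift_op_weight[OF cy w] by simp
    ultimately have "shift_op (r # rs) (sc c y + z') = 0" by (simp add: shift_op_add[OF cy z(2)])
    moreover have "sc c y + z = sc d v0 + (sc c y + z')" using z(1) by simp
    moreover have "sc c y + z' \<in> V" using cy z(2) lie_moduleD(2)[OF m] by (intro vs.subspace_add)
    ultimately show ?thesis using z(3) False by (intro exI[of _ d] exI[of _ "sc c y + z'"] exI[of _ "r # rs"]) auto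
  qed
qed

text \<open>On a vector of top weight a factor of \<open>shift_op\<close> is multiplication by
  \<open>2*r\<close> with \<open>r > 0\<close>. Since the product kills the remainder
  \<open>y\<close>, which also has top weight, \<open>y\<close> is zero: the top weight space of the
  generated submodule is a line.\<close>

lemma hspan_top_weight:
  assumes x: "x \<in> hspan \<gg> sc \<rho> v0" and w: "\<rho> (grading_el N) x = sc (\<mu> (grading_el N)) x"
  shows "\<exists>c. x = sc c v0"
proof -
  obtain c y rs where y: "x = sc c v0 + y" "y \<in> V" "0 \<notin> set rs" "shift_op rs y = 0"
    using hspan_decompose[OF x] by blast
  have v0: "v0 \<in> V" using hv by (simp add: highest_vector_def)
  have H: "grading_el N \<in> \<gg>" by (rule graded_algD(6)[OF g])
  have "\<rho> (grading_el N) v0 = sc (\<mu> (grading_el N)) v0" using hwords_weight[OF hwords.base] by simp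
  then have "\<rho> (grading_el N) (sc c v0 + y) = sc (\<mu> (grading_el N)) (sc c v0) + \<rho> (grading_el N) y"
    using lie_moduleD(4)[OF m H v0 y(2), of c] by (simp add: mult.commute)
  then have "\<rho> (grading_el N) y = sc (\<mu> (grading_el N)) y"
    using w y(1) by (simp add: vs.scale_right_distrib)
  from shift_op_weight[OF y(2) this, of rs] y(4)
  have "sc (\<Prod>r\<leftarrow>rs. 2 * of_nat r) y = 0" by simp
  moreover have "(\<Prod>r\<leftarrow>rs. 2 * of_nat r :: complex) \<noteq> 0" using y(3) by (auto simp: prod_list_zero_iff)
  ultimately have "y = 0" by simp
  then show ?thesis using y(1) by auto
qed

end

lemma is_irrep_iff:
  "is_irrep \<gg> sc V \<rho> \<mu> \<longleftrightarrow> irreducible_module \<gg> sc V \<rho> \<and> (\<exists>B. finite B \<and> V = module.span sc B) \<and>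
     (\<exists>v. v \<noteq> 0 \<and> highest_vector \<gg> sc V \<rho> \<mu> v)"
  by (auto simp: is_irrep_def highest_vector_def)

lemma irreducibleD:
  assumes "irreducible_module \<gg> sc V \<rho>"
  shows "lie_module \<gg> sc V \<rho>" "V \<noteq> {0}"
    "0 \<in> W \<Longrightarrow> (\<And>c v w. v \<in> W \<Longrightarrow> w \<in> W \<Longrightarrow> sc c v + w \<in> W) \<Longrightarrow> W \<subseteq> V \<Longrightarrow>
      (\<And>A w. A \<in> \<gg> \<Longrightarrow> w \<in> W \<Longrightarrow> \<rho> A w \<in> W) \<Longrightarrow> W = {0} \<or> W = V"
proof -
  show m: "lie_module \<gg> sc V \<rho>" "V \<noteq> {0}" using assms by (auto simp: irreducible_module_def)
  show "W = {0} \<or> W = V" if "0 \<in> W" "\<And>c v w. v \<in> W \<Longrightarrow> w \<in> W \<Longrightarrow> sc c v + w \<in> W" "W \<subseteq> V"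
      "\<And>A w. A \<in> \<gg> \<Longrightarrow> w \<in> W \<Longrightarrow> \<rho> A w \<in> W"
    using assms that subspace_iff[OF lie_moduleD(1)[OF m(1)], of W] unfolding irreducible_module_def by blast
qed

section \<open>Comparison of irreducible modules with the same highest weight\<close>

definition pair_scale :: "(complex \<Rightarrow> 'v \<Rightarrow> 'v) \<Rightarrow> (complex \<Rightarrow> 'w \<Rightarrow> 'w) \<Rightarrow> complex \<Rightarrow> 'v \<times> 'w \<Rightarrow> 'v \<times> 'w" where
  "pair_scale sc sc' c p = (sc c (fst p), sc' c (snd p))"

definition pair_act :: "(complex mat \<Rightarrow> 'v \<Rightarrow> 'v) \<Rightarrow> (complex mat \<Rightarrow> 'w \<Rightarrow> 'w) \<Rightarrow> complex mat \<Rightarrow> 'v \<times> 'w \<Rightarrow> 'v \<times> 'w" where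
  "pair_act \<rho> \<sigma> A p = (\<rho> A (fst p), \<sigma> A (snd p))"

lemma pair_module:
  assumes m: "lie_module \<gg> sc V \<rho>" "lie_module \<gg> sc' W \<sigma>"
  shows "lie_module \<gg> (pair_scale sc sc') (V \<times> W) (pair_act \<rho> \<sigma>)"
proof -
  interpret v: vector_space sc by (rule lie_moduleD(1)[OF m(1)])
  interpret w: vector_space sc' by (rule lie_moduleD(1)[OF m(2)])
  have vs: "vector_space (pair_scale sc sc')"
    by unfold_locales (auto simp: pair_scale_def v.scale_right_distrib w.scale_right_distrib v.scale_left_distrib w.scale_left_distrib)
  have "module.subspace (pair_scale sc sc') (V \<times> W)"
    using lie_moduleD(2)[OF m(1)] lie_moduleD(2)[OF m(2)]
    by (auto simp: subspace_iff[OF vs] subspace_iff[OF v.vector_space_axioms] subspace_iff[OF w.vector_space_axioms] pair_scale_def zero_prod_def)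
  then show ?thesis using vs lie_moduleD(3-6)[OF m(1)] lie_moduleD(3-6)[OF m(2)]
    by (auto simp: lie_module_def pair_scale_def pair_act_def)
qed

text \<open>The graph of the isomorphism is the submodule of \<open>V \<times> W\<close> generated by the pair of highest weight
  vectors.\<close>

lemma highest_weight_iso:
  assumes g: "graded_alg N \<gg>"
    and V: "is_irrep \<gg> sc V \<rho> \<mu>" and W: "is_irrep \<gg> sc' W \<sigma> \<mu>"
  shows "module_iso \<gg> sc V \<rho> sc' W \<sigma>"
proof -
  have iV: "irreducible_module \<gg> sc V \<rho>" and iW: "irreducible_module \<gg> sc' W \<sigma>" using V W by (auto simp: is_irrep_iff)
  note mV = irreducibleD(1)[OF iV] and mW = irreducibleD(1)[OF iW]
  obtain v where v: "v \<noteq> 0" "highest_vector \<gg> sc V \<rho> \<mu> v" using V by (auto simp: is_irrep_iff)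
  obtain w where w: "w \<noteq> 0" "highest_vector \<gg> sc' W \<sigma> \<mu> w" using W by (auto simp: is_irrep_iff)
  interpret v: vector_space sc by (rule lie_moduleD(1)[OF mV])
  interpret w: vector_space sc' by (rule lie_moduleD(1)[OF mW])
  let ?sc = "pair_scale sc sc'" and ?act = "pair_act \<rho> \<sigma>"
  note m = pair_module[OF mV mW]
  have hv: "highest_vector \<gg> ?sc (V \<times> W) ?act \<mu> (v, w)"
    using v w by (auto simp: highest_vector_def pair_scale_def pair_act_def zero_prod_def)
  define T where "T = hspan \<gg> ?sc ?act (v, w)"
  have TV: "T \<subseteq> V \<times> W" using hspan_V[OF g m hv] by (auto simp: T_def)
  have T0: "0 \<in> T" by (simp add: T_def hspan.zero)
  have Tlin: "?sc c x + y \<in> T" if "x \<in> T" "y \<in> T" for c x y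
    using hspan_add[OF g m hv hspan_scale[OF g m hv]] that by (simp add: T_def)
  have Tact: "?act A x \<in> T" if "A \<in> \<gg>" "x \<in> T" for A x
    using hspan_stable[OF g m hv] that by (simp add: T_def)
  have Tvw: "(v, w) \<in> T" unfolding T_def by (rule hspan_word[OF g m hv hwords.base])
  \<comment> \<open>The projections of \<open>T\<close> to the two factors are nonzero submodules,
    hence everything by irreducibility.\<close>
  have fstT: "fst ` T = V"
  proof -
    have "fst ` T = {0} \<or> fst ` T = V"
    proof (rule irreducibleD(3)[OF iV])
      show "0 \<in> fst ` T" using T0 by force
      show "sc c x + y \<in> fst ` T" if xy: "x \<in> fst ` T" "y \<in> fst ` T" for c x y
      proof -
        obtain a b where ab: "(x, a) \<in> T" "(y, b) \<in> T" using xy by auto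
        from Tlin[OF this, of c] show ?thesis by (force simp: pair_scale_def)
      qed
      show "fst ` T \<subseteq> V" using TV by auto
      show "\<rho> A x \<in> fst ` T" if A: "A \<in> \<gg>" and x: "x \<in> fst ` T" for A x
      proof -
        obtain a where "(x, a) \<in> T" using x by auto
        from Tact[OF A this] show ?thesis by (force simp: pair_act_def)
      qed
    qed
    moreover have "v \<in> fst ` T" using Tvw by force
    ultimately show ?thesis using v(1) by auto
  qed
  have sndT: "snd ` T = W"
  proof -
    have "snd ` T = {0} \<or> snd ` T = W"
    proof (rule irreducibleD(3)[OF iW])
      show "0 \<in> snd ` T" using T0 by force
      show "sc' c x + y \<in> snd ` T" if xy: "x \<in> snd ` T" "y \<in> snd ` T" for c x y
      proof -
        obtain a b where ab: "(a, x) \<in> T" "(b, y) \<in> T" using xy by auto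
        from Tlin[OF this, of c] show ?thesis by (force simp: pair_scale_def)
      qed
      show "snd ` T \<subseteq> W" using TV by auto
      show "\<sigma> A x \<in> snd ` T" if A: "A \<in> \<gg>" and x: "x \<in> snd ` T" for A x
      proof -
        obtain a where "(a, x) \<in> T" using x by auto
        from Tact[OF A this] show ?thesis by (force simp: pair_act_def)
      qed
    qed
    moreover have "w \<in> snd ` T" using Tvw by force
    ultimately show ?thesis using w(1) by auto
  qed
  have H: "grading_el N \<in> \<gg>" by (rule graded_algD(6)[OF g])
  have \<rho>0: "\<rho> A 0 = 0" if "A \<in> \<gg>" for A by (rule act_zero[OF g mV v(2) that])
  have \<sigma>0: "\<sigma> A 0 = 0" if "A \<in> \<gg>" for A by (rule act_zero[OF g mW w(2) that])
  have inj: "{x. (x, 0) \<in> T} = {0}"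
  proof -
    have "{x. (x, 0) \<in> T} = {0} \<or> {x. (x, 0) \<in> T} = V"
    proof (rule irreducibleD(3)[OF iV])
      show "0 \<in> {x. (x, 0) \<in> T}" using T0 by (simp add: zero_prod_def)
      show "sc c x + y \<in> {x. (x, 0) \<in> T}" if "x \<in> {x. (x, 0) \<in> T}" "y \<in> {x. (x, 0) \<in> T}" for c x y
        using Tlin[of "(x, 0)" "(y, 0)" c] that by (simp add: pair_scale_def)
      show "{x. (x, 0) \<in> T} \<subseteq> V" using TV by auto
      show "\<rho> A x \<in> {x. (x, 0) \<in> T}" if "A \<in> \<gg>" "x \<in> {x. (x, 0) \<in> T}" for A x
        using Tact[of A "(x, 0)"] that \<sigma>0 by (simp add: pair_act_def)
    qed
    \<comment> \<open>Otherwise \<open>(v, 0)\<close> would be a vector of top weight in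
      \<open>T\<close> that is not proportional to \<open>(v, w)\<close>.\<close>
    moreover have False if "{x. (x, 0) \<in> T} = V"
    proof -
      have "(v, 0) \<in> T" using that v(2) by (auto simp: highest_vector_def)
      moreover have "?act (grading_el N) (v, 0) = ?sc (\<mu> (grading_el N)) (v, 0)"
        using v(2) H grading_el_diagonal \<sigma>0[OF H] by (simp add: highest_vector_def pair_act_def pair_scale_def)
      ultimately obtain c where "(v, 0) = ?sc c (v, w)"
        using hspan_top_weight[OF g m hv] unfolding T_def by blast
      then have "v = sc c v" "sc' c w = 0" by (auto simp: pair_scale_def)
      then show False using v(1) w(1) by auto
    qed
    ultimately show ?thesis by blast
  qed
  have surj: "{y. (0, y) \<in> T} = {0}"
  proof -
    have "{y. (0, y) \<in> T} = {0} \<or> {y. (0, y) \<in> T} = W"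
    proof (rule irreducibleD(3)[OF iW])
      show "0 \<in> {y. (0, y) \<in> T}" using T0 by (simp add: zero_prod_def)
      show "sc' c x + y \<in> {y. (0, y) \<in> T}" if "x \<in> {y. (0, y) \<in> T}" "y \<in> {y. (0, y) \<in> T}" for c x y
        using Tlin[of "(0, x)" "(0, y)" c] that by (simp add: pair_scale_def)
      show "{y. (0, y) \<in> T} \<subseteq> W" using TV by auto
      show "\<sigma> A x \<in> {y. (0, y) \<in> T}" if "A \<in> \<gg>" "x \<in> {y. (0, y) \<in> T}" for A x
        using Tact[of A "(0, x)"] that \<rho>0 by (simp add: pair_act_def)
    qed
    moreover have False if "{y. (0, y) \<in> T} = W"
    proof -
      have "(0, w) \<in> T" using that w(2) by (auto simp: highest_vector_def)
      moreover have "?act (grading_el N) (0, w) = ?sc (\<mu> (grading_el N)) (0, w)"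
        using w(2) H grading_el_diagonal \<rho>0[OF H] by (simp add: highest_vector_def pair_act_def pair_scale_def)
      ultimately obtain c where "(0, w) = ?sc c (v, w)"
        using hspan_top_weight[OF g m hv] unfolding T_def by blast
      then have "w = sc' c w" "sc c v = 0" by (auto simp: pair_scale_def)
      then show False using v(1) w(1) by auto
    qed
    ultimately show ?thesis by blast
  qed
  have Tdiff: "x - y \<in> T" if "x \<in> T" "y \<in> T" for x y
  proof -
    have "?sc (-1) y + x = x - y" by (simp add: pair_scale_def prod_eq_iff)
    then show ?thesis using Tlin[OF that(2,1), of "-1"] by simp
  qed
  have unique: "b = b'" if "(a, b) \<in> T" "(a, b') \<in> T" for a b b'
  proof -
    have "b - b' \<in> {y. (0, y) \<in> T}" using Tdiff[OF that] by simp
    then show ?thesis unfolding surj by simp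
  qed
  have unique': "a = a'" if "(a, b) \<in> T" "(a', b) \<in> T" for a a' b
  proof -
    have "a - a' \<in> {x. (x, 0) \<in> T}" using Tdiff[OF that] by simp
    then show ?thesis unfolding inj by simp
  qed
  define f where "f = (\<lambda>a. THE b. (a, b) \<in> T)"
  have f: "(a, f a) \<in> T" if a: "a \<in> V" for a
  proof -
    obtain b where "(a, b) \<in> T" using a fstT by force
    then show ?thesis unfolding f_def by (rule theI) (use unique \<open>(a, b) \<in> T\<close> in blast)
  qed
  have f_eq: "f a = b" if "(a, b) \<in> T" for a b
    using f[of a] unique that TV by blast
  have "bij_betw f V W"
  proof (rule bij_betw_imageI)
    show "inj_on f V" by (rule inj_onI) (metis f unique')
    show "f ` V = W"
    proof
      show "f ` V \<subseteq> W" using f TV by blast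
      show "W \<subseteq> f ` V"
      proof
        fix b assume "b \<in> W"
        then obtain a where "(a, b) \<in> T" using sndT by force
        then show "b \<in> f ` V" using f_eq TV by blast
      qed
    qed
  qed
  moreover have "f (sc c a + b) = sc' c (f a) + f b" if "a \<in> V" "b \<in> V" for c a b
    using Tlin[OF f[OF that(1)] f[OF that(2)], of c] by (intro f_eq) (simp add: pair_scale_def)
  moreover have "f (\<rho> A a) = \<sigma> A (f a)" if "A \<in> \<gg>" "a \<in> V" for A a
    using Tact[OF that(1) f[OF that(2)]] by (intro f_eq) (simp add: pair_act_def)
  ultimately show ?thesis unfolding module_iso_def using mV mW by blast
qed

section \<open>Restriction to subalgebras and transport of irreducibility\<close>

lemma lie_module_subset:
  assumes "\<hh> \<subseteq> \<gg>" and m: "lie_module \<gg> sc V \<rho>" shows "lie_module \<hh> sc V \<rho>"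
proof -
  have h: "A \<in> \<gg>" if "A \<in> \<hh>" for A using that assms(1) by blast
  show ?thesis
    unfolding lie_module_def
    by (intro conjI ballI allI lie_moduleD(1)[OF m] lie_moduleD(2)[OF m] lie_moduleD(3)[OF m h]
        lie_moduleD(4)[OF m h] lie_moduleD(5)[OF m h h] lie_moduleD(6)[OF m h h])
qed

lemma module_iso_subset:
  assumes "\<hh> \<subseteq> \<gg>" "module_iso \<gg> sc V \<rho> sc' W \<sigma>"
  shows "module_iso \<hh> sc V \<rho> sc' W \<sigma>"
proof -
  obtain f where f: "lie_module \<gg> sc V \<rho>" "lie_module \<gg> sc' W \<sigma>" "bij_betw f V W"
    "\<forall>c. \<forall>v\<in>V. \<forall>w\<in>V. f (sc c v + w) = sc' c (f v) + f w" "\<forall>A\<in>\<gg>. \<forall>v\<in>V. f (\<rho> A v) = \<sigma> A (f v)"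
    using assms(2) unfolding module_iso_def by blast
  then have "\<forall>A\<in>\<hh>. \<forall>v\<in>V. f (\<rho> A v) = \<sigma> A (f v)" using assms(1) by blast
  then show ?thesis
    unfolding module_iso_def
    using lie_module_subset[OF assms(1) f(1)] lie_module_subset[OF assms(1) f(2)] f(3,4)
    by (intro conjI exI[of _ f])
qed

lemma module_iso_irreducible:
  assumes iso: "module_iso \<gg> sc V \<rho> sc' W \<sigma>" and W: "irreducible_module \<gg> sc' W \<sigma>"
  shows "irreducible_module \<gg> sc V \<rho>"
proof -
  obtain f where m: "lie_module \<gg> sc V \<rho>" "lie_module \<gg> sc' W \<sigma>" and bij: "bij_betw f V W"
    and lin: "\<And>c v w. v \<in> V \<Longrightarrow> w \<in> V \<Longrightarrow> f (sc c v + w) = sc' c (f v) + f w"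
    and act: "\<And>A v. A \<in> \<gg> \<Longrightarrow> v \<in> V \<Longrightarrow> f (\<rho> A v) = \<sigma> A (f v)"
    using iso unfolding module_iso_def by blast
  interpret v: vector_space sc by (rule lie_moduleD(1)[OF m(1)])
  interpret w: vector_space sc' by (rule lie_moduleD(1)[OF m(2)])
  have z: "0 \<in> V" using lie_moduleD(2)[OF m(1)] by (rule v.subspace_0)
  have f0: "f 0 = 0" using lin[OF z z, of "-1"] by simp
  have inj: "inj_on f V" and img: "f ` V = W" using bij by (auto simp: bij_betw_def)
  have "V \<noteq> {0}" using irreducibleD(2)[OF W] img f0 by auto
  moreover have "U = {0} \<or> U = V" if U: "v.subspace U" "U \<subseteq> V" "\<forall>A\<in>\<gg>. \<forall>u\<in>U. \<rho> A u \<in> U" for U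
  proof -
    have U': "0 \<in> U" "\<And>c x y. x \<in> U \<Longrightarrow> y \<in> U \<Longrightarrow> sc c x + y \<in> U"
      using U(1) subspace_iff[OF v.vector_space_axioms, of U] by auto
    have "f ` U = {0} \<or> f ` U = W"
    proof (rule irreducibleD(3)[OF W])
      show "0 \<in> f ` U" using U'(1) f0 by force
      show "sc' c x + y \<in> f ` U" if xy: "x \<in> f ` U" "y \<in> f ` U" for c x y
      proof -
        obtain a b where ab: "a \<in> U" "b \<in> U" "x = f a" "y = f b" using xy by blast
        then have "a \<in> V" "b \<in> V" using U(2) by auto
        from lin[OF this, of c] have "sc' c x + y = f (sc c a + b)" using ab by simp
        then show ?thesis using U'(2)[OF ab(1,2)] by blast
      qed
      show "f ` U \<subseteq> W" using U(2) img by blast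
      show "\<sigma> A x \<in> f ` U" if A: "A \<in> \<gg>" and x: "x \<in> f ` U" for A x
      proof -
        obtain a where a: "a \<in> U" "x = f a" using x by blast
        then have "\<sigma> A x = f (\<rho> A a)" using act[OF A] U(2) by auto
        then show ?thesis using U(3) A a(1) by blast
      qed
    qed
    then show ?thesis
    proof
      assume "f ` U = {0}"
      then have "U \<subseteq> {0}" using inj f0 z U(2) by (fastforce simp: inj_on_def)
      then show ?thesis using U'(1) by blast
    next
      assume "f ` U = W"
      then show ?thesis using inj_on_image_eq_iff[OF inj U(2) order.refl] img by simp
    qed
  qed
  ultimately show ?thesis using m(1) by (auto simp: irreducible_module_def)
qed

section \<open>The gradings of the symplectic and special linear algebras\<close>

lemma band_carrier [simp]: "band N S A \<in> carrier_mat N N"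
  by (simp add: band_def)

lemma graded_alg_sp: "graded_alg (2*n) (sp n)"
proof -
  have "band (2*n) {j} A \<in> sp n" if A: "A \<in> sp n" for A j
  proof -
    \<comment> \<open>The coordinate \<open>(r, s)\<close> is read off an entry on the diagonal
      \<open>2*n - 1 - s - r\<close>. This number is symmetric in \<open>r\<close> and
      \<open>s\<close>, so extracting a diagonal keeps the coordinates symmetric.\<close>
    have "mc n (band (2*n) {j} A) r s = (if int (2*n) - 1 - int s - int r = j then mc n A r s else 0)"
      if "r < 2*n" "s < 2*n" for r s
    proof -
      have "2*n-1-s < 2*n" "int (2*n-1-s) = int (2*n) - 1 - int s" using that by auto
      then show ?thesis using that by (simp add: mc_def band_def)
    qed
    then show ?thesis using mc_sym[OF A] by (auto simp: sp_iff algebra_simps)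
  qed
  moreover have "grading_el (2*n) \<in> sp n"
  proof -
    have "grading_el (2*n) \<in> cartan n"
    proof (rule diag_in_cartan)
      show "grading_el (2*n) $$ (2*n-1-r, 2*n-1-r) = - grading_el (2*n) $$ (r, r)" if r: "r < 2*n" for r
      proof -
        have "2*n-1-r < 2*n" "int (2*n-1-r) = int (2*n) - 1 - int r" using r by auto
        then show ?thesis using r unfolding grading_el_def by (simp add: of_nat_diff)
      qed
    next
      show "grading_el (2*n) \<in> carrier_mat (2*n) (2*n)" by (simp add: grading_el_def)
    qed (rule grading_el_diagonal)
    then show ?thesis by (simp add: cartan_def)
  qed
  ultimately show ?thesis
    by (auto simp: graded_alg_def sp_carrier sp_lin sp_bracket)
qed

lemma mtrace_lin:
  "A \<in> carrier_mat N N \<Longrightarrow> B \<in> carrier_mat N N \<Longrightarrow> mtrace (c \<cdot>\<^sub>m A + B) = c * mtrace A + mtrace B"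
  by (auto simp: mtrace_def sum.distrib sum_distrib_left)

lemma mtrace_mult_commute:
  assumes "A \<in> carrier_mat N N" "B \<in> carrier_mat N N"
  shows "mtrace (A * B) = mtrace (B * A)"
proof -
  have tr: "mtrace (A * B) = (\<Sum>i<N. \<Sum>u<N. A $$ (i, u) * B $$ (u, i))"
    if c: "A \<in> carrier_mat N N" "B \<in> carrier_mat N N" for A B
    unfolding mtrace_def carrier_matD(1)[OF mult_carrier_mat[OF c]]
    by (intro sum.cong refl mult_mat_entry[OF c]) auto
  have "(\<Sum>i<N. \<Sum>u<N. A $$ (i, u) * B $$ (u, i)) = (\<Sum>u<N. \<Sum>i<N. A $$ (i, u) * B $$ (u, i))" by (rule sum.swap)
  then show ?thesis unfolding tr[OF assms] tr[OF assms(2,1)] by (simp only: mult.commute)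
qed

lemma graded_alg_sl: "graded_alg N (sl N)"
proof -
  have br: "bracket A B \<in> sl N" if "A \<in> sl N" "B \<in> sl N" for A B
  proof -
    have c: "A \<in> carrier_mat N N" "B \<in> carrier_mat N N" using that by (auto simp: sl_def)
    have "mtrace (bracket A B) = mtrace (A * B) - mtrace (B * A)"
      using c by (simp add: bracket_def mtrace_def sum_subtractf)
    then show ?thesis using c mtrace_mult_commute[OF c] by (simp add: sl_def bracket_carrier)
  qed
  have bd: "band N {j} A \<in> sl N" if A: "A \<in> sl N" for A j
  proof -
    have "mtrace (band N {j} A) = (if j = 0 then mtrace A else 0)"
      using A by (auto simp: mtrace_def band_def sl_def)
    then show ?thesis using A by (simp add: sl_def)
  qed
  have gr: "grading_el N \<in> sl N"
  proof -
    have "mtrace (grading_el N) = (\<Sum>r<N. of_int (int N - 1 - 2 * int r))" by (simp add: mtrace_def grading_el_def)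
    also have "\<dots> = of_int (\<Sum>r<N. int N - 1 - 2 * int r)" by simp
    also have "(\<Sum>r<N. int N - 1 - 2 * int r) = 0"
    proof -
      \<comment> \<open>A closed form general enough for induction; for \<open>M = N\<close> and
        \<open>c = N - 1\<close> its second factor is zero.\<close>
      have "(\<Sum>r<M. c - 2 * int r) = int M * (c - int M + 1)" for M c
        by (induction M) (auto simp: algebra_simps)
      from this[where M = N and c = "int N - 1"] show ?thesis by simp
    qed
    finally show ?thesis by (simp add: sl_def grading_el_def)
  qed
  have li: "c \<cdot>\<^sub>m A + B \<in> sl N" if "A \<in> sl N" "B \<in> sl N" for A B c
    using that mtrace_lin[of A N B c] by (simp add: sl_def)
  have ze: "0\<^sub>m N N \<in> sl N" by (simp add: sl_def mtrace_def)
  have ca: "sl N \<subseteq> carrier_mat N N" by (auto simp: sl_def)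
  show ?thesis unfolding graded_alg_def by (intro conjI ballI allI ca ze gr li br bd)
qed

text \<open>Mirror entries on the diagonal are opposite, so the trace equals its own
  negative.\<close>

lemma sp_subset_sl: "sp n \<subseteq> sl (2*n)"
proof
  fix A assume A: "A \<in> sp n"
  have c: "A \<in> carrier_mat (2*n) (2*n)" by (rule sp_carrier[OF A])
  have e: "A $$ (2*n-1-r, 2*n-1-r) = - A $$ (r, r)" if r: "r < 2*n" for r
  proof -
    have r': "2*n-1-r < 2*n" "2*n-1-(2*n-1-r) = r" using r by auto
    have "sgp n r * (- A $$ (r, r)) = sgp n r * A $$ (2*n-1-r, 2*n-1-r)"
      using mc_sym[OF A r r'(1)] r r' by (simp add: mc_def sgp_reflect)
    then show ?thesis by (metis mult_left_cancel sgp_nonzero)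
  qed
  have "(\<Sum>r<2*n. A $$ (r, r)) = (\<Sum>r<2*n. A $$ (2*n-1-r, 2*n-1-r))" by (rule sum_reflect)
  also have "\<dots> = - (\<Sum>r<2*n. A $$ (r, r))" using e by (simp add: sum_negf)
  finally have "(\<Sum>r<2*n. A $$ (r, r)) = 0" by (simp add: eq_neg_iff_add_eq_0)
  then show "A \<in> sl (2*n)" using c by (simp add: sl_def mtrace_def)
qed

section \<open>Irreducibility of the symmetric powers\<close>

lemma lookup_single_times:
  fixes q :: sym_alg
  shows "Poly_Mapping.lookup (Poly_Mapping.single k c * q) (k + m) = c * Poly_Mapping.lookup q m"
proof -
  have "Poly_Mapping.lookup (Poly_Mapping.single k c * q) (k + m)
    = (\<Sum>l. (c * (\<Sum>q'. Poly_Mapping.lookup q q' when k + m = l + q')) when k = l)"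
    by (simp add: lookup_mult lookup_single when_mult)
  also have "\<dots> = c * (\<Sum>q'. Poly_Mapping.lookup q q' when m = q')" by simp
  finally show ?thesis by simp
qed

lemma lookup_single_times_eq_0:
  fixes q :: sym_alg
  assumes "\<And>m'. m \<noteq> k + m'"
  shows "Poly_Mapping.lookup (Poly_Mapping.single k c * q) m = 0"
proof -
  have "Poly_Mapping.lookup (Poly_Mapping.single k c * q) m
    = (\<Sum>l. (c * (\<Sum>q'. Poly_Mapping.lookup q q' when m = l + q')) when k = l)"
    by (simp add: lookup_mult lookup_single when_mult)
  also have "\<dots> = c * (\<Sum>q'. Poly_Mapping.lookup q q' when m = k + q')" by simp
  finally show ?thesis using assms by simp
qed

definition evar :: "nat \<Rightarrow> sym_alg" where
  "evar i = Poly_Mapping.single (Poly_Mapping.single i 1) 1"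

lemma lookup_evar_times:
  "Poly_Mapping.lookup (evar i * q) m =
     (if Poly_Mapping.lookup m i > 0 then Poly_Mapping.lookup q (m - Poly_Mapping.single i 1) else 0)"
proof (cases "Poly_Mapping.lookup m i > 0")
  case True
  then have "m = Poly_Mapping.single i 1 + (m - Poly_Mapping.single i 1)"
    by (intro poly_mapping_eqI) (auto simp: lookup_add lookup_minus lookup_single when_def)
  then show ?thesis using True lookup_single_times[of "Poly_Mapping.single i 1" 1 q "m - Poly_Mapping.single i 1"]
    by (simp add: evar_def)
next
  case False
  have "m \<noteq> Poly_Mapping.single i 1 + m'" for m'
  proof
    assume "m = Poly_Mapping.single i 1 + m'"
    then have "Poly_Mapping.lookup m i = 1 + Poly_Mapping.lookup m' i" by (simp add: lookup_add)
    then show False using False by simp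
  qed
  then show ?thesis using False lookup_single_times_eq_0 by (simp add: evar_def)
qed

lemma lookup_scale [simp]: "Poly_Mapping.lookup (sym_scale c p) m = c * Poly_Mapping.lookup p m"
  using lookup_single_times[of 0 c p m] by (simp add: sym_scale_def)

text \<open>The truncated subtraction in \<open>sym_pd\<close> concerns only monomials without
  \<open>e_j\<close>, which enter with coefficient zero. Every monomial of the derivative therefore
  has a single source.\<close>

lemma lookup_sym_pd:
  "Poly_Mapping.lookup (sym_pd j p) m =
     of_nat (Poly_Mapping.lookup m j + 1) * Poly_Mapping.lookup p (m + Poly_Mapping.single j 1)"
proof -
  let ?m = "m + Poly_Mapping.single j 1"
  have iff: "m' = ?m" if "m' - Poly_Mapping.single j 1 = m" "Poly_Mapping.lookup m' j > 0" for m'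
    unfolding that(1)[symmetric] using that(2)
    by (intro poly_mapping_eqI) (auto simp: lookup_add lookup_minus lookup_single when_def)
  have "Poly_Mapping.lookup (sym_pd j p) m = (\<Sum>m'\<in>Poly_Mapping.keys p.
      (of_nat (Poly_Mapping.lookup m' j) * Poly_Mapping.lookup p m' when m' - Poly_Mapping.single j 1 = m))"
    by (simp add: sym_pd_def lookup_sum lookup_single)
  also have "\<dots> = (\<Sum>m'\<in>Poly_Mapping.keys p.
      if m' = ?m then of_nat (Poly_Mapping.lookup m j + 1) * Poly_Mapping.lookup p m' else 0)"
  proof (intro sum.cong refl)
    fix m'
    consider "m' = ?m" | "m' \<noteq> ?m" "Poly_Mapping.lookup m' j = 0" | "m' \<noteq> ?m" "m' - Poly_Mapping.single j 1 \<noteq> m"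
      using iff by blast
    then show "(of_nat (Poly_Mapping.lookup m' j) * Poly_Mapping.lookup p m' when m' - Poly_Mapping.single j 1 = m) =
      (if m' = ?m then of_nat (Poly_Mapping.lookup m j + 1) * Poly_Mapping.lookup p m' else 0)"
      by cases (simp_all add: lookup_add when_def)
  qed
  also have "\<dots> = of_nat (Poly_Mapping.lookup m j + 1) * Poly_Mapping.lookup p ?m"
    by (simp add: in_keys_iff)
  finally show ?thesis .
qed

lemma sym_pd_linear:
  "sym_pd j (p + q) = sym_pd j p + sym_pd j q" "sym_pd j (sym_scale c p) = sym_scale c (sym_pd j p)"
  "sym_pd j (\<Sum>i\<in>I. f i) = (\<Sum>i\<in>I. sym_pd j (f i))"
proof -
  show a: "sym_pd j (p + q) = sym_pd j p + sym_pd j q" for p q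
    by (intro poly_mapping_eqI) (simp add: lookup_sym_pd lookup_add algebra_simps)
  show "sym_pd j (sym_scale c p) = sym_scale c (sym_pd j p)"
    by (intro poly_mapping_eqI) (simp add: lookup_sym_pd lookup_add)
  have "sym_pd j 0 = 0" by (simp add: sym_pd_def)
  then show "sym_pd j (\<Sum>i\<in>I. f i) = (\<Sum>i\<in>I. sym_pd j (f i))"
    by (induction I rule: infinite_finite_induct) (auto simp: a)
qed

lemma sym_pd_evar: "sym_pd j (evar i * q) = evar i * sym_pd j q + (if i = j then q else 0)"
proof (intro poly_mapping_eqI)
  fix m
  show "Poly_Mapping.lookup (sym_pd j (evar i * q)) m = Poly_Mapping.lookup (evar i * sym_pd j q + (if i = j then q else 0)) m"
  proof (cases "i = j")
    case True
    have "m - Poly_Mapping.single j 1 + Poly_Mapping.single j 1 = m" if "Poly_Mapping.lookup m j > 0"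
      using that by (intro poly_mapping_eqI) (auto simp: lookup_add lookup_minus lookup_single when_def)
    then show ?thesis
      using True by (auto simp: lookup_sym_pd lookup_evar_times lookup_add lookup_minus distrib_right)
  next
    case False
    then have "m + Poly_Mapping.single j 1 - Poly_Mapping.single i 1 = m - Poly_Mapping.single i 1 + Poly_Mapping.single j 1"
      by (intro poly_mapping_eqI) (auto simp: lookup_add lookup_minus lookup_single when_def)
    then show ?thesis
      using False by (auto simp: lookup_sym_pd lookup_evar_times lookup_add lookup_minus lookup_single)
  qed
qed

lemma sym_pd_commute: "sym_pd i (sym_pd j p) = sym_pd j (sym_pd i p)"
proof (intro poly_mapping_eqI)
  fix m
  have eq: "m + Poly_Mapping.single i 1 + Poly_Mapping.single j 1 = m + Poly_Mapping.single j 1 + Poly_Mapping.single i (1::nat)"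
    by (simp add: add_ac)
  show "Poly_Mapping.lookup (sym_pd i (sym_pd j p)) m = Poly_Mapping.lookup (sym_pd j (sym_pd i p)) m"
  proof (cases "i = j")
    case False
    then show ?thesis using eq by (simp add: lookup_sym_pd lookup_add lookup_single)
  qed simp
qed

lemma sym_scale_simps:
  "sym_scale c (p + q) = sym_scale c p + sym_scale c q" "sym_scale (c + d) p = sym_scale c p + sym_scale d p"
  "sym_scale c (sym_scale d p) = sym_scale (c * d) p" "sym_scale 1 p = p" "sym_scale 0 p = 0"
  "sym_scale c 0 = 0" "q * sym_scale c p = sym_scale c (q * p)"
  "sym_scale c (\<Sum>i\<in>I. f i) = (\<Sum>i\<in>I. sym_scale c (f i))"
  "sym_scale (\<Sum>i\<in>I. g i) p = (\<Sum>i\<in>I. sym_scale (g i) p)"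
proof -
  show "q * sym_scale c p = sym_scale c (q * p)" by (simp add: sym_scale_def algebra_simps)
qed (intro poly_mapping_eqI, simp add: lookup_add lookup_sum sum_distrib_left sum_distrib_right algebra_simps)+

lemma sym_scale_vector_space: "vector_space sym_scale"
  by unfold_locales (simp_all add: sym_scale_simps)

section \<open>The action by first order differential operators\<close>

lemma sym_act_evar:
  "sym_act A p = (\<Sum>i<dim_row A. \<Sum>j<dim_col A. sym_scale (A $$ (i, j)) (evar i * sym_pd j p))"
  by (simp add: sym_act_def evar_def)

lemma sym_act_carrier:
  "A \<in> carrier_mat N N \<Longrightarrow> sym_act A p = (\<Sum>i<N. \<Sum>j<N. sym_scale (A $$ (i, j)) (evar i * sym_pd j p))"
  by (simp add: sym_act_evar)

lemma sym_act_linear: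
  "sym_act A (sym_scale c p + q) = sym_scale c (sym_act A p) + sym_act A q"
  by (simp add: sym_act_evar sym_pd_linear sym_scale_simps distrib_left sum.distrib mult.commute[of c])

lemma sym_act_linear_mat:
  assumes "A \<in> carrier_mat N N" "B \<in> carrier_mat N N"
  shows "sym_act (c \<cdot>\<^sub>m A + B) p = sym_scale c (sym_act A p) + sym_act B p"
proof -
  have "c \<cdot>\<^sub>m A + B \<in> carrier_mat N N" using assms by simp
  from sym_act_carrier[OF this]
  have "sym_act (c \<cdot>\<^sub>m A + B) p = (\<Sum>i<N. \<Sum>j<N. sym_scale c (sym_scale (A $$ (i, j)) (evar i * sym_pd j p)) + sym_scale (B $$ (i, j)) (evar i * sym_pd j p))"
    using assms by (auto simp: sym_scale_simps intro!: sum.cong)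
  then show ?thesis unfolding sym_act_carrier[OF assms(1)] sym_act_carrier[OF assms(2)]
    by (simp add: sym_scale_simps sum.distrib)
qed

lemma sym_pd_act:
  assumes B: "B \<in> carrier_mat N N" and j: "j < N"
  shows "sym_pd j (sym_act B p) = sym_act B (sym_pd j p) + (\<Sum>l<N. sym_scale (B $$ (j, l)) (sym_pd l p))"
proof -
  have "sym_pd j (sym_act B p) = (\<Sum>k<N. \<Sum>l<N. sym_scale (B $$ (k, l)) (evar k * sym_pd l (sym_pd j p)))
     + (\<Sum>k<N. \<Sum>l<N. sym_scale (B $$ (k, l)) (if k = j then sym_pd l p else 0))"
    unfolding sym_act_carrier[OF B]
    by (simp add: sym_pd_linear sym_pd_evar sym_scale_simps sum.distrib sym_pd_commute[of j])
  also have "(\<Sum>k<N. \<Sum>l<N. sym_scale (B $$ (k, l)) (if k = j then sym_pd l p else 0))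
     = (\<Sum>k<N. if k = j then \<Sum>l<N. sym_scale (B $$ (k, l)) (sym_pd l p) else 0)"
    by (intro sum.cong) (auto simp: sym_scale_simps)
  also have "\<dots> = (\<Sum>l<N. sym_scale (B $$ (j, l)) (sym_pd l p))" using j by simp
  finally show ?thesis unfolding sym_act_carrier[OF B] .
qed

text \<open>A product of two first order operators is the first order operator of the matrix product
  plus a second order part. As derivatives and variables commute, the latter is symmetric in the two
  matrices and cancels in the commutator.\<close>

lemma sym_act_act:
  assumes A: "A \<in> carrier_mat N N" and B: "B \<in> carrier_mat N N"
  shows "sym_act A (sym_act B p) = sym_act (A * B) p
    + (\<Sum>i<N. \<Sum>j<N. \<Sum>k<N. \<Sum>l<N. sym_scale (A $$ (i, j) * B $$ (k, l)) (evar i * (evar k * sym_pd l (sym_pd j p))))"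
proof -
  have "sym_act A (sym_act B p) = (\<Sum>i<N. \<Sum>j<N. sym_scale (A $$ (i, j)) (evar i * sym_act B (sym_pd j p)))
    + (\<Sum>i<N. \<Sum>j<N. \<Sum>l<N. sym_scale (A $$ (i, j) * B $$ (j, l)) (evar i * sym_pd l p))"
    unfolding sym_act_carrier[OF A] sum.distrib[symmetric]
    by (intro sum.cong refl) (simp add: sym_pd_act[OF B] distrib_left sum_distrib_left sym_scale_simps)
  also have "(\<Sum>i<N. \<Sum>j<N. \<Sum>l<N. sym_scale (A $$ (i, j) * B $$ (j, l)) (evar i * sym_pd l p))
    = (\<Sum>i<N. \<Sum>l<N. \<Sum>j<N. sym_scale (A $$ (i, j) * B $$ (j, l)) (evar i * sym_pd l p))"
    by (intro sum.cong refl sum.swap)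
  also have "\<dots> = (\<Sum>i<N. \<Sum>l<N. sym_scale ((A * B) $$ (i, l)) (evar i * sym_pd l p))"
    by (intro sum.cong refl) (simp add: mult_mat_entry[OF A B] sym_scale_simps)
  also have "\<dots> = sym_act (A * B) p" using sym_act_carrier[of "A * B" N] A B by simp
  finally show ?thesis
    unfolding sym_act_carrier[OF B]
    by (simp add: sym_scale_simps sum_distrib_left)
qed

lemma sym_act_bracket:
  assumes A: "A \<in> carrier_mat N N" and B: "B \<in> carrier_mat N N"
  shows "sym_act (bracket A B) p = sym_act A (sym_act B p) - sym_act B (sym_act A p)"
proof -
  let ?q = "\<lambda>A B i j k l. sym_scale (A $$ (i, j) * B $$ (k, l)) (evar i * (evar k * sym_pd l (sym_pd j p)))"
  have "bracket A B = (-1) \<cdot>\<^sub>m (B * A) + A * B"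
    unfolding bracket_def using A B by (intro eq_matI) auto
  then have 1: "sym_act (bracket A B) p = sym_act (A * B) p - sym_act (B * A) p"
    using sym_act_linear_mat[of "B * A" N "A * B" "-1" p] A B
    by (simp add: sym_scale_def single_uminus)
  \<comment> \<open>The second order parts of the two orders agree after renaming the summation
    indices.\<close>
  have "(\<Sum>i<N. \<Sum>j<N. \<Sum>k<N. \<Sum>l<N. ?q B A i j k l) = (\<Sum>i<N. \<Sum>j<N. \<Sum>k<N. \<Sum>l<N. ?q A B k l i j)"
    by (intro sum.cong refl) (simp add: mult_ac sym_pd_commute)
  also have "\<dots> = (\<Sum>i<N. \<Sum>k<N. \<Sum>j<N. \<Sum>l<N. ?q A B k l i j)"
    by (intro sum.cong refl sum.swap)
  also have "\<dots> = (\<Sum>k<N. \<Sum>i<N. \<Sum>l<N. \<Sum>j<N. ?q A B k l i j)"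
    by (subst sum.swap) (intro sum.cong refl sum.swap)
  also have "\<dots> = (\<Sum>k<N. \<Sum>l<N. \<Sum>i<N. \<Sum>j<N. ?q A B k l i j)"
    by (intro sum.cong refl sum.swap)
  finally show ?thesis unfolding 1 sym_act_act[OF A B] sym_act_act[OF B A] by simp
qed

lemma sym_pow_iff:
  "p \<in> sym_pow N d \<longleftrightarrow> (\<forall>m. Poly_Mapping.lookup p m \<noteq> 0 \<longrightarrow>
     (\<forall>i\<ge>N. Poly_Mapping.lookup m i = 0) \<and> (\<Sum>i<N. Poly_Mapping.lookup m i) = d)"
proof -
  have iff: "Poly_Mapping.keys m \<subseteq> {..<N} \<and> (\<Sum>i\<in>Poly_Mapping.keys m. Poly_Mapping.lookup m i) = d
    \<longleftrightarrow> (\<forall>i\<ge>N. Poly_Mapping.lookup m i = 0) \<and> (\<Sum>i<N. Poly_Mapping.lookup m i) = d" for m :: "nat \<Rightarrow>\<^sub>0 nat"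
  proof -
    have "Poly_Mapping.keys m \<subseteq> {..<N} \<longleftrightarrow> (\<forall>i\<ge>N. Poly_Mapping.lookup m i = 0)"
      by (meson in_keys_iff lessThan_iff linorder_not_less subset_iff)
    moreover have "(\<Sum>i\<in>Poly_Mapping.keys m. Poly_Mapping.lookup m i) = (\<Sum>i<N. Poly_Mapping.lookup m i)"
      if "Poly_Mapping.keys m \<subseteq> {..<N}"
      using that by (intro sum.mono_neutral_left) (auto simp: in_keys_iff)
    ultimately show ?thesis by auto
  qed
  show ?thesis by (simp only: sym_pow_def mem_Collect_eq iff Ball_def) (simp only: in_keys_iff)
qed

lemma sym_pow_subspace: "module.subspace sym_scale (sym_pow N d)"
proof -
  have "sym_scale c p + q \<in> sym_pow N d" if "p \<in> sym_pow N d" "q \<in> sym_pow N d" for c p q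
  proof -
    have "Poly_Mapping.lookup p m \<noteq> 0 \<or> Poly_Mapping.lookup q m \<noteq> 0"
      if "Poly_Mapping.lookup (sym_scale c p + q) m \<noteq> 0" for m
      using that by (auto simp: lookup_add)
    then show ?thesis using that unfolding sym_pow_iff by blast
  qed
  moreover have "0 \<in> sym_pow N d" by (simp add: sym_pow_def)
  ultimately show ?thesis unfolding subspace_iff[OF sym_scale_vector_space] by blast
qed

lemma sym_pow_transfer:
  assumes p: "p \<in> sym_pow N d" and ij: "i < N" "j < N"
  shows "evar i * sym_pd j p \<in> sym_pow N d"
  unfolding sym_pow_iff
proof (intro allI impI)
  fix m assume nz: "Poly_Mapping.lookup (evar i * sym_pd j p) m \<noteq> 0"
  let ?m = "m - Poly_Mapping.single i 1 + Poly_Mapping.single j 1"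
  have mi: "Poly_Mapping.lookup m i > 0" and "Poly_Mapping.lookup p ?m \<noteq> 0"
    using nz by (auto simp: lookup_evar_times lookup_sym_pd split: if_splits)
  then have *: "\<forall>i\<ge>N. Poly_Mapping.lookup ?m i = 0" "(\<Sum>i<N. Poly_Mapping.lookup ?m i) = d"
    using p unfolding sym_pow_iff by blast+
  \<comment> \<open>Stated additively to avoid truncated subtraction under the sum.\<close>
  have eq: "Poly_Mapping.lookup ?m k + (if k = i then 1 else 0) = Poly_Mapping.lookup m k + (if k = j then 1 else 0)" for k
    using mi by (auto simp: lookup_add lookup_minus lookup_single when_def)
  have "(\<Sum>k<N. Poly_Mapping.lookup ?m k + (if k = i then 1 else 0)) = (\<Sum>k<N. Poly_Mapping.lookup m k + (if k = j then 1 else 0))"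
    unfolding eq ..
  then have "(\<Sum>k<N. Poly_Mapping.lookup m k) = d" using *(2) ij unfolding sum.distrib by simp
  moreover have "Poly_Mapping.lookup m k = 0" if "k \<ge> N" for k
    using *(1) eq[of k] that ij by (auto split: if_splits)
  ultimately show "(\<forall>k\<ge>N. Poly_Mapping.lookup m k = 0) \<and> (\<Sum>k<N. Poly_Mapping.lookup m k) = d" by blast
qed

lemma sym_pow_module:
  assumes "\<gg> \<subseteq> carrier_mat N N"
  shows "lie_module \<gg> sym_scale (sym_pow N d) sym_act"
proof -
  interpret vector_space sym_scale by (rule sym_scale_vector_space)
  have c: "A \<in> carrier_mat N N" if "A \<in> \<gg>" for A using that assms by blast
  have "sym_act A p \<in> sym_pow N d" if "A \<in> \<gg>" "p \<in> sym_pow N d" for A p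
    unfolding sym_act_carrier[OF c[OF that(1)]]
    by (intro subspace_sum[OF sym_pow_subspace] subspace_scale[OF sym_pow_subspace] sym_pow_transfer that(2)) auto
  then show ?thesis
    unfolding lie_module_def
    by (intro conjI ballI allI sym_scale_vector_space sym_pow_subspace sym_act_linear
        sym_act_linear_mat[OF c c] sym_act_bracket[OF c c]) auto
qed

text \<open>Monomials as multisets, so that the generation lemma used for relations also serves
  symmetric powers.\<close>

definition mset_mon :: "nat multiset \<Rightarrow> nat \<Rightarrow>\<^sub>0 nat" where
  "mset_mon M = Abs_poly_mapping (count M)"

lemma lookup_mset_mon [simp]: "Poly_Mapping.lookup (mset_mon M) = count M"
  unfolding mset_mon_def by (rule lookup_Abs_poly_mapping) simp

lemma mset_mon_surj:
  assumes "\<forall>i\<ge>N. Poly_Mapping.lookup m i = 0" "(\<Sum>i<N. Poly_Mapping.lookup m i) = d"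
  obtains M where "m = mset_mon M" "size M = d" "set_mset M \<subseteq> {..<N}"
proof
  let ?M = "Abs_multiset (Poly_Mapping.lookup m)"
  have ct: "count ?M = Poly_Mapping.lookup m" by (rule count_Abs_multiset) (use finite_lookup[of m] in simp)
  show "m = mset_mon ?M" by (intro poly_mapping_eqI) (simp add: ct)
  show sub: "set_mset ?M \<subseteq> {..<N}" using assms(1) ct by (metis count_eq_zero_iff lessThan_iff linorder_not_less subsetI)
  have "size ?M = (\<Sum>i\<in>set_mset ?M. Poly_Mapping.lookup m i)" by (simp add: size_multiset_overloaded_eq ct)
  also have "\<dots> = (\<Sum>i<N. Poly_Mapping.lookup m i)"
    using sub by (intro sum.mono_neutral_left) (auto simp: not_in_iff ct)
  finally show "size ?M = d" using assms(2) by simp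
qed

lemma sym_scale_single: "sym_scale c (Poly_Mapping.single m x) = Poly_Mapping.single m (c * x)"
  by (simp add: sym_scale_def mult_single)

text \<open>For monomials the factor is the multiplicity of \<open>j\<close> before the replacement,
  in contrast to \<open>mtransfer\<close>, where coordinates of tensors give the multiplicity after
  it. Without any \<open>j\<close> both sides are zero.\<close>

lemma transfer_mset_mon:
  "evar i * sym_pd j (Poly_Mapping.single (mset_mon M) 1)
    = sym_scale (of_nat (count M j)) (Poly_Mapping.single (mset_mon (add_mset i (M - {#j#}))) 1)"
proof -
  have "Poly_Mapping.single i 1 + (mset_mon M - Poly_Mapping.single j 1) = mset_mon (add_mset i (M - {#j#}))"
    by (intro poly_mapping_eqI) (auto simp: lookup_add lookup_minus lookup_single when_def)
  then show ?thesis by (simp add: sym_pd_def mult_single sym_scale_single evar_def)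
qed

lemma sym_act_bm:
  assumes "p < 2*n" "q < 2*n"
  shows "sym_act (bm n p q) f = sym_scale (sgp n q) (evar p * sym_pd (2*n-1-q) f)
    + sym_scale (sgp n p) (evar q * sym_pd (2*n-1-p) f)"
proof -
  let ?t = "\<lambda>u v. evar u * sym_pd v f"
  have lt: "2*n-1-q < 2*n" "2*n-1-p < 2*n" using assms by auto
  have "(\<Sum>v<2*n. sym_scale (bm n p q $$ (u, v)) (?t u v)) =
      (if u = p then sym_scale (sgp n q) (?t p (2*n-1-q)) else 0)
      + (if u = q then sym_scale (sgp n p) (?t q (2*n-1-p)) else 0)" if u: "u < 2*n" for u
  proof -
    have "(\<Sum>v<2*n. sym_scale (bm n p q $$ (u, v)) (?t u v)) = (\<Sum>v<2*n.
        (if v = 2*n-1-q then if u = p then sym_scale (sgp n q) (?t u v) else 0 else 0)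
        + (if v = 2*n-1-p then if u = q then sym_scale (sgp n p) (?t u v) else 0 else 0))"
      by (intro sum.cong refl) (simp only: bm_entry[OF assms u] lessThan_iff, simp add: sym_scale_simps)
    also have "\<dots> = (if u = p then sym_scale (sgp n q) (?t p (2*n-1-q)) else 0)
      + (if u = q then sym_scale (sgp n p) (?t q (2*n-1-p)) else 0)"
      using lt unfolding sum.distrib by (subst (1 2) sum.delta) auto
    finally show ?thesis .
  qed
  then have "sym_act (bm n p q) f = (\<Sum>u<2*n. (if u = p then sym_scale (sgp n q) (?t p (2*n-1-q)) else 0)
      + (if u = q then sym_scale (sgp n p) (?t q (2*n-1-p)) else 0))"
    unfolding sym_act_carrier[OF bm_carrier] by (intro sum.cong) auto
  then show ?thesis using assms unfolding sum.distrib by simp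
qed

lemma sym_pow_eqI:
  assumes W: "module.subspace sym_scale W" "W \<subseteq> sym_pow N d"
    and mon: "\<And>M. size M = d \<Longrightarrow> set_mset M \<subseteq> {..<N} \<Longrightarrow> Poly_Mapping.single (mset_mon M) 1 \<in> W"
  shows "W = sym_pow N d"
proof (intro equalityI W(2) subsetI)
  interpret vector_space sym_scale by (rule sym_scale_vector_space)
  fix p assume p: "p \<in> sym_pow N d"
  have "p = (\<Sum>m\<in>Poly_Mapping.keys p. sym_scale (Poly_Mapping.lookup p m) (Poly_Mapping.single m 1))"
    by (intro poly_mapping_eqI) (simp add: lookup_sum lookup_single when_def in_keys_iff if_distrib cong: if_cong)
  also have "\<dots> \<in> W"
  proof (intro subspace_sum[OF W(1)] subspace_scale[OF W(1)])
    fix m assume "m \<in> Poly_Mapping.keys p"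
    then have "\<forall>i\<ge>N. Poly_Mapping.lookup m i = 0" "(\<Sum>i<N. Poly_Mapping.lookup m i) = d"
      using p unfolding sym_pow_iff in_keys_iff by blast+
    then show "Poly_Mapping.single m 1 \<in> W" by (rule mset_mon_surj) (use mon in auto)
  qed
  finally show "p \<in> W" .
qed

lemma mset_mon_sym_pow:
  assumes "size M = d" "set_mset M \<subseteq> {..<N}"
  shows "Poly_Mapping.single (mset_mon M) 1 \<in> sym_pow N d"
proof -
  have "(\<Sum>i<N. count M i) = d"
    unfolding assms(1)[symmetric] size_multiset_overloaded_eq using assms(2)
    by (intro sum.mono_neutral_right) (auto simp flip: not_in_iff)
  moreover have "count M i = 0" if "i \<ge> N" for i using assms(2) that by (force simp: count_eq_zero_iff)
  ultimately show ?thesis by (auto simp: sym_pow_iff lookup_single when_def)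
qed

text \<open>An element whose monomials contain the highest possible power of \<open>e\<^sub>0\<close> is killed by all raising
  operators, hence is a multiple of \<open>e\<^sub>0\<^sup>d\<close>, from which all monomials are generated.\<close>

lemma sym_pow_sp_submodule:
  assumes n: "1 \<le> n" and W: "module.subspace sym_scale W" "W \<subseteq> sym_pow (2*n) d"
    and stable: "\<forall>A\<in>sp n. \<forall>w\<in>W. sym_act A w \<in> W" and nz: "W \<noteq> {0}"
  shows "W = sym_pow (2*n) d"
proof -
  interpret vector_space sym_scale by (rule sym_scale_vector_space)
  let ?z = "2*n - 1"
  have z: "?z < 2*n" "0 < 2*n" "0 < ?z" using n by auto
  have unscale: "p \<in> W" if "sym_scale c p \<in> W" "c \<noteq> 0" for c p
    using subspace_scale[OF W(1) that(1), of "1 / c"] that(2) by simp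
  define a where "a p = Min ((\<lambda>m. Poly_Mapping.lookup m 0) ` Poly_Mapping.keys p)" for p :: sym_alg
  obtain p0 where p0: "p0 \<in> W" "p0 \<noteq> 0" using nz subspace_0[OF W(1)] by blast
  have bound: "a p \<le> d" if p: "p \<in> W \<and> p \<noteq> 0" for p
  proof -
    obtain m where "Poly_Mapping.lookup p m \<noteq> 0" using p by (metis lookup_zero poly_mapping_eqI)
    then have m: "m \<in> Poly_Mapping.keys p" by (simp add: in_keys_iff)
    have "a p \<le> Poly_Mapping.lookup m 0" unfolding a_def using m by (intro Min_le) auto
    also have "\<dots> \<le> (\<Sum>i<2*n. Poly_Mapping.lookup m i)" using z by (intro member_le_sum) auto
    also have "\<dots> = d" using m W(2) p unfolding in_keys_iff by (meson sym_pow_iff subsetD)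
    finally show ?thesis .
  qed
  \<comment> \<open>The least exponent of \<open>e_0\<close> is bounded by the degree, so it can be
    maximized over the nonzero elements of \<open>W\<close>.\<close>
  have "\<exists>p. (p \<in> W \<and> p \<noteq> 0) \<and> (\<forall>q. q \<in> W \<and> q \<noteq> 0 \<longrightarrow> a q \<le> a p)"
    using p0 bound by (intro ex_has_greatest_nat[of _ p0 a "Suc d"]) (auto simp: less_Suc_eq_le)
  then obtain p where p: "p \<in> W" "p \<noteq> 0" and max: "\<And>q. q \<in> W \<Longrightarrow> q \<noteq> 0 \<Longrightarrow> a q \<le> a p"
    by blast
  \<comment> \<open>Replacing some \<open>e_b\<close> by \<open>e_0\<close> raises the least
    exponent of \<open>e_0\<close>, so by maximality the result is zero; and multiplication by
    \<open>e_0\<close> is injective.\<close>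
  have raise: "sym_pd b p = 0" if b: "b \<noteq> 0" and mem: "evar 0 * sym_pd b p \<in> W" for b
  proof (rule ccontr)
    let ?q = "evar 0 * sym_pd b p"
    assume "sym_pd b p \<noteq> 0"
    then obtain m where "Poly_Mapping.lookup (sym_pd b p) m \<noteq> 0" by (metis lookup_zero poly_mapping_eqI)
    then have "Poly_Mapping.lookup ?q (Poly_Mapping.single 0 1 + m) \<noteq> 0"
      using lookup_single_times[of "Poly_Mapping.single 0 1" 1 "sym_pd b p" m] by (simp add: evar_def)
    then have q0: "?q \<noteq> 0" by (metis lookup_zero)
    have "a p + 1 \<le> Poly_Mapping.lookup m 0" if m: "m \<in> Poly_Mapping.keys ?q" for m
    proof -
      have m0: "Poly_Mapping.lookup m 0 > 0"
        and "m - Poly_Mapping.single 0 1 + Poly_Mapping.single b 1 \<in> Poly_Mapping.keys p"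
        using m by (auto simp: in_keys_iff lookup_evar_times lookup_sym_pd split: if_splits)
      then have "a p \<le> Poly_Mapping.lookup (m - Poly_Mapping.single 0 1 + Poly_Mapping.single b 1) 0"
        unfolding a_def by (intro Min_le) auto
      then show ?thesis using m0 b by (simp add: lookup_add lookup_minus lookup_single)
    qed
    then have "a p + 1 \<le> a ?q" unfolding a_def[of ?q] using q0 by (subst Min_ge_iff) auto
    then show False using max[OF mem q0] by simp
  qed
  have "sym_act (bm n 0 0) p \<in> W" using stable p(1) by simp
  then have "sym_scale (2 * sgp n 0) (evar 0 * sym_pd ?z p) \<in> W"
    using sym_act_bm[OF z(2) z(2)] by (simp add: sym_scale_simps(2)[symmetric])
  then have "evar 0 * sym_pd ?z p \<in> W" by (rule unscale) simp
  with z have pz: "sym_pd ?z p = 0" by (intro raise) auto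
  have pd0: "sym_pd b p = 0" if b: "b \<noteq> 0" "b < 2*n" for b
  proof -
    have lt: "?z - b < 2*n" "2*n - 1 - (?z - b) = b" using b by auto
    \<comment> \<open>This raising operator has a second term with a derivative at
      \<open>?z\<close>. It vanishes by \<open>pz\<close>, which is why the long root is treated
      first.\<close>
    have "sym_act (bm n 0 (?z - b)) p \<in> W" using stable p(1) by simp
    then have "sym_scale (sgp n (?z - b)) (evar 0 * sym_pd b p) \<in> W"
      unfolding sym_act_bm[OF z(2) lt(1)] lt(2) using pz by (simp add: sym_scale_simps)
    then have "evar 0 * sym_pd b p \<in> W" by (rule unscale) simp
    with b show ?thesis by (intro raise)
  qed
  have supp: "m = mset_mon (replicate_mset d 0)" if m: "Poly_Mapping.lookup p m \<noteq> 0" for m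
  proof -
    have *: "\<forall>i\<ge>2*n. Poly_Mapping.lookup m i = 0" "(\<Sum>i<2*n. Poly_Mapping.lookup m i) = d"
      using m p(1) W(2) by (meson sym_pow_iff subsetD)+
    have b0: "Poly_Mapping.lookup m b = 0" if b: "b \<noteq> 0" for b
    proof (rule ccontr)
      assume nz: "Poly_Mapping.lookup m b \<noteq> 0"
      then have "b < 2*n" using *(1) by (meson linorder_not_less)
      from pd0[OF b this] have "Poly_Mapping.lookup (sym_pd b p) (m - Poly_Mapping.single b 1) = 0" by simp
      moreover have "m - Poly_Mapping.single b 1 + Poly_Mapping.single b 1 = m"
        using nz by (intro poly_mapping_eqI) (auto simp: lookup_add lookup_minus lookup_single when_def)
      ultimately have "of_nat (Poly_Mapping.lookup (m - Poly_Mapping.single b 1) b + 1) * Poly_Mapping.lookup p m = 0"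
        by (simp only: lookup_sym_pd)
      then show False using m of_nat_neq_0 by (simp del: of_nat_add of_nat_Suc)
    qed
    have "(\<Sum>i<2*n. Poly_Mapping.lookup m i) = (\<Sum>i<2*n. if i = 0 then Poly_Mapping.lookup m 0 else 0)"
      using b0 by (intro sum.cong) auto
    then have "Poly_Mapping.lookup m 0 = d" using *(2) n by simp
    then show ?thesis using b0 by (intro poly_mapping_eqI) auto
  qed
  have base: "Poly_Mapping.single (mset_mon (replicate_mset d 0)) 1 \<in> W"
  proof (rule unscale)
    let ?m = "mset_mon (replicate_mset d 0)"
    have "p = sym_scale (Poly_Mapping.lookup p ?m) (Poly_Mapping.single ?m 1)"
      using supp by (intro poly_mapping_eqI) (auto simp: lookup_single when_def)
    then show "sym_scale (Poly_Mapping.lookup p ?m) (Poly_Mapping.single ?m 1) \<in> W" using p(1) by simp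
    show "Poly_Mapping.lookup p ?m \<noteq> 0" using p(2) supp by (metis lookup_zero poly_mapping_eqI)
  qed
  let ?e = "\<lambda>M. Poly_Mapping.single (mset_mon M) 1 :: sym_alg"
  have mon: "?e M \<in> W" if M: "size M = d" "set_mset M \<subseteq> {..<2*n}" for M
  proof -
    have "M \<in> {M. ?e M \<in> W}"
    proof (rule multiset_generation_symplectic[where m = d and z = ?z])
      show "set_mset M \<subseteq> {..?z}" using M(2) z by auto
    next
      fix M assume M: "M \<in> {M. ?e M \<in> W}" "0 \<in># M"
      have "sym_act (bm n ?z ?z) (?e M) = sym_scale (2 * sgp n ?z * of_nat (count M 0)) (?e (add_mset ?z (M - {#0#})))"
        unfolding sym_act_bm[OF z(1) z(1)] diff_self_eq_0 transfer_mset_mon sym_scale_simps(3) sym_scale_simps(2)[symmetric]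
        by (simp only: mult_2 distrib_right)
      moreover have "sym_act (bm n ?z ?z) (?e M) \<in> W" using M stable by simp
      moreover have "2 * sgp n ?z * of_nat (count M 0) \<noteq> 0" using M(2) by simp
      ultimately show "add_mset ?z (M - {#0#}) \<in> {M. ?e M \<in> W}" using unscale by (metis mem_Collect_eq)
    next
      fix M b assume M: "M \<in> {M. ?e M \<in> W}" "0 \<in># M" and b: "b < ?z" "b \<noteq> 0"
        and h: "?z - b \<in># M \<Longrightarrow> add_mset ?z (M - {#?z - b#}) \<in> {M. ?e M \<in> W}"
      have bn: "b < 2*n" using b z by linarith
      \<comment> \<open>The second term of \<open>bm n b ?z\<close>, which lies in \<open>W\<close>
        by the induction hypothesis or is zero and can be subtracted.\<close>
      let ?r = "sym_scale (sgp n b) (evar ?z * sym_pd (?z - b) (?e M))"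
      have "?r \<in> W"
      proof (cases "?z - b \<in># M")
        case True
        then show ?thesis using h[OF True] by (simp only: transfer_mset_mon mem_Collect_eq subspace_scale[OF W(1)])
      next
        case False
        then have "count M (?z - b) = 0" by (simp add: not_in_iff)
        then show ?thesis using subspace_0[OF W(1)] by (simp only: transfer_mset_mon sym_scale_simps of_nat_0)
      qed
      moreover have "sym_scale (sgp n ?z) (evar b * sym_pd 0 (?e M)) + ?r \<in> W"
        using stable M(1) sym_act_bm[OF bn z(1), of "?e M"] by (metis bm_sp diff_self_eq_0 mem_Collect_eq)
      ultimately have "(sym_scale (sgp n ?z) (evar b * sym_pd 0 (?e M)) + ?r) - ?r \<in> W" by (intro subspace_diff[OF W(1)])
      then have "sym_scale (sgp n ?z * of_nat (count M 0)) (?e (add_mset b (M - {#0#}))) \<in> W"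
        by (simp add: transfer_mset_mon sym_scale_simps(3))
      moreover have "sgp n ?z * of_nat (count M 0) \<noteq> 0" using M(2) by simp
      ultimately show "add_mset b (M - {#0#}) \<in> {M. ?e M \<in> W}" using unscale by (metis mem_Collect_eq)
    qed (use base M z in auto)
    then show ?thesis by simp
  qed
  show ?thesis by (rule sym_pow_eqI[OF W mon])
qed

section \<open>Symmetric powers as highest weight modules and their restriction\<close>

lemma sym_pow_nonzero: "1 \<le> N \<Longrightarrow> sym_pow N d \<noteq> {0}"
proof -
  assume "1 \<le> N"
  then have "Poly_Mapping.single (mset_mon (replicate_mset d 0)) 1 \<in> sym_pow N d"
    by (intro mset_mon_sym_pow) auto
  moreover have "Poly_Mapping.single (mset_mon (replicate_mset d 0)) (1::complex) \<noteq> 0"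
    by (metis lookup_single_eq lookup_zero zero_neq_one)
  ultimately show ?thesis by auto
qed

text \<open>A submodule for an algebra containing \<open>sp n\<close> is a submodule for
  \<open>sp n\<close>, so one irreducibility statement covers both \<open>sl (2*n)\<close> and
  \<open>sp n\<close>. The highest weight vector is the power of \<open>e_0\<close> in both
  cases.\<close>

lemma sym_pow_is_irrep:
  assumes n: "1 \<le> n" and \<gg>: "sp n \<subseteq> \<gg>" "\<gg> \<subseteq> carrier_mat (2*n) (2*n)"
    and \<mu>: "\<And>H. H \<in> \<gg> \<Longrightarrow> diagonal_mat H \<Longrightarrow> \<mu> H = of_nat d * H $$ (0, 0)"
  shows "is_irrep \<gg> sym_scale (sym_pow (2*n) d) sym_act \<mu>"
proof -
  interpret vector_space sym_scale by (rule sym_scale_vector_space)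
  let ?e = "\<lambda>M. Poly_Mapping.single (mset_mon M) 1 :: sym_alg"
  let ?v = "?e (replicate_mset d 0)"
  have "irreducible_module \<gg> sym_scale (sym_pow (2*n) d) sym_act"
    unfolding irreducible_module_def
  proof (intro conjI allI impI)
    show "lie_module \<gg> sym_scale (sym_pow (2*n) d) sym_act" by (rule sym_pow_module[OF \<gg>(2)])
    show "sym_pow (2*n) d \<noteq> {0}" using n by (intro sym_pow_nonzero) simp
    fix W assume "subspace W \<and> W \<subseteq> sym_pow (2*n) d \<and> (\<forall>A\<in>\<gg>. \<forall>w\<in>W. sym_act A w \<in> W)"
    then have "subspace W" "W \<subseteq> sym_pow (2*n) d" "\<forall>A\<in>sp n. \<forall>w\<in>W. sym_act A w \<in> W" using \<gg>(1) by auto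
    from sym_pow_sp_submodule[OF n this] show "W = {0} \<or> W = sym_pow (2*n) d" by blast
  qed
  moreover have "\<exists>B. finite B \<and> sym_pow (2*n) d = span B"
  proof (intro exI conjI)
    let ?B = "?e ` {M. size M = d \<and> set_mset M \<subseteq> {..<2*n}}"
    have "finite {M. set_mset M \<subseteq> {..<2*n} \<and> size M = d}"
      using finite_multisets_of_size[of "{..<2*n}" d] by (simp add: multisets_of_size_def)
    then show "finite ?B" by (simp add: conj_commute)
    have "span ?B \<subseteq> sym_pow (2*n) d" by (rule span_minimal[OF _ sym_pow_subspace]) (auto intro: mset_mon_sym_pow)
    then show "sym_pow (2*n) d = span ?B" by (intro sym_pow_eqI[symmetric] subspace_span) (auto intro: span_base)
  qed
  \<comment> \<open>An \<open>A\<close> whose first column vanishes below the diagonal scales the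
    power of \<open>e_0\<close>; this covers strictly upper triangular and diagonal elements at
    once.\<close>
  moreover have "sym_act A ?v = sym_scale (of_nat d * A $$ (0, 0)) ?v"
    if A: "A \<in> \<gg>" and u: "\<And>i. 0 < i \<Longrightarrow> i < 2*n \<Longrightarrow> A $$ (i, 0) = 0" for A
  proof -
    have "A \<in> carrier_mat (2*n) (2*n)" using A \<gg>(2) by blast
    then have "sym_act A ?v = (\<Sum>i<2*n. \<Sum>j<2*n. if j = 0 then sym_scale (A $$ (i, j) * of_nat d) (?e (add_mset i (replicate_mset d 0 - {#0#}))) else 0)"
      unfolding sym_act_carrier[OF \<open>A \<in> carrier_mat (2*n) (2*n)\<close>] transfer_mset_mon
      by (intro sum.cong refl) (simp add: sym_scale_simps)
    also have "\<dots> = (\<Sum>i<2*n. if i = 0 then sym_scale (A $$ (i, 0) * of_nat d) (?e (add_mset i (replicate_mset d 0 - {#0#}))) else 0)"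
      using n u by (intro sum.cong) (auto simp: sym_scale_simps)
    also have "\<dots> = sym_scale (A $$ (0, 0) * of_nat d) (?e (add_mset 0 (replicate_mset d 0 - {#0#})))"
      using n by simp
    also have "\<dots> = sym_scale (of_nat d * A $$ (0, 0)) ?v"
      by (cases d) (simp_all add: sym_scale_simps mult.commute)
    finally show ?thesis .
  qed
  note act = this
  have c: "A \<in> carrier_mat (2*n) (2*n)" if "A \<in> \<gg>" for A using that \<gg>(2) by blast
  have "sym_act A ?v = 0" if "A \<in> \<gg>" "strictly_upper A" for A
  proof -
    have "A $$ (i, 0) = 0" if "i < 2*n" for i using c[OF \<open>A \<in> \<gg>\<close>] \<open>strictly_upper A\<close> that by (auto simp: strictly_upper_def)
    then show ?thesis using act[OF that(1)] n by (simp add: sym_scale_simps)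
  qed
  moreover have "sym_act H ?v = sym_scale (\<mu> H) ?v" if "H \<in> \<gg>" "diagonal_mat H" for H
  proof -
    have "H $$ (i, 0) = 0" if "0 < i" "i < 2*n" for i using c[OF \<open>H \<in> \<gg>\<close>] \<open>diagonal_mat H\<close> that by (auto simp: diagonal_mat_def)
    then show ?thesis using act[OF that(1)] \<mu>[OF that] by simp
  qed
  moreover have "?v \<in> sym_pow (2*n) d" using n by (intro mset_mon_sym_pow) auto
  moreover have "?v \<noteq> 0" by (metis lookup_single_eq lookup_zero zero_neq_one)
  ultimately show ?thesis unfolding is_irrep_def by blast
qed

text \<open>By uniqueness of highest weight modules \<open>V\<close> is the symmetric power over
  \<open>sl (2*n)\<close>, and this isomorphism restricts to \<open>sp n\<close>. The highest weight
  vector is kept, since \<theta> is twice the first coordinate and the two weights are the same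
  functional.\<close>

lemma restriction_symplectic:
  assumes n: "1 \<le> n" and V: "is_irrep (sl (2*n)) sc V \<rho> (\<lambda>H. of_nat (2*m) * omega1 H)"
  shows "module_iso (sp n) sc V \<rho> sym_scale (sym_pow (2*n) (2*m)) sym_act"
    and "is_irrep (sp n) sc V \<rho> (\<lambda>H. of_nat m * theta H)"
proof -
  have S: "is_irrep (sl (2*n)) sym_scale (sym_pow (2*n) (2*m)) sym_act (\<lambda>H. of_nat (2*m) * omega1 H)"
    using n by (intro sym_pow_is_irrep sp_subset_sl) (auto simp: sl_def omega1_def)
  have S': "is_irrep (sp n) sym_scale (sym_pow (2*n) (2*m)) sym_act (\<lambda>H. of_nat m * theta H)"
    using n by (intro sym_pow_is_irrep) (auto simp: theta_def dest: sp_carrier)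
  show iso: "module_iso (sp n) sc V \<rho> sym_scale (sym_pow (2*n) (2*m)) sym_act"
    by (rule module_iso_subset[OF sp_subset_sl highest_weight_iso[OF graded_alg_sl V S]])
  have "irreducible_module (sp n) sc V \<rho>"
    using S' by (intro module_iso_irreducible[OF iso]) (simp add: is_irrep_def)
  moreover have "(\<lambda>H. of_nat (2*m) * omega1 H) = (\<lambda>H. of_nat m * theta H)"
    by (simp add: omega1_def theta_def fun_eq_iff)
  ultimately show "is_irrep (sp n) sc V \<rho> (\<lambda>H. of_nat m * theta H)"
    using V sp_subset_sl[of n] unfolding is_irrep_def by (metis (no_types, lifting) subsetD)
qed

theorem proposition4p1:
  fixes l :: nat
    and scV :: "complex \<Rightarrow> 'v::ab_group_add \<Rightarrow> 'v"
    and scM :: "complex \<Rightarrow> 'w::ab_group_add \<Rightarrow> 'w"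
  assumes l: "l \<ge> 1"
  shows
    "(\<forall>m::nat.
       is_irrep (sl (2*l)) sym_scale (sym_pow (2*l) (2*m)) sym_act (\<lambda>H. of_nat (2*m) * omega1 H) \<and>
       is_irrep (sp l) sym_scale (sym_pow (2*l) (2*m)) sym_act (\<lambda>H. of_nat m * theta H) \<and>
       (\<forall>V \<rho>. is_irrep (sl (2*l)) scV V \<rho> (\<lambda>H. of_nat (2*m) * omega1 H) \<longrightarrow>
          irreducible_module (sp l) scV V \<rho> \<and>
          module_iso (sp l) scV V \<rho> sym_scale (sym_pow (2*l) (2*m)) sym_act \<and>
          (\<forall>M \<sigma>. is_irrep (sp l) scM M \<sigma> (\<lambda>H. of_nat m * theta H) \<longrightarrow>
             module_iso (sp l) scM M \<sigma> scV V \<rho>))) \<and>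
     bij_betw (phi l) (colors1 (2*l)) (colors l) \<and>
     (\<forall>x \<in> colors1 (2*l). \<forall>y \<in> colors1 (2*l).
        color_less x y \<longleftrightarrow> color_less (phi l x) (phi l y)) \<and>
     bij_betw (phi_part l) (cparts1 (2*l)) (cparts l) \<and>
     (\<forall>k X Y. k \<ge> 1 \<and> root_vectors (2*l) X \<and> root_vectors l Y \<longrightarrow>
        leading_terms (2*l) X (relations0 (2*l) X k) \<subseteq> cparts1 (2*l) \<and>
        phi_part l ` leading_terms (2*l) X (relations0 (2*l) X k)
          = leading_terms l Y (relations l Y k))"
proof -
  have S: "is_irrep (sl (2*l)) sym_scale (sym_pow (2*l) (2*m)) sym_act (\<lambda>H. of_nat (2*m) * omega1 H)" for m
    using l by (intro sym_pow_is_irrep sp_subset_sl) (auto simp: sl_def omega1_def)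
  have S': "is_irrep (sp l) sym_scale (sym_pow (2*l) (2*m)) sym_act (\<lambda>H. of_nat m * theta H)" for m
    using l by (intro sym_pow_is_irrep) (auto simp: theta_def dest: sp_carrier)
  have R: "irreducible_module (sp l) scV V \<rho> \<and>
      module_iso (sp l) scV V \<rho> sym_scale (sym_pow (2*l) (2*m)) sym_act \<and>
      (\<forall>M \<sigma>. is_irrep (sp l) scM M \<sigma> (\<lambda>H. of_nat m * theta H) \<longrightarrow> module_iso (sp l) scM M \<sigma> scV V \<rho>)"
    if V: "is_irrep (sl (2*l)) scV V \<rho> (\<lambda>H. of_nat (2*m) * omega1 H)" for m V \<rho>
  proof (intro conjI allI impI)
    show "irreducible_module (sp l) scV V \<rho>"
      using restriction_symplectic(2)[OF l V] by (simp add: is_irrep_def)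
    show "module_iso (sp l) scV V \<rho> sym_scale (sym_pow (2*l) (2*m)) sym_act"
      by (rule restriction_symplectic(1)[OF l V])
    show "module_iso (sp l) scM M \<sigma> scV V \<rho>" if "is_irrep (sp l) scM M \<sigma> (\<lambda>H. of_nat m * theta H)" for M \<sigma>
      by (rule highest_weight_iso[OF graded_alg_sp that restriction_symplectic(2)[OF l V]])
  qed
  have L: "leading_terms (2*l) X (relations0 (2*l) X k) = minimal_parts (2*l) (2*l) k"
    if "root_vectors (2*l) X" for X k
    using l by (intro leading_terms_relations0[OF that]) simp
  have L': "leading_terms l Y (relations l Y k) = minimal_parts l (2*l) k" if "root_vectors l Y" for Y k
    by (rule leading_terms_relations[OF that l])
  show ?thesis
  proof (intro conjI allI ballI impI)
    fix m
    show "is_irrep (sl (2*l)) sym_scale (sym_pow (2*l) (2*m)) sym_act (\<lambda>H. of_nat (2*m) * omega1 H)" by (rule S)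
    show "is_irrep (sp l) sym_scale (sym_pow (2*l) (2*m)) sym_act (\<lambda>H. of_nat m * theta H)" by (rule S')
  next
    fix m V \<rho> assume "is_irrep (sl (2*l)) scV V \<rho> (\<lambda>H. of_nat (2*m) * omega1 H)"
    note R = R[OF this]
    show "irreducible_module (sp l) scV V \<rho>"
      "module_iso (sp l) scV V \<rho> sym_scale (sym_pow (2*l) (2*m)) sym_act"
      using R by blast+
    fix M \<sigma> assume "is_irrep (sp l) scM M \<sigma> (\<lambda>H. of_nat m * theta H)"
    then show "module_iso (sp l) scM M \<sigma> scV V \<rho>" using R by blast
  next
    show "bij_betw (phi l) (colors1 (2*l)) (colors l)" by (rule phi_bij)
    show "bij_betw (phi_part l) (cparts1 (2*l)) (cparts l)" by (rule phi_part_bij)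
    show "color_less x y = color_less (phi l x) (phi l y)" if "x \<in> colors1 (2*l)" "y \<in> colors1 (2*l)" for x y
      by (rule phi_color_less[OF that])
  next
    fix k :: nat and X Y assume "1 \<le> k \<and> root_vectors (2*l) X \<and> root_vectors l Y"
    then show "leading_terms (2*l) X (relations0 (2*l) X k) \<subseteq> cparts1 (2*l)"
      "phi_part l ` leading_terms (2*l) X (relations0 (2*l) X k) = leading_terms l Y (relations l Y k)"
      using minimal_parts_cparts1[of "2*l" k] minimal_parts_phi[of l k] by (simp_all add: L L')
  qed
qed

end
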